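(* Let $\eta\in\mathcal{S}_2$ with $\|\eta\|_2<1$. Let $\rho\in\mathcal{S}_2$ be such that \[ \rho(t,s)=\eta(t,s)-\int_t^T\eta(t,u)\eta(u,s)\,du\qquad\text{for }0\le s<t\le T . \] Then \[ \int_{\mathcal W} f(\iota+G_\eta)\,e^{\mathfrak q_\rho}\,d\mu=e^{\|\eta\|_2^2/4}\int_{\mathcal W} f\,d\mu\qquad\text{for all } f\in C_b(\mathcal W). \]
   Context: Standing setting: $T>0$, $d\in\mathbb N$. $\mathcal W$ is the Banach space (sup norm) of continuous $w:[0,T]\to\mathbb R^d$ with $w(0)=0$, $\mu$ is the Wiener measure on $\mathcal W$, and $\theta(t)(w)=w(t)$ is the coordinate process; $d\theta(t)$ denotes Itô integration. Vectors in $\mathbb R^d$ are columns, $\langle\cdot,\cdot\rangle$ is the Euclidean inner product, $|M|$ is the Euclidean (Frobenius) norm of $M\in\mathbb R^{d\times d}$ and $M^\dagger$ its transpose. $\mathcal H$ is the Cameron–Martin space of absolutely continuous $h\in\mathcal W$ with $h'\in L^2$, with $\langle h,g\rangle_{\mathcal H}=\int_0^T\langle h'(t),g'(t)\rangle dt$. $\mathcal S_2$ is the set of measurable $\eta:[0,T]^2\to\mathbb R^{d\times d}$ with $\|\eta\|_2:=(\int_0^T\int_0^T|\eta(t,s)|^2dsdt)^{1/2}<\infty$ and $\eta(t,s)^\dagger=\eta(s,t)$ for all $(t,s)$. For $\eta\in\mathcal S_2$, $G_\eta:\mathcal W\to\mathcal H$ is the Wiener functional $G_\eta(t)=-\int_0^t\bigl(\int_0^s\eta(s,u)\,d\theta(u)\bigr)ds$,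 $t\in[0,T]$, and $\mathfrak q_\eta=\int_0^T\bigl\langle\int_0^t\eta(t,s)\,d\theta(s),d\theta(t)\bigr\rangle$ (iterated Itô integral). $\iota$ is the identity map of $\mathcal W$ and $C_b(\mathcal W)$ is the space of bounded continuous real functions on $\mathcal W$; $f(\iota+G_\eta)$ denotes $w\mapsto f(w+G_\eta(w))$. *)

theory Defs
  imports "HOL-Probability.Probability"
begin

text \<open>Paths: functions real => R^d.  The Wiener space W is the set of continuous
  paths on [0,T] starting at 0, extended by 0 outside [0,T] (canonical representatives).\<close>

definition Wsp :: "real \<Rightarrow> (real \<Rightarrow> real ^ 'd) set" where
  "Wsp T = {w. continuous_on {0..T} w \<and> w 0 = 0 \<and> (\<forall>t. t \<notin> {0..T} \<longrightarrow> w t = 0)}"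

definition supnorm :: "real \<Rightarrow> (real \<Rightarrow> real ^ 'd) \<Rightarrow> real" where
  "supnorm T w = (SUP t\<in>{0..T}. norm (w t))"

text \<open>The measurable structure on W: the coordinate (cylinder) sigma algebra, which
  coincides with the Borel sigma algebra of the sup norm.\<close>
definition Wsig :: "real \<Rightarrow> (real \<Rightarrow> real ^ 'd) measure" where
  "Wsig T = restrict_space (Pi\<^sub>M UNIV (\<lambda>_. borel)) (Wsp T)"

text \<open>Wiener measure: the probability measure on W whose coordinate process is a
  centred Gaussian process with covariance min(s,t) I_d (characteristic functional).\<close>
definition wiener :: "real \<Rightarrow> (real \<Rightarrow> real ^ 'd) measure" where
  "wiener T = (SOME M. sets M = sets (Wsig T) \<and> prob_space M \<and>
     (\<forall>(n::nat) (t::nat \<Rightarrow> real) (\<xi>::nat \<Rightarrow> real ^ 'd). (\<forall>k<n. t k \<in> {0..T}) \<longrightarrow>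
        (\<integral>w. cis (\<Sum>k<n. \<xi> k \<bullet> w (t k)) \<partial>M) =
        complex_of_real (exp (- (\<Sum>j<n. \<Sum>k<n. min (t j) (t k) * (\<xi> j \<bullet> \<xi> k)) / 2))))"

definition Filt :: "real \<Rightarrow> real \<Rightarrow> (real \<Rightarrow> real ^ 'd) measure" where
  "Filt T t = sigma (Wsp T) {{w \<in> Wsp T. w s \<in> B} | s B. s \<in> {0..t} \<and> B \<in> sets borel}"

definition has_simple_ito ::
  "real \<Rightarrow> (real \<Rightarrow> (real \<Rightarrow> real ^ 'd) \<Rightarrow> real ^ 'd) \<Rightarrow> ((real \<Rightarrow> real ^ 'd) \<Rightarrow> real) \<Rightarrow> bool" where
  "has_simple_ito T H Y \<longleftrightarrow>
     (\<exists>(n::nat) (\<tau>::nat \<Rightarrow> real) (\<xi>::nat \<Rightarrow> (real \<Rightarrow> real ^ 'd) \<Rightarrow> real ^ 'd).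
        0 \<le> \<tau> 0 \<and> (\<forall>k<n. \<tau> k \<le> \<tau> (Suc k) \<and> \<tau> (Suc k) \<le> T) \<and>
        (\<forall>k<n. \<xi> k \<in> borel_measurable (Filt T (\<tau> k)) \<and> bounded (\<xi> k ` Wsp T)) \<and>
        (\<forall>s w. H s w = (\<Sum>k<n. indicator {\<tau> k<..\<tau> (Suc k)} s *\<^sub>R \<xi> k w)) \<and>
        (\<forall>w. Y w = (\<Sum>k<n. \<xi> k w \<bullet> (w (\<tau> (Suc k)) - w (\<tau> k)))))"

definition has_ito_integral ::
  "real \<Rightarrow> (real \<Rightarrow> (real \<Rightarrow> real ^ 'd) \<Rightarrow> real ^ 'd) \<Rightarrow> ((real \<Rightarrow> real ^ 'd) \<Rightarrow> real) \<Rightarrow> bool" where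
  "has_ito_integral T H Y \<longleftrightarrow>
     (\<lambda>(s, w). H s w) \<in> borel_measurable (lborel \<Otimes>\<^sub>M wiener T) \<and>
     Y \<in> borel_measurable (wiener T) \<and>
     (\<exists>Hn Yn. (\<forall>m::nat. has_simple_ito T (Hn m) (Yn m)) \<and>
        (\<lambda>m. \<integral>\<^sup>+ w. (\<integral>\<^sup>+ s\<in>{0..T}. ennreal ((norm (Hn m s w - H s w))\<^sup>2) \<partial>lborel) \<partial>wiener T)
          \<longlonglongrightarrow> 0 \<and>
        (\<lambda>m. \<integral>\<^sup>+ w. ennreal ((Yn m w - Y w)\<^sup>2) \<partial>wiener T) \<longlonglongrightarrow> 0)"

definition wint_process ::
  "real \<Rightarrow> (real \<Rightarrow> real \<Rightarrow> real ^ 'd ^ 'd) \<Rightarrow> (real \<Rightarrow> (real \<Rightarrow> real ^ 'd) \<Rightarrow> real ^ 'd) \<Rightarrow> bool" where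
  "wint_process T \<eta> X \<longleftrightarrow>
     (\<lambda>(t, w). X t w) \<in> borel_measurable (lborel \<Otimes>\<^sub>M wiener T) \<and>
     (AE t in lborel. t \<in> {0..T} \<longrightarrow>
        (\<forall>i. has_ito_integral T (\<lambda>s w. indicator {0..t} s *\<^sub>R (\<eta> t s $ i)) (\<lambda>w. X t w $ i)))"

definition qfun :: "real \<Rightarrow> (real \<Rightarrow> real \<Rightarrow> real ^ 'd ^ 'd) \<Rightarrow> (real \<Rightarrow> real ^ 'd) \<Rightarrow> real" where
  "qfun T \<eta> = (SOME Q. \<exists>X. wint_process T \<eta> X \<and> has_ito_integral T X Q)"

definition Gfun :: "real \<Rightarrow> (real \<Rightarrow> real \<Rightarrow> real ^ 'd ^ 'd) \<Rightarrow> (real \<Rightarrow> real ^ 'd) \<Rightarrow> (real \<Rightarrow> real ^ 'd)" where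
  "Gfun T \<eta> = (SOME G. G \<in> measurable (wiener T) (Wsig T) \<and>
     (\<exists>X. wint_process T \<eta> X \<and>
        (AE w in wiener T. \<forall>t\<in>{0..T}. G w t = - (LINT s:{0..t}|lborel. X s w))))"

definition sqnorm_int :: "real \<Rightarrow> (real \<Rightarrow> real \<Rightarrow> real ^ 'd ^ 'd) \<Rightarrow> ennreal" where
  "sqnorm_int T \<eta> = (\<integral>\<^sup>+ ts. indicator ({0..T} \<times> {0..T}) ts *
       ennreal ((norm (\<eta> (fst ts) (snd ts)))\<^sup>2) \<partial>(lborel \<Otimes>\<^sub>M lborel))"

definition norm2 :: "real \<Rightarrow> (real \<Rightarrow> real \<Rightarrow> real ^ 'd ^ 'd) \<Rightarrow> real" where
  "norm2 T \<eta> = sqrt (enn2real (sqnorm_int T \<eta>))"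

definition S2 :: "real \<Rightarrow> (real \<Rightarrow> real \<Rightarrow> real ^ 'd ^ 'd) set" where
  "S2 T = {\<eta>. (\<lambda>ts. indicator ({0..T} \<times> {0..T}) ts *\<^sub>R \<eta> (fst ts) (snd ts))
              \<in> borel_measurable (lborel \<Otimes>\<^sub>M lborel) \<and>
            sqnorm_int T \<eta> < \<infinity> \<and>
            (\<forall>t\<in>{0..T}. \<forall>s\<in>{0..T}. transpose (\<eta> t s) = \<eta> s t)}"

definition Cb :: "real \<Rightarrow> ((real \<Rightarrow> real ^ 'd) \<Rightarrow> real) set" where
  "Cb T = {f. (\<exists>B. \<forall>w\<in>Wsp T. \<bar>f w\<bar> \<le> B) \<and>
              (\<forall>w\<in>Wsp T. \<forall>e>0. \<exists>d>0. \<forall>v\<in>Wsp T.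
                  supnorm T (\<lambda>t. v t - w t) < d \<longrightarrow> \<bar>f v - f w\<bar> < e)}"

end

theory Submission
  imports Defs
begin

text \<open>
  Discretise the kernel: approximate the part of \<open>\<eta>\<close> below the diagonal in \<open>L\<^sup>2\<close> by kernels that are constant
  on the cells of a uniform grid. The increments of the path over the grid are independent Gaussian
  vectors, and adding the discrete drift is a strictly triangular shear of them, so shifting one
  Gaussian after the other gives an exact Girsanov formula. Expanding the square in its
  exponent turns the linear terms into the quadratic form of a reduced kernel, the discrete analogue of
  \<open>\<rho>\<close>, minus half of a diagonal sum, which concentrates at half the squared \<open>L\<^sup>2\<close> norm of the lower
  triangle, that is at a quarter of the squared norm of \<open>\<eta>\<close>. The bound on that norm makes the shear
  invertible uniformly in the grid; read backwards, the shear shows that the discrete densities are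
  uniformly integrable, and the formula passes to the limit.

  Wiener measure and the stochastic integrals are introduced by Hilbert choice, so that
  their existence is part of the proof: the measure comes from the Levy construction, the
  integrals from completeness of \<open>L\<^sup>2\<close>.
\<close>

section \<open>Characteristic functions and joint laws\<close>

text \<open>The obstacle is the integrability of the densities, and no exponential moment is
  estimated for it. The Girsanov formula itself turns the integral of a density over the set where
  its logarithm exceeds \<open>L\<close> into the probability that this logarithm, rewritten through
  the inverse shear, exceeds \<open>L\<close>; second moments suffice there. The inverse drift
  solves a discrete Volterra equation, and |u + v|^2 \<le> 2 |u|^2 + 2 |v|^2 with Cauchy-Schwarz
  closes the estimate once the lower triangle has squared norm below 1/2. This is exactly
  \<open>norm2 T \<eta> < 1\<close>, since by symmetry the lower triangle carries half of the mass.

  A step kernel close to \<eta> may have large entries, bounded by some \<open>C\<close>, while the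
  diagonal errors are only of order \<open>C ^ 4 / N\<close>. Subdividing the grid without changing
  the kernel keeps \<open>C\<close> and lets \<open>N\<close> grow, so that all errors become small
  together.

  Squared errors are kept below \<open>(1/4) ^ n\<close>; they are then summable, and one sequence
  of grids gives almost sure convergence of paths, quadratic forms and diagonal sums.\<close>

lemma weighted_char_unique:
  fixes X :: "'a \<Rightarrow> real" and Y :: "'b \<Rightarrow> real"
  assumes X[measurable]: "X \<in> borel_measurable M" and Y[measurable]: "Y \<in> borel_measurable N"
    and U: "integrable M U" "\<And>w. U w \<ge> (0::real)" and V: "integrable N V" "\<And>w. V w \<ge> (0::real)"
    and eq: "\<And>t. (\<integral>w. complex_of_real (U w) * cis (t * X w) \<partial>M) = (\<integral>w. complex_of_real (V w) * cis (t * Y w) \<partial>N)"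
    and A[measurable]: "A \<in> sets borel"
  shows "(\<integral>w. U w * indicator A (X w) \<partial>M) = (\<integral>w. V w * indicator A (Y w) \<partial>N)"
proof -
  define c where "c = (\<integral>w. U w \<partial>M)"
  have c': "c = (\<integral>w. V w \<partial>N)"
    using eq[of 0] by (simp add: c_def)
  have Um[measurable]: "U \<in> borel_measurable M" and Vm[measurable]: "V \<in> borel_measurable N"
    using U V by auto
  show ?thesis
  proof (cases "c = 0")
    case True
    have "AE w in M. U w = 0"
      using integral_nonneg_eq_0_iff_AE[OF U(1)] U(2) True c_def by auto
    moreover have "AE w in N. V w = 0"
      using integral_nonneg_eq_0_iff_AE[OF V(1)] V(2) True c' by auto
    ultimately have "(\<integral>w. U w * indicator A (X w) \<partial>M) = 0" "(\<integral>w. V w * indicator A (Y w) \<partial>N) = 0"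
      by (auto intro!: integral_eq_zero_AE)
    then show ?thesis by simp
  next
    case False
    have c: "c > 0"
    proof -
      have "0 \<le> c" unfolding c_def using U(2) by (intro Bochner_Integration.integral_nonneg) auto
      then show ?thesis using False by simp
    qed
    \<comment> \<open>The identity at \<open>t = 0\<close> shows that both weights have mass
      \<open>c\<close>. Dividing by it makes them probability densities, and Levy's uniqueness
      theorem compares the two laws.\<close>
    define P where "P = distr (density M (\<lambda>w. ennreal (U w / c))) borel X"
    define Q where "Q = distr (density N (\<lambda>w. ennreal (V w / c))) borel Y"
    have "emeasure (density M (\<lambda>w. ennreal (U w / c))) (space M) = 1"
    proof -
      have "(\<integral>\<^sup>+w. ennreal (U w / c) \<partial>M) = ennreal (\<integral>w. U w / c \<partial>M)"
        using U c by (intro nn_integral_eq_integral) auto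
      also have "(\<integral>w. U w / c \<partial>M) = 1" using c by (simp flip: c_def)
      finally show ?thesis by (simp add: emeasure_density cong: nn_integral_cong)
    qed
    then have "prob_space (density M (\<lambda>w. ennreal (U w / c)))"
      by (intro prob_spaceI) simp
    then have "prob_space P" unfolding P_def by (rule prob_space.prob_space_distr) simp
    then have rP: "real_distribution P"
      by (auto simp: real_distribution_def real_distribution_axioms_def P_def)
    have "emeasure (density N (\<lambda>w. ennreal (V w / c))) (space N) = 1"
    proof -
      have "(\<integral>\<^sup>+w. ennreal (V w / c) \<partial>N) = ennreal (\<integral>w. V w / c \<partial>N)"
        using V c by (intro nn_integral_eq_integral) auto
      also have "(\<integral>w. V w / c \<partial>N) = 1" using c by (simp flip: c')
      finally show ?thesis by (simp add: emeasure_density cong: nn_integral_cong)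
    qed
    then have "prob_space (density N (\<lambda>w. ennreal (V w / c)))"
      by (intro prob_spaceI) simp
    then have "prob_space Q" unfolding Q_def by (rule prob_space.prob_space_distr) simp
    then have rQ: "real_distribution Q"
      by (auto simp: real_distribution_def real_distribution_axioms_def Q_def)
    have "char P t = char Q t" for t
    proof -
      have "char P t = (\<integral>w. (U w / c) *\<^sub>R cis (t * X w) \<partial>M)"
        unfolding char_def P_def using c U(2)
        by (subst integral_distr) (auto simp: integral_density cis_conv_exp)
      also have "\<dots> = (\<integral>w. complex_of_real (1/c) * (complex_of_real (U w) * cis (t * X w)) \<partial>M)"
        by (intro Bochner_Integration.integral_cong) (auto simp: scaleR_conv_of_real)
      also have "\<dots> = (\<integral>w. complex_of_real (1/c) * (complex_of_real (V w) * cis (t * Y w)) \<partial>N)"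
        by (simp only: integral_mult_right_zero eq)
      also have "\<dots> = (\<integral>w. (V w / c) *\<^sub>R cis (t * Y w) \<partial>N)"
        by (intro Bochner_Integration.integral_cong) (auto simp: scaleR_conv_of_real)
      also have "\<dots> = char Q t"
        unfolding char_def Q_def using c V(2)
        by (subst integral_distr) (auto simp: integral_density cis_conv_exp)
      finally show ?thesis .
    qed
    then have PQ: "P = Q" by (intro Levy_uniqueness[OF rP rQ]) auto
    have "(\<integral>x. (indicator A x::real) \<partial>P) = (\<integral>w. (U w / c) *\<^sub>R indicator A (X w) \<partial>M)"
      unfolding P_def using c U(2) by (subst integral_distr) (auto simp: integral_density)
    moreover have "(\<integral>x. (indicator A x::real) \<partial>Q) = (\<integral>w. (V w / c) *\<^sub>R indicator A (Y w) \<partial>N)"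
      unfolding Q_def using c V(2) by (subst integral_distr) (auto simp: integral_density)
    ultimately have "(\<integral>w. (U w / c) *\<^sub>R (indicator A (X w)::real) \<partial>M) = (\<integral>w. (V w / c) *\<^sub>R indicator A (Y w) \<partial>N)"
      using PQ by simp
    then show ?thesis
      using c by simp
  qed
qed

lemma cis_measurable[measurable]: "cis \<in> borel_measurable borel"
  by (intro borel_measurable_continuous_onI continuous_on_cis continuous_on_id)

lemma integral_lincomb5:
  fixes f g h :: "'a \<Rightarrow> complex"
  assumes "integrable M f" "integrable M g" "integrable M h"
  shows "(\<integral>x. f x + a * g x + a * h x + b * g x - b * h x \<partial>M)
    = integral\<^sup>L M f + a * integral\<^sup>L M g + a * integral\<^sup>L M h + b * integral\<^sup>L M g - b * integral\<^sup>L M h"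
  using assms by simp

text \<open>Induction on \<open>J\<close>: the coordinates are converted one after another from a
  frequency into an indicator. The indicators already obtained, together with the exponentials still
  present, form the weight with which \<open>weighted_char_unique\<close> is applied to the next
  coordinate.\<close>

lemma joint_char_partial:
  fixes X :: "'i \<Rightarrow> 'a \<Rightarrow> real" and Y :: "'i \<Rightarrow> 'b \<Rightarrow> real"
  assumes "prob_space M" "prob_space N" and I: "finite I"
    and X[measurable]: "\<And>i. X i \<in> borel_measurable M" and Y[measurable]: "\<And>i. Y i \<in> borel_measurable N"
    and eq: "\<And>\<xi>. (\<integral>w. cis (\<Sum>i\<in>I. \<xi> i * X i w) \<partial>M) = (\<integral>w. cis (\<Sum>i\<in>I. \<xi> i * Y i w) \<partial>N)"
    and A[measurable]: "\<And>i. A i \<in> sets borel"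
    and J: "J \<subseteq> I"
  shows "(\<integral>w. complex_of_real (\<Prod>i\<in>J. indicator (A i) (X i w)) * cis (\<Sum>i\<in>I-J. \<xi> i * X i w) \<partial>M)
       = (\<integral>w. complex_of_real (\<Prod>i\<in>J. indicator (A i) (Y i w)) * cis (\<Sum>i\<in>I-J. \<xi> i * Y i w) \<partial>N)"
proof -
  have "finite J" using I J finite_subset by auto
  then show ?thesis using J
  proof (induction J arbitrary: \<xi>)
    case empty
    then show ?case using eq by simp
  next
    case (insert k J)
    interpret M: prob_space M by fact
    interpret N: prob_space N by fact
    define pM where "pM w = (\<Prod>i\<in>J. indicator (A i) (X i w) :: real)" for w
    define pN where "pN w = (\<Prod>i\<in>J. indicator (A i) (Y i w) :: real)" for w
    define K where "K = I - insert k J"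
    define tM where "tM w = (\<Sum>i\<in>K. \<xi> i * X i w)" for w
    define tN where "tN w = (\<Sum>i\<in>K. \<xi> i * Y i w)" for w
    have [measurable]: "pM \<in> borel_measurable M" "pN \<in> borel_measurable N"
      "tM \<in> borel_measurable M" "tN \<in> borel_measurable N"
      unfolding pM_def pN_def tM_def tN_def by measurable
    have p01: "0 \<le> pM w" "pM w \<le> 1" "0 \<le> pN v" "pN v \<le> 1" for w v
      unfolding pM_def pN_def by (auto intro!: prod_nonneg prod_le_1)
    have I': "I - J = insert k K" "k \<notin> K" "finite K"
      using insert I by (auto simp: K_def)
    \<comment> \<open>The extra factor \<open>r\<close> yields the cases \<open>r = 0\<close>,
      \<open>1\<close> and \<open>- 1\<close> at once, that is the weights 1, \<open>cis\<close> and
      its conjugate, from which cosine and sine are combined.\<close>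
    have base: "(\<integral>w. complex_of_real (pM w) * cis (r * tM w) * cis (t * X k w) \<partial>M)
              = (\<integral>w. complex_of_real (pN w) * cis (r * tN w) * cis (t * Y k w) \<partial>N)" for r t
    proof -
      have e: "(\<Sum>i\<in>I-J. (if i = k then t else r * \<xi> i) * Z i) = t * Z k + r * (\<Sum>i\<in>K. \<xi> i * Z i)" for Z
        unfolding I'(1) using I'(2,3) by (auto simp: sum_distrib_left mult.assoc intro!: sum.cong)
      have "(\<integral>w. complex_of_real (pM w) * cis (t * X k w + r * tM w) \<partial>M)
              = (\<integral>w. complex_of_real (pN w) * cis (t * Y k w + r * tN w) \<partial>N)"
        using insert.IH[of "\<lambda>i. if i = k then t else r * \<xi> i"] insert.prems
        by (simp add: e pM_def pN_def tM_def tN_def)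
      then show ?thesis by (simp add: mult.assoc cis_mult add.commute)
    qed
    have bM: "integrable M (\<lambda>w. complex_of_real (pM w) * cis (r * tM w) * cis (t * X k w))" for r t
      by (rule M.integrable_const_bound[of _ 1]) (use p01 in \<open>auto simp: norm_mult\<close>)
    have bN: "integrable N (\<lambda>w. complex_of_real (pN w) * cis (r * tN w) * cis (t * Y k w))" for r t
      by (rule N.integrable_const_bound[of _ 1]) (use p01 in \<open>auto simp: norm_mult\<close>)
    \<comment> \<open>The nonnegative weights 1, 1 + cos and 1 + sin span cis, and each of them reduces to the one-dimensional uniqueness theorem.\<close>
    have fin: "(\<integral>w. pM w * (1 + a * cos (tM w) + b * sin (tM w)) * indicator (A k) (X k w) \<partial>M)
       = (\<integral>w. pN w * (1 + a * cos (tN w) + b * sin (tN w)) * indicator (A k) (Y k w) \<partial>N)"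
      if ab: "(a = 0 \<or> a = 1) \<and> b = 0 \<or> a = 0 \<and> b = 1" for a b :: real
    proof (rule weighted_char_unique)
      have nn: "0 \<le> 1 + a * cos x + b * sin x" "1 + a * cos x + b * sin x \<le> 2" for x
      proof -
        have "- 1 \<le> a * cos x + b * sin x \<and> a * cos x + b * sin x \<le> 1" using ab by (elim disjE conjE) auto
        then show "0 \<le> 1 + a * cos x + b * sin x" "1 + a * cos x + b * sin x \<le> 2" by auto
      qed
      have pq: "\<bar>p * q\<bar> \<le> 2" if "0 \<le> p" "p \<le> 1" "0 \<le> q" "q \<le> 2" for p q :: real
        using mult_mono[of p 1 q 2] that by (simp add: abs_mult)
      show "integrable M (\<lambda>w. pM w * (1 + a * cos (tM w) + b * sin (tM w)))"
        by (intro M.integrable_const_bound[of _ 2] AE_I2) (use pq[OF p01(1,2) nn] in simp_all)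
      show "integrable N (\<lambda>w. pN w * (1 + a * cos (tN w) + b * sin (tN w)))"
        by (intro N.integrable_const_bound[of _ 2] AE_I2) (use pq[OF p01(3,4) nn] in simp_all)
      show "0 \<le> pM w * (1 + a * cos (tM w) + b * sin (tM w))" "0 \<le> pN v * (1 + a * cos (tN v) + b * sin (tN v))" for w v
        using p01 nn by auto
      have cs: "complex_of_real (p * (1 + a * cos x + b * sin x)) * z
        = of_real p * cis (0 * x) * z + (of_real a / 2) * (of_real p * cis (1 * x) * z) + (of_real a / 2) * (of_real p * cis (- 1 * x) * z)
          + (of_real b / (2 * \<i>)) * (of_real p * cis (1 * x) * z) - (of_real b / (2 * \<i>)) * (of_real p * cis (- 1 * x) * z)" for p x z
      proof -
        have c2: "complex_of_real (cos x) = (cis x + cis (- x)) / 2" and s2: "complex_of_real (sin x) = (cis x - cis (- x)) / (2 * \<i>)"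
          by (auto simp: complex_eq_iff Re_divide Im_divide)
        show ?thesis unfolding of_real_mult of_real_add c2 s2 of_real_1
          by (simp add: algebra_simps add_divide_distrib diff_divide_distrib)
      qed
      show "(\<integral>w. complex_of_real (pM w * (1 + a * cos (tM w) + b * sin (tM w))) * cis (t * X k w) \<partial>M)
         = (\<integral>w. complex_of_real (pN w * (1 + a * cos (tN w) + b * sin (tN w))) * cis (t * Y k w) \<partial>N)" for t
        unfolding cs integral_lincomb5[OF bM[of 0 t] bM[of 1 t] bM[of "- 1" t]]
          integral_lincomb5[OF bN[of 0 t] bN[of 1 t] bN[of "- 1" t]] base ..
    qed auto
    define qM where "qM w = pM w * indicator (A k) (X k w)" for w
    define qN where "qN w = pN w * indicator (A k) (Y k w)" for w
    have [measurable]: "qM \<in> borel_measurable M" "qN \<in> borel_measurable N"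
      unfolding qM_def qN_def by measurable
    have q01: "0 \<le> qM w" "qM w \<le> 1" "0 \<le> qN v" "qN v \<le> 1" for w v
      using p01 by (auto simp: qM_def qN_def indicator_def)
    have b1: "\<bar>q * y\<bar> \<le> 1" if "0 \<le> q" "q \<le> 1" "\<bar>y\<bar> \<le> 1" for q y :: real
      using mult_mono[of q 1 "\<bar>y\<bar>" 1] that by (simp add: abs_mult)
    have iM: "integrable M (\<lambda>w. qM w)" "integrable M (\<lambda>w. qM w * cos (tM w))" "integrable M (\<lambda>w. qM w * sin (tM w))"
      using q01 by (auto intro!: M.integrable_const_bound[of _ 1] AE_I2 b1)
    have iN: "integrable N (\<lambda>w. qN w)" "integrable N (\<lambda>w. qN w * cos (tN w))" "integrable N (\<lambda>w. qN w * sin (tN w))"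
      using q01 by (auto intro!: N.integrable_const_bound[of _ 1] AE_I2 b1)
    have f0: "(\<integral>w. qM w \<partial>M) = (\<integral>w. qN w \<partial>N)"
      using fin[of 0 0] by (simp add: qM_def qN_def)
    have "(\<integral>w. qM w + qM w * cos (tM w) \<partial>M) = (\<integral>w. qN w + qN w * cos (tN w) \<partial>N)"
      using fin[of 1 0] by (simp add: qM_def qN_def algebra_simps)
    then have f1: "(\<integral>w. qM w * cos (tM w) \<partial>M) = (\<integral>w. qN w * cos (tN w) \<partial>N)"
      using f0 iM iN by simp
    have "(\<integral>w. qM w + qM w * sin (tM w) \<partial>M) = (\<integral>w. qN w + qN w * sin (tN w) \<partial>N)"
      using fin[of 0 1] by (simp add: qM_def qN_def algebra_simps)
    then have f2: "(\<integral>w. qM w * sin (tM w) \<partial>M) = (\<integral>w. qN w * sin (tN w) \<partial>N)"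
      using f0 iM iN by simp
    have ce: "complex_of_real q * cis x = complex_of_real (q * cos x) + \<i> * complex_of_real (q * sin x)" for q x
      by (simp add: complex_eq_iff)
    have "(\<integral>w. complex_of_real (qM w) * cis (tM w) \<partial>M) = (\<integral>w. complex_of_real (qN w) * cis (tN w) \<partial>N)"
      unfolding ce using iM iN f1 f2
      by (subst (1 2) Bochner_Integration.integral_add) (auto intro!: integrable_of_real simp del: of_real_mult)
    then show ?case
      using insert.hyps by (simp add: qM_def qN_def pM_def pN_def tM_def tN_def K_def mult.commute)
  qed
qed

lemma joint_char_unique:
  fixes X :: "'i \<Rightarrow> 'a \<Rightarrow> real" and Y :: "'i \<Rightarrow> 'b \<Rightarrow> real"
  assumes M: "prob_space M" and N: "prob_space N" and I: "finite I"
    and X[measurable]: "\<And>i. X i \<in> borel_measurable M" and Y[measurable]: "\<And>i. Y i \<in> borel_measurable N"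
    and eq: "\<And>\<xi>. (\<integral>w. cis (\<Sum>i\<in>I. \<xi> i * X i w) \<partial>M) = (\<integral>w. cis (\<Sum>i\<in>I. \<xi> i * Y i w) \<partial>N)"
  shows "distr M (Pi\<^sub>M I (\<lambda>_. borel)) (\<lambda>w. \<lambda>i\<in>I. X i w) = distr N (Pi\<^sub>M I (\<lambda>_. borel)) (\<lambda>w. \<lambda>i\<in>I. Y i w)"
proof (rule measure_eqI_PiM_finite[OF I])
  interpret M: prob_space M by fact
  interpret N: prob_space N by fact
  have [measurable]: "(\<lambda>w. \<lambda>i\<in>I. X i w) \<in> measurable M (Pi\<^sub>M I (\<lambda>_. borel))"
    "(\<lambda>w. \<lambda>i\<in>I. Y i w) \<in> measurable N (Pi\<^sub>M I (\<lambda>_. borel))" by measurable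
  interpret DM: prob_space "distr M (Pi\<^sub>M I (\<lambda>_. borel)) (\<lambda>w. \<lambda>i\<in>I. X i w)" by (rule M.prob_space_distr) simp
  interpret DN: prob_space "distr N (Pi\<^sub>M I (\<lambda>_. borel)) (\<lambda>w. \<lambda>i\<in>I. Y i w)" by (rule N.prob_space_distr) simp
  fix A :: "'i \<Rightarrow> real set" assume "\<And>i. i \<in> I \<Longrightarrow> A i \<in> sets borel"
  then have A[measurable]: "\<And>i. i \<in> I \<Longrightarrow> A i \<in> sets borel" by simp
  \<comment> \<open>\<open>joint_char_partial\<close> expects a Borel set for every index; the empty
    set is a filler off \<open>I\<close>, invisible to the product over \<open>I\<close>.\<close>
  define A' where "A' i = (if i \<in> I then A i else {})" for i
  have A'[measurable]: "A' i \<in> sets borel" for i using A by (auto simp: A'_def)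
  have pe: "Pi\<^sub>E I A = Pi\<^sub>E I A'" by (auto simp: A'_def PiE_def Pi_def)
  have "Pi\<^sub>E I A' \<in> sets (Pi\<^sub>M I (\<lambda>_. borel))" using I by (intro sets_PiM_I_finite) auto
  note [measurable] = this
  have ind: "(\<Prod>i\<in>I. indicator (A' i) (x i) :: real) = indicator (Pi\<^sub>E I A') (\<lambda>i\<in>I. x i)" for x
    using I by (auto simp: indicator_def prod_zero_iff PiE_def Pi_def)
  have "(\<integral>w. complex_of_real (indicator (Pi\<^sub>E I A') (\<lambda>i\<in>I. X i w)) \<partial>M)
      = (\<integral>w. complex_of_real (indicator (Pi\<^sub>E I A') (\<lambda>i\<in>I. Y i w)) \<partial>N)"
    using joint_char_partial[OF M N I X Y eq _ order_refl, where A=A' and \<xi>="\<lambda>_. 0"] unfolding ind using A' by simp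
  then have "(\<integral>w. (indicator (Pi\<^sub>E I A') (\<lambda>i\<in>I. X i w)::real) \<partial>M) = (\<integral>w. indicator (Pi\<^sub>E I A') (\<lambda>i\<in>I. Y i w) \<partial>N)"
    by (simp only: integral_complex_of_real of_real_eq_iff)
  moreover have "(\<integral>w. (indicator (Pi\<^sub>E I A') (\<lambda>i\<in>I. X i w)::real) \<partial>M)
     = measure (distr M (Pi\<^sub>M I (\<lambda>_. borel)) (\<lambda>w. \<lambda>i\<in>I. X i w)) (Pi\<^sub>E I A')"
    by (subst integral_distr[symmetric, where g="\<lambda>w. \<lambda>i\<in>I. X i w" and N="Pi\<^sub>M I (\<lambda>_. borel)"]) auto
  moreover have "(\<integral>w. (indicator (Pi\<^sub>E I A') (\<lambda>i\<in>I. Y i w)::real) \<partial>N)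
     = measure (distr N (Pi\<^sub>M I (\<lambda>_. borel)) (\<lambda>w. \<lambda>i\<in>I. Y i w)) (Pi\<^sub>E I A')"
    by (subst integral_distr[symmetric, where g="\<lambda>w. \<lambda>i\<in>I. Y i w" and N="Pi\<^sub>M I (\<lambda>_. borel)"]) auto
  ultimately show "emeasure (distr M (Pi\<^sub>M I (\<lambda>_. borel)) (\<lambda>w. \<lambda>i\<in>I. X i w)) (Pi\<^sub>E I A)
     = emeasure (distr N (Pi\<^sub>M I (\<lambda>_. borel)) (\<lambda>w. \<lambda>i\<in>I. Y i w)) (Pi\<^sub>E I A)"
    by (simp add: DM.emeasure_eq_measure DN.emeasure_eq_measure pe)
next
  interpret DM: prob_space "distr M (Pi\<^sub>M I (\<lambda>_. borel)) (\<lambda>w. \<lambda>i\<in>I. X i w)"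
    by (rule prob_space.prob_space_distr[OF M]) simp
  show "range (\<lambda>_::nat. space (Pi\<^sub>M I (\<lambda>_. borel::real measure))) \<subseteq> prod_algebra I (\<lambda>_. borel)"
    using space_in_prod_algebra[of I "\<lambda>_. borel::real measure"] by (simp add: space_PiM)
  show "(\<Union>i::nat. space (Pi\<^sub>M I (\<lambda>_. borel::real measure))) = space (Pi\<^sub>M I (\<lambda>_. borel))" by simp
  show "emeasure (distr M (Pi\<^sub>M I (\<lambda>_. borel)) (\<lambda>w. \<lambda>i\<in>I. X i w)) (space (Pi\<^sub>M I (\<lambda>_. borel))) \<noteq> \<infinity>"
    using DM.emeasure_space_1 by simp
qed simp_all

lemma borel_measurable_vec_lambda:
  fixes f :: "'a \<Rightarrow> 'd::finite \<Rightarrow> real"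
  assumes "\<And>j. (\<lambda>x. f x j) \<in> borel_measurable M"
  shows "(\<lambda>x. \<chi> j. f x j) \<in> borel_measurable M"
proof (intro borel_measurable_euclidean_space[where 'c="real^'d", THEN iffD2] ballI)
  fix b :: "real ^ 'd" assume "b \<in> Basis"
  then obtain j where b: "b = axis j 1" by (auto simp: Basis_vec_def)
  show "(\<lambda>x. (\<chi> j. f x j) \<bullet> b) \<in> borel_measurable M"
    using assms[of j] by (simp add: b inner_axis)
qed

text \<open>A family of vectors indexed by \<open>I\<close> is a family of scalars indexed by
  \<open>I \<times> UNIV\<close>; the map \<open>\<Phi>\<close> reassembles the vectors, so the
  scalar statement is pushed forward along it.\<close>

lemma joint_char_unique_vec:
  fixes X :: "'i \<Rightarrow> 'a \<Rightarrow> real ^ 'd" and Y :: "'i \<Rightarrow> 'b \<Rightarrow> real ^ 'd"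
  assumes M: "prob_space M" and N: "prob_space N" and I: "finite I"
    and X: "\<And>i. i \<in> I \<Longrightarrow> X i \<in> borel_measurable M"
    and Y: "\<And>i. i \<in> I \<Longrightarrow> Y i \<in> borel_measurable N"
    and eq: "\<And>\<xi>. (\<integral>w. cis (\<Sum>i\<in>I. \<xi> i \<bullet> X i w) \<partial>M) = (\<integral>w. cis (\<Sum>i\<in>I. \<xi> i \<bullet> Y i w) \<partial>N)"
  shows "distr M (Pi\<^sub>M I (\<lambda>_. borel)) (\<lambda>w. \<lambda>i\<in>I. X i w) = distr N (Pi\<^sub>M I (\<lambda>_. borel)) (\<lambda>w. \<lambda>i\<in>I. Y i w)"
proof -
  define J where "J = I \<times> (UNIV :: 'd set)"
  \<comment> \<open>The scalar statement asks for measurability at every index, hence the value 0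
    off \<open>I\<close>.\<close>
  define X' where "X' p w = (if fst p \<in> I then X (fst p) w $ snd p else 0)" for p w
  define Y' where "Y' p w = (if fst p \<in> I then Y (fst p) w $ snd p else 0)" for p w
  have [measurable]: "X' p \<in> borel_measurable M" "Y' p \<in> borel_measurable N" for p
  proof -
    have "X' p \<in> borel_measurable M \<and> Y' p \<in> borel_measurable N"
    proof (cases "fst p \<in> I")
      case True
      have "X' p = (\<lambda>w. X (fst p) w $ snd p)" "Y' p = (\<lambda>w. Y (fst p) w $ snd p)"
        using True by (auto simp: X'_def Y'_def)
      then show ?thesis
        using measurable_compose[OF X[OF True] borel_measurable_nth]
          measurable_compose[OF Y[OF True] borel_measurable_nth] by simp
    next
      case False
      then have "X' p = (\<lambda>w. 0)" "Y' p = (\<lambda>w. 0)" by (auto simp: X'_def Y'_def)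
      then show ?thesis by simp
    qed
    then show "X' p \<in> borel_measurable M" "Y' p \<in> borel_measurable N" by auto
  qed
  have s: "(\<Sum>p\<in>J. \<xi> p * X' p w) = (\<Sum>i\<in>I. (\<chi> j. \<xi> (i,j)) \<bullet> X i w)"
     "(\<Sum>p\<in>J. \<xi> p * Y' p v) = (\<Sum>i\<in>I. (\<chi> j. \<xi> (i,j)) \<bullet> Y i v)" for \<xi> w v
  proof -
    have "(\<Sum>i\<in>I. \<Sum>j\<in>UNIV. \<xi> (i,j) * (X i w $ j)) = (\<Sum>p\<in>J. \<xi> p * X' p w)"
      unfolding sum.cartesian_product J_def by (rule sum.cong) (auto simp: X'_def)
    then show "(\<Sum>p\<in>J. \<xi> p * X' p w) = (\<Sum>i\<in>I. (\<chi> j. \<xi> (i,j)) \<bullet> X i w)"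
      by (simp add: inner_vec_def)
    have "(\<Sum>i\<in>I. \<Sum>j\<in>UNIV. \<xi> (i,j) * (Y i v $ j)) = (\<Sum>p\<in>J. \<xi> p * Y' p v)"
      unfolding sum.cartesian_product J_def by (rule sum.cong) (auto simp: Y'_def)
    then show "(\<Sum>p\<in>J. \<xi> p * Y' p v) = (\<Sum>i\<in>I. (\<chi> j. \<xi> (i,j)) \<bullet> Y i v)"
      by (simp add: inner_vec_def)
  qed
  have D: "distr M (Pi\<^sub>M J (\<lambda>_. borel)) (\<lambda>w. \<lambda>i\<in>J. X' i w) = distr N (Pi\<^sub>M J (\<lambda>_. borel)) (\<lambda>w. \<lambda>i\<in>J. Y' i w)"
    using I by (intro joint_char_unique[OF M N]) (simp_all only: s eq, auto simp: J_def)
  define \<Phi> where "\<Phi> x = (\<lambda>i\<in>I. \<chi> j. (x (i,j) :: real))" for x :: "'i \<times> 'd \<Rightarrow> real"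
  have \<Phi>[measurable]: "\<Phi> \<in> measurable (Pi\<^sub>M J (\<lambda>_. borel)) (Pi\<^sub>M I (\<lambda>_. borel))"
    unfolding \<Phi>_def
  proof (rule measurable_restrict)
    fix i assume i: "i \<in> I"
    show "(\<lambda>x::'i \<times> 'd \<Rightarrow> real. \<chi> j. x (i, j)) \<in> borel_measurable (Pi\<^sub>M J (\<lambda>_. borel))"
    proof (rule borel_measurable_vec_lambda)
      fix j have "(i, j) \<in> J" using i by (simp add: J_def)
      then show "(\<lambda>x::'i \<times> 'd \<Rightarrow> real. x (i, j)) \<in> borel_measurable (Pi\<^sub>M J (\<lambda>_. borel))" by simp
    qed
  qed
  have e: "\<Phi> (\<lambda>i\<in>J. X' i w) = (\<lambda>i\<in>I. X i w)" "\<Phi> (\<lambda>i\<in>J. Y' i v) = (\<lambda>i\<in>I. Y i v)" for w v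
    by (auto simp: \<Phi>_def X'_def Y'_def J_def restrict_def vec_eq_iff)
  have "distr M (Pi\<^sub>M I (\<lambda>_. borel)) (\<lambda>w. \<lambda>i\<in>I. X i w) = distr (distr M (Pi\<^sub>M J (\<lambda>_. borel)) (\<lambda>w. \<lambda>i\<in>J. X' i w)) (Pi\<^sub>M I (\<lambda>_. borel)) \<Phi>"
    by (subst distr_distr) (auto simp: comp_def e)
  also have "\<dots> = distr (distr N (Pi\<^sub>M J (\<lambda>_. borel)) (\<lambda>w. \<lambda>i\<in>J. Y' i w)) (Pi\<^sub>M I (\<lambda>_. borel)) \<Phi>"
    unfolding D ..
  also have "\<dots> = distr N (Pi\<^sub>M I (\<lambda>_. borel)) (\<lambda>w. \<lambda>i\<in>I. Y i w)"
    by (subst distr_distr) (auto simp: comp_def e)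
  finally show ?thesis .
qed

section \<open>The Levy construction of Wiener measure\<close>

definition dyadic_overlap :: "real \<Rightarrow> nat \<Rightarrow> nat \<Rightarrow> real \<Rightarrow> real" where
  "dyadic_overlap T n k t = max 0 (min (t - T * real k / 2 ^ n) (T / 2 ^ n))"

text \<open>These are the integrals over \<open>{0..t}\<close> of the normalised Haar functions.
  \<open>dyadic_overlap T n k t\<close> is the length of the part of the \<open>k\<close>-th dyadic
  interval of level \<open>n\<close> that lies left of \<open>t\<close>; the overlap with the left
  half minus that with the right half, divided by the square root of the length of the parent
  interval, integrates one Haar function. Level 0 is the constant function.\<close>

definition schauder :: "real \<Rightarrow> nat \<Rightarrow> nat \<Rightarrow> real \<Rightarrow> real" where
  "schauder T n k t = (case n of 0 \<Rightarrow> dyadic_overlap T 0 0 t / sqrt T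
     | Suc m \<Rightarrow> (dyadic_overlap T (Suc m) (2 * k) t - dyadic_overlap T (Suc m) (2 * k + 1) t) / sqrt (T / 2 ^ m))"

definition level_size :: "nat \<Rightarrow> nat" where
  "level_size n = (case n of 0 \<Rightarrow> 1 | Suc m \<Rightarrow> 2 ^ m)"

lemma level_size_simps[simp]: "level_size 0 = 1" "level_size (Suc m) = 2 ^ m"
  by (simp_all add: level_size_def)

lemma sum_lessThan_double:
  fixes f :: "nat \<Rightarrow> 'a::comm_monoid_add"
  shows "(\<Sum>k<2 * n. f k) = (\<Sum>k<n. f (2 * k) + f (2 * k + 1))"
  by (induction n) (auto simp: algebra_simps)

lemma dyadic_overlap_split:
  assumes "T > 0"
  shows "dyadic_overlap T n k t = dyadic_overlap T (Suc n) (2 * k) t + dyadic_overlap T (Suc n) (2 * k + 1) t"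
proof -
  define d where "d = T / 2 ^ Suc n"
  define x where "x = t - T * real k / 2 ^ n"
  have "d > 0" using assms by (simp add: d_def)
  then have "max 0 (min x (2 * d)) = max 0 (min x d) + max 0 (min (x - d) d)"
    by (auto simp: min_def max_def)
  moreover have e: "T / 2 ^ n = 2 * d" "T * real (2 * k) / 2 ^ Suc n = T * real k / 2 ^ n"
    "t - T * real (2 * k + 1) / 2 ^ Suc n = x - d"
    by (auto simp: d_def x_def field_simps)
  ultimately show ?thesis by (simp only: dyadic_overlap_def e x_def[symmetric] d_def[symmetric])
qed

text \<open>Parseval at a finite level: the Haar functions of levels up to \<open>n\<close> and the
  normalised indicators of the dyadic intervals of level \<open>n\<close> are orthonormal bases of
  the same space, so their kernels agree. The passage to the next level is the identity (a + a')(b +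
  b') + (a - a')(b - b') = 2 (a b + a' b').\<close>

lemma schauder_kernel:
  assumes T: "T > 0"
  shows "(\<Sum>m\<le>n. \<Sum>k<level_size m. schauder T m k s * schauder T m k t)
     = (\<Sum>k<2^n. dyadic_overlap T n k s * dyadic_overlap T n k t / (T / 2 ^ n))"
proof (induction n)
  case 0
  show ?case using T by (simp add: level_size_def schauder_def)
next
  case (Suc n)
  let ?o = "dyadic_overlap T"
  define \<delta> where "\<delta> = T / 2 ^ n"
  have \<delta>: "\<delta> > 0" "T / 2 ^ Suc n = \<delta> / 2" using T by (auto simp: \<delta>_def)
  have "(\<Sum>m\<le>Suc n. \<Sum>k<level_size m. schauder T m k s * schauder T m k t)
     = (\<Sum>k<2^n. ?o n k s * ?o n k t / \<delta>) + (\<Sum>k<2^n. schauder T (Suc n) k s * schauder T (Suc n) k t)"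
    unfolding sum.atMost_Suc Suc level_size_simps \<delta>_def ..
  also have "\<dots> = (\<Sum>k<2^n. ?o n k s * ?o n k t / \<delta> + schauder T (Suc n) k s * schauder T (Suc n) k t)"
    by (rule sum.distrib[symmetric])
  also have "\<dots> = (\<Sum>k<2^n. ?o (Suc n) (2*k) s * ?o (Suc n) (2*k) t / (\<delta>/2) + ?o (Suc n) (2*k+1) s * ?o (Suc n) (2*k+1) t / (\<delta>/2))"
  proof (rule sum.cong[OF refl])
    fix k
    define a a' b b' where "a = ?o (Suc n) (2*k) s" "a' = ?o (Suc n) (2*k+1) s" "b = ?o (Suc n) (2*k) t" "b' = ?o (Suc n) (2*k+1) t"
    have "schauder T (Suc n) k s * schauder T (Suc n) k t = (a - a') * (b - b') / (sqrt \<delta> * sqrt \<delta>)"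
      by (simp add: schauder_def a_a'_b_b'_def \<delta>_def)
    also have "sqrt \<delta> * sqrt \<delta> = \<delta>" using \<delta> by simp
    finally show "?o n k s * ?o n k t / \<delta> + schauder T (Suc n) k s * schauder T (Suc n) k t
      = ?o (Suc n) (2*k) s * ?o (Suc n) (2*k) t / (\<delta>/2) + ?o (Suc n) (2*k+1) s * ?o (Suc n) (2*k+1) t / (\<delta>/2)"
      unfolding dyadic_overlap_split[OF T, of n k] a_a'_b_b'_def[symmetric] using \<delta>
      by (simp add: field_simps)
  qed
  also have "\<dots> = (\<Sum>k<2^Suc n. ?o (Suc n) k s * ?o (Suc n) k t / (T / 2 ^ Suc n))"
    unfolding \<delta>(2) unfolding power_Suc sum_lessThan_double ..
  finally show ?case .
qed

lemma dyadic_overlap_le: "T > 0 \<Longrightarrow> dyadic_overlap T n k t \<le> T / 2 ^ n"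
  and dyadic_overlap_nonneg: "0 \<le> dyadic_overlap T n k t"
  by (auto simp: dyadic_overlap_def)

lemma dyadic_overlap_eq_0_iff: "T > 0 \<Longrightarrow> dyadic_overlap T n k t = 0 \<longleftrightarrow> t \<le> T * real k / 2 ^ n"
  using divide_pos_pos[of T "2 ^ n"] by (auto simp: dyadic_overlap_def max_def min_def simp del: zero_less_divide_iff divide_pos_pos)

lemma dyadic_overlap_full: "T > 0 \<Longrightarrow> T * real (Suc k) / 2 ^ n \<le> t \<Longrightarrow> dyadic_overlap T n k t = T / 2 ^ n"
proof -
  assume "T > 0" "T * real (Suc k) / 2 ^ n \<le> t"
  moreover have "T * real (Suc k) / 2 ^ n = T * real k / 2 ^ n + T / 2 ^ n" by (simp add: field_simps)
  moreover have "0 < T / 2 ^ n" using \<open>T > 0\<close> by simp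
  ultimately show ?thesis unfolding dyadic_overlap_def by linarith
qed

lemma dyadic_overlap_sum:
  assumes "T > 0" "0 \<le> t"
  shows "(\<Sum>k<m. dyadic_overlap T n k t) = min t (T * real m / 2 ^ n)"
proof (induction m)
  case 0 then show ?case using assms by simp
next
  case (Suc m)
  have "T * real (Suc m) / 2 ^ n = T * real m / 2 ^ n + T / 2 ^ n" by (simp add: field_simps)
  moreover have "T / 2 ^ n > 0" using assms by simp
  ultimately show ?case using Suc by (auto simp: dyadic_overlap_def min_def max_def)
qed

lemma dyadic_index_unique:
  assumes "T > 0" "T * real k / 2 ^ n < t" "t < T * real (Suc k) / 2 ^ n"
  shows "k = nat \<lfloor>t * 2 ^ n / T\<rfloor>"
proof -
  have "real k \<le> t * 2 ^ n / T" "t * 2 ^ n / T < real k + 1"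
    using assms by (auto simp: field_simps)
  then have "\<lfloor>t * 2 ^ n / T\<rfloor> = int k" by (intro floor_unique) auto
  then show ?thesis by simp
qed

text \<open>The overlaps with \<open>s\<close> add up to \<open>s\<close>, and each term of the
  kernel equals such an overlap except for one: if the interval lies left of \<open>s\<close>, its
  overlap with \<open>t\<close> is full, and if it lies right of \<open>s\<close>, both expressions
  vanish. Only the interval having \<open>s\<close> in its interior contributes, by at most its
  length.\<close>

lemma schauder_kernel_bound:
  assumes T: "T > 0" and st: "0 \<le> s" "s \<le> t" "t \<le> T"
  shows "\<bar>(\<Sum>m\<le>n. \<Sum>k<level_size m. schauder T m k s * schauder T m k t) - s\<bar> \<le> T / 2 ^ n"
proof -
  let ?o = "dyadic_overlap T n"
  define \<delta> where "\<delta> = T / 2 ^ n"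
  have d: "\<delta> > 0" using T by (simp add: \<delta>_def)
  have o: "0 \<le> ?o k t" "?o k t \<le> \<delta>" for k t
    using dyadic_overlap_le[OF T, of n k t] dyadic_overlap_nonneg[of T n k t] by (auto simp: \<delta>_def)
  have s: "(\<Sum>k<2^n. ?o k s) = s" using dyadic_overlap_sum[OF T st(1), of n "2^n"] st T by simp
  have "(\<Sum>m\<le>n. \<Sum>k<level_size m. schauder T m k s * schauder T m k t) - s
     = (\<Sum>k<2^n. ?o k s * ?o k t / \<delta> - ?o k s)"
    unfolding schauder_kernel[OF T] sum_subtractf s \<delta>_def ..
  also have "\<bar>\<dots>\<bar> \<le> (\<Sum>k<2^n. \<bar>?o k s * ?o k t / \<delta> - ?o k s\<bar>)" by (rule sum_abs)
  also have "\<dots> \<le> (\<Sum>k<2^n. if k = nat \<lfloor>s * 2 ^ n / T\<rfloor> then \<delta> else 0)"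
  proof (rule sum_mono)
    fix k
    show "\<bar>?o k s * ?o k t / \<delta> - ?o k s\<bar> \<le> (if k = nat \<lfloor>s * 2 ^ n / T\<rfloor> then \<delta> else 0)"
    proof (cases "T * real k / 2 ^ n < s \<and> s < T * real (Suc k) / 2 ^ n")
      case True
      then have k: "k = nat \<lfloor>s * 2 ^ n / T\<rfloor>" using dyadic_index_unique[OF T] by auto
      have b: "0 \<le> ?o k s" "?o k s \<le> \<delta>" "0 \<le> ?o k t / \<delta>" "?o k t / \<delta> \<le> 1"
        using o d by auto
      then have "?o k s * (?o k t / \<delta>) \<le> ?o k s * 1" by (intro mult_left_mono)
      moreover have "0 \<le> ?o k s * (?o k t / \<delta>)" using b by (intro mult_nonneg_nonneg)
      ultimately have "\<bar>?o k s * (?o k t / \<delta>) - ?o k s\<bar> \<le> \<delta>" using b by (simp add: abs_if)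
      then show ?thesis using k by simp
    next
      case False
      then consider "s \<le> T * real k / 2 ^ n" | "T * real (Suc k) / 2 ^ n \<le> s" by linarith
      then have "?o k s * ?o k t / \<delta> - ?o k s = 0"
      proof cases
        case 1 then show ?thesis using dyadic_overlap_eq_0_iff[OF T, of n k s] by simp
      next
        case 2 then show ?thesis using dyadic_overlap_full[OF T, of k n t] st d by (simp flip: \<delta>_def)
      qed
      then show ?thesis using d by simp
    qed
  qed
  also have "\<dots> \<le> \<delta>" using d by (simp add: sum.delta)
  finally show ?thesis unfolding \<delta>_def .
qed

lemma schauder_kernel_tendsto:
  assumes T: "T > 0" and st: "s \<in> {0..T}" "t \<in> {0..T}"
  shows "(\<lambda>n. \<Sum>m<n. \<Sum>k<level_size m. schauder T m k s * schauder T m k t) \<longlonglongrightarrow> min s t"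
proof -
  have lim: "(\<lambda>n. T / 2 ^ n) \<longlonglongrightarrow> 0"
    using tendsto_mult[OF tendsto_const[of T] LIMSEQ_power_zero[of "1/2::real"]] by (simp add: power_divide)
  have "(\<lambda>n. \<Sum>m\<le>n. \<Sum>k<level_size m. schauder T m k s * schauder T m k t) \<longlonglongrightarrow> min s t"
  proof (rule LIM_zero_cancel, rule Lim_null_comparison[OF _ lim], rule always_eventually, rule allI)
    fix n
    show "norm ((\<Sum>m\<le>n. \<Sum>k<level_size m. schauder T m k s * schauder T m k t) - min s t) \<le> T / 2 ^ n"
    proof (cases "s \<le> t")
      case True then show ?thesis using schauder_kernel_bound[OF T, of s t n] st by (simp add: min_def)
    next
      case False then show ?thesis using schauder_kernel_bound[OF T, of t s n] st
        by (simp add: min_def mult.commute)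
    qed
  qed
  then show ?thesis by (subst filterlim_sequentially_Suc[symmetric]) (simp add: lessThan_Suc_atMost)
qed

text \<open>Within one level the supports overlap at most in endpoints. At a given time a whole
  level of the random series thus reduces to a single term, which is what makes the bound of a level
  independent of the number of its functions.\<close>

lemma schauder_eq_0:
  assumes T: "T > 0" and k: "k \<noteq> nat \<lfloor>t * 2 ^ m / T\<rfloor>"
  shows "schauder T (Suc m) k t = 0"
proof -
  consider "t \<le> T * real k / 2 ^ m" | "T * real (Suc k) / 2 ^ m \<le> t"
    using dyadic_index_unique[OF T, of k m t] k by linarith
  then show ?thesis
  proof cases
    case 1
    have "T * real k / 2 ^ m = T * real (2 * k) / 2 ^ Suc m" by simp
    moreover have "T * real (2 * k) / 2 ^ Suc m \<le> T * real (2 * k + 1) / 2 ^ Suc m"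
      using T by (intro divide_right_mono mult_left_mono) auto
    ultimately have "dyadic_overlap T (Suc m) (2 * k) t = 0" "dyadic_overlap T (Suc m) (2 * k + 1) t = 0"
      using 1 dyadic_overlap_eq_0_iff[OF T, of "Suc m" "2 * k" t] dyadic_overlap_eq_0_iff[OF T, of "Suc m" "2 * k + 1" t]
      by linarith+
    then show ?thesis by (simp add: schauder_def)
  next
    case 2
    have "T * real (Suc k) / 2 ^ m = T * real (Suc (2 * k + 1)) / 2 ^ Suc m" by (simp add: field_simps)
    moreover have "T * real (Suc (2 * k)) / 2 ^ Suc m \<le> T * real (Suc (2 * k + 1)) / 2 ^ Suc m"
      using T by (intro divide_right_mono mult_left_mono) auto
    ultimately have "dyadic_overlap T (Suc m) (2 * k) t = T / 2 ^ Suc m" "dyadic_overlap T (Suc m) (2 * k + 1) t = T / 2 ^ Suc m"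
      using 2 dyadic_overlap_full[OF T, of "2 * k" "Suc m" t] dyadic_overlap_full[OF T, of "2 * k + 1" "Suc m" t]
      by linarith+
    then show ?thesis by (simp add: schauder_def)
  qed
qed

lemma schauder_abs_le:
  assumes T: "T > 0"
  shows "\<bar>schauder T (Suc m) k t\<bar> \<le> sqrt (T / 2 ^ m)"
proof -
  define \<delta> where "\<delta> = T / 2 ^ m"
  have d: "\<delta> > 0" "T / 2 ^ Suc m \<le> \<delta>" using T by (auto simp: \<delta>_def field_simps)
  let ?a = "dyadic_overlap T (Suc m) (2 * k) t" and ?b = "dyadic_overlap T (Suc m) (2 * k + 1) t"
  have "\<bar>?a - ?b\<bar> \<le> \<delta>"
    using d dyadic_overlap_le[OF T, of "Suc m" "2 * k" t] dyadic_overlap_le[OF T, of "Suc m" "2 * k + 1" t]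
      dyadic_overlap_nonneg[of T "Suc m" "2 * k" t] dyadic_overlap_nonneg[of T "Suc m" "2 * k + 1" t] by linarith
  then have "\<bar>?a - ?b\<bar> / sqrt \<delta> \<le> \<delta> / sqrt \<delta>" using d by (intro divide_right_mono) auto
  also have "\<delta> / sqrt \<delta> = sqrt \<delta>" using d by (intro real_div_sqrt) simp
  finally show ?thesis using d by (simp add: schauder_def flip: \<delta>_def)
qed

text \<open>In fourth powers, coefficients growing like \<open>3 ^ m\<close> meet Schauder functions
  decaying like \<open>T\<^sup>2 / 4 ^ m\<close>, which leaves a geometric bound of ratio
  \<open>root 4 (3/4)\<close>. The factor 4 comes from the shift between level \<open>Suc m\<close>
  and the length \<open>T / 2 ^ m\<close>.\<close>

lemma schauder_level_bound:
  assumes T: "T > 0" and C: "C \<ge> 0" and g: "\<And>k. k < level_size (Suc m) \<Longrightarrow> (g k) ^ 4 \<le> C * 3 ^ Suc m"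
  shows "\<bar>\<Sum>k<level_size (Suc m). g k * schauder T (Suc m) k t\<bar> \<le> root 4 (4 * T\<^sup>2 * C) * root 4 (3/4) ^ Suc m"
proof -
  let ?R = "root 4 (4 * T\<^sup>2 * C) * root 4 (3/4) ^ Suc m"
  have R: "?R \<ge> 0" using T C by simp
  have each: "\<bar>g k * schauder T (Suc m) k t\<bar> \<le> ?R" if "k < level_size (Suc m)" for k
  proof -
    have "\<bar>g k * schauder T (Suc m) k t\<bar> ^ 4 = g k ^ 4 * \<bar>schauder T (Suc m) k t\<bar> ^ 4"
      by (simp add: abs_mult power_mult_distrib)
    also have "\<dots> \<le> (C * 3 ^ Suc m) * sqrt (T / 2 ^ m) ^ 4"
      using g[OF that] schauder_abs_le[OF T, of m k t] C by (intro mult_mono power_mono) auto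
    also have "sqrt (T / 2 ^ m) ^ 4 = (T / 2 ^ m)\<^sup>2"
    proof -
      have "sqrt (T / 2 ^ m) ^ 4 = (sqrt (T / 2 ^ m) ^ 2) ^ 2" by (simp flip: power_mult)
      then show ?thesis using T by simp
    qed
    also have "(C * 3 ^ Suc m) * (T / 2 ^ m)\<^sup>2 = (4 * T\<^sup>2 * C) * (3/4) ^ Suc m"
    proof -
      have "((2::real) ^ m)\<^sup>2 = 4 ^ m" by (simp add: power2_eq_square flip: power_mult_distrib)
      then show ?thesis by (simp add: power_divide field_simps)
    qed
    also have "\<dots> = ?R ^ 4"
    proof -
      have "?R ^ 4 = root 4 (4 * T\<^sup>2 * C) ^ 4 * (root 4 (3/4) ^ 4) ^ Suc m"
        unfolding power_mult_distrib power_mult[symmetric] by (simp only: mult.commute)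
      also have "root 4 (4 * T\<^sup>2 * C) ^ 4 = 4 * T\<^sup>2 * C" using T C by (intro real_root_pow_pos2) auto
      also have "root 4 (3/4::real) ^ 4 = 3/4" by (intro real_root_pow_pos2) auto
      finally show ?thesis by simp
    qed
    finally have le: "\<bar>g k * schauder T (Suc m) k t\<bar> ^ 4 \<le> ?R ^ 4" .
    show ?thesis by (rule power_mono_iff[THEN iffD1, OF _ R _ le]) simp_all
  qed
  let ?k = "nat \<lfloor>t * 2 ^ m / T\<rfloor>"
  have "\<bar>\<Sum>k<level_size (Suc m). g k * schauder T (Suc m) k t\<bar> \<le> (\<Sum>k<level_size (Suc m). \<bar>g k * schauder T (Suc m) k t\<bar>)"
    by (rule sum_abs)
  also have "\<dots> \<le> (\<Sum>k<level_size (Suc m). if k = ?k then ?R else 0)"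
    using each schauder_eq_0[OF T, of _ t m] by (intro sum_mono) auto
  also have "\<dots> \<le> ?R" using R by (simp add: sum.delta)
  finally show ?thesis .
qed

lemma schauder_continuous[continuous_intros]: "continuous_on A (schauder T m k)"
  unfolding schauder_def dyadic_overlap_def divide_inverse by (cases m) (auto intro!: continuous_intros)

lemma schauder_0: "T > 0 \<Longrightarrow> schauder T m k 0 = 0"
  using dyadic_overlap_eq_0_iff[of T _ _ 0] by (cases m) (simp_all add: schauder_def)

section \<open>Independent standard Gaussian coordinates\<close>

lemma cis_sum: "cis (\<Sum>p\<in>F. f p) = (\<Prod>p\<in>F. cis (f p))"
  proof (induction F rule: infinite_finite_induct)
  case (insert x F)
  then show ?case using cis_mult[of "f x" "\<Sum>p\<in>F. f p"] by simp
qed simp_all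

lemma std_normal_prob_space: "prob_space std_normal_distribution"
  using real_dist_normal_dist by (simp add: real_distribution_def)

lemma std_normal_char: "(\<integral>x. cis (c * x) \<partial>std_normal_distribution) = complex_of_real (exp (- c\<^sup>2 / 2))"
  using fun_cong[OF char_std_normal_distribution, of c] unfolding char_def by (simp add: cis_conv_exp)

lemma iid_gaussian_char:
  assumes F: "finite F"
  shows "(\<integral>\<omega>. cis (\<Sum>p\<in>F. c p * \<omega> p) \<partial>Pi\<^sub>M UNIV (\<lambda>_. std_normal_distribution))
    = complex_of_real (exp (- (\<Sum>p\<in>F. (c p)\<^sup>2) / 2))"
proof -
  interpret std: prob_space std_normal_distribution by (rule std_normal_prob_space)
  interpret product_prob_space "\<lambda>_. std_normal_distribution" UNIV
    by (intro product_prob_spaceI std_normal_prob_space)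
  have int: "integrable std_normal_distribution (\<lambda>x. cis (c p * x))" for p
    by (rule std.integrable_const_bound[of _ 1]) auto
  have "(\<integral>\<omega>. cis (\<Sum>p\<in>F. c p * \<omega> p) \<partial>Pi\<^sub>M UNIV (\<lambda>_. std_normal_distribution))
    = (\<integral>\<omega>. (\<Prod>p\<in>F. cis (c p * restrict \<omega> F p)) \<partial>Pi\<^sub>M UNIV (\<lambda>_. std_normal_distribution))"
    unfolding cis_sum by (intro Bochner_Integration.integral_cong prod.cong) auto
  also have "\<dots> = (\<integral>x. (\<Prod>p\<in>F. cis (c p * x p)) \<partial>distr (Pi\<^sub>M UNIV (\<lambda>_. std_normal_distribution)) (Pi\<^sub>M F (\<lambda>_. std_normal_distribution)) (\<lambda>\<omega>. restrict \<omega> F))"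
    by (subst integral_distr) (auto intro!: measurable_restrict)
  also have "\<dots> = (\<integral>x. (\<Prod>p\<in>F. cis (c p * x p)) \<partial>Pi\<^sub>M F (\<lambda>_. std_normal_distribution))"
    using F by (subst distr_PiM_restrict_finite) auto
  also have "\<dots> = (\<Prod>p\<in>F. \<integral>x. cis (c p * x) \<partial>std_normal_distribution)"
    by (rule product_integral_prod[OF F int])
  also have "\<dots> = complex_of_real (exp (\<Sum>p\<in>F. - (c p)\<^sup>2 / 2))"
    using F by (simp add: std_normal_char exp_sum)
  finally show ?thesis by (simp add: sum_negf sum_divide_distrib)
qed

section \<open>The random Schauder series and its law\<close>

lemma sum4_swap:
  fixes g :: "'j \<Rightarrow> 'i \<Rightarrow> 'm \<Rightarrow> 'k \<Rightarrow> 'a::comm_monoid_add"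
  shows "(\<Sum>j\<in>A. \<Sum>i\<in>B. \<Sum>m\<in>C. \<Sum>k\<in>D m. g j i m k) = (\<Sum>m\<in>C. \<Sum>k\<in>D m. \<Sum>j\<in>A. \<Sum>i\<in>B. g j i m k)"
proof -
  have "(\<Sum>j\<in>A. \<Sum>i\<in>B. \<Sum>m\<in>C. \<Sum>k\<in>D m. g j i m k) = (\<Sum>j\<in>A. \<Sum>m\<in>C. \<Sum>i\<in>B. \<Sum>k\<in>D m. g j i m k)"
    by (intro sum.cong refl sum.swap)
  also have "\<dots> = (\<Sum>m\<in>C. \<Sum>j\<in>A. \<Sum>i\<in>B. \<Sum>k\<in>D m. g j i m k)" by (rule sum.swap)
  also have "\<dots> = (\<Sum>m\<in>C. \<Sum>j\<in>A. \<Sum>k\<in>D m. \<Sum>i\<in>B. g j i m k)"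
    by (intro sum.cong refl sum.swap)
  also have "\<dots> = (\<Sum>m\<in>C. \<Sum>k\<in>D m. \<Sum>j\<in>A. \<Sum>i\<in>B. g j i m k)"
    by (intro sum.cong refl sum.swap)
  finally show ?thesis .
qed

text \<open>Finiteness bounds the fourth powers of the coefficients of level \<open>m\<close> by a
  constant times \<open>3 ^ m\<close>. The base 3 lies between 2, the growth of the number of
  coefficients, so that the expectation is finite, and 4, the decay of the fourth powers of the
  Schauder functions, so that the series converges.\<close>

definition series_weight :: "(nat \<times> nat \<times> 'd \<Rightarrow> real) \<Rightarrow> 'd \<Rightarrow> ennreal" where
  "series_weight \<omega> i = (\<Sum>m. \<Sum>k<level_size m. ennreal (\<omega> (m, k, i) ^ 4 / 3 ^ m))"

text \<open>The value 0 on the exceptional event and outside the time interval makes every sample,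
  and not only almost every one, an element of \<open>Wsp T\<close>; the map into
  \<open>Wsig T\<close> is then defined everywhere.\<close>

definition levy_path :: "real \<Rightarrow> (nat \<times> nat \<times> 'd \<Rightarrow> real) \<Rightarrow> real \<Rightarrow> real ^ 'd" where
  "levy_path T \<omega> t = (if (\<forall>i. series_weight \<omega> i < \<infinity>) \<and> t \<in> {0..T}
     then \<chi> i. \<Sum>m. \<Sum>k<level_size m. \<omega> (m, k, i) * schauder T m k t else 0)"

lemma level_size_le: "level_size m \<le> 2 ^ m"
  by (cases m) auto

lemma AE_series_weight:
  "AE \<omega> in Pi\<^sub>M UNIV (\<lambda>_. std_normal_distribution). \<forall>i::'d::finite. series_weight \<omega> i < \<infinity>"
proof -
  let ?\<Omega> = "Pi\<^sub>M UNIV (\<lambda>_::nat \<times> nat \<times> 'd. std_normal_distribution)"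
  have "AE \<omega> in ?\<Omega>. series_weight \<omega> i < \<infinity>" for i :: 'd
  proof -
  have m4: "(\<integral>\<^sup>+\<omega>. ennreal (\<omega> p ^ 4) \<partial>?\<Omega>) = 3" for p
  proof -
    have "(\<integral>\<^sup>+\<omega>. ennreal (\<omega> p ^ 4) \<partial>?\<Omega>) = (\<integral>\<^sup>+x. ennreal (x ^ 4) \<partial>distr ?\<Omega> std_normal_distribution (\<lambda>\<omega>. \<omega> p))"
      by (subst nn_integral_distr) auto
    also have "distr ?\<Omega> std_normal_distribution (\<lambda>\<omega>. \<omega> p) = std_normal_distribution"
      by (rule distr_PiM_component) (auto intro: std_normal_prob_space)
    also have "(\<integral>\<^sup>+x. ennreal (x ^ 4) \<partial>std_normal_distribution) = ennreal (\<integral>x. x ^ (2 * 2) \<partial>std_normal_distribution)"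
      using std_normal_distribution_even_moments(2)[of 2] by (subst nn_integral_eq_integral) auto
    also have "(\<integral>x. x ^ (2 * 2) \<partial>std_normal_distribution) = 3"
      by (subst std_normal_distribution_even_moments(1)) (simp add: fact_numeral)
    finally show ?thesis by simp
  qed
  have meas: "(\<lambda>\<omega>. series_weight \<omega> i) \<in> borel_measurable ?\<Omega>"
    unfolding series_weight_def by measurable
  have "(\<integral>\<^sup>+\<omega>. series_weight \<omega> i \<partial>?\<Omega>) = (\<Sum>m. \<Sum>k<level_size m. \<integral>\<^sup>+\<omega>. ennreal (\<omega> (m, k, i) ^ 4 / 3 ^ m) \<partial>?\<Omega>)"
    unfolding series_weight_def by (subst nn_integral_suminf) (auto simp: nn_integral_sum simp del: sum_ennreal)
  also have "\<dots> = (\<Sum>m. \<Sum>k<level_size m. ennreal (3 / 3 ^ m))"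
  proof (intro suminf_cong sum.cong refl)
    fix m k
    have "(\<integral>\<^sup>+\<omega>. ennreal (\<omega> (m, k, i) ^ 4 / 3 ^ m) \<partial>?\<Omega>) = (\<integral>\<^sup>+\<omega>. ennreal (1 / 3 ^ m) * ennreal (\<omega> (m, k, i) ^ 4) \<partial>?\<Omega>)"
      by (intro nn_integral_cong) (simp add: ennreal_mult[symmetric])
    also have "\<dots> = ennreal (1 / 3 ^ m) * 3" by (subst nn_integral_cmult) (auto simp: m4)
    also have "\<dots> = ennreal (3 / 3 ^ m)"
      using ennreal_mult[of "1 / 3 ^ m" 3] by simp
    finally show "(\<integral>\<^sup>+\<omega>. ennreal (\<omega> (m, k, i) ^ 4 / 3 ^ m) \<partial>?\<Omega>) = ennreal (3 / 3 ^ m)" .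
  qed
  also have "\<dots> \<le> (\<Sum>m. ennreal (3 * (2 / 3) ^ m))"
  proof (intro suminf_le allI)
    fix m
    have "(\<Sum>k<level_size m. ennreal (3 / 3 ^ m)) = ennreal (real (level_size m) * (3 / 3 ^ m))"
      by (subst sum_ennreal) auto
    also have "\<dots> \<le> ennreal (2 ^ m * (3 / 3 ^ m))"
      using of_nat_mono[OF level_size_le[of m], where 'a=real] by (intro ennreal_leI mult_right_mono) auto
    finally show "(\<Sum>k<level_size m. ennreal (3 / 3 ^ m)) \<le> ennreal (3 * (2 / 3) ^ m)"
      by (simp add: power_divide mult.commute)
  qed auto
  also have "\<dots> < \<infinity>"
    by (subst suminf_ennreal2) (auto intro!: summable_mult summable_geometric)
  finally have "(\<integral>\<^sup>+\<omega>. series_weight \<omega> i \<partial>?\<Omega>) \<noteq> \<infinity>" by simp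
  then have "AE \<omega> in ?\<Omega>. series_weight \<omega> i \<noteq> \<infinity>" by (intro nn_integral_PInf_AE meas)
  then show ?thesis by (auto simp: top.not_eq_extremum)
  qed
  then have "AE \<omega> in ?\<Omega>. \<forall>i\<in>UNIV. series_weight \<omega> i < \<infinity>" by (intro AE_finite_allI) auto
  then show ?thesis by simp
qed

lemma levy_series_uniform:
  assumes T: "T > 0" and w: "series_weight \<omega> i < \<infinity>"
  shows "uniform_limit {0..T} (\<lambda>n t. \<Sum>m<n. \<Sum>k<level_size m. \<omega> (m, k, i) * schauder T m k t)
      (\<lambda>t. \<Sum>m. \<Sum>k<level_size m. \<omega> (m, k, i) * schauder T m k t) sequentially"
proof -
  obtain C where C: "C \<ge> 0" "series_weight \<omega> i = ennreal C"
    using w by (cases "series_weight \<omega> i") auto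
  have bnd: "\<omega> (m, k, i) ^ 4 \<le> C * 3 ^ m" if k: "k < level_size m" for m k
  proof -
    have "ennreal (\<omega> (m, k, i) ^ 4 / 3 ^ m) \<le> (\<Sum>k<level_size m. ennreal (\<omega> (m, k, i) ^ 4 / 3 ^ m))"
      using k by (intro member_le_sum) auto
    also have "\<dots> \<le> series_weight \<omega> i" unfolding series_weight_def
      using sum_le_suminf[of "\<lambda>m. \<Sum>k<level_size m. ennreal (\<omega> (m, k, i) ^ 4 / 3 ^ m)" "{m}"] by simp
    finally have "\<omega> (m, k, i) ^ 4 / 3 ^ m \<le> C" using C by (simp add: ennreal_le_iff)
    then show ?thesis by (simp add: field_simps)
  qed
  show ?thesis
  proof (rule Weierstrass_m_test_ev)
    show "\<forall>\<^sub>F m in sequentially. \<forall>t\<in>{0..T}. norm (\<Sum>k<level_size m. \<omega> (m, k, i) * schauder T m k t)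
        \<le> root 4 (4 * T\<^sup>2 * C) * root 4 (3/4) ^ m"
      unfolding eventually_sequentially
    \<comment> \<open>The bound covers the levels \<open>Suc m\<close> only; the Weierstrass test is
      content with eventual domination, so level 0 is passed over.\<close>
    proof (intro exI[of _ 1] allI impI ballI)
      fix m t assume "(1::nat) \<le> m"
      then obtain m' where m: "m = Suc m'" by (cases m) auto
      show "norm (\<Sum>k<level_size m. \<omega> (m, k, i) * schauder T m k t) \<le> root 4 (4 * T\<^sup>2 * C) * root 4 (3/4) ^ m"
        unfolding m real_norm_def by (rule schauder_level_bound[OF T C(1)]) (use bnd[of _ "Suc m'"] in auto)
    qed
    have "root 4 (3/4::real) < 1" by (simp add: real_root_lt_1_iff)
    then show "summable (\<lambda>m. root 4 (4 * T\<^sup>2 * C) * root 4 (3/4) ^ m)"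
      by (intro summable_mult summable_geometric) auto
  qed
qed

lemma levy_path_Wsp: "T > 0 \<Longrightarrow> levy_path T \<omega> \<in> Wsp T"
proof -
  assume T: "T > 0"
  show ?thesis
  proof (cases "\<forall>i. series_weight \<omega> i < \<infinity>")
    case False
    then have "levy_path T \<omega> = (\<lambda>_. 0)" by (intro ext) (auto simp: levy_path_def)
    then show ?thesis by (simp add: Wsp_def)
  next
    case True
    have "continuous_on {0..T} (\<lambda>t. \<chi> i. \<Sum>m. \<Sum>k<level_size m. \<omega> (m, k, i) * schauder T m k t)"
    proof (intro continuous_on_vec_lambda)
      fix i
      show "continuous_on {0..T} (\<lambda>t. \<Sum>m. \<Sum>k<level_size m. \<omega> (m, k, i) * schauder T m k t)"
        using True by (intro uniform_limit_theorem[OF _ levy_series_uniform[OF T]] always_eventually allI)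
          (auto intro!: continuous_intros)
    qed
    then have "continuous_on {0..T} (levy_path T \<omega>)"
      using True by (subst continuous_on_cong[OF refl, where g="\<lambda>t. \<chi> i. \<Sum>m. \<Sum>k<level_size m. \<omega> (m, k, i) * schauder T m k t"])
        (auto simp: levy_path_def)
    moreover have "levy_path T \<omega> 0 = 0" using T by (simp add: levy_path_def schauder_0 vec_eq_iff)
    moreover have "\<forall>t. t \<notin> {0..T} \<longrightarrow> levy_path T \<omega> t = 0" by (auto simp: levy_path_def)
    ultimately show ?thesis by (simp add: Wsp_def)
  qed
qed

lemma levy_path_measurable:
  assumes "T > 0"
  shows "levy_path T \<in> measurable (Pi\<^sub>M UNIV (\<lambda>_. std_normal_distribution)) (Wsig T)"
  unfolding Wsig_def
proof (rule measurable_restrict_space2)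
  show "levy_path T \<in> space (Pi\<^sub>M UNIV (\<lambda>_. std_normal_distribution)) \<rightarrow> Wsp T"
    using levy_path_Wsp[OF assms] by auto
  have "(\<lambda>\<omega>. levy_path T \<omega> t) \<in> borel_measurable (Pi\<^sub>M UNIV (\<lambda>_. std_normal_distribution))" for t
  proof -
    have [measurable]: "(\<lambda>\<omega>. series_weight \<omega> i) \<in> borel_measurable (Pi\<^sub>M UNIV (\<lambda>_. std_normal_distribution))" for i
      unfolding series_weight_def by measurable
    have [measurable]: "(\<lambda>\<omega>. \<chi> i. \<Sum>m. \<Sum>k<level_size m. \<omega> (m, k, i) * schauder T m k t) \<in> borel_measurable (Pi\<^sub>M UNIV (\<lambda>_. std_normal_distribution))"
      by (intro borel_measurable_vec_lambda) measurable
    show ?thesis unfolding levy_path_def by measurable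
  qed
  then show "levy_path T \<in> measurable (Pi\<^sub>M UNIV (\<lambda>_. std_normal_distribution)) (Pi\<^sub>M UNIV (\<lambda>_. borel))"
    by (intro measurable_PiM_single') (auto simp: space_PiM)
qed

definition is_wiener :: "real \<Rightarrow> (real \<Rightarrow> real ^ 'd) measure \<Rightarrow> bool" where
  "is_wiener T M \<longleftrightarrow> sets M = sets (Wsig T) \<and> prob_space M \<and>
     (\<forall>(n::nat) (t::nat \<Rightarrow> real) (\<xi>::nat \<Rightarrow> real ^ 'd). (\<forall>k<n. t k \<in> {0..T}) \<longrightarrow>
        (\<integral>w. cis (\<Sum>k<n. \<xi> k \<bullet> w (t k)) \<partial>M) =
        complex_of_real (exp (- (\<Sum>j<n. \<Sum>k<n. min (t j) (t k) * (\<xi> j \<bullet> \<xi> k)) / 2)))"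

lemma Wsig_coordinate: "(\<lambda>w. w t) \<in> borel_measurable (Wsig T)"
  unfolding Wsig_def by (intro measurable_restrict_space1) simp

text \<open>For a truncated series, a linear functional of finitely many path values is a finite
  combination of independent standard normals, and its variance is the truncated Schauder kernel
  applied to the frequencies. On the left dominated convergence removes the truncation, on the right
  the kernel tends to \<open>min\<close>.\<close>

lemma is_wiener_levy:
  assumes T: "T > 0"
  shows "is_wiener T (distr (Pi\<^sub>M UNIV (\<lambda>_. std_normal_distribution)) (Wsig T) (levy_path T :: (nat \<times> nat \<times> 'd \<Rightarrow> real) \<Rightarrow> real \<Rightarrow> real ^ 'd))"
proof -
  let ?\<Omega> = "Pi\<^sub>M UNIV (\<lambda>_::nat \<times> nat \<times> 'd. std_normal_distribution)"
  interpret \<Omega>: prob_space ?\<Omega> by (intro prob_space_PiM std_normal_prob_space)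
  note [measurable] = levy_path_measurable[OF T]
  have "(\<integral>\<omega>. cis (\<Sum>j<n. \<xi> j \<bullet> levy_path T \<omega> (t j)) \<partial>?\<Omega>) =
        complex_of_real (exp (- (\<Sum>j<n. \<Sum>l<n. min (t j) (t l) * (\<xi> j \<bullet> \<xi> l)) / 2))"
    if t: "\<forall>k<n. t k \<in> {0..T}" for n :: nat and t :: "nat \<Rightarrow> real" and \<xi> :: "nat \<Rightarrow> real ^ 'd"
  proof -
    define F where "F N = (SIGMA m:{..<N}. {..<level_size m} \<times> (UNIV::'d set))" for N
    define c where "c = (\<lambda>(m, k, i). \<Sum>j<n. \<xi> j $ i * schauder T m k (t j))"
    have F[simp]: "finite (F N)" for N unfolding F_def by auto
    have sumF: "(\<Sum>p\<in>F N. g p) = (\<Sum>m<N. \<Sum>k<level_size m. \<Sum>i\<in>UNIV. g (m, k, i))" for N and g :: "_ \<Rightarrow> real"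
    proof -
      have "(\<Sum>m<N. \<Sum>q\<in>{..<level_size m} \<times> UNIV. g (m, q)) = (\<Sum>p\<in>F N. g p)"
        unfolding F_def by (subst sum.Sigma) auto
      then show ?thesis by (simp add: sum.cartesian_product case_prod_beta)
    qed
    have P: "(\<Sum>j<n. \<xi> j \<bullet> (\<chi> i. \<Sum>m<N. \<Sum>k<level_size m. \<omega> (m, k, i) * schauder T m k (t j))) = (\<Sum>p\<in>F N. c p * \<omega> p)" for N \<omega>
    proof -
      have "(\<Sum>j<n. \<xi> j \<bullet> (\<chi> i. \<Sum>m<N. \<Sum>k<level_size m. \<omega> (m, k, i) * schauder T m k (t j)))
        = (\<Sum>j<n. \<Sum>i\<in>UNIV. \<Sum>m<N. \<Sum>k<level_size m. \<xi> j $ i * schauder T m k (t j) * \<omega> (m, k, i))"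
        unfolding inner_vec_def by (simp add: sum_distrib_left mult_ac)
      also have "\<dots> = (\<Sum>m<N. \<Sum>k<level_size m. \<Sum>j<n. \<Sum>i\<in>UNIV. \<xi> j $ i * schauder T m k (t j) * \<omega> (m, k, i))"
        by (rule sum4_swap)
      also have "\<dots> = (\<Sum>m<N. \<Sum>k<level_size m. \<Sum>i\<in>UNIV. \<Sum>j<n. \<xi> j $ i * schauder T m k (t j) * \<omega> (m, k, i))"
        by (intro sum.cong refl sum.swap)
      finally show ?thesis by (simp add: sumF c_def sum_distrib_right)
    qed
    have Q: "(\<Sum>p\<in>F N. (c p)\<^sup>2) = (\<Sum>j<n. \<Sum>l<n. (\<Sum>m<N. \<Sum>k<level_size m. schauder T m k (t j) * schauder T m k (t l)) * (\<xi> j \<bullet> \<xi> l))" for N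
    proof -
      have "(\<Sum>i\<in>UNIV. (c (m, k, i))\<^sup>2) = (\<Sum>j<n. \<Sum>l<n. schauder T m k (t j) * schauder T m k (t l) * (\<xi> j \<bullet> \<xi> l))" for m k
      proof -
        have "(\<Sum>i\<in>UNIV. (c (m, k, i))\<^sup>2) = (\<Sum>j<n. schauder T m k (t j) *\<^sub>R \<xi> j) \<bullet> (\<Sum>l<n. schauder T m k (t l) *\<^sub>R \<xi> l)"
          by (simp add: inner_vec_def c_def power2_eq_square mult.commute)
        also have "\<dots> = (\<Sum>j<n. \<Sum>l<n. schauder T m k (t j) * schauder T m k (t l) * (\<xi> j \<bullet> \<xi> l))"
          unfolding inner_sum_left unfolding inner_sum_right by (simp add: mult_ac)
        finally show ?thesis .
      qed
      then show ?thesis by (simp add: sumF sum_distrib_right sum4_swap)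
    qed
    have lim1: "(\<lambda>N. \<integral>\<omega>. cis (\<Sum>j<n. \<xi> j \<bullet> (\<chi> i. \<Sum>m<N. \<Sum>k<level_size m. \<omega> (m, k, i) * schauder T m k (t j))) \<partial>?\<Omega>)
       \<longlonglongrightarrow> (\<integral>\<omega>. cis (\<Sum>j<n. \<xi> j \<bullet> levy_path T \<omega> (t j)) \<partial>?\<Omega>)"
    proof (rule integral_dominated_convergence[where w="\<lambda>_. 1"])
      have [measurable]: "(\<lambda>\<omega>. levy_path T \<omega> u) \<in> borel_measurable ?\<Omega>" for u
        by (rule measurable_compose[OF levy_path_measurable[OF T] Wsig_coordinate])
      show "(\<lambda>\<omega>. cis (\<Sum>j<n. \<xi> j \<bullet> levy_path T \<omega> (t j))) \<in> borel_measurable ?\<Omega>" by measurable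
      show "(\<lambda>\<omega>. cis (\<Sum>j<n. \<xi> j \<bullet> (\<chi> i. \<Sum>m<N. \<Sum>k<level_size m. \<omega> (m, k, i) * schauder T m k (t j)))) \<in> borel_measurable ?\<Omega>" for N
        unfolding P by measurable
      show "AE \<omega> in ?\<Omega>. (\<lambda>N. cis (\<Sum>j<n. \<xi> j \<bullet> (\<chi> i. \<Sum>m<N. \<Sum>k<level_size m. \<omega> (m, k, i) * schauder T m k (t j))))
          \<longlonglongrightarrow> cis (\<Sum>j<n. \<xi> j \<bullet> levy_path T \<omega> (t j))"
        using AE_series_weight
      proof eventually_elim
        case (elim \<omega>)
        have "(\<lambda>N. \<xi> j \<bullet> (\<chi> i. \<Sum>m<N. \<Sum>k<level_size m. \<omega> (m, k, i) * schauder T m k (t j))) \<longlonglongrightarrow> \<xi> j \<bullet> levy_path T \<omega> (t j)" if "j < n" for j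
        proof -
          have tj: "t j \<in> {0..T}" using t that by auto
          have "levy_path T \<omega> (t j) = (\<chi> i. \<Sum>m. \<Sum>k<level_size m. \<omega> (m, k, i) * schauder T m k (t j))"
            using elim tj by (simp add: levy_path_def)
          moreover have "(\<lambda>N. \<Sum>m<N. \<Sum>k<level_size m. \<omega> (m, k, i) * schauder T m k (t j)) \<longlonglongrightarrow> (\<Sum>m. \<Sum>k<level_size m. \<omega> (m, k, i) * schauder T m k (t j))" for i
            by (rule tendsto_uniform_limitI[OF levy_series_uniform[OF T] tj]) (use elim in auto)
          ultimately show ?thesis
            by (simp only:) (intro tendsto_inner tendsto_const tendsto_vec_lambda)
        qed
        then have "(\<lambda>N. \<Sum>j<n. \<xi> j \<bullet> (\<chi> i. \<Sum>m<N. \<Sum>k<level_size m. \<omega> (m, k, i) * schauder T m k (t j))) \<longlonglongrightarrow> (\<Sum>j<n. \<xi> j \<bullet> levy_path T \<omega> (t j))"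
          by (intro tendsto_sum) auto
        then show ?case by (intro continuous_on_tendsto_compose[where s=UNIV and f=cis] continuous_on_cis continuous_on_id) auto
      qed
    qed auto
    have "(\<lambda>N. complex_of_real (exp (- (\<Sum>p\<in>F N. (c p)\<^sup>2) / 2))) \<longlonglongrightarrow>
      complex_of_real (exp (- (\<Sum>j<n. \<Sum>l<n. min (t j) (t l) * (\<xi> j \<bullet> \<xi> l)) / 2))"
      unfolding Q using t by (intro tendsto_intros schauder_kernel_tendsto[OF T]) auto
    then show ?thesis
      using LIMSEQ_unique[OF lim1] unfolding P iid_gaussian_char[OF F] by blast
  qed
  moreover have "prob_space (distr ?\<Omega> (Wsig T) (levy_path T))" by (rule \<Omega>.prob_space_distr) simp
  moreover have "(\<integral>w. cis (\<Sum>j<n. \<xi> j \<bullet> w (t j)) \<partial>distr ?\<Omega> (Wsig T) (levy_path T)) = (\<integral>\<omega>. cis (\<Sum>j<n. \<xi> j \<bullet> levy_path T \<omega> (t j)) \<partial>?\<Omega>)"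
    for n :: nat and t :: "nat \<Rightarrow> real" and \<xi> :: "nat \<Rightarrow> real ^ 'd"
  proof -
    note [measurable] = Wsig_coordinate
    show ?thesis by (subst integral_distr) auto
  qed
  ultimately show ?thesis unfolding is_wiener_def by simp
qed

text \<open>The choice in \<open>wiener\<close> is opened only here; afterwards Wiener measure is
  known through its sigma-algebra, its mass and its characteristic functional.\<close>

theorem is_wiener_wiener: "T > 0 \<Longrightarrow> is_wiener T (wiener T)"
  unfolding wiener_def is_wiener_def[symmetric] by (rule someI[of "is_wiener T", OF is_wiener_levy])

section \<open>Increments of the coordinate process\<close>

locale wiener_setup =
  fixes T :: real and M :: "(real \<Rightarrow> real ^ 'd) measure"
  assumes T_pos: "T > 0" and M_wiener: "M = wiener T"
begin

lemma is_wiener_M: "is_wiener T M"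
  using is_wiener_wiener[OF T_pos] by (simp add: M_wiener)

sublocale prob_space M
  using is_wiener_M by (simp add: is_wiener_def)

lemma sets_M: "sets M = sets (Wsig T)"
  using is_wiener_M by (simp add: is_wiener_def)

lemma space_M: "space M = Wsp T"
  using sets_eq_imp_space_eq[OF sets_M] by (simp add: Wsig_def space_restrict_space space_PiM)

lemma coordinate_measurable[measurable]: "(\<lambda>w. w t) \<in> borel_measurable M"
  using Wsig_coordinate by (simp cong: measurable_cong_sets add: sets_M)

lemma increment_char:
  fixes \<xi> :: "'i \<Rightarrow> real ^ 'd"
  assumes I: "finite I" and ab: "\<And>i. i \<in> I \<Longrightarrow> a i \<in> {0..T}" "\<And>i. i \<in> I \<Longrightarrow> b i \<in> {0..T}"
  shows "(\<integral>w. cis (\<Sum>i\<in>I. \<xi> i \<bullet> (w (b i) - w (a i))) \<partial>M) =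
    complex_of_real (exp (- (\<Sum>i\<in>I. \<Sum>j\<in>I.
      (min (b i) (b j) - min (a i) (b j) - min (b i) (a j) + min (a i) (a j)) * (\<xi> i \<bullet> \<xi> j)) / 2))"
proof -
  obtain h n where h: "bij_betw h {..<n::nat} I"
    using ex_bij_betw_nat_finite[OF I] by (auto simp: atLeast0LessThan)
  have hI: "k < n \<Longrightarrow> h k \<in> I" for k using h by (auto simp: bij_betw_def)
  \<comment> \<open>An increment is a difference of two coordinates: even positions list the right
    ends, odd positions the left ends with the opposite frequency. Summing by consecutive pairs then
    produces the covariance of increments.\<close>
  define t where "t m = (if even m then b (h (m div 2)) else a (h (m div 2)))" for m :: nat
  define \<zeta> where "\<zeta> m = (if even m then \<xi> (h (m div 2)) else - \<xi> (h (m div 2)))" for m :: nat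
  have t[simp]: "t (2 * k) = b (h k)" "t (Suc (2 * k)) = a (h k)" "\<zeta> (2 * k) = \<xi> (h k)" "\<zeta> (Suc (2 * k)) = - \<xi> (h k)" for k
    by (auto simp: t_def \<zeta>_def)
  have tT: "\<forall>k<2 * n. t k \<in> {0..T}" using ab hI by (auto simp: t_def)
  have "(\<integral>w. cis (\<Sum>k<2 * n. \<zeta> k \<bullet> w (t k)) \<partial>M) =
    complex_of_real (exp (- (\<Sum>j<2 * n. \<Sum>k<2 * n. min (t j) (t k) * (\<zeta> j \<bullet> \<zeta> k)) / 2))"
    using is_wiener_M tT unfolding is_wiener_def by blast
  moreover have "(\<Sum>k<2 * n. \<zeta> k \<bullet> w (t k)) = (\<Sum>i\<in>I. \<xi> i \<bullet> (w (b i) - w (a i)))" for w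
    unfolding sum_lessThan_double
    by (subst sum.reindex_bij_betw[OF h, symmetric]) (auto simp: inner_diff_right intro!: sum.cong)
  moreover have "(\<Sum>j<2 * n. \<Sum>k<2 * n. min (t j) (t k) * (\<zeta> j \<bullet> \<zeta> k)) = (\<Sum>i\<in>I. \<Sum>j\<in>I.
      (min (b i) (b j) - min (a i) (b j) - min (b i) (a j) + min (a i) (a j)) * (\<xi> i \<bullet> \<xi> j))"
  proof -
    have "(\<Sum>j<2 * n. \<Sum>k<2 * n. min (t j) (t k) * (\<zeta> j \<bullet> \<zeta> k)) = (\<Sum>j<n. \<Sum>k<n.
      (min (b (h j)) (b (h k)) - min (a (h j)) (b (h k)) - min (b (h j)) (a (h k)) + min (a (h j)) (a (h k))) * (\<xi> (h j) \<bullet> \<xi> (h k)))"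
      unfolding sum_lessThan_double by (simp add: sum.distrib[symmetric], simp add: algebra_simps)
    also have "\<dots> = (\<Sum>i\<in>I. \<Sum>j\<in>I.
      (min (b i) (b j) - min (a i) (b j) - min (b i) (a j) + min (a i) (a j)) * (\<xi> i \<bullet> \<xi> j))"
      by (simp only: sum.reindex_bij_betw[OF h, symmetric])
    finally show ?thesis .
  qed
  ultimately show ?thesis by simp
qed

section \<open>Independence of the past and the next increment\<close>

definition cyl :: "real \<Rightarrow> (real \<Rightarrow> real ^ 'd) set set" where
  "cyl c = {{w \<in> Wsp T. \<forall>s\<in>F. w s \<in> B s} | F B. finite F \<and> F \<subseteq> {0..c} \<and> (\<forall>s. B s \<in> sets borel)}"

text \<open>The generators of \<open>Filt\<close> constrain a single time and are not closed under
  intersection. The sets in \<open>cyl\<close> constrain finitely many times at once; they form the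
  pi-system on which independence is checked.\<close>

lemma sets_Filt_cyl: "sets (Filt T c :: (real \<Rightarrow> real ^ 'd) measure) \<subseteq> sigma_sets (Wsp T) (cyl c)"
proof -
  have "{w \<in> Wsp T. w s \<in> B} \<in> cyl c" if "s \<in> {0..c}" "B \<in> sets borel" for s and B :: "(real ^ 'd) set"
    unfolding cyl_def using that by (auto intro!: exI[of _ "{s}"] exI[of _ "\<lambda>_. B"])
  then have *: "{{w \<in> Wsp T. w s \<in> B} | s B. s \<in> {0..c} \<and> B \<in> sets borel} \<subseteq> cyl c" by auto
  show ?thesis unfolding Filt_def
    using sigma_sets_mono'[OF *] by (subst sets_measure_of) blast+
qed

lemma cyl_sets: "cyl c \<subseteq> sets M"
proof
  fix E assume "E \<in> cyl c"
  then obtain F B where E: "E = {w \<in> space M. \<forall>s\<in>F. w s \<in> B s}" "finite F" and B[measurable]: "\<And>s. B s \<in> sets borel"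
    unfolding cyl_def space_M by auto
  show "E \<in> sets M" unfolding E(1) using E(2) by measurable
qed

lemma sets_Filt: "sets (Filt T c) \<subseteq> sets M"
  using sets_Filt_cyl[of c] sets.sigma_sets_subset[OF cyl_sets, of c] space_M by auto

lemma space_Filt: "space (Filt T c) = Wsp T"
  by (simp add: Filt_def space_measure_of_conv)

lemma measurable_Filt: "f \<in> measurable (Filt T c) N \<Longrightarrow> f \<in> measurable M N"
  using measurable_mono[OF order_refl refl sets_Filt, of c N] by (auto simp only: space_Filt space_M)

lemma Filt_mono:
  fixes f :: "(real \<Rightarrow> real ^ 'd) \<Rightarrow> 'b"
  assumes cd: "c \<le> d" and f: "f \<in> measurable (Filt T c) N"
  shows "f \<in> measurable (Filt T d) N"
proof -
  let ?g = "\<lambda>c. {{w \<in> Wsp T. w s \<in> B} | s B. s \<in> {0..c} \<and> B \<in> sets borel} :: (real \<Rightarrow> real ^ 'd) set set"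
  have g: "?g c \<subseteq> ?g d"
  proof safe
    fix s and B :: "(real ^ 'd) set" assume "s \<in> {0..c}" "B \<in> sets borel"
    then show "\<exists>s' B'. {w \<in> Wsp T. w s \<in> B} = {w \<in> Wsp T. w s' \<in> B'} \<and> s' \<in> {0..d} \<and> B' \<in> sets borel"
      using cd by (intro exI[of _ s] exI[of _ B]) auto
  qed
  have "?g e \<subseteq> Pow (Wsp T)" for e by auto
  then have sub: "sets (Filt T c :: (real \<Rightarrow> real ^ 'd) measure) \<subseteq> sets (Filt T d)"
    unfolding Filt_def using sigma_sets_mono'[OF g] by (simp only: sets_measure_of)
  have "(measurable (Filt T c) N :: ((real \<Rightarrow> real ^ 'd) \<Rightarrow> 'b) set) \<subseteq> measurable (Filt T d) N"
    by (rule measurable_mono[OF order_refl refl sub]) (simp add: space_Filt)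
  then show "f \<in> measurable (Filt T d) N" using f by (rule subsetD)
qed

lemma Filt_coordinate: "0 \<le> s \<Longrightarrow> s \<le> c \<Longrightarrow> (\<lambda>w. w s) \<in> borel_measurable (Filt T c :: (real \<Rightarrow> real ^ 'd) measure)"
proof (rule measurableI)
  fix A :: "(real ^ 'd) set" assume s: "0 \<le> s" "s \<le> c" and A: "A \<in> sets borel"
  have "(\<lambda>w. w s) -` A \<inter> space (Filt T c) = {w \<in> Wsp T. w s \<in> A}" by (auto simp: space_Filt)
  also have "\<dots> \<in> sets (Filt T c)" unfolding Filt_def
    by (subst sets_measure_of) (use s A in \<open>auto intro!: sigma_sets.Basic\<close>)
  finally show "(\<lambda>w. w s) -` A \<inter> space (Filt T c) \<in> sets (Filt T c)" .
qed auto

text \<open>On the product of two copies of Wiener space, read the past off the first path and the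
  increment off the second. Both families have the same joint characteristic function, hence the
  same joint law, and in the product independence holds by construction. The index
  \<open>None\<close> stands for the increment, \<open>Some s\<close> for the value at time
  \<open>s\<close>.\<close>

lemma cyl_indep:
  assumes cd: "0 \<le> c" "c \<le> d" "d \<le> T" and F: "finite F" "F \<subseteq> {0..c}" and B: "\<And>s. B s \<in> sets borel" and A: "A \<in> sets borel"
  shows "prob {w \<in> space M. (\<forall>s\<in>F. w s \<in> B s) \<and> w d - w c \<in> A}
     = prob {w \<in> space M. \<forall>s\<in>F. w s \<in> B s} * prob {w \<in> space M. w d - w c \<in> A}"
proof -
  interpret P: pair_prob_space M M ..
  note [measurable] = B A
  define I where "I = insert None (Some ` F)"
  have I: "finite I" using F by (simp add: I_def)
  define X where "X i w = (case i of None \<Rightarrow> w d - w c | Some s \<Rightarrow> w s)" for i and w :: "real \<Rightarrow> real ^ 'd"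
  define Y where "Y i p = (case i of None \<Rightarrow> snd p d - snd p c | Some s \<Rightarrow> fst p s)" for i and p :: "(real \<Rightarrow> real ^ 'd) \<times> (real \<Rightarrow> real ^ 'd)"
  have Xm: "X i \<in> borel_measurable M" for i unfolding X_def by (cases i) auto
  have Ym: "Y i \<in> borel_measurable (M \<Otimes>\<^sub>M M)" for i
    unfolding Y_def by (cases i) (auto intro!: borel_measurable_diff measurable_compose[OF measurable_snd coordinate_measurable]
        measurable_compose[OF measurable_fst coordinate_measurable])
  note [measurable] = Xm Ym
  define A' where "A' i = (case i of None \<Rightarrow> A | Some s \<Rightarrow> B s)" for i
  have A'[measurable]: "A' i \<in> sets borel" for i by (auto simp: A'_def split: option.split)
  have sumI: "(\<Sum>i\<in>I. g i) = g None + (\<Sum>s\<in>F. g (Some s))" for g :: "real option \<Rightarrow> real"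
    unfolding I_def using F by (subst sum.insert) (auto simp: sum.reindex)
  have "(\<integral>w. cis (\<Sum>i\<in>I. \<xi> i \<bullet> X i w) \<partial>M) = (\<integral>p. cis (\<Sum>i\<in>I. \<xi> i \<bullet> Y i p) \<partial>(M \<Otimes>\<^sub>M M))" for \<xi>
  proof -
    \<comment> \<open>A value \<open>w s\<close> is the increment from 0 to \<open>s\<close>, so one
      formula, \<open>increment_char\<close>, serves the past and the increment.\<close>
    define a where "a i = (case i of None \<Rightarrow> c | Some s \<Rightarrow> 0)" for i :: "real option"
    define b where "b i = (case i of None \<Rightarrow> d | Some s \<Rightarrow> s)" for i :: "real option"
    have ab: "a i \<in> {0..T}" "b i \<in> {0..T}" if "i \<in> I" for i
      using that cd F T_pos by (auto simp: a_def b_def I_def)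
    have s0: "min d s = s" "min c s = s" "min s d = s" "min s c = s" "min 0 s = 0" "min s 0 = 0" if "s \<in> F" for s using that F cd by auto
    have X1: "(\<integral>w. cis (\<Sum>i\<in>J. \<xi> i \<bullet> X i w) \<partial>M) = (\<integral>w. cis (\<Sum>i\<in>J. \<xi> i \<bullet> (w (b i) - w (a i))) \<partial>M)" for J
    proof (intro Bochner_Integration.integral_cong refl arg_cong[of _ _ cis] sum.cong)
      fix w i assume "w \<in> space M"
      then have "w 0 = 0" by (auto simp: space_M Wsp_def)
      then show "\<xi> i \<bullet> X i w = \<xi> i \<bullet> (w (b i) - w (a i))" by (auto simp: X_def a_def b_def split: option.split)
    qed
    let ?q = "\<lambda>i j. (min (b i) (b j) - min (a i) (b j) - min (b i) (a j) + min (a i) (a j)) * (\<xi> i \<bullet> \<xi> j)"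
    \<comment> \<open>The mixed covariances cancel: \<open>s \<le> c \<le> d\<close> makes the
      minima of \<open>s\<close> with \<open>c\<close> and with \<open>d\<close> both equal to
      \<open>s\<close>.\<close>
    have split: "(\<Sum>i\<in>I. \<Sum>j\<in>I. ?q i j) = (\<Sum>i\<in>{None}. \<Sum>j\<in>{None}. ?q i j) + (\<Sum>i\<in>Some ` F. \<Sum>j\<in>Some ` F. ?q i j)"
      unfolding sumI using F cd s0 by (simp add: sum.reindex a_def b_def)
    have "(\<integral>w. cis (\<Sum>i\<in>I. \<xi> i \<bullet> X i w) \<partial>M) = (\<integral>w. cis (\<Sum>i\<in>{None}. \<xi> i \<bullet> X i w) \<partial>M) * (\<integral>w. cis (\<Sum>i\<in>Some ` F. \<xi> i \<bullet> X i w) \<partial>M)"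
      unfolding X1
      apply (subst increment_char[OF I], (rule ab, assumption)+)
      apply (subst increment_char, simp, (rule ab, simp add: I_def)+)
      apply (subst increment_char, simp add: F, (rule ab, simp add: I_def)+)
      unfolding split by (simp add: mult_exp_exp add_divide_distrib diff_divide_distrib flip: of_real_mult)
    also have "\<dots> = (\<integral>w. (\<integral>v. cis (\<Sum>i\<in>{None}. \<xi> i \<bullet> X i v) \<partial>M) * cis (\<Sum>i\<in>Some ` F. \<xi> i \<bullet> X i w) \<partial>M)"
      by simp
    also have "\<dots> = (\<integral>w. (\<integral>v. cis (\<Sum>i\<in>{None}. \<xi> i \<bullet> X i v) * cis (\<Sum>i\<in>Some ` F. \<xi> i \<bullet> X i w) \<partial>M) \<partial>M)"
      by simp
    also have "\<dots> = (\<integral>w. (\<integral>v. cis (\<Sum>i\<in>I. \<xi> i \<bullet> Y i (w, v)) \<partial>M) \<partial>M)"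
      unfolding sumI by (simp add: sum.reindex X_def Y_def cis_mult)
    also have "\<dots> = (\<integral>p. cis (\<Sum>i\<in>I. \<xi> i \<bullet> Y i p) \<partial>(M \<Otimes>\<^sub>M M))"
      by (rule P.integral_fst') (auto intro!: P.integrable_const_bound[of _ 1])
    finally show ?thesis .
  qed
  then have D: "distr M (Pi\<^sub>M I (\<lambda>_. borel)) (\<lambda>w. \<lambda>i\<in>I. X i w) = distr (M \<Otimes>\<^sub>M M) (Pi\<^sub>M I (\<lambda>_. borel)) (\<lambda>w. \<lambda>i\<in>I. Y i w)"
    by (intro joint_char_unique_vec prob_space_axioms P.prob_space_axioms I Xm Ym)
  have S: "Pi\<^sub>E I A' \<in> sets (Pi\<^sub>M I (\<lambda>_. borel))" using I A' by (intro sets_PiM_I_finite) auto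
  have "prob {w \<in> space M. (\<forall>s\<in>F. w s \<in> B s) \<and> w d - w c \<in> A} = measure (distr M (Pi\<^sub>M I (\<lambda>_. borel)) (\<lambda>w. \<lambda>i\<in>I. X i w)) (Pi\<^sub>E I A')"
    by (subst measure_distr[OF _ S]) (auto intro!: measurable_restrict Xm arg_cong[of _ _ prob] simp: I_def X_def A'_def Pi_iff)
  also have "\<dots> = measure (M \<Otimes>\<^sub>M M) ({w \<in> space M. \<forall>s\<in>F. w s \<in> B s} \<times> {w \<in> space M. w d - w c \<in> A})"
    unfolding D by (subst measure_distr[OF _ S]) (auto intro!: measurable_restrict Ym arg_cong[of _ _ "measure (M \<Otimes>\<^sub>M M)"] simp: I_def Y_def A'_def space_pair_measure Pi_iff)
  also have "\<dots> = prob {w \<in> space M. \<forall>s\<in>F. w s \<in> B s} * prob {w \<in> space M. w d - w c \<in> A}"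
    using F by (simp add: measure_def emeasure_pair_measure_Times enn2real_mult)
  finally show ?thesis .
qed

text \<open>Both the cylinder sets up to time \<open>c\<close> and the events of the increment are
  stable under intersection, so their independence extends to the generated sigma-algebras, with
  respect to which the two variables are measurable.\<close>

lemma Filt_indep_var:
  fixes V :: "_ \<Rightarrow> real" and g :: "real ^ 'd \<Rightarrow> real"
  assumes cd: "0 \<le> c" "c \<le> d" "d \<le> T" and V: "V \<in> borel_measurable (Filt T c)" and g[measurable]: "g \<in> borel_measurable borel"
  shows "indep_var borel V borel (\<lambda>w. g (w d - w c))"
proof -
  define \<A> where "\<A> = cyl c"
  define \<B> where "\<B> = {{w \<in> space M. w d - w c \<in> A} | A. A \<in> sets borel}"
  have "indep_set \<A> \<B>"
  proof (rule indep_setI)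
    show "\<A> \<subseteq> events" using cyl_sets by (simp add: \<A>_def)
    show "\<B> \<subseteq> events" unfolding \<B>_def by auto
    fix a b assume "a \<in> \<A>" "b \<in> \<B>"
    then obtain F B A where a: "a = {w \<in> space M. \<forall>s\<in>F. w s \<in> B s}" "finite F" "F \<subseteq> {0..c}" "\<And>s. B s \<in> sets borel"
      and b: "b = {w \<in> space M. w d - w c \<in> A}" "A \<in> sets borel"
      unfolding \<A>_def \<B>_def cyl_def space_M by auto
    have "a \<inter> b = {w \<in> space M. (\<forall>s\<in>F. w s \<in> B s) \<and> w d - w c \<in> A}" using a b by auto
    then show "prob (a \<inter> b) = prob a * prob b" using cyl_indep[OF cd a(2,3,4) b(2)] a(1) b(1) by simp
  qed
  moreover have "Int_stable \<A>"
  proof (rule Int_stableI)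
    fix a b assume "a \<in> \<A>" "b \<in> \<A>"
    then obtain F B F' B' where a: "a = {w \<in> Wsp T. \<forall>s\<in>F. w s \<in> B s}" "finite F" "F \<subseteq> {0..c}" "\<And>s. B s \<in> sets borel"
      and b: "b = {w \<in> Wsp T. \<forall>s\<in>F'. w s \<in> B' s}" "finite F'" "F' \<subseteq> {0..c}" "\<And>s. B' s \<in> sets borel"
      unfolding \<A>_def cyl_def by auto
    define C where "C s = (if s \<in> F then B s else UNIV) \<inter> (if s \<in> F' then B' s else UNIV)" for s
    have "a \<inter> b = {w \<in> Wsp T. \<forall>s\<in>F \<union> F'. w s \<in> C s}" unfolding a(1) b(1) C_def by auto
    moreover have "\<forall>s. C s \<in> sets borel" using a(4) b(4) by (auto simp: C_def)
    ultimately show "a \<inter> b \<in> \<A>" unfolding \<A>_def cyl_def using a(2,3) b(2,3)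
      by (intro CollectI exI[of _ "F \<union> F'"] exI[of _ C]) auto
  qed
  moreover have "Int_stable \<B>"
  proof (rule Int_stableI)
    fix a b assume "a \<in> \<B>" "b \<in> \<B>"
    then obtain A A' where "a = {w \<in> space M. w d - w c \<in> A}" "A \<in> sets borel" "b = {w \<in> space M. w d - w c \<in> A'}" "A' \<in> sets borel"
      unfolding \<B>_def by auto
    then show "a \<inter> b \<in> \<B>" unfolding \<B>_def by (intro CollectI exI[of _ "A \<inter> A'"]) auto
  qed
  ultimately have ind: "indep_set (sigma_sets (space M) \<A>) (sigma_sets (space M) \<B>)"
    by (rule indep_set_sigma_sets)
  have Vm: "V \<in> borel_measurable M" using V by (rule measurable_Filt)
  have "sigma_sets (space M) {V -` A \<inter> space M |A. A \<in> sets borel} \<subseteq> sigma_sets (space M) \<A>"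
  proof (rule sigma_sets_mono, safe)
    fix A :: "real set" assume "A \<in> sets borel"
    then have "V -` A \<inter> space (Filt T c) \<in> sets (Filt T c)" using V by (rule measurable_sets[rotated])
    then show "V -` A \<inter> space M \<in> sigma_sets (space M) \<A>"
      using sets_Filt_cyl[of c] by (auto simp: space_Filt space_M \<A>_def)
  qed
  moreover have "sigma_sets (space M) {(\<lambda>w. g (w d - w c)) -` A \<inter> space M |A. A \<in> sets borel} \<subseteq> sigma_sets (space M) \<B>"
  proof (rule sigma_sets_mono, safe)
    fix A :: "real set" assume A: "A \<in> sets borel"
    have "(\<lambda>w. g (w d - w c)) -` A \<inter> space M = {w \<in> space M. w d - w c \<in> g -` A}" by auto
    moreover have "g -` A \<in> sets borel" using measurable_sets[OF g A] by simp
    ultimately show "(\<lambda>w. g (w d - w c)) -` A \<inter> space M \<in> sigma_sets (space M) \<B>"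
      by (intro sigma_sets.Basic) (auto simp: \<B>_def)
  qed
  ultimately have "indep_set (sigma_sets (space M) {V -` A \<inter> space M |A. A \<in> sets borel})
      (sigma_sets (space M) {(\<lambda>w. g (w d - w c)) -` A \<inter> space M |A. A \<in> sets borel})"
    using ind unfolding indep_set_def by (elim indep_sets_mono_sets) (auto split: bool.split)
  then show ?thesis unfolding indep_var_eq using Vm by simp
qed

section \<open>Gaussian moments of the increments\<close>

lemma increment_law:
  assumes cd: "0 \<le> c" "c \<le> d" "d \<le> T"
  shows "distr M borel (\<lambda>w. \<zeta> \<bullet> (w d - w c)) = distr std_normal_distribution borel (\<lambda>x. sqrt ((d - c) * (\<zeta> \<bullet> \<zeta>)) * x)"
proof (rule Levy_uniqueness)
  interpret std: prob_space std_normal_distribution by (rule std_normal_prob_space)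
  show "real_distribution (distr M borel (\<lambda>w. \<zeta> \<bullet> (w d - w c)))"
    by (auto simp: real_distribution_def real_distribution_axioms_def intro!: prob_space_distr)
  show "real_distribution (distr std_normal_distribution borel (\<lambda>x. sqrt ((d - c) * (\<zeta> \<bullet> \<zeta>)) * x))"
    by (auto simp: real_distribution_def real_distribution_axioms_def intro!: std.prob_space_distr)
  show "char (distr M borel (\<lambda>w. \<zeta> \<bullet> (w d - w c))) = char (distr std_normal_distribution borel (\<lambda>x. sqrt ((d - c) * (\<zeta> \<bullet> \<zeta>)) * x))"
  proof
    fix t :: real
    have "char (distr M borel (\<lambda>w. \<zeta> \<bullet> (w d - w c))) t = (\<integral>w. cis (\<Sum>i\<in>{()}. (t *\<^sub>R \<zeta>) \<bullet> (w d - w c)) \<partial>M)"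
      unfolding char_def by (subst integral_distr) (auto simp: cis_conv_exp)
    also have "\<dots> = complex_of_real (exp (- (d - c) * (t\<^sup>2 * (\<zeta> \<bullet> \<zeta>)) / 2))"
      using cd by (subst increment_char) (auto simp: min_def power2_eq_square field_simps)
    also have "\<dots> = complex_of_real (exp (- (t * sqrt ((d - c) * (\<zeta> \<bullet> \<zeta>)))\<^sup>2 / 2))"
      using cd by (simp add: power_mult_distrib mult_ac, simp add: algebra_simps)
    also have "\<dots> = (\<integral>x. cis (t * sqrt ((d - c) * (\<zeta> \<bullet> \<zeta>)) * x) \<partial>std_normal_distribution)"
      by (rule std_normal_char[symmetric])
    also have "\<dots> = char (distr std_normal_distribution borel (\<lambda>x. sqrt ((d - c) * (\<zeta> \<bullet> \<zeta>)) * x)) t"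
      unfolding char_def by (subst integral_distr) (auto simp: cis_conv_exp mult_ac)
    finally show "char (distr M borel (\<lambda>w. \<zeta> \<bullet> (w d - w c))) t = char (distr std_normal_distribution borel (\<lambda>x. sqrt ((d - c) * (\<zeta> \<bullet> \<zeta>)) * x)) t" .
  qed
qed

lemma increment_moment:
  assumes cd: "0 \<le> c" "c \<le> d" "d \<le> T"
  shows increment_moment_integrable: "integrable M (\<lambda>w. (\<zeta> \<bullet> (w d - w c)) ^ k)"
    and increment_moment_eq: "(\<integral>w. (\<zeta> \<bullet> (w d - w c)) ^ k \<partial>M) = sqrt ((d - c) * (\<zeta> \<bullet> \<zeta>)) ^ k * (\<integral>x. x ^ k \<partial>std_normal_distribution)"
proof -
  let ?q = "sqrt ((d - c) * (\<zeta> \<bullet> \<zeta>))"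
  have i: "integrable std_normal_distribution (\<lambda>x. (?q * x) ^ k)"
    unfolding power_mult_distrib using integrable_std_normal_distribution_moment[of k] by (intro integrable_mult_right)
  have "integrable (distr M borel (\<lambda>w. \<zeta> \<bullet> (w d - w c))) (\<lambda>x. x ^ k)"
    unfolding increment_law[OF cd] using i by (subst integrable_distr_eq) auto
  then show "integrable M (\<lambda>w. (\<zeta> \<bullet> (w d - w c)) ^ k)" by (subst (asm) integrable_distr_eq) auto
  have "(\<integral>w. (\<zeta> \<bullet> (w d - w c)) ^ k \<partial>M) = (\<integral>x. x ^ k \<partial>distr M borel (\<lambda>w. \<zeta> \<bullet> (w d - w c)))"
    by (subst integral_distr) auto
  also have "\<dots> = (\<integral>x. (?q * x) ^ k \<partial>std_normal_distribution)"
    unfolding increment_law[OF cd] by (subst integral_distr) auto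
  also have "\<dots> = ?q ^ k * (\<integral>x. x ^ k \<partial>std_normal_distribution)"
    unfolding power_mult_distrib by simp
  finally show "(\<integral>w. (\<zeta> \<bullet> (w d - w c)) ^ k \<partial>M) = ?q ^ k * (\<integral>x. x ^ k \<partial>std_normal_distribution)" .
qed

lemma increment_moment2:
  assumes cd: "0 \<le> c" "c \<le> d" "d \<le> T"
  shows "(\<integral>w. (\<zeta> \<bullet> (w d - w c)) ^ 2 \<partial>M) = (d - c) * (\<zeta> \<bullet> \<zeta>)"
proof -
  have "(\<integral>x. x ^ 2 \<partial>std_normal_distribution) = 1"
    using std_normal_distribution_even_moments(1)[of 1] by simp
  then show ?thesis using cd by (simp add: increment_moment_eq[OF cd])
qed

lemma increment_moment4:
  assumes cd: "0 \<le> c" "c \<le> d" "d \<le> T"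
  shows "(\<integral>w. ((w d - w c) $ i) ^ 4 \<partial>M) = 3 * (d - c)\<^sup>2" "integrable M (\<lambda>w. ((w d - w c) $ i) ^ 4)"
proof -
  have "(\<integral>x. x ^ 4 \<partial>std_normal_distribution) = 3"
    using std_normal_distribution_even_moments(1)[of 2] by (simp add: fact_numeral)
  moreover have "sqrt (d - c) ^ 4 = (d - c)\<^sup>2"
  proof -
    have "sqrt (d - c) ^ 4 = (sqrt (d - c) ^ 2) ^ 2" by (simp flip: power_mult)
    then show ?thesis using cd by simp
  qed
  ultimately show "(\<integral>w. ((w d - w c) $ i) ^ 4 \<partial>M) = 3 * (d - c)\<^sup>2"
    using increment_moment_eq[OF cd, of "axis i 1" 4] by (simp add: inner_axis' inner_axis_axis)
  show "integrable M (\<lambda>w. ((w d - w c) $ i) ^ 4)"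
    using increment_moment_integrable[OF cd, of "axis i 1" 4] by (simp add: inner_axis')
qed

lemma increment_mean:
  assumes cd: "0 \<le> c" "c \<le> d" "d \<le> T"
  shows "(\<integral>w. (w d - w c) $ i \<partial>M) = 0" "integrable M (\<lambda>w. (w d - w c) $ i)"
  using increment_moment_eq[OF cd, of "axis i 1" 1] increment_moment_integrable[OF cd, of "axis i 1" 1]
    integral_std_normal_distribution_moment_odd[of 1]
  by (simp_all add: inner_axis')

lemma increment_cov:
  assumes cd: "0 \<le> c" "c \<le> d" "d \<le> T"
  shows "(\<integral>w. (w d - w c) $ i * (w d - w c) $ j \<partial>M) = (if i = j then d - c else 0)"
    "integrable M (\<lambda>w. (w d - w c) $ i * (w d - w c) $ j)"
proof -
  let ?D = "\<lambda>w. w d - w c"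
  \<comment> \<open>Polarisation: a mixed moment of two coordinates is a difference of second
    moments of two projections.\<close>
  have e: "?D w $ i * ?D w $ j = ((axis i 1 + axis j 1) \<bullet> ?D w) ^ 2 / 4 - ((axis i 1 - axis j 1) \<bullet> ?D w) ^ 2 / 4" for w
    by (simp add: inner_add_left inner_diff_left inner_axis' power2_eq_square field_simps)
  show "integrable M (\<lambda>w. ?D w $ i * ?D w $ j)"
    unfolding e by (intro Bochner_Integration.integrable_diff integrable_divide increment_moment_integrable[OF cd])
  have "(\<integral>w. ?D w $ i * ?D w $ j \<partial>M) = (d - c) * ((axis i 1 + axis j 1) \<bullet> (axis i 1 + axis j (1::real))) / 4 - (d - c) * ((axis i 1 - axis j 1) \<bullet> (axis i 1 - axis j (1::real))) / 4"
    unfolding e using increment_moment_integrable[OF cd, of _ 2] by (subst Bochner_Integration.integral_diff) (auto simp: increment_moment2[OF cd])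
  also have "\<dots> = (if i = j then d - c else 0)"
    by (auto simp: inner_add_left inner_diff_left inner_add_right inner_diff_right inner_axis_axis field_simps)
  finally show "(\<integral>w. ?D w $ i * ?D w $ j \<partial>M) = (if i = j then d - c else 0)" .
qed

text \<open>This is all that the isometry takes from the filtration: given the past, an increment
  has mean 0 and covariance \<open>d - c\<close> times the identity, here tested against an
  integrable variable of the past.\<close>

lemma Filt_mult_increment:
  assumes cd: "0 \<le> c" "c \<le> d" "d \<le> T" and V: "V \<in> borel_measurable (Filt T c)" "integrable M V"
  shows "integrable M (\<lambda>w. V w * (w d - w c) $ i)" "(\<integral>w. V w * (w d - w c) $ i \<partial>M) = 0"
    "integrable M (\<lambda>w. V w * ((w d - w c) $ i * (w d - w c) $ j))"
    "(\<integral>w. V w * ((w d - w c) $ i * (w d - w c) $ j) \<partial>M) = (\<integral>w. V w \<partial>M) * (if i = j then d - c else 0)"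
proof -
  have i1: "indep_var borel V borel (\<lambda>w. (w d - w c) $ i)"
    using Filt_indep_var[OF cd V(1), of "\<lambda>x. x $ i"] by simp
  have i2: "indep_var borel V borel (\<lambda>w. (w d - w c) $ i * (w d - w c) $ j)"
    using Filt_indep_var[OF cd V(1), of "\<lambda>x. x $ i * x $ j"] by simp
  show "integrable M (\<lambda>w. V w * (w d - w c) $ i)" "(\<integral>w. V w * (w d - w c) $ i \<partial>M) = 0"
    using indep_var_integrable[OF i1 V(2) increment_mean(2)[OF cd]]
      indep_var_lebesgue_integral[OF i1 V(2) increment_mean(2)[OF cd]] increment_mean(1)[OF cd] by auto
  show "integrable M (\<lambda>w. V w * ((w d - w c) $ i * (w d - w c) $ j))"
    "(\<integral>w. V w * ((w d - w c) $ i * (w d - w c) $ j) \<partial>M) = (\<integral>w. V w \<partial>M) * (if i = j then d - c else 0)"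
    using indep_var_integrable[OF i2 V(2) increment_cov(2)[OF cd]]
      indep_var_lebesgue_integral[OF i2 V(2) increment_cov(2)[OF cd]] increment_cov(1)[OF cd] by auto
qed

end

section \<open>The Ito isometry\<close>

lemma norm_diff3_sq:
  fixes x y z u :: "'a::real_normed_vector"
  shows "(norm (x - u))\<^sup>2 \<le> 3 * (norm (x - y))\<^sup>2 + 3 * (norm (y - z))\<^sup>2 + 3 * (norm (z - u))\<^sup>2"
proof -
  define a b c where "a = norm (x - y)" "b = norm (y - z)" "c = norm (z - u)"
  have "norm (x - u) \<le> a + b + c"
    using norm_triangle_ineq[of "x - y" "y - u"] norm_triangle_ineq[of "y - z" "z - u"] by (simp add: a_b_c_def)
  then have "(norm (x - u))\<^sup>2 \<le> (a + b + c)\<^sup>2" by (intro power_mono) auto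
  moreover have "(a + b + c)\<^sup>2 \<le> 3 * a\<^sup>2 + 3 * b\<^sup>2 + 3 * c\<^sup>2"
    using zero_le_power2[of "a - b"] zero_le_power2[of "b - c"] zero_le_power2[of "a - c"]
    by (simp add: power2_eq_square algebra_simps)
  ultimately show ?thesis unfolding a_b_c_def by (rule order_trans)
qed

lemma norm_diff2_sq:
  fixes x y z :: "'a::real_normed_vector"
  shows "(norm (x - z))\<^sup>2 \<le> 2 * (norm (x - y))\<^sup>2 + 2 * (norm (y - z))\<^sup>2"
proof -
  define a b where "a = norm (x - y)" "b = norm (y - z)"
  have "norm (x - z) \<le> a + b"
    using norm_triangle_ineq[of "x - y" "y - z"] by (simp add: a_b_def)
  then have "(norm (x - z))\<^sup>2 \<le> (a + b)\<^sup>2" by (intro power_mono) auto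
  moreover have "(a + b)\<^sup>2 \<le> 2 * a\<^sup>2 + 2 * b\<^sup>2"
    using zero_le_power2[of "a - b"] by (simp add: power2_eq_square algebra_simps)
  ultimately show ?thesis unfolding a_b_def by (rule order_trans)
qed

text \<open>The squared distance as an extended nonnegative integral: it makes sense without any
  integrability, at the price of the factors 2 and 3 in the triangle inequalities.\<close>

definition L2dist :: "'a measure \<Rightarrow> ('a \<Rightarrow> 'b::real_normed_vector) \<Rightarrow> ('a \<Rightarrow> 'b) \<Rightarrow> ennreal" where
  "L2dist M f g = (\<integral>\<^sup>+x. ennreal ((norm (f x - g x))\<^sup>2) \<partial>M)"

lemma L2dist_commute: "L2dist M f g = L2dist M g f"
  by (simp add: L2dist_def norm_minus_commute)

lemma ennreal_numeral_mult: "0 \<le> a \<Longrightarrow> ennreal (numeral n * a) = numeral n * ennreal a"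
  by (subst ennreal_mult) auto

lemma ennreal_le_2: "a \<le> 2 * b + 2 * c \<Longrightarrow> 0 \<le> b \<Longrightarrow> 0 \<le> c \<Longrightarrow> ennreal a \<le> 2 * ennreal b + 2 * ennreal c"
  using ennreal_leI[of a "2 * b + 2 * c"] by (simp add: ennreal_plus ennreal_numeral_mult)

lemma ennreal_le_3: "a \<le> 3 * b + 3 * c + 3 * d \<Longrightarrow> 0 \<le> b \<Longrightarrow> 0 \<le> c \<Longrightarrow> 0 \<le> d \<Longrightarrow> ennreal a \<le> 3 * ennreal b + 3 * ennreal c + 3 * ennreal d"
  using ennreal_leI[of a "3 * b + 3 * c + 3 * d"] by (simp add: ennreal_plus ennreal_numeral_mult)

lemma L2dist_triangle:
  fixes f g h :: "'a \<Rightarrow> 'b::{second_countable_topology, real_normed_vector}"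
  assumes [measurable]: "f \<in> borel_measurable M" "g \<in> borel_measurable M" "h \<in> borel_measurable M"
  shows "L2dist M f h \<le> 2 * L2dist M f g + 2 * L2dist M g h"
proof -
  have "L2dist M f h \<le> (\<integral>\<^sup>+x. 2 * ennreal ((norm (f x - g x))\<^sup>2) + 2 * ennreal ((norm (g x - h x))\<^sup>2) \<partial>M)"
    unfolding L2dist_def
    by (intro nn_integral_mono ennreal_le_2 norm_diff2_sq) auto
  also have "\<dots> = 2 * L2dist M f g + 2 * L2dist M g h"
    unfolding L2dist_def by (simp add: nn_integral_add nn_integral_cmult)
  finally show ?thesis .
qed

lemma L2dist_triangle3:
  fixes f g h k :: "'a \<Rightarrow> 'b::{second_countable_topology, real_normed_vector}"
  assumes [measurable]: "f \<in> borel_measurable M" "g \<in> borel_measurable M" "h \<in> borel_measurable M" "k \<in> borel_measurable M"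
  shows "L2dist M f k \<le> 3 * L2dist M f g + 3 * L2dist M g h + 3 * L2dist M h k"
proof -
  have "L2dist M f k \<le> (\<integral>\<^sup>+x. 3 * ennreal ((norm (f x - g x))\<^sup>2) + 3 * ennreal ((norm (g x - h x))\<^sup>2) + 3 * ennreal ((norm (h x - k x))\<^sup>2) \<partial>M)"
    unfolding L2dist_def
    by (intro nn_integral_mono ennreal_le_3 norm_diff3_sq) auto
  also have "\<dots> = 3 * L2dist M f g + 3 * L2dist M g h + 3 * L2dist M h k"
    unfolding L2dist_def by (simp add: nn_integral_add nn_integral_cmult)
  finally show ?thesis .
qed

lemma ennreal_le_suminf:
  fixes g :: "nat \<Rightarrow> ennreal"
  shows "g n \<le> (\<Sum>n. g n)"
  using sum_le_suminf[of g "{n}"] by simp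

text \<open>The rate \<open>(1/4) ^ n\<close> leaves room for a weight \<open>2 ^ n\<close>: the
  weighted sum of the squared successive differences has finite integral, so almost surely these
  differences are dominated by a geometric sequence of ratio \<open>sqrt (1/2)\<close>. This gives
  pointwise convergence, and Fatou's lemma carries the distance bound to the limit.\<close>

lemma L2_complete:
  fixes f :: "nat \<Rightarrow> 'a \<Rightarrow> 'b::{second_countable_topology, banach}"
  assumes f[measurable]: "\<And>n. f n \<in> borel_measurable M"
    and cauchy: "\<And>n m. n \<le> m \<Longrightarrow> L2dist M (f n) (f m) \<le> ennreal ((1/4) ^ n)"
  obtains g where "g \<in> borel_measurable M" "AE x in M. (\<lambda>n. f n x) \<longlonglongrightarrow> g x"
    "\<And>n. L2dist M (f n) g \<le> ennreal ((1/4) ^ n)"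
proof -
  define S where "S x = (\<Sum>n. ennreal (2 ^ n * (norm (f n x - f (Suc n) x))\<^sup>2))" for x
  have "(\<integral>\<^sup>+x. S x \<partial>M) = (\<Sum>n. \<integral>\<^sup>+x. ennreal (2 ^ n * (norm (f n x - f (Suc n) x))\<^sup>2) \<partial>M)"
    unfolding S_def by (rule nn_integral_suminf) measurable
  also have "\<dots> = (\<Sum>n. ennreal (2 ^ n) * L2dist M (f n) (f (Suc n)))"
    unfolding L2dist_def by (intro suminf_cong) (simp add: ennreal_mult nn_integral_cmult)
  also have "\<dots> \<le> (\<Sum>n. ennreal ((1/2) ^ n))"
  proof (intro suminf_le allI)
    fix n
    have "ennreal (2 ^ n) * L2dist M (f n) (f (Suc n)) \<le> ennreal (2 ^ n) * ennreal ((1/4) ^ n)"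
      by (intro mult_left_mono cauchy) auto
    also have "\<dots> = ennreal ((1/2) ^ n)"
    proof -
      have "(2::real) ^ n * (1/4) ^ n = (2 * (1/4)) ^ n" by (rule power_mult_distrib[symmetric])
      then show ?thesis by (simp add: ennreal_mult[symmetric])
    qed
    finally show "ennreal (2 ^ n) * L2dist M (f n) (f (Suc n)) \<le> ennreal ((1/2) ^ n)" .
  qed auto
  also have "\<dots> < \<infinity>" by (subst suminf_ennreal2) (auto intro!: summable_geometric)
  finally have "(\<integral>\<^sup>+x. S x \<partial>M) \<noteq> \<infinity>" by simp
  moreover have "S \<in> borel_measurable M" unfolding S_def by measurable
  ultimately have "AE x in M. S x \<noteq> \<infinity>" by (intro nn_integral_PInf_AE)
  then have conv: "AE x in M. convergent (\<lambda>n. f n x)"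
  proof eventually_elim
    case (elim x)
    then obtain C where C: "C \<ge> 0" "S x = ennreal C" by (cases "S x") auto
    have b: "norm (f n x - f (Suc n) x) \<le> sqrt C * (sqrt (1/2)) ^ n" for n
    proof -
      have "ennreal (2 ^ n * (norm (f n x - f (Suc n) x))\<^sup>2) \<le> S x"
        unfolding S_def by (rule ennreal_le_suminf)
      then have "2 ^ n * (norm (f n x - f (Suc n) x))\<^sup>2 \<le> C" using C by (simp add: ennreal_le_iff)
      then have "(2 ^ n * (norm (f n x - f (Suc n) x))\<^sup>2) * (1/2) ^ n \<le> C * (1/2) ^ n" by (intro mult_right_mono) auto
      moreover have "(2 ^ n * r) * (1/2) ^ n = r" for r :: real by (simp add: power_divide)
      ultimately have "(norm (f n x - f (Suc n) x))\<^sup>2 \<le> C * (1/2) ^ n" by simp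
      then have "norm (f n x - f (Suc n) x) \<le> sqrt (C * (1/2) ^ n)" by (rule real_le_rsqrt)
      then show ?thesis by (simp add: real_sqrt_mult real_sqrt_power)
    qed
    have s: "summable (\<lambda>n. sqrt C * (sqrt (1/2)) ^ n)"
    proof (intro summable_mult summable_geometric)
      show "norm (sqrt (1 / 2) :: real) < 1" by simp
    qed
    have "summable (\<lambda>n. f (Suc n) x - f n x)"
      by (rule summable_comparison_test'[OF s, of 0]) (use b in \<open>simp add: norm_minus_commute\<close>)
    then have "convergent (\<lambda>n. \<Sum>i<n. f (Suc i) x - f i x)" by (simp add: summable_iff_convergent)
    then have "convergent (\<lambda>n. (\<Sum>i<n. f (Suc i) x - f i x) + f 0 x)" by (intro convergent_add convergent_const)
    then show ?case by (simp add: sum_lessThan_telescope[of "\<lambda>i. f i x"])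
  qed
  \<comment> \<open>Replacing divergent sequences by 0 makes the limit exist at every point, which
    gives measurability of \<open>g\<close>.\<close>
  define g where "g x = lim (\<lambda>n. if convergent (\<lambda>n. f n x) then f n x else 0)" for x
  have gm: "g \<in> borel_measurable M" unfolding g_def
  proof (rule borel_measurable_lim_metric)
    fix n
    have [measurable]: "Measurable.pred M (\<lambda>x. Cauchy (\<lambda>n. f n x))" by measurable
    show "(\<lambda>x. if convergent (\<lambda>n. f n x) then f n x else 0) \<in> borel_measurable M"
      unfolding Cauchy_convergent_iff[symmetric] by measurable
  qed
  have lim: "AE x in M. (\<lambda>n. f n x) \<longlonglongrightarrow> g x"
    using conv by eventually_elim (simp add: g_def convergent_LIMSEQ_iff)
  have "L2dist M (f n) g \<le> ennreal ((1/4) ^ n)" for n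
  proof -
    have "L2dist M (f n) g = (\<integral>\<^sup>+x. liminf (\<lambda>m. ennreal ((norm (f n x - f m x))\<^sup>2)) \<partial>M)"
      unfolding L2dist_def
    proof (intro nn_integral_cong_AE, use lim in eventually_elim)
      case (elim x)
      then have "(\<lambda>m. ennreal ((norm (f n x - f m x))\<^sup>2)) \<longlonglongrightarrow> ennreal ((norm (f n x - g x))\<^sup>2)"
        by (intro tendsto_ennrealI tendsto_intros)
      then show ?case by (rule lim_imp_Liminf[OF trivial_limit_sequentially, symmetric])
    qed
    also have "\<dots> \<le> liminf (\<lambda>m. L2dist M (f n) (f m))"
      unfolding L2dist_def by (rule nn_integral_liminf) measurable
    also have "\<dots> \<le> ennreal ((1/4) ^ n)"
    proof (rule Liminf_le)
      show "\<forall>\<^sub>F m in sequentially. L2dist M (f n) (f m) \<le> ennreal ((1/4) ^ n)"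
        using cauchy by (auto simp: eventually_sequentially)
    qed simp
    finally show ?thesis .
  qed
  with gm lim that show thesis by blast
qed

section \<open>The isometry for simple integrands\<close>

context wiener_setup
begin

definition adapted_bounded :: "real \<Rightarrow> ((real \<Rightarrow> real ^ 'd) \<Rightarrow> real ^ 'd) \<Rightarrow> bool" where
  "adapted_bounded c \<xi> \<longleftrightarrow> \<xi> \<in> borel_measurable (Filt T c) \<and> bounded (\<xi> ` Wsp T)"

lemma adapted_bounded_mono: "adapted_bounded c \<xi> \<Longrightarrow> c \<le> d \<Longrightarrow> adapted_bounded d \<xi>"
  by (auto simp: adapted_bounded_def intro: Filt_mono)

lemma adapted_boundedD:
  assumes "adapted_bounded c \<xi>"
  shows "\<xi> \<in> borel_measurable M" "(\<lambda>w. \<xi> w $ i) \<in> borel_measurable (Filt T c)" "\<exists>C. \<forall>w\<in>space M. \<bar>\<xi> w $ i\<bar> \<le> C"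
    "integrable M (\<lambda>w. \<xi> w $ i)"
proof -
  show m: "\<xi> \<in> borel_measurable M" "(\<lambda>w. \<xi> w $ i) \<in> borel_measurable (Filt T c)"
    using assms by (auto simp: adapted_bounded_def intro: measurable_Filt measurable_compose[OF _ borel_measurable_nth])
  obtain C where C: "\<And>w. w \<in> Wsp T \<Longrightarrow> norm (\<xi> w) \<le> C"
    using assms by (auto simp: adapted_bounded_def bounded_iff)
  then have C': "\<bar>\<xi> w $ i\<bar> \<le> C" if "w \<in> space M" for w
    using that component_le_norm_cart[of "\<xi> w" i] by (force simp: space_M intro: order_trans)
  then show "\<exists>C. \<forall>w\<in>space M. \<bar>\<xi> w $ i\<bar> \<le> C" by blast
  show "integrable M (\<lambda>w. \<xi> w $ i)"
    using C' m by (intro integrable_const_bound[of _ C]) (auto intro!: AE_I2 measurable_compose[OF _ borel_measurable_nth])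
qed

lemma integrable_mult_bounded:
  fixes f g :: "_ \<Rightarrow> real"
  assumes f: "integrable M f" and g: "g \<in> borel_measurable M" "\<exists>C. \<forall>w\<in>space M. \<bar>g w\<bar> \<le> C"
  shows "integrable M (\<lambda>w. f w * g w)"
proof -
  obtain C where C: "\<And>w. w \<in> space M \<Longrightarrow> \<bar>g w\<bar> \<le> C" using g by auto
  show ?thesis
  proof (rule Bochner_Integration.integrable_bound[of _ "\<lambda>w. C * f w"])
    show "integrable M (\<lambda>w. C * f w)" using f by simp
    show "(\<lambda>w. f w * g w) \<in> borel_measurable M" using f g by auto
    show "AE w in M. norm (f w * g w) \<le> norm (C * f w)"
    proof (rule AE_I2)
      fix w assume "w \<in> space M"
      then have "\<bar>g w\<bar> * \<bar>f w\<bar> \<le> \<bar>C\<bar> * \<bar>f w\<bar>" using C[of w] by (intro mult_right_mono) auto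
      then show "norm (f w * g w) \<le> norm (C * f w)" by (simp add: abs_mult mult.commute)
    qed
  qed
qed

text \<open>Everything except the last increment is known at time \<open>c\<close>, so each
  coordinate of that increment meets a factor of the past and averages to 0. The factor is
  integrable as a product of a bounded variable with one coming from the earlier increment.\<close>

lemma ito_pair_disjoint:
  assumes abcd: "0 \<le> a" "a \<le> b" "b \<le> c" "c \<le> d" "d \<le> T"
    and \<xi>: "adapted_bounded a \<xi>" and \<xi>': "adapted_bounded c \<xi>'"
  shows "has_bochner_integral M (\<lambda>w. (\<xi> w \<bullet> (w b - w a)) * (\<xi>' w \<bullet> (w d - w c))) 0"
proof -
  define V where "V i w = (\<xi> w \<bullet> (w b - w a)) * \<xi>' w $ i" for i w
  have "(\<lambda>w::real \<Rightarrow> real ^ 'd. w b - w a) \<in> borel_measurable (Filt T c)"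
    using abcd by (intro borel_measurable_diff Filt_coordinate) auto
  moreover have "\<xi> \<in> borel_measurable (Filt T c)"
    using adapted_bounded_mono[OF \<xi>, of c] abcd by (auto simp: adapted_bounded_def)
  ultimately have m: "V i \<in> borel_measurable (Filt T c)" for i
    unfolding V_def by (intro borel_measurable_times borel_measurable_inner adapted_boundedD(2)[OF \<xi>'])
  have "integrable M (\<lambda>w. \<xi> w \<bullet> (w b - w a))"
    unfolding inner_vec_def using abcd adapted_boundedD[OF \<xi>]
    by (auto intro!: Bochner_Integration.integrable_sum Filt_mult_increment(1)[of a b] simp del: vector_minus_component)
  then have i: "integrable M (V i)" for i
    unfolding V_def using adapted_boundedD(1,3)[OF \<xi>']
    by (intro integrable_mult_bounded) (auto intro: measurable_compose[OF _ borel_measurable_nth])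
  have "has_bochner_integral M (\<lambda>w. \<Sum>i\<in>UNIV. V i w * (w d - w c) $ i) (\<Sum>i\<in>(UNIV::'d set). 0)"
    using Filt_mult_increment(1,2)[OF _ _ _ m i, of d] abcd
    by (intro has_bochner_integral_sum) (auto simp: has_bochner_integral_iff simp del: vector_minus_component)
  then show ?thesis unfolding V_def by (simp add: inner_vec_def[of "\<xi>' _"] sum_distrib_left mult.assoc)
qed

lemma ito_pair_same:
  assumes pq: "0 \<le> p" "p \<le> q" "q \<le> T" and \<xi>: "adapted_bounded p \<xi>" and \<xi>': "adapted_bounded p \<xi>'"
  shows "has_bochner_integral M (\<lambda>w. (\<xi> w \<bullet> (w q - w p)) * (\<xi>' w \<bullet> (w q - w p))) ((\<integral>w. \<xi> w \<bullet> \<xi>' w \<partial>M) * (q - p))"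
proof -
  let ?D = "\<lambda>w. w q - w p"
  have m: "(\<lambda>w. \<xi> w $ i * \<xi>' w $ j) \<in> borel_measurable (Filt T p)" for i j
    using adapted_boundedD(2)[OF \<xi>] adapted_boundedD(2)[OF \<xi>'] by auto
  have i: "integrable M (\<lambda>w. \<xi> w $ i * \<xi>' w $ j)" for i j
    using adapted_boundedD[OF \<xi>] adapted_boundedD[OF \<xi>'] by (intro integrable_mult_bounded) (auto intro: measurable_Filt)
  have "has_bochner_integral M (\<lambda>w. \<Sum>i\<in>UNIV. \<Sum>j\<in>UNIV. (\<xi> w $ i * \<xi>' w $ j) * (?D w $ i * ?D w $ j))
     (\<Sum>i\<in>UNIV. \<Sum>j\<in>UNIV. (\<integral>w. \<xi> w $ i * \<xi>' w $ j \<partial>M) * (if i = j then q - p else 0))"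
    by (intro has_bochner_integral_sum has_bochner_integral_iff[THEN iffD2] conjI Filt_mult_increment(3,4)[OF pq m i])
  moreover have "(\<Sum>i\<in>UNIV. \<Sum>j\<in>UNIV. (\<integral>w. \<xi> w $ i * \<xi>' w $ j \<partial>M) * (if i = j then q - p else 0)) = (\<integral>w. \<xi> w \<bullet> \<xi>' w \<partial>M) * (q - p)"
  proof -
    have "(\<integral>w. \<xi> w \<bullet> \<xi>' w \<partial>M) = (\<Sum>i\<in>UNIV. \<integral>w. \<xi> w $ i * \<xi>' w $ i \<partial>M)"
      unfolding inner_vec_def using i by simp
    then show ?thesis by (simp add: if_distrib[of "\<lambda>x. _ * x"] sum_distrib_right cong: if_cong)
  qed
  ultimately show ?thesis
    by (simp add: inner_vec_def[of "\<xi> _" "?D _"] inner_vec_def[of "\<xi>' _" "?D _"] sum_product mult_ac del: vector_minus_component)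
qed

text \<open>Cut both intervals at the ends \<open>p\<close> and \<open>q\<close> of their
  intersection and expand into nine products. Two vanish identically, because one of the two pieces
  before \<open>p\<close> and one of the two pieces after \<open>q\<close> is trivial; six pair
  separated pieces and have mean 0; the common piece contributes its length
  \<open>q - p\<close>.\<close>

lemma ito_pair:
  assumes ab: "0 \<le> a" "a \<le> b" "b \<le> T" and cd: "0 \<le> c" "c \<le> d" "d \<le> T"
    and \<xi>: "adapted_bounded a \<xi>" and \<xi>': "adapted_bounded c \<xi>'"
  shows "has_bochner_integral M (\<lambda>w. (\<xi> w \<bullet> (w b - w a)) * (\<xi>' w \<bullet> (w d - w c)))
    ((\<integral>w. \<xi> w \<bullet> \<xi>' w \<partial>M) * measure lborel ({a<..b} \<inter> {c<..d}))"
proof -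
  define p where "p = max a c"
  define q where "q = min b d"
  show ?thesis
  proof (cases "p < q")
    case False
    then have e: "{a<..b} \<inter> {c<..d} = {}" by (auto simp: p_def q_def)
    consider "b \<le> c" | "d \<le> a" | "a = b" | "c = d" using False ab cd unfolding p_def q_def by linarith
    then show ?thesis
    proof cases
      case 1 then show ?thesis using ito_pair_disjoint[OF _ _ 1 _ _ \<xi> \<xi>'] ab cd by (simp add: e)
    next
      case 2 then show ?thesis using ito_pair_disjoint[OF _ _ 2 _ _ \<xi>' \<xi>] ab cd by (simp add: e mult.commute)
    qed (simp_all add: e has_bochner_integral_zero)
  next
    case True
    have o: "a \<le> p" "c \<le> p" "p \<le> q" "q \<le> b" "q \<le> d" "0 \<le> p" "0 \<le> q" "q \<le> T" "p \<le> T"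
      using True ab cd by (auto simp: p_def q_def)
    have e: "{a<..b} \<inter> {c<..d} = {p<..q}" by (auto simp: p_def q_def)
    note x = \<xi> adapted_bounded_mono[OF \<xi> o(1)] adapted_bounded_mono[OF \<xi> order_trans[OF o(1,3)]]
    note y = \<xi>' adapted_bounded_mono[OF \<xi>' o(2)] adapted_bounded_mono[OF \<xi>' order_trans[OF o(2,3)]]
    let ?x = "\<lambda>r s w. \<xi> w \<bullet> (w s - w r)" and ?y = "\<lambda>r s w. \<xi>' w \<bullet> (w s - w r)"
    have dis: "has_bochner_integral M (\<lambda>w. ?x a p w * ?y p q w) 0" "has_bochner_integral M (\<lambda>w. ?x a p w * ?y q d w) 0"
      "has_bochner_integral M (\<lambda>w. ?x p q w * ?y q d w) 0"
      using o ab cd by (auto intro!: ito_pair_disjoint x y)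
    have dis': "has_bochner_integral M (\<lambda>w. ?x p q w * ?y c p w) 0" "has_bochner_integral M (\<lambda>w. ?x q b w * ?y c p w) 0"
      "has_bochner_integral M (\<lambda>w. ?x q b w * ?y p q w) 0"
      using o ab cd by (auto intro!: ito_pair_disjoint[of _ _ _ _ \<xi>' \<xi>] x y simp: mult.commute[of "\<xi> _ \<bullet> _"])
    have z: "?x a p w * ?y c p w = 0" "?x q b w * ?y q d w = 0" for w
      by (auto simp: p_def q_def max_def min_def)
    have eq: "?x a b w * ?y c d w = ?x a p w * ?y p q w + (?x a p w * ?y q d w + (?x p q w * ?y q d w +
       (?x p q w * ?y c p w + (?x q b w * ?y c p w + (?x q b w * ?y p q w + ?x p q w * ?y p q w)))))" for w
    proof -
      have "?x a b w = ?x a p w + ?x p q w + ?x q b w" "?y c d w = ?y c p w + ?y p q w + ?y q d w"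
        by (simp_all add: inner_diff_right)
      then have "?x a b w * ?y c d w = (?x a p w + ?x p q w + ?x q b w) * (?y c p w + ?y p q w + ?y q d w)" by (simp only:)
      also have "\<dots> = ?x a p w * ?y p q w + (?x a p w * ?y q d w + (?x p q w * ?y q d w +
       (?x p q w * ?y c p w + (?x q b w * ?y c p w + (?x q b w * ?y p q w + ?x p q w * ?y p q w))))) + (?x a p w * ?y c p w + ?x q b w * ?y q d w)"
        by (simp only: distrib_left distrib_right add_ac)
      finally show ?thesis using z by simp
    qed
    have hb: "has_bochner_integral M (\<lambda>w. ?x a p w * ?y p q w + (?x a p w * ?y q d w + (?x p q w * ?y q d w +
       (?x p q w * ?y c p w + (?x q b w * ?y c p w + (?x q b w * ?y p q w + ?x p q w * ?y p q w))))))
       (0 + (0 + (0 + (0 + (0 + (0 + (\<integral>w. \<xi> w \<bullet> \<xi>' w \<partial>M) * (q - p)))))))"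
      by (intro has_bochner_integral_add dis dis' ito_pair_same o x y)
    have "measure lborel {p<..q} = q - p" using True by simp
    then show ?thesis unfolding eq e using hb by (simp only: add_0)
  qed
qed

text \<open>The intervals may overlap in any way. A difference of two simple integrands over
  different partitions is therefore covered directly, without a common refinement.\<close>

lemma ito_isometry_sum:
  fixes \<xi> :: "'i \<Rightarrow> _ \<Rightarrow> real ^ 'd"
  assumes I: "finite I" and ab: "\<And>k. k \<in> I \<Longrightarrow> 0 \<le> a k \<and> a k \<le> b k \<and> b k \<le> T"
    and \<xi>: "\<And>k. k \<in> I \<Longrightarrow> adapted_bounded (a k) (\<xi> k)"
  shows "(\<integral>\<^sup>+w. ennreal ((\<Sum>k\<in>I. \<xi> k w \<bullet> (w (b k) - w (a k)))\<^sup>2) \<partial>M)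
    = (\<integral>\<^sup>+w. (\<integral>\<^sup>+s\<in>{0..T}. ennreal ((norm (\<Sum>k\<in>I. indicator {a k<..b k} s *\<^sub>R \<xi> k w))\<^sup>2) \<partial>lborel) \<partial>M)"
proof -
  define len where "len k l = measure lborel ({a k<..b k} \<inter> {a l<..b l})" for k l
  define Q where "Q w = (\<Sum>k\<in>I. \<Sum>l\<in>I. (\<xi> k w \<bullet> \<xi> l w) * len k l)" for w
  have i: "integrable M (\<lambda>w. \<xi> k w \<bullet> \<xi> l w)" if "k \<in> I" "l \<in> I" for k l
    unfolding inner_vec_def using adapted_boundedD[OF \<xi>[OF that(1)]] adapted_boundedD[OF \<xi>[OF that(2)]]
    by (auto intro!: Bochner_Integration.integrable_sum integrable_mult_bounded intro: measurable_Filt)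
  have "has_bochner_integral M (\<lambda>w. \<Sum>k\<in>I. \<Sum>l\<in>I. (\<xi> k w \<bullet> (w (b k) - w (a k))) * (\<xi> l w \<bullet> (w (b l) - w (a l))))
     (\<Sum>k\<in>I. \<Sum>l\<in>I. (\<integral>w. \<xi> k w \<bullet> \<xi> l w \<partial>M) * len k l)"
    unfolding len_def using ab \<xi> by (intro has_bochner_integral_sum ito_pair) auto
  then have h: "has_bochner_integral M (\<lambda>w. (\<Sum>k\<in>I. \<xi> k w \<bullet> (w (b k) - w (a k)))\<^sup>2) (\<Sum>k\<in>I. \<Sum>l\<in>I. (\<integral>w. \<xi> k w \<bullet> \<xi> l w \<partial>M) * len k l)"
    by (simp add: power2_eq_square sum_product)
  have hQ: "has_bochner_integral M Q (\<Sum>k\<in>I. \<Sum>l\<in>I. (\<integral>w. \<xi> k w \<bullet> \<xi> l w \<partial>M) * len k l)"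
    unfolding Q_def by (intro has_bochner_integral_sum has_bochner_integral_mult_left has_bochner_integral_integrable i)
  have inner: "has_bochner_integral lborel (\<lambda>s. (norm (\<Sum>k\<in>I. indicator {a k<..b k} s *\<^sub>R \<xi> k w))\<^sup>2) (Q w)" for w
  proof -
    have "(norm (\<Sum>k\<in>I. indicator {a k<..b k} s *\<^sub>R \<xi> k w))\<^sup>2 = (\<Sum>k\<in>I. \<Sum>l\<in>I. (\<xi> k w \<bullet> \<xi> l w) * indicator ({a k<..b k} \<inter> {a l<..b l}) s)" for s
      unfolding power2_norm_eq_inner inner_sum_left unfolding inner_sum_right
      by (intro sum.cong refl) (auto simp: indicator_def)
    moreover have "has_bochner_integral lborel (\<lambda>s. \<Sum>k\<in>I. \<Sum>l\<in>I. (\<xi> k w \<bullet> \<xi> l w) * indicator ({a k<..b k} \<inter> {a l<..b l}) s) (Q w)"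
      unfolding Q_def len_def
    proof (intro has_bochner_integral_sum has_bochner_integral_mult_right has_bochner_integral_real_indicator)
      fix k l
      have "emeasure lborel ({a k<..b k} \<inter> {a l<..b l}) \<le> emeasure lborel {a k<..b k}" by (intro emeasure_mono) auto
      also have "\<dots> < \<infinity>" by (cases "a k \<le> b k") auto
      finally show "emeasure lborel ({a k<..b k} \<inter> {a l<..b l}) < \<infinity>" .
    qed auto
    ultimately show ?thesis by simp
  qed
  have inner': "(\<integral>\<^sup>+s\<in>{0..T}. ennreal ((norm (\<Sum>k\<in>I. indicator {a k<..b k} s *\<^sub>R \<xi> k w))\<^sup>2) \<partial>lborel) = ennreal (Q w)" for w
  proof -
    have "(\<integral>\<^sup>+s\<in>{0..T}. ennreal ((norm (\<Sum>k\<in>I. indicator {a k<..b k} s *\<^sub>R \<xi> k w))\<^sup>2) \<partial>lborel)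
       = (\<integral>\<^sup>+s. ennreal ((norm (\<Sum>k\<in>I. indicator {a k<..b k} s *\<^sub>R \<xi> k w))\<^sup>2) \<partial>lborel)"
    proof (intro nn_integral_cong)
      fix s
      show "ennreal ((norm (\<Sum>k\<in>I. indicator {a k<..b k} s *\<^sub>R \<xi> k w))\<^sup>2) * indicator {0..T} s = ennreal ((norm (\<Sum>k\<in>I. indicator {a k<..b k} s *\<^sub>R \<xi> k w))\<^sup>2)"
      proof (cases "s \<in> {0..T}")
        case False
        then have "(\<Sum>k\<in>I. indicator {a k<..b k} s *\<^sub>R \<xi> k w) = (\<Sum>k\<in>I. 0)"
          using ab by (intro sum.cong refl) (force simp: indicator_def)
        then show ?thesis by simp
      qed simp
    qed
    also have "\<dots> = ennreal (Q w)"
      using inner[of w] by (simp add: has_bochner_integral_iff nn_integral_eq_integral)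
    finally show ?thesis .
  qed
  have "0 \<le> Q w" for w
    using inner[of w] by (auto simp: has_bochner_integral_iff dest!: sym[of _ "Q w"])
  then show ?thesis unfolding inner'
    using h hQ by (simp add: has_bochner_integral_iff nn_integral_eq_integral)
qed

end

section \<open>Ito integrals as limits of simple ones\<close>

definition interval_measure_T :: "real \<Rightarrow> real measure" where
  "interval_measure_T T = density lborel (indicator {0..T})"

lemma sets_interval_measure_T[simp, measurable_cong]: "sets (interval_measure_T T) = sets borel"
  and space_interval_measure_T[simp]: "space (interval_measure_T T) = UNIV"
  by (auto simp: interval_measure_T_def)

lemma nn_integral_interval_measure_T:
  "f \<in> borel_measurable borel \<Longrightarrow> (\<integral>\<^sup>+s. f s \<partial>interval_measure_T T) = (\<integral>\<^sup>+s\<in>{0..T}. f s \<partial>lborel)"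
  unfolding interval_measure_T_def by (subst nn_integral_density) (auto simp: mult.commute)

lemma finite_interval_measure_T: "finite_measure (interval_measure_T T)"
proof (rule finite_measureI)
  have "emeasure (interval_measure_T T) UNIV = emeasure lborel {0..T}"
    unfolding interval_measure_T_def by (subst emeasure_density) auto
  also have "\<dots> < \<infinity>" by (cases "0 \<le> T") auto
  finally show "emeasure (interval_measure_T T) (space (interval_measure_T T)) \<noteq> \<infinity>" by simp
qed

lemma norm_sum_sq_le:
  fixes f :: "nat \<Rightarrow> 'a::real_normed_vector"
  shows "(norm (\<Sum>k<n. f k))\<^sup>2 \<le> real n * (\<Sum>k<n. (norm (f k))\<^sup>2)"
proof -
  have "(norm (\<Sum>k<n. f k))\<^sup>2 \<le> (\<Sum>k<n. norm (f k))\<^sup>2" by (intro power_mono norm_sum) auto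
  also have "\<dots> \<le> (\<Sum>k<n. (norm (f k))\<^sup>2) * real (card {..<n})" by (rule sum_squared_le_sum_of_squares)
  finally show ?thesis by (simp add: mult.commute)
qed

lemma ennreal_tendsto_0_iff: "(\<lambda>n. (f n :: ennreal)) \<longlonglongrightarrow> 0 \<Longrightarrow> e > 0 \<Longrightarrow> \<exists>n. f n < e"
  by (metis eventually_sequentially order_tendstoD(2) order_refl)

lemma tendsto_0_le_ennreal:
  fixes f g :: "nat \<Rightarrow> ennreal"
  assumes "\<And>n. f n \<le> g n" "g \<longlonglongrightarrow> 0"
  shows "f \<longlonglongrightarrow> 0"
  by (rule tendsto_sandwich[OF _ _ tendsto_const assms(2)]) (use assms(1) in auto)

lemma has_simple_itoE:
  assumes "has_simple_ito T H Y"
  obtains n and \<tau> :: "nat \<Rightarrow> real" and \<xi> where "0 \<le> \<tau> 0" "\<forall>k<n. \<tau> k \<le> \<tau> (Suc k) \<and> \<tau> (Suc k) \<le> T"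
    "\<And>k. k < n \<Longrightarrow> \<xi> k \<in> borel_measurable (Filt T (\<tau> k)) \<and> bounded (\<xi> k ` Wsp T)"
    "\<And>s w. H s w = (\<Sum>k<n. indicator {\<tau> k<..\<tau> (Suc k)} s *\<^sub>R \<xi> k w)"
    "\<And>w. Y w = (\<Sum>k<n. \<xi> k w \<bullet> (w (\<tau> (Suc k)) - w (\<tau> k)))"
  using assms[unfolded has_simple_ito_def]
proof (elim exE conjE)
  fix n and \<tau> :: "nat \<Rightarrow> real" and \<xi>
  assume "0 \<le> \<tau> 0" "\<forall>k<n. \<tau> k \<le> \<tau> (Suc k) \<and> \<tau> (Suc k) \<le> T"
    "\<forall>k<n. \<xi> k \<in> borel_measurable (Filt T (\<tau> k)) \<and> bounded (\<xi> k ` Wsp T)"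
    "\<forall>s w. H s w = (\<Sum>k<n. indicator {\<tau> k<..\<tau> (Suc k)} s *\<^sub>R \<xi> k w)"
    "\<forall>w. Y w = (\<Sum>k<n. \<xi> k w \<bullet> (w (\<tau> (Suc k)) - w (\<tau> k)))"
  then show thesis by (intro that[of \<tau> n \<xi>]) blast+
qed

context wiener_setup
begin

abbreviation "\<mu>T \<equiv> interval_measure_T T"

sublocale TM: pair_sigma_finite \<mu>T M
proof -
  interpret F: finite_measure \<mu>T by (rule finite_interval_measure_T)
  show "pair_sigma_finite \<mu>T M" ..
qed

lemma measurable_TM: "measurable (lborel \<Otimes>\<^sub>M M) N = measurable (\<mu>T \<Otimes>\<^sub>M M) N"
  by (intro measurable_cong_sets sets_pair_measure_cong) auto

definition procdist :: "(real \<Rightarrow> (real \<Rightarrow> real ^ 'd) \<Rightarrow> real ^ 'd) \<Rightarrow> (real \<Rightarrow> (real \<Rightarrow> real ^ 'd) \<Rightarrow> real ^ 'd) \<Rightarrow> ennreal" where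
  "procdist H K = (\<integral>\<^sup>+ w. (\<integral>\<^sup>+ s\<in>{0..T}. ennreal ((norm (H s w - K s w))\<^sup>2) \<partial>lborel) \<partial>M)"

definition jm :: "(real \<Rightarrow> (real \<Rightarrow> real ^ 'd) \<Rightarrow> real ^ 'd) \<Rightarrow> bool" where
  "jm H \<longleftrightarrow> (\<lambda>(s, w). H s w) \<in> borel_measurable (lborel \<Otimes>\<^sub>M M)"

lemma jm_TM: "jm H \<longleftrightarrow> (\<lambda>(s, w). H s w) \<in> borel_measurable (\<mu>T \<Otimes>\<^sub>M M)"
  unfolding jm_def measurable_TM ..

lemma procdist_eq:
  assumes "jm H" "jm K"
  shows "procdist H K = L2dist (\<mu>T \<Otimes>\<^sub>M M) (\<lambda>(s, w). H s w) (\<lambda>(s, w). K s w)"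
proof -
  have m: "(\<lambda>(s, w). ennreal ((norm (H s w - K s w))\<^sup>2)) \<in> borel_measurable (\<mu>T \<Otimes>\<^sub>M M)"
    using assms unfolding jm_TM by (simp add: case_prod_beta')
  have "L2dist (\<mu>T \<Otimes>\<^sub>M M) (\<lambda>(s, w). H s w) (\<lambda>(s, w). K s w) = (\<integral>\<^sup>+p. (\<lambda>(s, w). ennreal ((norm (H s w - K s w))\<^sup>2)) p \<partial>(\<mu>T \<Otimes>\<^sub>M M))"
    unfolding L2dist_def by (simp add: case_prod_beta')
  also have "\<dots> = (\<integral>\<^sup>+w. (\<integral>\<^sup>+s. ennreal ((norm (H s w - K s w))\<^sup>2) \<partial>\<mu>T) \<partial>M)"
    using TM.nn_integral_snd[OF m] by simp
  also have "\<dots> = procdist H K"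
    unfolding procdist_def
  proof (intro nn_integral_cong nn_integral_interval_measure_T)
    fix w assume "w \<in> space M"
    from measurable_Pair1[OF m this] show "(\<lambda>s. ennreal ((norm (H s w - K s w))\<^sup>2)) \<in> borel_measurable borel"
      by (simp only: prod.case measurable_cong_sets[OF sets_interval_measure_T refl])
  qed
  finally show ?thesis by simp
qed

lemma procdist_commute: "procdist H K = procdist K H"
  by (simp add: procdist_def norm_minus_commute)

lemma procdist_triangle:
  assumes "jm H" "jm K" "jm L"
  shows "procdist H L \<le> 2 * procdist H K + 2 * procdist K L"
  using assms by (simp add: procdist_eq) (auto simp: jm_TM intro: L2dist_triangle)

lemma procdist_triangle3:
  assumes "jm H" "jm K" "jm L" "jm J"
  shows "procdist H J \<le> 3 * procdist H K + 3 * procdist K L + 3 * procdist L J"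
  using assms by (simp add: procdist_eq) (auto simp: jm_TM intro: L2dist_triangle3)

lemma jm_sum:
  assumes "\<And>k. k < n \<Longrightarrow> \<xi> k \<in> borel_measurable M"
  shows "jm (\<lambda>s w. \<Sum>k<n. indicator {\<tau> k<..\<tau> (Suc k)} s *\<^sub>R \<xi> k w)"
  unfolding jm_def case_prod_beta'
proof (intro borel_measurable_sum borel_measurable_scaleR)
  fix k assume "k \<in> {..<n}"
  then show "(\<lambda>x. \<xi> k (snd x)) \<in> borel_measurable (lborel \<Otimes>\<^sub>M M)"
    using assms by (intro measurable_compose[OF measurable_snd]) auto
qed simp

lemma has_simple_itoD:
  assumes "has_simple_ito T H Y"
  shows "jm H" "Y \<in> borel_measurable M"
proof -
  obtain n and \<tau> :: "nat \<Rightarrow> real" and \<xi> where s: "0 \<le> \<tau> 0" "\<forall>k<n. \<tau> k \<le> \<tau> (Suc k) \<and> \<tau> (Suc k) \<le> T"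
    "\<And>k. k < n \<Longrightarrow> \<xi> k \<in> borel_measurable (Filt T (\<tau> k)) \<and> bounded (\<xi> k ` Wsp T)"
    and H: "\<And>s w. H s w = (\<Sum>k<n. indicator {\<tau> k<..\<tau> (Suc k)} s *\<^sub>R \<xi> k w)"
    and Y: "\<And>w. Y w = (\<Sum>k<n. \<xi> k w \<bullet> (w (\<tau> (Suc k)) - w (\<tau> k)))"
    by (rule has_simple_itoE[OF assms]) (rule that)
  have m: "k < n \<Longrightarrow> \<xi> k \<in> borel_measurable M" for k using s(3)[of k] by (auto intro: measurable_Filt)
  have "H = (\<lambda>s w. \<Sum>k<n. indicator {\<tau> k<..\<tau> (Suc k)} s *\<^sub>R \<xi> k w)" using H by auto
  then show "jm H" using jm_sum[OF m] by simp
  have "Y = (\<lambda>w. \<Sum>k<n. \<xi> k w \<bullet> (w (\<tau> (Suc k)) - w (\<tau> k)))" using Y by auto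
  then show "Y \<in> borel_measurable M" using m by (auto intro!: borel_measurable_sum borel_measurable_inner borel_measurable_diff)
qed

lemma partition_nonneg:
  assumes "0 \<le> \<tau> (0::nat)" "\<forall>k<n. \<tau> k \<le> \<tau> (Suc k) \<and> \<tau> (Suc k) \<le> (T::real)" "k \<le> n"
  shows "0 \<le> \<tau> k"
  using assms(3)
proof (induction k)
  case (Suc k) then show ?case using assms(2)[rule_format, of k] by auto
qed (use assms in auto)

text \<open>The difference of the two integrands is a single sum over the disjoint union of the two
  index sets, with the coefficients of the second negated.\<close>

lemma simple_isometry:
  assumes "has_simple_ito T H Y" "has_simple_ito T H' Y'"
  shows "L2dist M Y Y' = procdist H H'"
proof -
  obtain n and \<tau> :: "nat \<Rightarrow> real" and \<xi> where s: "0 \<le> \<tau> 0" "\<forall>k<n. \<tau> k \<le> \<tau> (Suc k) \<and> \<tau> (Suc k) \<le> T"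
    "\<And>k. k < n \<Longrightarrow> \<xi> k \<in> borel_measurable (Filt T (\<tau> k)) \<and> bounded (\<xi> k ` Wsp T)"
    and H: "\<And>s w. H s w = (\<Sum>k<n. indicator {\<tau> k<..\<tau> (Suc k)} s *\<^sub>R \<xi> k w)"
    and Y: "\<And>w. Y w = (\<Sum>k<n. \<xi> k w \<bullet> (w (\<tau> (Suc k)) - w (\<tau> k)))"
    by (rule has_simple_itoE[OF assms(1)]) (rule that)
  obtain n' and \<tau>' :: "nat \<Rightarrow> real" and \<xi>' where s': "0 \<le> \<tau>' 0" "\<forall>k<n'. \<tau>' k \<le> \<tau>' (Suc k) \<and> \<tau>' (Suc k) \<le> T"
    "\<And>k. k < n' \<Longrightarrow> \<xi>' k \<in> borel_measurable (Filt T (\<tau>' k)) \<and> bounded (\<xi>' k ` Wsp T)"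
    and H': "\<And>s w. H' s w = (\<Sum>k<n'. indicator {\<tau>' k<..\<tau>' (Suc k)} s *\<^sub>R \<xi>' k w)"
    and Y': "\<And>w. Y' w = (\<Sum>k<n'. \<xi>' k w \<bullet> (w (\<tau>' (Suc k)) - w (\<tau>' k)))"
    by (rule has_simple_itoE[OF assms(2)]) (rule that)
  define I where "I = {..<n} <+> {..<n'}"
  define a where "a = case_sum \<tau> \<tau>'"
  define b where "b = case_sum (\<lambda>k. \<tau> (Suc k)) (\<lambda>k. \<tau>' (Suc k))"
  define \<zeta> where "\<zeta> = case_sum \<xi> (\<lambda>k w. - \<xi>' k w)"
  have "(\<integral>\<^sup>+w. ennreal ((\<Sum>k\<in>I. \<zeta> k w \<bullet> (w (b k) - w (a k)))\<^sup>2) \<partial>M)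
    = (\<integral>\<^sup>+w. (\<integral>\<^sup>+s\<in>{0..T}. ennreal ((norm (\<Sum>k\<in>I. indicator {a k<..b k} s *\<^sub>R \<zeta> k w))\<^sup>2) \<partial>lborel) \<partial>M)"
  proof (rule ito_isometry_sum)
    show "finite I" by (simp add: I_def)
    fix k assume k: "k \<in> I"
    show "0 \<le> a k \<and> a k \<le> b k \<and> b k \<le> T"
      using k s(2) s'(2) partition_nonneg[OF s(1,2)] partition_nonneg[OF s'(1,2)]
      by (auto simp: I_def a_def b_def)
    show "adapted_bounded (a k) (\<zeta> k)"
    proof -
      consider i where "k = Inl i" "i < n" | i where "k = Inr i" "i < n'" using k by (auto simp: I_def)
      then show ?thesis
      proof cases
        case 1
        then show ?thesis using s(3)[of i] by (simp add: a_def \<zeta>_def adapted_bounded_def)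
      next
        case 2
        then show ?thesis using s'(3)[of i] by (simp add: a_def \<zeta>_def adapted_bounded_def bounded_iff)
      qed
    qed
  qed
  moreover have "(\<Sum>k\<in>I. \<zeta> k w \<bullet> (w (b k) - w (a k))) = Y w - Y' w" for w
    unfolding I_def Y Y' by (subst sum.Plus) (auto simp: a_def b_def \<zeta>_def sum_negf)
  moreover have "(\<Sum>k\<in>I. indicator {a k<..b k} s *\<^sub>R \<zeta> k w) = H s w - H' s w" for s w
    unfolding I_def H H' by (subst sum.Plus) (auto simp: a_def b_def \<zeta>_def sum_negf)
  ultimately show ?thesis unfolding L2dist_def procdist_def by simp
qed

lemma has_ito_iff:
  "has_ito_integral T H Y \<longleftrightarrow> jm H \<and> Y \<in> borel_measurable M \<and>
    (\<exists>Hn Yn. (\<forall>m::nat. has_simple_ito T (Hn m) (Yn m)) \<and> (\<lambda>m. procdist (Hn m) H) \<longlonglongrightarrow> 0 \<and> (\<lambda>m. L2dist M (Yn m) Y) \<longlonglongrightarrow> 0)"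
  unfolding has_ito_integral_def jm_def procdist_def L2dist_def M_wiener[symmetric] by simp

text \<open>The isometry passed to the limit. The three-term triangle inequality is applied once to
  the integrals and once to the integrands, hence the factor 3 * 3 = 9. With \<open>H = H'\<close>
  it also says that the integral is unique up to null sets, which makes the choices in
  \<open>qfun\<close> and \<open>Gfun\<close> harmless.\<close>

lemma ito_ineq:
  assumes "has_ito_integral T H Y" "has_ito_integral T H' Y'"
  shows "L2dist M Y Y' \<le> 9 * procdist H H'"
proof -
  obtain Hn Yn where n: "jm H" "Y \<in> borel_measurable M" "\<And>m::nat. has_simple_ito T (Hn m) (Yn m)"
    "(\<lambda>m. procdist (Hn m) H) \<longlonglongrightarrow> 0" "(\<lambda>m. L2dist M (Yn m) Y) \<longlonglongrightarrow> 0"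
    using assms(1) unfolding has_ito_iff by blast
  obtain Hn' Yn' where n': "jm H'" "Y' \<in> borel_measurable M" "\<And>m::nat. has_simple_ito T (Hn' m) (Yn' m)"
    "(\<lambda>m. procdist (Hn' m) H') \<longlonglongrightarrow> 0" "(\<lambda>m. L2dist M (Yn' m) Y') \<longlonglongrightarrow> 0"
    using assms(2) unfolding has_ito_iff by blast
  define u where "u m = 3 * L2dist M (Yn m) Y + 3 * (3 * procdist (Hn m) H + 3 * procdist H H' + 3 * procdist (Hn' m) H') + 3 * L2dist M (Yn' m) Y'" for m
  have le: "L2dist M Y Y' \<le> u m" for m
  proof -
    have "L2dist M Y Y' \<le> 3 * L2dist M Y (Yn m) + 3 * L2dist M (Yn m) (Yn' m) + 3 * L2dist M (Yn' m) Y'"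
      using n(2) n'(2) has_simple_itoD[OF n(3)] has_simple_itoD[OF n'(3)] by (intro L2dist_triangle3) auto
    also have "L2dist M (Yn m) (Yn' m) = procdist (Hn m) (Hn' m)" by (rule simple_isometry[OF n(3) n'(3)])
    also have "procdist (Hn m) (Hn' m) \<le> 3 * procdist (Hn m) H + 3 * procdist H H' + 3 * procdist H' (Hn' m)"
      using n(1) n'(1) has_simple_itoD[OF n(3)] has_simple_itoD[OF n'(3)] by (intro procdist_triangle3) auto
    finally show ?thesis
      unfolding u_def by (simp add: L2dist_commute[of M Y] procdist_commute[of H'] add_mono mult_left_mono)
  qed
  have "u \<longlonglongrightarrow> 3 * 0 + 3 * (3 * 0 + 3 * procdist H H' + 3 * 0) + 3 * 0"
    unfolding u_def by (intro tendsto_add ennreal_tendsto_cmult tendsto_const n n') auto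
  also have "3 * 0 + 3 * (3 * 0 + 3 * procdist H H' + 3 * 0) + 3 * 0 = 9 * procdist H H'"
    by (simp add: mult.assoc[symmetric])
  finally show ?thesis using le by (intro LIMSEQ_le_const) auto
qed

text \<open>A diagonal choice: for each \<open>n\<close> take a simple pair within
  \<open>1 / Suc n\<close> of the \<open>n\<close>-th integrand and its integral at once.\<close>

lemma ito_closed:
  assumes h: "\<And>n::nat. has_ito_integral T (Hn n) (Yn n)" and H: "jm H" and Y: "Y \<in> borel_measurable M"
    and lim: "(\<lambda>n. procdist (Hn n) H) \<longlonglongrightarrow> 0" "(\<lambda>n. L2dist M (Yn n) Y) \<longlonglongrightarrow> 0"
  shows "has_ito_integral T H Y"
proof -
  have "\<exists>K Z. has_simple_ito T K Z \<and> procdist K (Hn n) < ennreal (1 / Suc n) \<and> L2dist M Z (Yn n) < ennreal (1 / Suc n)" for n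
  proof -
    obtain K Z where k: "\<And>m::nat. has_simple_ito T (K m) (Z m)"
      "(\<lambda>m. procdist (K m) (Hn n)) \<longlonglongrightarrow> 0" "(\<lambda>m. L2dist M (Z m) (Yn n)) \<longlonglongrightarrow> 0"
      using h[of n] unfolding has_ito_iff by blast
    have e: "0 < ennreal (1 / Suc n)" by (simp add: ennreal_zero_less_divide)
    have "\<forall>\<^sub>F m in sequentially. procdist (K m) (Hn n) < ennreal (1 / Suc n) \<and> L2dist M (Z m) (Yn n) < ennreal (1 / Suc n)"
      using order_tendstoD(2)[OF k(2) e] order_tendstoD(2)[OF k(3) e] by eventually_elim auto
    then obtain m where "procdist (K m) (Hn n) < ennreal (1 / Suc n) \<and> L2dist M (Z m) (Yn n) < ennreal (1 / Suc n)"
      by (auto simp: eventually_sequentially)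
    then show ?thesis using k(1) by blast
  qed
  then obtain K Z where k: "\<And>n. has_simple_ito T (K n) (Z n)" "\<And>n. procdist (K n) (Hn n) < ennreal (1 / Suc n)" "\<And>n. L2dist M (Z n) (Yn n) < ennreal (1 / Suc n)"
    by metis
  have z: "(\<lambda>n. ennreal (1 / Suc n)) \<longlonglongrightarrow> 0"
    using tendsto_ennrealI[OF LIMSEQ_inverse_real_of_nat] by (simp add: inverse_eq_divide)
  have jmn: "jm (Hn n)" "Yn n \<in> borel_measurable M" for n using h[of n] unfolding has_ito_iff by auto
  have "(\<lambda>n. procdist (K n) H) \<longlonglongrightarrow> 0"
  proof (rule tendsto_0_le_ennreal)
    show "procdist (K n) H \<le> 2 * ennreal (1 / Suc n) + 2 * procdist (Hn n) H" for n
      using procdist_triangle[OF has_simple_itoD(1)[OF k(1)] jmn(1) H, of n n] k(2)[of n]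
      by (meson add_right_mono mult_left_mono order_trans less_imp_le zero_le)
    have "(\<lambda>n. 2 * ennreal (1 / Suc n) + 2 * procdist (Hn n) H) \<longlonglongrightarrow> 2 * 0 + 2 * 0"
      by (intro tendsto_add ennreal_tendsto_cmult z lim) auto
    then show "(\<lambda>n. 2 * ennreal (1 / Suc n) + 2 * procdist (Hn n) H) \<longlonglongrightarrow> 0" by simp
  qed
  moreover have "(\<lambda>n. L2dist M (Z n) Y) \<longlonglongrightarrow> 0"
  proof (rule tendsto_0_le_ennreal)
    show "L2dist M (Z n) Y \<le> 2 * ennreal (1 / Suc n) + 2 * L2dist M (Yn n) Y" for n
      using L2dist_triangle[OF has_simple_itoD(2)[OF k(1)] jmn(2) Y, of n n] k(3)[of n]
      by (meson add_right_mono mult_left_mono order_trans less_imp_le zero_le)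
    have "(\<lambda>n. 2 * ennreal (1 / Suc n) + 2 * L2dist M (Yn n) Y) \<longlonglongrightarrow> 2 * 0 + 2 * 0"
      by (intro tendsto_add ennreal_tendsto_cmult z lim) auto
    then show "(\<lambda>n. 2 * ennreal (1 / Suc n) + 2 * L2dist M (Yn n) Y) \<longlonglongrightarrow> 0" by simp
  qed
  ultimately show ?thesis unfolding has_ito_iff using H Y k(1) by blast
qed

text \<open>\<open>has_simple_ito\<close> allows bounded coefficients only, whereas the drifts that
  occur are linear in the increments. Truncation at norm \<open>m\<close> gives simple integrands;
  they converge by domination, since the coefficients are square integrable.\<close>

lemma step_process_ito:
  fixes \<tau> :: "nat \<Rightarrow> real" and \<xi> :: "nat \<Rightarrow> _ \<Rightarrow> real ^ 'd"
  assumes \<tau>: "0 \<le> \<tau> 0" "\<forall>k<n. \<tau> k \<le> \<tau> (Suc k) \<and> \<tau> (Suc k) \<le> T"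
    and \<xi>: "\<And>k. k < n \<Longrightarrow> \<xi> k \<in> borel_measurable (Filt T (\<tau> k))"
    and sq: "\<And>k. k < n \<Longrightarrow> (\<integral>\<^sup>+w. ennreal ((norm (\<xi> k w))\<^sup>2) \<partial>M) < \<infinity>"
  shows "has_ito_integral T (\<lambda>s w. \<Sum>k<n. indicator {\<tau> k<..\<tau> (Suc k)} s *\<^sub>R \<xi> k w) (\<lambda>w. \<Sum>k<n. \<xi> k w \<bullet> (w (\<tau> (Suc k)) - w (\<tau> k)))"
proof -
  define \<zeta> where "\<zeta> m k w = (if norm (\<xi> k w) \<le> real m then \<xi> k w else 0)" for m k w
  define H where "H s w = (\<Sum>k<n. indicator {\<tau> k<..\<tau> (Suc k)} s *\<^sub>R \<xi> k w)" for s w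
  define Y where "Y w = (\<Sum>k<n. \<xi> k w \<bullet> (w (\<tau> (Suc k)) - w (\<tau> k)))" for w
  define Hn where "Hn m s w = (\<Sum>k<n. indicator {\<tau> k<..\<tau> (Suc k)} s *\<^sub>R \<zeta> m k w)" for m s w
  define Yn where "Yn m w = (\<Sum>k<n. \<zeta> m k w \<bullet> (w (\<tau> (Suc k)) - w (\<tau> k)))" for m w
  have \<xi>M: "k < n \<Longrightarrow> \<xi> k \<in> borel_measurable M" for k using \<xi> by (auto intro: measurable_Filt)
  have \<zeta>m: "\<zeta> m k \<in> borel_measurable (Filt T (\<tau> k))" if "k < n" for m k
    unfolding \<zeta>_def using \<xi>[OF that] by measurable
  have simple: "has_simple_ito T (Hn m) (Yn m)" for m
    unfolding has_simple_ito_def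
  proof (intro exI[of _ n] exI[of _ \<tau>] exI[of _ "\<zeta> m"] conjI allI impI \<tau>(1))
    fix k assume k: "k < n"
    then show "\<zeta> m k \<in> borel_measurable (Filt T (\<tau> k))" using \<zeta>m by simp
    show "\<tau> k \<le> \<tau> (Suc k)" "\<tau> (Suc k) \<le> T" using \<tau>(2) k by auto
    show "bounded (\<zeta> m k ` Wsp T)" unfolding bounded_iff by (intro exI[of _ "real m"]) (auto simp: \<zeta>_def)
  qed (simp_all add: Hn_def Yn_def)
  have jmH: "jm H" unfolding H_def using \<xi>M by (rule jm_sum)
  have Ym: "Y \<in> borel_measurable M" unfolding Y_def using \<xi>M by (auto intro!: borel_measurable_sum borel_measurable_inner borel_measurable_diff)
  define G where "G w = ennreal (real n * (\<Sum>k<n. (norm (\<xi> k w))\<^sup>2))" for w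
  have Gm: "G \<in> borel_measurable M" unfolding G_def using \<xi>M by measurable
  have Gi: "(\<integral>\<^sup>+w. G w \<partial>M) < \<infinity>"
  proof -
    have "(\<integral>\<^sup>+w. G w \<partial>M) = (\<integral>\<^sup>+w. ennreal (real n) * (\<Sum>k<n. ennreal ((norm (\<xi> k w))\<^sup>2)) \<partial>M)"
      unfolding G_def by (intro nn_integral_cong) (simp add: ennreal_mult sum_nonneg)
    also have "\<dots> = ennreal (real n) * (\<Sum>k<n. \<integral>\<^sup>+w. ennreal ((norm (\<xi> k w))\<^sup>2) \<partial>M)"
    proof -
      have m: "(\<lambda>w. ennreal ((norm (\<xi> k w))\<^sup>2)) \<in> borel_measurable M" if "k \<in> {..<n}" for k using \<xi>M[of k] that by simp
      have "(\<integral>\<^sup>+w. ennreal (real n) * (\<Sum>k<n. ennreal ((norm (\<xi> k w))\<^sup>2)) \<partial>M) = ennreal (real n) * (\<integral>\<^sup>+w. (\<Sum>k<n. ennreal ((norm (\<xi> k w))\<^sup>2)) \<partial>M)"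
        by (rule nn_integral_cmult) (rule borel_measurable_sum[OF m])
      also have "(\<integral>\<^sup>+w. (\<Sum>k<n. ennreal ((norm (\<xi> k w))\<^sup>2)) \<partial>M) = (\<Sum>k<n. \<integral>\<^sup>+w. ennreal ((norm (\<xi> k w))\<^sup>2) \<partial>M)"
        by (rule nn_integral_sum[OF m])
      finally show ?thesis .
    qed
    also have "\<dots> < \<infinity>" using sq by (auto simp: ennreal_mult_less_top)
    finally show ?thesis .
  qed
  have G2: "(\<integral>\<^sup>+p. G (snd p) \<partial>(\<mu>T \<Otimes>\<^sub>M M)) < \<infinity>"
  proof -
    interpret F: finite_measure \<mu>T by (rule finite_interval_measure_T)
    have "(\<integral>\<^sup>+p. G (snd p) \<partial>(\<mu>T \<Otimes>\<^sub>M M)) = (\<integral>\<^sup>+w. (\<integral>\<^sup>+s. G w \<partial>\<mu>T) \<partial>M)"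
      using TM.nn_integral_snd[of "\<lambda>p. G (snd p)"] Gm by simp
    also have "\<dots> = (\<integral>\<^sup>+w. G w \<partial>M) * emeasure \<mu>T UNIV" using Gm by (simp add: nn_integral_multc)
    also have "\<dots> < \<infinity>"
    proof -
      have "emeasure \<mu>T UNIV < \<top>" using F.emeasure_finite[of UNIV] unfolding infinity_ennreal_def less_top .
      then show ?thesis using Gi by (simp add: ennreal_mult_less_top)
    qed
    finally show ?thesis .
  qed
  have procH: "(\<lambda>m. procdist (Hn m) H) \<longlonglongrightarrow> 0"
  proof -
    have jmn: "jm (Hn m)" for m by (rule has_simple_itoD[OF simple])
    have "(\<lambda>m. \<integral>\<^sup>+p. ennreal ((norm ((\<lambda>(s, w). Hn m s w) p - (\<lambda>(s, w). H s w) p))\<^sup>2) \<partial>(\<mu>T \<Otimes>\<^sub>M M)) \<longlonglongrightarrow> (\<integral>\<^sup>+p. 0 \<partial>(\<mu>T \<Otimes>\<^sub>M M))"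
    proof (rule nn_integral_dominated_convergence[where w="\<lambda>p. G (snd p)"])
      fix m
      show "(\<lambda>p. ennreal ((norm ((\<lambda>(s, w). Hn m s w) p - (\<lambda>(s, w). H s w) p))\<^sup>2)) \<in> borel_measurable (\<mu>T \<Otimes>\<^sub>M M)"
        using jmn[of m] jmH unfolding jm_TM by measurable
      show "AE p in \<mu>T \<Otimes>\<^sub>M M. ennreal ((norm ((\<lambda>(s, w). Hn m s w) p - (\<lambda>(s, w). H s w) p))\<^sup>2) \<le> G (snd p)"
      proof (rule AE_I2, clarsimp)
        fix s w
        have "(norm (Hn m s w - H s w))\<^sup>2 = (norm (\<Sum>k<n. indicator {\<tau> k<..\<tau> (Suc k)} s *\<^sub>R (\<zeta> m k w - \<xi> k w)))\<^sup>2"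
          unfolding Hn_def H_def by (simp add: sum_subtractf scaleR_diff_right)
        also have "\<dots> \<le> real n * (\<Sum>k<n. (norm (indicator {\<tau> k<..\<tau> (Suc k)} s *\<^sub>R (\<zeta> m k w - \<xi> k w)))\<^sup>2)"
          by (rule norm_sum_sq_le)
        also have "\<dots> \<le> real n * (\<Sum>k<n. (norm (\<xi> k w))\<^sup>2)"
          by (intro mult_left_mono sum_mono power_mono) (auto simp: \<zeta>_def indicator_def)
        finally show "ennreal ((norm (Hn m s w - H s w))\<^sup>2) \<le> G w" unfolding G_def by (rule ennreal_leI)
      qed
    next
      show "(\<lambda>p. G (snd p)) \<in> borel_measurable (\<mu>T \<Otimes>\<^sub>M M)" using Gm by measurable
      show "AE p in \<mu>T \<Otimes>\<^sub>M M. (\<lambda>m. ennreal ((norm ((\<lambda>(s, w). Hn m s w) p - (\<lambda>(s, w). H s w) p))\<^sup>2)) \<longlonglongrightarrow> 0"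
      proof (rule AE_I2, clarsimp)
        fix s w
        obtain m0 where m0: "\<And>k. k < n \<Longrightarrow> norm (\<xi> k w) \<le> real m0"
        proof -
          obtain m0 where "(\<Sum>k<n. norm (\<xi> k w)) \<le> real m0" using real_arch_simple by blast
          then have "norm (\<xi> k w) \<le> real m0" if "k < n" for k
            using member_le_sum[of k "{..<n}" "\<lambda>k. norm (\<xi> k w)"] that by force
          then show thesis using that by blast
        qed
        have "Hn m s w = H s w" if "m \<ge> m0" for m
          unfolding Hn_def H_def using m0 that by (intro sum.cong refl) (force simp: \<zeta>_def)
        then show "(\<lambda>m. ennreal ((norm (Hn m s w - H s w))\<^sup>2)) \<longlonglongrightarrow> 0"
          by (intro tendsto_eventually) (auto simp: eventually_sequentially)
      qed
    qed (use G2 in auto)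
    then show ?thesis using jmn jmH by (simp add: procdist_eq L2dist_def)
  qed
  \<comment> \<open>On a fixed path the truncated sums are eventually equal to \<open>Y\<close>, so
    Fatou's lemma in \<open>p\<close> bounds the distance to \<open>Y\<close> by distances between
    simple integrals, which the isometry controls.\<close>
  have LY: "L2dist M (Yn m) Y \<le> 2 * procdist (Hn m) H" for m
  proof -
    have Ynm: "Yn p \<in> borel_measurable M" for p by (rule has_simple_itoD[OF simple])
    have "L2dist M (Yn m) Y = (\<integral>\<^sup>+w. liminf (\<lambda>p. ennreal ((norm (Yn m w - Yn p w))\<^sup>2)) \<partial>M)"
      unfolding L2dist_def
    proof (intro nn_integral_cong)
      fix w
      obtain m0 where m0: "\<And>k. k < n \<Longrightarrow> norm (\<xi> k w) \<le> real m0"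
      proof -
        obtain m0 where "(\<Sum>k<n. norm (\<xi> k w)) \<le> real m0" using real_arch_simple by blast
        then have "norm (\<xi> k w) \<le> real m0" if "k < n" for k
          using member_le_sum[of k "{..<n}" "\<lambda>k. norm (\<xi> k w)"] that by force
        then show thesis using that by blast
      qed
      have "Yn p w = Y w" if "p \<ge> m0" for p
        unfolding Yn_def Y_def using m0 that by (intro sum.cong refl) (force simp: \<zeta>_def)
      then have "(\<lambda>p. ennreal ((norm (Yn m w - Yn p w))\<^sup>2)) \<longlonglongrightarrow> ennreal ((norm (Yn m w - Y w))\<^sup>2)"
        by (intro tendsto_eventually) (auto simp: eventually_sequentially intro!: exI[of _ m0])
      then show "ennreal ((norm (Yn m w - Y w))\<^sup>2) = liminf (\<lambda>p. ennreal ((norm (Yn m w - Yn p w))\<^sup>2))"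
        by (rule lim_imp_Liminf[OF trivial_limit_sequentially, symmetric])
    qed
    also have "\<dots> \<le> liminf (\<lambda>p. L2dist M (Yn m) (Yn p))"
      unfolding L2dist_def using Ynm by (intro nn_integral_liminf) auto
    also have "\<dots> \<le> liminf (\<lambda>p. 2 * procdist (Hn m) H + 2 * procdist (Hn p) H)"
    proof (rule Liminf_mono, rule always_eventually, rule allI)
      fix p
      show "L2dist M (Yn m) (Yn p) \<le> 2 * procdist (Hn m) H + 2 * procdist (Hn p) H"
        unfolding simple_isometry[OF simple simple]
        using procdist_triangle[OF has_simple_itoD(1)[OF simple] jmH has_simple_itoD(1)[OF simple], of m p]
        by (simp add: procdist_commute[of H])
    qed
    also have "\<dots> = 2 * procdist (Hn m) H + 2 * 0"
      by (intro lim_imp_Liminf tendsto_add ennreal_tendsto_cmult procH tendsto_const) auto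
    finally show ?thesis by simp
  qed
  have "(\<lambda>m. 2 * procdist (Hn m) H) \<longlonglongrightarrow> 2 * 0" by (intro ennreal_tendsto_cmult procH) auto
  then have "(\<lambda>m. L2dist M (Yn m) Y) \<longlonglongrightarrow> 0" using LY by (intro tendsto_0_le_ennreal[OF LY]) simp
  then have "has_ito_integral T H Y" unfolding has_ito_iff using jmH Ym simple procH by blast
  then show ?thesis unfolding H_def Y_def .
qed

end

section \<open>Step kernels\<close>

text \<open>Open on the left and closed on the right, as in the simple integrands. Time 0 lies in no
  cell, so the cells partition \<open>{0<..T}\<close>.\<close>

definition grid_cell :: "real \<Rightarrow> nat \<Rightarrow> nat \<Rightarrow> real set" where
  "grid_cell T N k = {T * real k / real N <.. T * real (Suc k) / real N}"

text \<open>The sum runs over \<open>k < j\<close>: diagonal cells are left out, so the row of a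
  time in cell \<open>j\<close> involves earlier increments only. This makes the drift adapted and
  the shear strictly triangular.\<close>

definition step_kernel :: "real \<Rightarrow> nat \<Rightarrow> (nat \<Rightarrow> nat \<Rightarrow> 'b) \<Rightarrow> real \<Rightarrow> real \<Rightarrow> 'b::real_vector" where
  "step_kernel T N A t s = (\<Sum>j<N. \<Sum>k<j. (indicator (grid_cell T N j) t * indicator (grid_cell T N k) s) *\<^sub>R A j k)"

definition square_measure :: "real \<Rightarrow> (real \<times> real) measure" where
  "square_measure T = density lborel (indicator ({0..T} \<times> {0..T}))"

lemma grid_cell_unique:
  assumes T: "T > 0" "N > 0" and t: "t \<in> grid_cell T N j" "t \<in> grid_cell T N j'"
  shows "j = j'"
proof -
  have "j \<le> j'" if "t \<in> grid_cell T N j" "t \<in> grid_cell T N j'" for j j'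
  proof -
    have "T * real j / real N < T * real (Suc j') / real N" using that unfolding grid_cell_def by auto
    then have "real j < real (Suc j')" using T by (simp add: divide_less_cancel)
    then show ?thesis by linarith
  qed
  then show ?thesis using t by (meson order_antisym)
qed

lemma grid_cell_exists:
  assumes T: "T > 0" "N > 0" and t: "t \<in> {0<..T}"
  obtains j where "j < N" "t \<in> grid_cell T N j"
proof -
  \<comment> \<open>Cells are closed on the right, so the index is the ceiling minus one rather than
    the floor.\<close>
  define c where "c = \<lceil>t * real N / T\<rceil>"
  have p: "0 < t * real N / T" "t * real N / T \<le> real N" using T t by (auto simp: field_simps)
  have c: "0 < c" "c \<le> int N" using p unfolding c_def by (simp, linarith)
  have "t * real N / T \<le> of_int c" "of_int c - 1 < t * real N / T" unfolding c_def by linarith+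
  moreover define j where "j = nat (c - 1)"
  moreover have "real j = of_int c - 1" "j < N" using c unfolding j_def by auto
  ultimately have "t * real N / T \<le> real (Suc j)" "real j < t * real N / T" by auto
  then have "t \<in> grid_cell T N j" using T unfolding grid_cell_def by (auto simp: field_simps)
  then show thesis using that \<open>j < N\<close> by blast
qed

lemma grid_cell_subset: "T > 0 \<Longrightarrow> k < N \<Longrightarrow> grid_cell T N k \<subseteq> {0<..T}"
proof
  fix x assume T: "T > 0" "k < N" and x: "x \<in> grid_cell T N k"
  have "0 \<le> T * real k / real N" using T by simp
  moreover have "T * real (Suc k) / real N \<le> T * real N / real N"
    using T by (intro divide_right_mono mult_left_mono) auto
  moreover have "T * real N / real N = T" using T by simp
  moreover have "T * real k / real N < x" "x \<le> T * real (Suc k) / real N" using x unfolding grid_cell_def by auto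
  ultimately show "x \<in> {0<..T}" unfolding greaterThanAtMost_iff by linarith
qed

lemma step_kernel_row:
  assumes T: "T > 0" "N > 0" and t: "t \<in> grid_cell T N j" and j: "j < N"
  shows "step_kernel T N A t s = (\<Sum>k<j. indicator (grid_cell T N k) s *\<^sub>R A j k)"
proof -
  have "step_kernel T N A t s = (\<Sum>i<N. if i = j then \<Sum>k<j. indicator (grid_cell T N k) s *\<^sub>R A j k else 0)"
    unfolding step_kernel_def
  proof (intro sum.cong refl)
    fix i assume "i \<in> {..<N}"
    show "(\<Sum>k<i. (indicator (grid_cell T N i) t * indicator (grid_cell T N k) s) *\<^sub>R A i k) = (if i = j then \<Sum>k<j. indicator (grid_cell T N k) s *\<^sub>R A j k else 0)"
    proof (cases "i = j")
      case True then show ?thesis using t by simp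
    next
      case False
      then have "t \<notin> grid_cell T N i" using grid_cell_unique[OF T t] by auto
      then show ?thesis using False by simp
    qed
  qed
  then show ?thesis using j by simp
qed

lemma step_kernel_eval:
  assumes T: "T > 0" "N > 0" and t: "t \<in> grid_cell T N j" "j < N" and s: "s \<in> grid_cell T N k"
  shows "step_kernel T N A t s = (if k < j then A j k else 0)"
proof -
  have "step_kernel T N A t s = (\<Sum>i<j. if i = k then A j k else 0)"
    unfolding step_kernel_row[OF T t]
  proof (intro sum.cong refl)
    fix i
    show "indicator (grid_cell T N i) s *\<^sub>R A j i = (if i = k then A j k else 0)"
      using grid_cell_unique[OF T s, of i] s by (cases "i = k") (auto simp: indicator_def)
  qed
  then show ?thesis by simp
qed

lemma step_kernel_outside:
  assumes T: "T > 0" and "t \<notin> {0<..T} \<or> s \<notin> {0<..T}"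
  shows "step_kernel T N A t s = 0"
  unfolding step_kernel_def
proof (intro sum.neutral ballI)
  fix j k assume "j \<in> {..<N}" "k \<in> {..<j}"
  then have "t \<notin> grid_cell T N j \<or> s \<notin> grid_cell T N k"
    using assms grid_cell_subset[OF T, of j N] grid_cell_subset[OF T, of k N] by auto
  then show "(indicator (grid_cell T N j) t * indicator (grid_cell T N k) s) *\<^sub>R A j k = 0" by auto
qed

lemma grid_cell_refine:
  assumes T: "T > 0" "N > 0" "p > 0" and t: "t \<in> grid_cell T (N * p) j"
  shows "t \<in> grid_cell T N (j div p)"
proof -
  have "real (j div p) * real p \<le> real j" by (metis div_times_less_eq_dividend of_nat_le_iff of_nat_mult)
  then have "T * (real (j div p) * real p) / (real N * real p) \<le> T * real j / (real N * real p)"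
    using T by (intro divide_right_mono mult_left_mono) auto
  moreover have "T * (real (j div p) * real p) / (real N * real p) = T * real (j div p) / real N" using T by simp
  moreover have "Suc j \<le> Suc (j div p) * p" using dividend_less_div_times[of p j] T by simp
  then have "real (Suc j) \<le> real (Suc (j div p)) * real p" by (metis of_nat_le_iff of_nat_mult)
  then have "T * real (Suc j) / (real N * real p) \<le> T * (real (Suc (j div p)) * real p) / (real N * real p)"
    using T by (intro divide_right_mono mult_left_mono) auto
  moreover have "T * (real (Suc (j div p)) * real p) / (real N * real p) = T * real (Suc (j div p)) / real N" using T by simp
  ultimately show ?thesis using t unfolding grid_cell_def by auto
qed

text \<open>A fine cell inherits the entry of its coarse cell, and the condition compares coarse
  indices: fine cells below the diagonal but inside a coarse diagonal cell receive 0. The kernel is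
  literally unchanged, which serves to bring two kernels to a common grid and to refine a grid at
  will.\<close>

lemma step_kernel_refine:
  assumes T: "T > 0" "N > 0" "p > 0"
  shows "step_kernel T N A t s = step_kernel T (N * p) (\<lambda>j k. if k div p < j div p then A (j div p) (k div p) else 0) t s"
proof (cases "t \<in> {0<..T} \<and> s \<in> {0<..T}")
  case True
  have Np: "N * p > 0" using T by simp
  obtain j where j: "j < N * p" "t \<in> grid_cell T (N * p) j" using grid_cell_exists[OF T(1) Np] True by blast
  obtain k where k: "k < N * p" "s \<in> grid_cell T (N * p) k" using grid_cell_exists[OF T(1) Np] True by blast
  have "j div p < N" using j by (simp add: less_mult_imp_div_less)
  have kj: "k < j" if "k div p < j div p" using that div_le_mono[of j k p] by linarith
  show ?thesis
    unfolding step_kernel_eval[OF T(1) Np j(2,1) k(2)]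
      step_kernel_eval[OF T(1,2) grid_cell_refine[OF T j(2)] \<open>j div p < N\<close> grid_cell_refine[OF T k(2)]]
    using kj by auto
next
  case False
  then have "t \<notin> {0<..T} \<or> s \<notin> {0<..T}" by auto
  then show ?thesis unfolding step_kernel_outside[OF T(1) \<open>t \<notin> {0<..T} \<or> s \<notin> {0<..T}\<close>] by simp
qed

lemma step_kernel_add: "step_kernel T N A t s + step_kernel T N B t s = step_kernel T N (\<lambda>j k. A j k + B j k) t s"
  unfolding step_kernel_def by (simp add: sum.distrib scaleR_add_right)

lemma grid_cell_borel[measurable]: "grid_cell T N k \<in> sets borel"
  by (simp add: grid_cell_def)

lemma step_kernel_measurable[measurable]:
  fixes A :: "nat \<Rightarrow> nat \<Rightarrow> 'b::{banach, second_countable_topology}"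
  shows "(\<lambda>p. step_kernel T N A (fst p) (snd p)) \<in> borel_measurable borel"
proof -
  have "(\<lambda>p::real \<times> real. step_kernel T N A (fst p) (snd p)) \<in> borel_measurable (borel \<Otimes>\<^sub>M borel)"
    unfolding step_kernel_def by measurable
  then show ?thesis by (simp add: borel_prod)
qed

lemma sets_square_measure[simp, measurable_cong]: "sets (square_measure T) = sets borel"
  and space_square_measure[simp]: "space (square_measure T) = UNIV"
  by (auto simp: square_measure_def)

lemma square_borel[measurable]: "({0..T} \<times> {0..T} :: (real \<times> real) set) \<in> sets borel"
  by (intro borel_closed closed_Times) auto

lemma square_measure_eq: "square_measure T = interval_measure_T T \<Otimes>\<^sub>M interval_measure_T T"
proof -
  have "interval_measure_T T \<Otimes>\<^sub>M interval_measure_T T = density (lborel \<Otimes>\<^sub>M lborel) (\<lambda>(x, y). indicator {0..T} x * indicator {0..T} y)"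
    using finite_interval_measure_T[of T] unfolding interval_measure_T_def
    by (intro pair_measure_density) (auto intro: sigma_finite_lborel finite_measure.sigma_finite_measure)
  also have "\<dots> = square_measure T"
    unfolding square_measure_def lborel_prod by (intro arg_cong[of _ _ "density lborel"]) (auto simp: indicator_def fun_eq_iff)
  finally show ?thesis by simp
qed

lemma square_measure_le: "E \<in> sets borel \<Longrightarrow> emeasure (square_measure T) E \<le> emeasure lborel E"
proof -
  assume [measurable]: "E \<in> sets borel"
  have "emeasure (square_measure T) E = (\<integral>\<^sup>+p. indicator ({0..T} \<times> {0..T}) p * indicator E p \<partial>lborel)"
    unfolding square_measure_def by (subst emeasure_density) auto
  also have "\<dots> \<le> (\<integral>\<^sup>+p. indicator E p \<partial>lborel)" by (intro nn_integral_mono) (auto simp: indicator_def)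
  also have "\<dots> = emeasure lborel E" by simp
  finally show ?thesis .
qed

lemma finite_square_measure: "finite_measure (square_measure T)"
proof -
  interpret F: finite_measure "interval_measure_T T" by (rule finite_interval_measure_T)
  have "emeasure (interval_measure_T T \<Otimes>\<^sub>M interval_measure_T T) (UNIV \<times> UNIV) = emeasure (interval_measure_T T) UNIV * emeasure (interval_measure_T T) UNIV"
    by (rule F.emeasure_pair_measure_Times) auto
  also have "\<dots> \<noteq> \<infinity>" using F.emeasure_finite[of UNIV] by (simp add: ennreal_mult_eq_top_iff)
  finally show ?thesis by (intro finite_measureI) (simp add: square_measure_eq space_pair_measure)
qed

lemma AE_square: "AE p in square_measure T. fst p \<in> {0<..T} \<and> snd p \<in> {0<..T}"
proof -
  have nz: "AE p in (lborel :: (real \<times> real) measure). fst p \<noteq> 0" "AE p in (lborel :: (real \<times> real) measure). snd p \<noteq> 0"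
  proof -
    have l: "emeasure (lborel \<Otimes>\<^sub>M lborel) ({0} \<times> UNIV :: (real \<times> real) set) = 0"
      by (subst lborel.emeasure_pair_measure_Times) auto
    have r: "emeasure (lborel \<Otimes>\<^sub>M lborel) (UNIV \<times> {0} :: (real \<times> real) set) = 0"
      by (subst lborel.emeasure_pair_measure_Times) auto
    have n: "({0} \<times> UNIV :: (real \<times> real) set) \<in> null_sets lborel" "(UNIV \<times> {0} :: (real \<times> real) set) \<in> null_sets lborel"
      using l r by (auto simp: lborel_prod null_sets_def intro!: borel_closed closed_Times)
    show "AE p in (lborel :: (real \<times> real) measure). fst p \<noteq> 0" using AE_not_in[OF n(1)] by eventually_elim auto
    show "AE p in (lborel :: (real \<times> real) measure). snd p \<noteq> 0" using AE_not_in[OF n(2)] by eventually_elim auto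
  qed
  have "AE p in lborel. 0 < (indicator ({0..T} \<times> {0..T}) p :: ennreal) \<longrightarrow> fst p \<in> {0<..T} \<and> snd p \<in> {0<..T}"
    using nz by eventually_elim (auto simp: indicator_def split: if_splits)
  then show ?thesis unfolding square_measure_def by (subst AE_density) auto
qed

section \<open>Density of the step kernels among kernels on the lower triangle\<close>

definition step_approx :: "real \<Rightarrow> (real \<times> real \<Rightarrow> 'b::{banach, second_countable_topology}) \<Rightarrow> bool" where
  "step_approx T f \<longleftrightarrow> f \<in> borel_measurable borel \<and>
    (\<forall>e>0. \<exists>N>0. \<exists>A. L2dist (square_measure T) f (\<lambda>p. step_kernel T N A (fst p) (snd p)) < ennreal e)"

lemma L2dist_triangle_less:
  fixes f g h :: "'a \<Rightarrow> 'b::{second_countable_topology, real_normed_vector}"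
  assumes "f \<in> borel_measurable M" "g \<in> borel_measurable M" "h \<in> borel_measurable M"
    and "L2dist M f g < ennreal (e / 4)" "L2dist M g h < ennreal (e / 4)" "e > 0"
  shows "L2dist M f h < ennreal e"
proof -
  have "L2dist M f h \<le> 2 * L2dist M f g + 2 * L2dist M g h" by (rule L2dist_triangle) fact+
  also have "2 * L2dist M f g + 2 * L2dist M g h < 2 * ennreal (e / 4) + 2 * ennreal (e / 4)"
    using assms(4,5) by (intro add_strict_mono ennreal_mult_strict_left_mono) auto
  also have "2 * ennreal (e / 4) + 2 * ennreal (e / 4) = ennreal e"
  proof -
    have "2 * ennreal (e / 4) = ennreal (e / 2)" using ennreal_numeral_mult[of "e / 4" "num.Bit0 num.One"] assms(6) by simp
    then show ?thesis using assms(6) by (simp flip: ennreal_plus)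
  qed
  finally show ?thesis .
qed

lemma step_approx_limit:
  fixes f :: "real \<times> real \<Rightarrow> 'b::{banach, second_countable_topology}"
  assumes f: "f \<in> borel_measurable borel" and g: "\<And>e. e > 0 \<Longrightarrow> \<exists>g. step_approx T g \<and> L2dist (square_measure T) f g < ennreal e"
  shows "step_approx T f"
  unfolding step_approx_def
proof (intro conjI allI impI f)
  fix e :: real assume e: "e > 0"
  then have e4: "e / 4 > 0" by simp
  obtain g where g: "step_approx T g" "L2dist (square_measure T) f g < ennreal (e / 4)" using g[OF e4] by blast
  then obtain N A where N: "N > 0" "L2dist (square_measure T) g (\<lambda>p. step_kernel T N A (fst p) (snd p)) < ennreal (e / 4)"
    unfolding step_approx_def using e4 by blast
  have "L2dist (square_measure T) f (\<lambda>p. step_kernel T N A (fst p) (snd p)) < ennreal e"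
  proof (rule L2dist_triangle_less[OF _ _ _ g(2) N(2) e])
    have gm: "g \<in> borel_measurable borel" using g(1) by (simp add: step_approx_def)
    then show "g \<in> borel_measurable (square_measure T)" by measurable
  qed (use f in auto)
  then show "\<exists>N>0. \<exists>A. L2dist (square_measure T) f (\<lambda>p. step_kernel T N A (fst p) (snd p)) < ennreal e" using N(1) by blast
qed

lemma step_approx_add:
  assumes T: "T > 0" and f: "step_approx T f" and g: "step_approx T g"
  shows "step_approx T (\<lambda>p. f p + g p)"
  unfolding step_approx_def
proof (intro conjI allI impI)
  have m[measurable]: "f \<in> borel_measurable borel" "g \<in> borel_measurable borel" using f g by (auto simp: step_approx_def)
  show "(\<lambda>p. f p + g p) \<in> borel_measurable borel" by measurable
  fix e :: real assume e: "e > 0"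
  then have e4: "e / 4 > 0" by simp
  obtain N A where N: "N > 0" "L2dist (square_measure T) f (\<lambda>p. step_kernel T N A (fst p) (snd p)) < ennreal (e / 4)"
    using f e4 unfolding step_approx_def by blast
  obtain N' A' where N': "N' > 0" "L2dist (square_measure T) g (\<lambda>p. step_kernel T N' A' (fst p) (snd p)) < ennreal (e / 4)"
    using g e4 unfolding step_approx_def by blast
  obtain B where B: "\<And>t s. step_kernel T N A t s = step_kernel T (N * N') B t s" using step_kernel_refine[OF T N(1) N'(1)] by blast
  obtain B' where B': "\<And>t s. step_kernel T N' A' t s = step_kernel T (N * N') B' t s"
    using step_kernel_refine[OF T N'(1) N(1)] unfolding mult.commute[of N' N] by blast
  have "L2dist (square_measure T) (\<lambda>p. f p + g p) (\<lambda>p. step_kernel T (N * N') (\<lambda>j k. B j k + B' j k) (fst p) (snd p)) < ennreal e"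
  proof (rule L2dist_triangle_less)
    show "L2dist (square_measure T) (\<lambda>p. f p + g p) (\<lambda>p. step_kernel T (N * N') B (fst p) (snd p) + g p) < ennreal (e / 4)"
      using N(2) unfolding B L2dist_def by simp
    show "L2dist (square_measure T) (\<lambda>p. step_kernel T (N * N') B (fst p) (snd p) + g p) (\<lambda>p. step_kernel T (N * N') (\<lambda>j k. B j k + B' j k) (fst p) (snd p)) < ennreal (e / 4)"
      using N'(2) unfolding B' L2dist_def step_kernel_add[symmetric] by simp
  qed (use e in auto)
  then show "\<exists>N>0. \<exists>A. L2dist (square_measure T) (\<lambda>p. f p + g p) (\<lambda>p. step_kernel T N A (fst p) (snd p)) < ennreal e"
    using N(1) N'(1) by (intro exI[of _ "N * N'"]) auto
qed

abbreviation "lower_triangle \<equiv> {p::real \<times> real. snd p < fst p}"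

lemma open_lower_triangle: "open lower_triangle"
  by (intro open_Collect_less continuous_intros)

text \<open>Fill \<open>U\<close> from inside with the cells whose product lies in \<open>U\<close>.
  Around a point of \<open>U\<close> sufficiently small cells fit, so the indicators converge almost
  everywhere; they are bounded on a finite measure space.\<close>

lemma step_approx_open:
  fixes c :: "'b::{banach, second_countable_topology}"
  assumes T: "T > 0" and U: "open U" "U \<subseteq> lower_triangle"
  shows "step_approx T (\<lambda>p. indicator U p *\<^sub>R c)"
proof -
  have Ub[measurable]: "U \<in> sets borel" using U by simp
  interpret Q: finite_measure "square_measure T" by (rule finite_square_measure)
  define A where "A N j k = (if grid_cell T N j \<times> grid_cell T N k \<subseteq> U then c else 0)" for N j k
  define S where "S N p = step_kernel T (Suc N) (A (Suc N)) (fst p) (snd p)" for N p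
  have [measurable]: "S N \<in> borel_measurable borel" for N unfolding S_def by measurable
  have Sval: "S N p = (if \<exists>j k. j < Suc N \<and> k < Suc N \<and> fst p \<in> grid_cell T (Suc N) j \<and> snd p \<in> grid_cell T (Suc N) k \<and> grid_cell T (Suc N) j \<times> grid_cell T (Suc N) k \<subseteq> U then c else 0)"
    if p: "fst p \<in> {0<..T}" "snd p \<in> {0<..T}" for N p
  proof -
    obtain j where j: "j < Suc N" "fst p \<in> grid_cell T (Suc N) j" using grid_cell_exists[OF T zero_less_Suc p(1)] .
    obtain k where k: "k < Suc N" "snd p \<in> grid_cell T (Suc N) k" using grid_cell_exists[OF T zero_less_Suc p(2)] .
    \<comment> \<open>Right endpoints belong to their cells, so the upper right corner of the
      product lies in \<open>U\<close>, hence below the diagonal; comparing its two coordinates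
      compares the indices.\<close>
    have "k < j" if sub: "grid_cell T (Suc N) j \<times> grid_cell T (Suc N) k \<subseteq> U"
    proof -
      have "T * real (Suc j) / real (Suc N) \<in> grid_cell T (Suc N) j" "T * real (Suc k) / real (Suc N) \<in> grid_cell T (Suc N) k"
        using T unfolding grid_cell_def by (auto intro!: divide_strict_right_mono)
      then have "(T * real (Suc j) / real (Suc N), T * real (Suc k) / real (Suc N)) \<in> lower_triangle" using sub U(2) by blast
      then have "T * real (Suc k) / real (Suc N) < T * real (Suc j) / real (Suc N)" by simp
      then have "real (Suc k) < real (Suc j)" using T by (simp add: divide_less_cancel)
      then show ?thesis by simp
    qed
    then have "S N p = (if grid_cell T (Suc N) j \<times> grid_cell T (Suc N) k \<subseteq> U then c else 0)"
      unfolding S_def step_kernel_eval[OF T zero_less_Suc j(2,1) k(2)] A_def by auto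
    moreover have "(\<exists>j k. j < Suc N \<and> k < Suc N \<and> fst p \<in> grid_cell T (Suc N) j \<and> snd p \<in> grid_cell T (Suc N) k \<and> grid_cell T (Suc N) j \<times> grid_cell T (Suc N) k \<subseteq> U)
       \<longleftrightarrow> grid_cell T (Suc N) j \<times> grid_cell T (Suc N) k \<subseteq> U"
      using j k grid_cell_unique[OF T zero_less_Suc] by blast
    ultimately show ?thesis by presburger
  qed
  have lim: "AE p in square_measure T. (\<lambda>N. S N p) \<longlonglongrightarrow> indicator U p *\<^sub>R c"
    using AE_square
  proof eventually_elim
    case (elim p)
    show ?case
    proof (cases "p \<in> U")
      case False
      then have "S N p = 0" for N using Sval[of p N] elim by (cases p) auto
      then show ?thesis using False by simp
    next
      case True
      then obtain e where e: "e > 0" "\<And>q. dist q p < e \<Longrightarrow> q \<in> U" using U(1) unfolding open_dist by blast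
      obtain N0 where N0: "2 * T / e < real N0" using reals_Archimedean2 by blast
      have "S N p = c" if "N \<ge> N0" for N
      proof -
        obtain j where j: "j < Suc N" "fst p \<in> grid_cell T (Suc N) j" using grid_cell_exists[OF T zero_less_Suc] elim by blast
        obtain k where k: "k < Suc N" "snd p \<in> grid_cell T (Suc N) k" using grid_cell_exists[OF T zero_less_Suc] elim by blast
        have d: "\<bar>x - y\<bar> < T / real (Suc N)" if "x \<in> grid_cell T (Suc N) i" "y \<in> grid_cell T (Suc N) i" for x y i
        proof -
          have "T * real (Suc i) / real (Suc N) = T * real i / real (Suc N) + T / real (Suc N)"
            by (simp add: add_divide_distrib[symmetric] algebra_simps)
          then show ?thesis using that unfolding grid_cell_def by (auto simp: abs_if)
        qed
        have TN: "T / real (Suc N) \<le> e / 2"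
        proof -
          have "2 * T / e < real (Suc N)" using N0 that by linarith
          then show ?thesis using e(1) by (simp add: field_simps)
        qed
        have "grid_cell T (Suc N) j \<times> grid_cell T (Suc N) k \<subseteq> U"
        proof
          fix q assume q: "q \<in> grid_cell T (Suc N) j \<times> grid_cell T (Suc N) k"
          have "dist q p \<le> \<bar>fst q - fst p\<bar> + \<bar>snd q - snd p\<bar>"
            unfolding dist_prod_def dist_real_def using sqrt_sum_squares_le_sum_abs[of "fst q - fst p" "snd q - snd p"] by simp
          also have "\<dots> < e" using d[of "fst q" j "fst p"] d[of "snd q" k "snd p"] q j k TN by (auto simp: mem_Times_iff)
          finally show "q \<in> U" by (rule e)
        qed
        then show ?thesis using Sval[of p N] elim j k by auto
      qed
      then have "(\<lambda>N. S N p) \<longlonglongrightarrow> c" by (intro tendsto_eventually) (auto simp: eventually_sequentially)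
      then show ?thesis using True by simp
    qed
  qed
  have "(\<lambda>N. \<integral>\<^sup>+p. ennreal ((norm (indicator U p *\<^sub>R c - S N p))\<^sup>2) \<partial>square_measure T) \<longlonglongrightarrow> (\<integral>\<^sup>+p. 0 \<partial>square_measure T)"
  proof (rule nn_integral_dominated_convergence[where w="\<lambda>p. ennreal ((2 * norm c)\<^sup>2)"])
    show "AE p in square_measure T. ennreal ((norm (indicator U p *\<^sub>R c - S N p))\<^sup>2) \<le> ennreal ((2 * norm c)\<^sup>2)" for N
      using AE_square
    proof eventually_elim
      case (elim p)
      have "norm (S N p) \<le> norm c" using Sval[of p N] elim by auto
      moreover have "norm (indicator U p *\<^sub>R c) \<le> norm c" by (auto simp: indicator_def)
      ultimately have "norm (indicator U p *\<^sub>R c - S N p) \<le> 2 * norm c" using norm_triangle_ineq4[of "indicator U p *\<^sub>R c" "S N p"] by linarith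
      then show ?case by (intro ennreal_leI power_mono) auto
    qed
    show "AE p in square_measure T. (\<lambda>N. ennreal ((norm (indicator U p *\<^sub>R c - S N p))\<^sup>2)) \<longlonglongrightarrow> 0"
      using lim
    proof eventually_elim
      case (elim p)
      have "(\<lambda>N. ennreal ((norm (indicator U p *\<^sub>R c - S N p))\<^sup>2)) \<longlonglongrightarrow> ennreal ((norm (indicator U p *\<^sub>R c - indicator U p *\<^sub>R c))\<^sup>2)"
        by (intro tendsto_ennrealI tendsto_intros elim)
      then show ?case by simp
    qed
    have "(\<integral>\<^sup>+p. ennreal ((2 * norm c)\<^sup>2) \<partial>square_measure T) = ennreal ((2 * norm c)\<^sup>2) * emeasure (square_measure T) UNIV" by simp
    also have "\<dots> < \<infinity>"
    proof -
      have "emeasure (square_measure T) UNIV < \<top>" using Q.emeasure_finite[of UNIV] unfolding infinity_ennreal_def less_top .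
      then show ?thesis by (simp add: ennreal_mult_less_top)
    qed
    finally show "(\<integral>\<^sup>+p. ennreal ((2 * norm c)\<^sup>2) \<partial>square_measure T) < \<infinity>" .
  qed auto
  then have L: "(\<lambda>N. L2dist (square_measure T) (\<lambda>p. indicator U p *\<^sub>R c) (S N)) \<longlonglongrightarrow> 0" by (simp add: L2dist_def)
  show ?thesis unfolding step_approx_def
  proof (intro conjI allI impI)
    show "(\<lambda>p. indicator U p *\<^sub>R c) \<in> borel_measurable borel" by measurable
    fix e :: real assume "e > 0"
    then obtain N where "L2dist (square_measure T) (\<lambda>p. indicator U p *\<^sub>R c) (S N) < ennreal e"
      using ennreal_tendsto_0_iff[OF L, of "ennreal e"] by auto
    then show "\<exists>N>0. \<exists>A. L2dist (square_measure T) (\<lambda>p. indicator U p *\<^sub>R c) (\<lambda>p. step_kernel T N A (fst p) (snd p)) < ennreal e"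
      unfolding S_def by blast
  qed
qed

text \<open>Outer regularity of Lebesgue measure reduces the claim to open sets; intersecting with
  the triangle, itself open, keeps the open set below the diagonal.\<close>

lemma step_approx_borel:
  fixes c :: "'b::{banach, second_countable_topology}"
  assumes T: "T > 0" and B: "B \<in> sets borel" "B \<subseteq> lower_triangle"
  shows "step_approx T (\<lambda>p. indicator B p *\<^sub>R c)"
proof (rule step_approx_limit)
  note [measurable] = B(1)
  show "(\<lambda>p. indicator B p *\<^sub>R c) \<in> borel_measurable borel" by measurable
  fix e :: real assume e: "e > 0"
  \<comment> \<open>The summand 1 avoids a division by 0 when \<open>c = 0\<close>.\<close>
  define q where "q = (norm c)\<^sup>2 + 1"
  define d where "d = e / (2 * q)"
  have c1: "q > 0" by (simp add: q_def add_nonneg_pos)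
  have d: "d > 0" using e c1 by (simp add: d_def)
  have "B \<in> sets lebesgue" using B(1) by simp
  then obtain U where U: "open U" "B \<subseteq> U" "emeasure lebesgue (U - B) < ennreal d"
    using d by (rule sets_lebesgue_outer_open) (rule that)
  define V where "V = U \<inter> lower_triangle"
  have V: "open V" "V \<subseteq> lower_triangle" "B \<subseteq> V" using U B(2) open_lower_triangle by (auto simp: V_def)
  have [measurable]: "V \<in> sets borel" using V(1) by simp
  have "emeasure (square_measure T) (V - B) \<le> emeasure lborel (V - B)" by (rule square_measure_le) measurable
  also have "\<dots> \<le> emeasure lborel (U - B)" using U(1) by (intro emeasure_mono) (auto simp: V_def)
  also have "\<dots> = emeasure lebesgue (U - B)" using U(1) B(1) by simp
  also have "\<dots> < ennreal d" by fact
  finally have m: "emeasure (square_measure T) (V - B) \<le> ennreal d" by simp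
  have "L2dist (square_measure T) (\<lambda>p. indicator B p *\<^sub>R c) (\<lambda>p. indicator V p *\<^sub>R c) = (\<integral>\<^sup>+p. ennreal ((norm c)\<^sup>2) * indicator (V - B) p \<partial>square_measure T)"
    unfolding L2dist_def using V(3) by (intro nn_integral_cong) (auto simp: indicator_def)
  also have "\<dots> = ennreal ((norm c)\<^sup>2) * emeasure (square_measure T) (V - B)" by (subst nn_integral_cmult_indicator) auto
  also have "\<dots> \<le> ennreal ((norm c)\<^sup>2) * ennreal d" by (intro mult_left_mono m) auto
  also have "\<dots> = ennreal ((norm c)\<^sup>2 * d)" using d by (simp add: ennreal_mult)
  also have "\<dots> < ennreal e"
  proof (rule ennreal_lessI)
    have "(norm c)\<^sup>2 * d \<le> q * d" using d by (intro mult_right_mono) (auto simp: q_def)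
    also have "\<dots> = e / 2" using c1 by (simp add: d_def)
    finally show "(norm c)\<^sup>2 * d < e" using e by simp
  qed (use e in simp)
  finally show "\<exists>g. step_approx T g \<and> L2dist (square_measure T) (\<lambda>p. indicator B p *\<^sub>R c) g < ennreal e"
    using step_approx_open[OF T V(1,2), of c] by blast
qed

lemma step_approx_zero: "step_approx T (\<lambda>p. 0)"
  unfolding step_approx_def
  by (auto simp: L2dist_def step_kernel_def intro!: exI[of _ 1])

lemma step_approx_sum:
  assumes T: "T > 0" and "finite F" "\<And>y. y \<in> F \<Longrightarrow> step_approx T (g y)"
  shows "step_approx T (\<lambda>p. \<Sum>y\<in>F. g y p)"
  using assms(2,3)
  by (induction F) (auto intro!: step_approx_add[OF T] step_approx_zero)

text \<open>Simple functions dominated by \<open>2 * norm (f p)\<close> vanish wherever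
  \<open>f\<close> does, so that their nonzero level sets stay inside the triangle, and the same
  domination gives convergence in mean square.\<close>

theorem step_approx_L2:
  fixes f :: "real \<times> real \<Rightarrow> 'b::{banach, second_countable_topology}"
  assumes T: "T > 0" and f[measurable]: "f \<in> borel_measurable borel" and low: "\<And>p. p \<notin> lower_triangle \<Longrightarrow> f p = 0"
    and sq: "(\<integral>\<^sup>+p. ennreal ((norm (f p))\<^sup>2) \<partial>square_measure T) < \<infinity>"
  shows "step_approx T f"
proof (rule step_approx_limit[OF f])
  fix e :: real assume e: "e > 0"
  obtain S where S: "\<And>i. simple_function (borel :: (real \<times> real) measure) (S i)" "\<And>p. (\<lambda>i. S i p) \<longlonglongrightarrow> f p" "\<And>i p. norm (S i p) \<le> 2 * norm (f p)"
    using borel_measurable_implies_sequence_metric[OF f, of 0] by (auto simp: dist_norm)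
  have Sm[measurable]: "S i \<in> borel_measurable borel" for i by (rule borel_measurable_simple_function[OF S(1)])
  have app: "step_approx T (S i)" for i
  proof -
    have fin: "finite (range (S i))" using simple_functionD(1)[OF S(1)[of i]] by simp
    \<comment> \<open>The value 0 is left out: its level set reaches beyond the triangle.\<close>
    have "step_approx T (\<lambda>p. \<Sum>y\<in>range (S i) - {0}. indicator (S i -` {y}) p *\<^sub>R y)"
    proof (rule step_approx_sum[OF T])
      fix y assume y: "y \<in> range (S i) - {0}"
      have "S i -` {y} \<in> sets borel" using simple_functionD(2)[OF S(1)[of i], of "{y}"] by simp
      moreover have "S i -` {y} \<subseteq> lower_triangle"
      proof
        fix p assume p: "p \<in> S i -` {y}"
        show "p \<in> lower_triangle"
        proof (rule ccontr)
          assume "p \<notin> lower_triangle"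
          then have "S i p = 0" using low[of p] S(3)[of i p] by simp
          then show False using p y by simp
        qed
      qed
      ultimately show "step_approx T (\<lambda>p. indicator (S i -` {y}) p *\<^sub>R y)" by (rule step_approx_borel[OF T])
    qed (use fin in simp)
    moreover have "(\<Sum>y\<in>range (S i) - {0}. indicator (S i -` {y}) p *\<^sub>R y) = S i p" for p
    proof -
      have "(\<Sum>y\<in>range (S i) - {0}. indicator (S i -` {y}) p *\<^sub>R y) = (\<Sum>y\<in>range (S i) - {0}. if y = S i p then S i p else 0)"
        by (intro sum.cong) (auto simp: indicator_def)
      also have "\<dots> = S i p" using fin by (subst sum.delta) auto
      finally show ?thesis .
    qed
    ultimately show ?thesis by simp
  qed
  have "(\<lambda>i. \<integral>\<^sup>+p. ennreal ((norm (f p - S i p))\<^sup>2) \<partial>square_measure T) \<longlonglongrightarrow> (\<integral>\<^sup>+p. 0 \<partial>square_measure T)"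
  proof (rule nn_integral_dominated_convergence[where w="\<lambda>p. ennreal (9 * (norm (f p))\<^sup>2)"])
    show "AE p in square_measure T. ennreal ((norm (f p - S i p))\<^sup>2) \<le> ennreal (9 * (norm (f p))\<^sup>2)" for i
    proof (intro AE_I2 ennreal_leI)
      fix p
      have "norm (f p - S i p) \<le> 3 * norm (f p)" using norm_triangle_ineq4[of "f p" "S i p"] S(3)[of i p] by linarith
      then have "(norm (f p - S i p))\<^sup>2 \<le> (3 * norm (f p))\<^sup>2" by (intro power_mono) auto
      then show "(norm (f p - S i p))\<^sup>2 \<le> 9 * (norm (f p))\<^sup>2" by (simp add: power_mult_distrib)
    qed
    show "AE p in square_measure T. (\<lambda>i. ennreal ((norm (f p - S i p))\<^sup>2)) \<longlonglongrightarrow> 0"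
    proof (rule AE_I2)
      fix p
      have "(\<lambda>i. ennreal ((norm (f p - S i p))\<^sup>2)) \<longlonglongrightarrow> ennreal ((norm (f p - f p))\<^sup>2)"
        by (intro tendsto_ennrealI tendsto_intros S)
      then show "(\<lambda>i. ennreal ((norm (f p - S i p))\<^sup>2)) \<longlonglongrightarrow> 0" by simp
    qed
    have "(\<integral>\<^sup>+p. ennreal (9 * (norm (f p))\<^sup>2) \<partial>square_measure T) = 9 * (\<integral>\<^sup>+p. ennreal ((norm (f p))\<^sup>2) \<partial>square_measure T)"
      by (subst nn_integral_cmult[symmetric]) (auto simp: ennreal_mult)
    also have "\<dots> < \<infinity>" using sq by (simp add: ennreal_mult_less_top)
    finally show "(\<integral>\<^sup>+p. ennreal (9 * (norm (f p))\<^sup>2) \<partial>square_measure T) < \<infinity>" .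
  qed auto
  then have "(\<lambda>i. L2dist (square_measure T) f (S i)) \<longlonglongrightarrow> 0" by (simp add: L2dist_def)
  then obtain i where "L2dist (square_measure T) f (S i) < ennreal e"
    using ennreal_tendsto_0_iff[of _ "ennreal e"] e by auto
  then show "\<exists>g. step_approx T g \<and> L2dist (square_measure T) f g < ennreal e" using app by blast
qed

text \<open>First the kernel is fixed, and with it the bound \<open>C\<close> of its entries; then
  the grid is subdivided \<open>p\<close> times, which changes neither the kernel nor
  \<open>C\<close>. So \<open>C ^ 4 / real N\<close>, the order of the errors stemming from the
  diagonal cells, becomes as small as the distance.\<close>

lemma step_approx_fine:
  fixes f :: "real \<times> real \<Rightarrow> 'b::{banach, second_countable_topology}"
  assumes T: "T > 0" and f: "step_approx T f" and e: "e > 0"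
  obtains N A C where "N > n" "C \<ge> 0" "\<And>j k. norm (A j k) \<le> C" "C ^ 4 / real N < e"
    "L2dist (square_measure T) f (\<lambda>p. step_kernel T N A (fst p) (snd p)) < ennreal e"
proof -
  obtain N A where N: "N > 0" "L2dist (square_measure T) f (\<lambda>p. step_kernel T N A (fst p) (snd p)) < ennreal e"
    using f e unfolding step_approx_def by blast
  define C where "C = (\<Sum>j<N. \<Sum>k<N. norm (A j k))"
  have C0: "C \<ge> 0" unfolding C_def by (intro sum_nonneg) auto
  have C: "norm (A j k) \<le> C" if "j < N" "k < N" for j k
  proof -
    have "norm (A j k) \<le> (\<Sum>k<N. norm (A j k))" using that by (intro member_le_sum) auto
    also have "\<dots> \<le> C" unfolding C_def using that by (intro member_le_sum[of j "{..<N}" "\<lambda>j. \<Sum>k<N. norm (A j k)"]) (auto intro: sum_nonneg)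
    finally show ?thesis .
  qed
  obtain p where p: "real p > C ^ 4 / e + real n + 1" using reals_Archimedean2 by blast
  have "C ^ 4 / e \<ge> 0" using e by simp
  then have "real n < real p" using p by linarith
  then have p0: "p > 0" "p > n" by auto
  \<comment> \<open>Only entries with indices below \<open>N\<close> are controlled by
    \<open>C\<close>; setting the others to 0 makes the bound hold for all indices.\<close>
  define A' where "A' j k = (if j < N \<and> k < N then A j k else 0)" for j k
  define B where "B j k = (if k div p < j div p then A' (j div p) (k div p) else 0)" for j k
  have B: "norm (B j k) \<le> C" for j k unfolding B_def A'_def using C C0 by auto
  have "step_kernel T N A t s = step_kernel T N A' t s" for t s
    unfolding step_kernel_def A'_def by (intro sum.cong) auto
  then have eq: "step_kernel T N A t s = step_kernel T (N * p) B t s" for t s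
    using step_kernel_refine[OF T N(1) p0(1), of A' t s] unfolding B_def by simp
  have Np: "real p \<le> real (N * p)" using N(1) mult_right_mono[of 1 "real N" "real p"] by simp
  have "C ^ 4 / real (N * p) < e"
  proof -
    have "C ^ 4 / e < real (N * p)" using p Np by linarith
    then show ?thesis using e N(1) p0 by (simp add: field_simps)
  qed
  moreover have "N * p > n" using p0(2) N(1) Np by (metis less_le_trans of_nat_le_iff)
  ultimately show thesis using that[of "N * p" C B] C0 B N(2) unfolding eq by blast
qed

section \<open>Wiener integrals of kernels\<close>

lemma norm_vec_sq: "(norm (x :: ('a::real_normed_vector) ^ 'd))\<^sup>2 = (\<Sum>i\<in>UNIV. (norm (x $ i))\<^sup>2)"
  by (simp add: norm_vec_def L2_set_def sum_nonneg)

lemma norm_matrix_vector_le: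
  fixes A :: "real ^ 'd ^ 'e"
  shows "norm (A *v x) \<le> norm A * norm x"
proof (rule power2_le_imp_le)
  have "(norm (A *v x))\<^sup>2 = (\<Sum>i\<in>UNIV. (A $ i \<bullet> x)\<^sup>2)"
    by (simp add: norm_vec_sq matrix_vector_mul_component)
  also have "\<dots> \<le> (\<Sum>i\<in>UNIV. (norm (A $ i))\<^sup>2 * (norm x)\<^sup>2)"
  proof (rule sum_mono)
    fix i
    have "\<bar>A $ i \<bullet> x\<bar>\<^sup>2 \<le> (norm (A $ i) * norm x)\<^sup>2" by (intro power_mono Cauchy_Schwarz_ineq2) auto
    then show "(A $ i \<bullet> x)\<^sup>2 \<le> (norm (A $ i))\<^sup>2 * (norm x)\<^sup>2" by (simp add: power_mult_distrib)
  qed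
  also have "\<dots> = (norm A * norm x)\<^sup>2"
    by (simp add: norm_vec_sq[of A] power_mult_distrib sum_distrib_right)
  finally show "(norm (A *v x))\<^sup>2 \<le> (norm A * norm x)\<^sup>2" .
qed simp

text \<open>The inner integrals run up to \<open>t\<close>, so this strictly lower part is all that
  the stochastic integrals see. The cut to the square is part of it because measurability is only
  known there.\<close>

definition lower_kernel :: "real \<Rightarrow> (real \<Rightarrow> real \<Rightarrow> 'b::real_vector) \<Rightarrow> real \<times> real \<Rightarrow> 'b" where
  "lower_kernel T \<eta> p = indicator lower_triangle p *\<^sub>R (indicator ({0..T} \<times> {0..T}) p *\<^sub>R \<eta> (fst p) (snd p))"

lemma lower_triangle_borel[measurable]: "lower_triangle \<in> sets borel"
  using open_lower_triangle by simp

context wiener_setup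
begin

definition grid_incr :: "nat \<Rightarrow> nat \<Rightarrow> (real \<Rightarrow> real ^ 'd) \<Rightarrow> real ^ 'd" where
  "grid_incr N k w = w (T * real (Suc k) / real N) - w (T * real k / real N)"

definition step_drift :: "nat \<Rightarrow> (nat \<Rightarrow> nat \<Rightarrow> real ^ 'd ^ 'd) \<Rightarrow> nat \<Rightarrow> (real \<Rightarrow> real ^ 'd) \<Rightarrow> real ^ 'd" where
  "step_drift N A j w = (\<Sum>k<j. A j k *v grid_incr N k w)"

definition step_process :: "nat \<Rightarrow> (nat \<Rightarrow> nat \<Rightarrow> real ^ 'd ^ 'd) \<Rightarrow> real \<Rightarrow> (real \<Rightarrow> real ^ 'd) \<Rightarrow> real ^ 'd" where
  "step_process N A t w = (\<Sum>j<N. indicator (grid_cell T N j) t *\<^sub>R step_drift N A j w)"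

definition step_q :: "nat \<Rightarrow> (nat \<Rightarrow> nat \<Rightarrow> real ^ 'd ^ 'd) \<Rightarrow> (real \<Rightarrow> real ^ 'd) \<Rightarrow> real" where
  "step_q N A w = (\<Sum>j<N. step_drift N A j w \<bullet> grid_incr N j w)"

lemma grid_order:
  assumes "N > 0" "k < N"
  shows "0 \<le> T * real k / real N" "T * real k / real N \<le> T * real (Suc k) / real N" "T * real (Suc k) / real N \<le> T"
proof -
  show "0 \<le> T * real k / real N" using T_pos by simp
  show "T * real k / real N \<le> T * real (Suc k) / real N" using T_pos by (intro divide_right_mono mult_left_mono) auto
  have "T * real (Suc k) / real N \<le> T * real N / real N" using T_pos assms by (intro divide_right_mono mult_left_mono) auto
  then show "T * real (Suc k) / real N \<le> T" using assms by simp
qed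

lemma grid_mono: "k \<le> j \<Longrightarrow> T * real k / real N \<le> T * real j / real N"
  using T_pos by (intro divide_right_mono mult_left_mono) auto

lemma grid_incr_measurable[measurable]: "grid_incr N k \<in> borel_measurable M"
  unfolding grid_incr_def by measurable

lemma grid_incr_Filt: "k < j \<Longrightarrow> grid_incr N k \<in> borel_measurable (Filt T (T * real j / real N))"
  unfolding grid_incr_def using grid_mono[of "Suc k" j N] grid_mono[of k j N] T_pos
  by (intro borel_measurable_diff Filt_coordinate) auto

lemma matrix_vector_borel[measurable (raw)]:
  "f \<in> borel_measurable N \<Longrightarrow> (\<lambda>x. (A :: real ^ 'n ^ 'm) *v f x) \<in> borel_measurable N"
  by (rule measurable_compose[of f]) (auto intro!: borel_measurable_continuous_onI matrix_vector_mult_linear_continuous_on)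

lemma step_drift_Filt: "step_drift N A j \<in> borel_measurable (Filt T (T * real j / real N))"
  unfolding step_drift_def by (intro borel_measurable_sum matrix_vector_borel grid_incr_Filt) auto

lemma step_drift_measurable[measurable]: "step_drift N A j \<in> borel_measurable M"
  unfolding step_drift_def by measurable

lemma grid_incr_sq:
  assumes "N > 0" "k < N"
  shows "integrable M (\<lambda>w. (norm (grid_incr N k w))\<^sup>2)" "(\<integral>w. (norm (grid_incr N k w))\<^sup>2 \<partial>M) = real CARD('d) * (T / real N)"
proof -
  note o = grid_order[OF assms]
  have d: "T * real (Suc k) / real N - T * real k / real N = T / real N"
    by (simp add: diff_divide_distrib[symmetric] algebra_simps)
  have e: "(norm (grid_incr N k w))\<^sup>2 = (\<Sum>i\<in>UNIV. grid_incr N k w $ i * grid_incr N k w $ i)" for w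
    unfolding norm_vec_sq by (simp add: power2_eq_square)
  have i: "integrable M (\<lambda>w. grid_incr N k w $ i * grid_incr N k w $ i)" "(\<integral>w. grid_incr N k w $ i * grid_incr N k w $ i \<partial>M) = T / real N" for i
    using increment_cov[OF o, of i i] unfolding grid_incr_def d by auto
  show "integrable M (\<lambda>w. (norm (grid_incr N k w))\<^sup>2)" unfolding e using i by (intro Bochner_Integration.integrable_sum)
  show "(\<integral>w. (norm (grid_incr N k w))\<^sup>2 \<partial>M) = real CARD('d) * (T / real N)"
    unfolding e using i by (subst Bochner_Integration.integral_sum) auto
qed

lemma step_drift_sq_integrable:
  assumes "N > 0" "j \<le> N"
  shows "integrable M (\<lambda>w. (norm (step_drift N A j w))\<^sup>2)"
proof (rule Bochner_Integration.integrable_bound)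
  show "integrable M (\<lambda>w. real j * (\<Sum>k<j. (norm (A j k))\<^sup>2 * (norm (grid_incr N k w))\<^sup>2))"
    using assms by (intro integrable_mult_right Bochner_Integration.integrable_sum grid_incr_sq) auto
  show "AE w in M. norm ((norm (step_drift N A j w))\<^sup>2) \<le> norm (real j * (\<Sum>k<j. (norm (A j k))\<^sup>2 * (norm (grid_incr N k w))\<^sup>2))"
  proof (rule AE_I2)
    fix w
    have "(norm (step_drift N A j w))\<^sup>2 \<le> real j * (\<Sum>k<j. (norm (A j k *v grid_incr N k w))\<^sup>2)"
      unfolding step_drift_def by (rule norm_sum_sq_le)
    also have "\<dots> \<le> real j * (\<Sum>k<j. (norm (A j k) * norm (grid_incr N k w))\<^sup>2)"
      by (intro mult_left_mono sum_mono power_mono norm_matrix_vector_le) auto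
    finally show "norm ((norm (step_drift N A j w))\<^sup>2) \<le> norm (real j * (\<Sum>k<j. (norm (A j k))\<^sup>2 * (norm (grid_incr N k w))\<^sup>2))"
      by (simp add: power_mult_distrib sum_nonneg)
  qed
qed measurable

lemma nn_integral_sq_finite: "integrable M (\<lambda>w. (norm (f w))\<^sup>2) \<Longrightarrow> (\<integral>\<^sup>+w. ennreal ((norm (f w))\<^sup>2) \<partial>M) < \<infinity>"
  by (subst nn_integral_eq_integral) auto

lemma step_ito:
  fixes \<xi> :: "nat \<Rightarrow> _ \<Rightarrow> real ^ 'd"
  assumes "N > 0" "n \<le> N" "\<And>j. j < n \<Longrightarrow> \<xi> j \<in> borel_measurable (Filt T (T * real j / real N))"
    "\<And>j. j < n \<Longrightarrow> integrable M (\<lambda>w. (norm (\<xi> j w))\<^sup>2)"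
  shows "has_ito_integral T (\<lambda>t w. \<Sum>j<n. indicator (grid_cell T N j) t *\<^sub>R \<xi> j w) (\<lambda>w. \<Sum>j<n. \<xi> j w \<bullet> grid_incr N j w)"
  unfolding grid_cell_def grid_incr_def using assms grid_order[OF assms(1)]
  by (intro step_process_ito[where \<tau>="\<lambda>k. T * real k / real N"]) (auto intro!: nn_integral_sq_finite[unfolded infinity_ennreal_def] simp del: of_nat_Suc)

lemma step_process_has_ito: "N > 0 \<Longrightarrow> has_ito_integral T (step_process N A) (step_q N A)"
  unfolding step_process_def[abs_def] step_q_def[abs_def]
  by (intro step_ito step_drift_Filt step_drift_sq_integrable) auto

lemma step_process_cell:
  assumes "N > 0" "t \<in> grid_cell T N j" "j < N"
  shows "step_process N A t w = step_drift N A j w"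
proof -
  have "step_process N A t w = (\<Sum>i<N. if i = j then step_drift N A j w else 0)"
    unfolding step_process_def
  proof (intro sum.cong refl)
    fix i
    show "indicator (grid_cell T N i) t *\<^sub>R step_drift N A i w = (if i = j then step_drift N A j w else 0)"
      using grid_cell_unique[OF T_pos assms(1,2), of i] assms(2) by (cases "i = j") (auto simp: indicator_def)
  qed
  then show ?thesis using assms(3) by simp
qed

lemma step_process_outside: "t \<notin> {0<..T} \<Longrightarrow> step_process N A t w = 0"
  unfolding step_process_def using grid_cell_subset[OF T_pos] by (intro sum.neutral) (force simp: indicator_def)

lemma step_process_jm: "N > 0 \<Longrightarrow> jm (step_process N A)"
  using step_process_has_ito[of N A] unfolding has_ito_iff by blast

lemma step_row_ito:
  assumes N: "N > 0" and t: "t \<in> {0..T}"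
  shows "has_ito_integral T (\<lambda>s w. indicator {0..t} s *\<^sub>R (step_kernel T N A t s $ i)) (\<lambda>w. step_process N A t w $ i)"
proof (cases "t = 0")
  case True
  then have "t \<notin> {0<..T}" by simp
  then show ?thesis using step_ito[OF N, of 0 "\<lambda>_ _. 0"] step_kernel_outside[OF T_pos, of t _ N A] step_process_outside[of t N A] by simp
next
  case False
  then have "t \<in> {0<..T}" using t by simp
  then obtain j where j: "j < N" "t \<in> grid_cell T N j" using grid_cell_exists[OF T_pos N] by blast
  have sub: "grid_cell T N k \<subseteq> {0..t}" if "k < j" for k
  proof -
    have "T * real (Suc k) / real N \<le> T * real j / real N" using grid_mono[of "Suc k" j N] that by simp
    then show ?thesis using grid_order(1)[OF N, of k] j that unfolding grid_cell_def by auto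
  qed
  \<comment> \<open>The row of \<open>t\<close> is supported on the cells before the one containing
    \<open>t\<close>, all of them inside \<open>{0..t}\<close>, so the indicator changes
    nothing.\<close>
  have "indicator {0..t} s *\<^sub>R (step_kernel T N A t s $ i) = (\<Sum>k<j. indicator (grid_cell T N k) s *\<^sub>R (A j k $ i))" for s
  proof -
    have "indicator {0..t} s *\<^sub>R (step_kernel T N A t s $ i) = (\<Sum>k<j. indicator {0..t} s *\<^sub>R (indicator (grid_cell T N k) s *\<^sub>R (A j k $ i)))"
      unfolding step_kernel_row[OF T_pos N j(2,1)] by (simp only: sum_component vector_scaleR_component scaleR_sum_right)
    also have "\<dots> = (\<Sum>k<j. indicator (grid_cell T N k) s *\<^sub>R (A j k $ i))"
    proof (intro sum.cong refl)
      fix k assume "k \<in> {..<j}"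
      then show "indicator {0..t} s *\<^sub>R (indicator (grid_cell T N k) s *\<^sub>R (A j k $ i)) = indicator (grid_cell T N k) s *\<^sub>R (A j k $ i)"
        using sub[of k] by (cases "s \<in> grid_cell T N k") (auto simp: indicator_def subset_eq)
    qed
    finally show ?thesis .
  qed
  moreover have "step_process N A t w $ i = (\<Sum>k<j. A j k $ i \<bullet> grid_incr N k w)" for w
    unfolding step_process_cell[OF N j(2,1)] step_drift_def by (simp add: matrix_vector_mul_component)
  ultimately show ?thesis
    using step_ito[OF N, of j "\<lambda>k _. A j k $ i"] j by simp
qed

lemma step_wint: "N > 0 \<Longrightarrow> wint_process T (step_kernel T N A) (step_process N A)"
  unfolding wint_process_def M_wiener[symmetric] using step_process_jm[of N A] step_row_ito[of N] by (auto simp: jm_def)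

text \<open>For almost every \<open>t\<close> each component of the process is an Ito integral of a
  deterministic row, so \<open>ito_ineq\<close> applies component by component; summing over
  components gives the Frobenius norm of the row difference, and integrating over \<open>t\<close>
  the distance of the kernels. With equal kernels this is uniqueness of the process up to null
  sets.\<close>

lemma wint_estimate:
  assumes X: "wint_process T \<eta> X" and X': "wint_process T \<eta>' X'"
    and m: "lower_kernel T \<eta> \<in> borel_measurable borel" "lower_kernel T \<eta>' \<in> borel_measurable borel"
  shows "procdist X X' \<le> 9 * L2dist (square_measure T) (lower_kernel T \<eta>) (lower_kernel T \<eta>')"
proof -
  have jmX: "jm X" "jm X'" using X X' unfolding wint_process_def jm_def M_wiener[symmetric] by auto
  interpret F: finite_measure \<mu>T by (rule finite_interval_measure_T)
  interpret FF: pair_sigma_finite \<mu>T \<mu>T ..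
  have am: "AE t in \<mu>T. t \<in> {0..T} \<and>
     (\<forall>i. has_ito_integral T (\<lambda>s w. indicator {0..t} s *\<^sub>R (\<eta> t s $ i)) (\<lambda>w. X t w $ i)) \<and>
     (\<forall>i. has_ito_integral T (\<lambda>s w. indicator {0..t} s *\<^sub>R (\<eta>' t s $ i)) (\<lambda>w. X' t w $ i))"
  proof -
    have "AE t in lborel. 0 < (indicator {0..T} t :: ennreal) \<longrightarrow> t \<in> {0..T} \<and>
     (\<forall>i. has_ito_integral T (\<lambda>s w. indicator {0..t} s *\<^sub>R (\<eta> t s $ i)) (\<lambda>w. X t w $ i)) \<and>
     (\<forall>i. has_ito_integral T (\<lambda>s w. indicator {0..t} s *\<^sub>R (\<eta>' t s $ i)) (\<lambda>w. X' t w $ i))"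
    proof -
      have "AE t in lborel. t \<in> {0..T} \<longrightarrow> (\<forall>i. has_ito_integral T (\<lambda>s w. indicator {0..t} s *\<^sub>R (\<eta> t s $ i)) (\<lambda>w. X t w $ i))"
        "AE t in lborel. t \<in> {0..T} \<longrightarrow> (\<forall>i. has_ito_integral T (\<lambda>s w. indicator {0..t} s *\<^sub>R (\<eta>' t s $ i)) (\<lambda>w. X' t w $ i))"
        using X X' unfolding wint_process_def by auto
      then show ?thesis by eventually_elim (auto simp: indicator_def)
    qed
    then show ?thesis unfolding interval_measure_T_def by (subst AE_density) auto
  qed
  have sm: "(\<lambda>p. ennreal ((norm (lower_kernel T \<eta> p - lower_kernel T \<eta>' p))\<^sup>2)) \<in> borel_measurable (\<mu>T \<Otimes>\<^sub>M \<mu>T)"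
    using m unfolding square_measure_eq[symmetric] by measurable
  have "procdist X X' = (\<integral>\<^sup>+t. (\<integral>\<^sup>+w. ennreal ((norm (X t w - X' t w))\<^sup>2) \<partial>M) \<partial>\<mu>T)"
  proof -
    have "(\<lambda>(t, w). ennreal ((norm (X t w - X' t w))\<^sup>2)) \<in> borel_measurable (\<mu>T \<Otimes>\<^sub>M M)"
      using jmX unfolding jm_TM by (simp add: case_prod_beta')
    from nn_integral_fst[OF this] show ?thesis
      unfolding procdist_eq[OF jmX] L2dist_def by (simp add: case_prod_beta')
  qed
  also have "\<dots> \<le> (\<integral>\<^sup>+t. (\<integral>\<^sup>+s. 9 * ennreal ((norm (lower_kernel T \<eta> (t, s) - lower_kernel T \<eta>' (t, s)))\<^sup>2) \<partial>\<mu>T) \<partial>\<mu>T)"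
  proof (rule nn_integral_mono_AE, use am in eventually_elim)
    case (elim t)
    have Xm: "X t \<in> borel_measurable M" "X' t \<in> borel_measurable M"
      using jmX measurable_Pair2[of "\<lambda>(s, w). X s w" \<mu>T M borel t] measurable_Pair2[of "\<lambda>(s, w). X' s w" \<mu>T M borel t] by (auto simp: jm_TM)
    define R where "R i s = indicator {0..t} s *\<^sub>R (\<eta> t s $ i) - indicator {0..t} s *\<^sub>R (\<eta>' t s $ i)" for i s
    have Rjm: "(\<lambda>s. indicator {0..t} s *\<^sub>R (\<eta> t s $ i)) \<in> borel_measurable borel" "(\<lambda>s. indicator {0..t} s *\<^sub>R (\<eta>' t s $ i)) \<in> borel_measurable borel" for i
    proof -
      \<comment> \<open>The rows do not depend on the path, so measurability in \<open>s\<close>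
        follows from joint measurability by freezing any path.\<close>
      obtain w where w: "w \<in> space M" using not_empty by blast
      show "(\<lambda>s. indicator {0..t} s *\<^sub>R (\<eta> t s $ i)) \<in> borel_measurable borel"
        using elim measurable_Pair1[of "\<lambda>(s, w). indicator {0..t} s *\<^sub>R (\<eta> t s $ i)" lborel M borel w] w by (auto simp: has_ito_iff jm_def)
      show "(\<lambda>s. indicator {0..t} s *\<^sub>R (\<eta>' t s $ i)) \<in> borel_measurable borel"
        using elim measurable_Pair1[of "\<lambda>(s, w). indicator {0..t} s *\<^sub>R (\<eta>' t s $ i)" lborel M borel w] w by (auto simp: has_ito_iff jm_def)
    qed
    then have Rm[measurable]: "R i \<in> borel_measurable borel" for i unfolding R_def by measurable
    have "(\<integral>\<^sup>+w. ennreal ((norm (X t w - X' t w))\<^sup>2) \<partial>M) = (\<integral>\<^sup>+w. (\<Sum>i\<in>UNIV. ennreal ((norm (X t w $ i - X' t w $ i))\<^sup>2)) \<partial>M)"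
      by (intro nn_integral_cong) (simp add: norm_vec_sq[of "X t _ - X' t _"])
    also have "\<dots> = (\<Sum>i\<in>UNIV. \<integral>\<^sup>+w. ennreal ((norm (X t w $ i - X' t w $ i))\<^sup>2) \<partial>M)"
      using measurable_compose[OF Xm(1) borel_measurable_nth] measurable_compose[OF Xm(2) borel_measurable_nth]
      by (intro nn_integral_sum) simp
    also have "\<dots> = (\<Sum>i\<in>UNIV. L2dist M (\<lambda>w. X t w $ i) (\<lambda>w. X' t w $ i))" by (simp add: L2dist_def)
    also have "\<dots> \<le> (\<Sum>i\<in>UNIV. 9 * procdist (\<lambda>s w. indicator {0..t} s *\<^sub>R (\<eta> t s $ i)) (\<lambda>s w. indicator {0..t} s *\<^sub>R (\<eta>' t s $ i)))"
      using elim by (intro sum_mono ito_ineq) auto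
    also have "\<dots> = (\<Sum>i\<in>UNIV. 9 * (\<integral>\<^sup>+s. ennreal ((norm (R i s))\<^sup>2) \<partial>\<mu>T))"
      unfolding procdist_def R_def[symmetric] by (intro sum.cong refl) (simp add: emeasure_space_1 nn_integral_interval_measure_T)
    also have "\<dots> = (\<integral>\<^sup>+s. 9 * (\<Sum>i\<in>UNIV. ennreal ((norm (R i s))\<^sup>2)) \<partial>\<mu>T)"
      by (simp add: sum_distrib_left[symmetric] nn_integral_cmult nn_integral_sum del: sum_ennreal)
    also have "\<dots> = (\<integral>\<^sup>+s. 9 * ennreal ((norm (lower_kernel T \<eta> (t, s) - lower_kernel T \<eta>' (t, s)))\<^sup>2) \<partial>\<mu>T)"
    proof (rule nn_integral_cong_AE)
      \<comment> \<open>At \<open>s = t\<close> the indicator of \<open>{0..t}\<close> is 1, while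
        the strict triangle gives 0; a single point is null.\<close>
      have "AE s in lborel. s \<noteq> t" by (rule AE_lborel_singleton)
      then have "AE s in lborel. 0 < (indicator {0..T} s :: ennreal) \<longrightarrow> s \<noteq> t \<and> s \<in> {0..T}"
        by eventually_elim (auto simp: indicator_def)
      then have "AE s in \<mu>T. s \<noteq> t \<and> s \<in> {0..T}" unfolding interval_measure_T_def by (subst AE_density) auto
      then show "AE s in \<mu>T. 9 * (\<Sum>i\<in>UNIV. ennreal ((norm (R i s))\<^sup>2)) = 9 * ennreal ((norm (lower_kernel T \<eta> (t, s) - lower_kernel T \<eta>' (t, s)))\<^sup>2)"
      proof eventually_elim
        case (elim s)
        then show ?case using \<open>t \<in> {0..T} \<and> _\<close>
          by (cases "s < t") (auto simp: R_def lower_kernel_def norm_vec_sq[of "_ - _ :: real ^ 'd ^ 'd"])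
      qed
    qed
    finally show ?case .
  qed
  also have "\<dots> = 9 * (\<integral>\<^sup>+t. (\<integral>\<^sup>+s. ennreal ((norm (lower_kernel T \<eta> (t, s) - lower_kernel T \<eta>' (t, s)))\<^sup>2) \<partial>\<mu>T) \<partial>\<mu>T)"
    using sm by (simp add: nn_integral_cmult)
  also have "\<dots> = 9 * L2dist (square_measure T) (lower_kernel T \<eta>) (lower_kernel T \<eta>')"
    unfolding L2dist_def square_measure_eq by (subst TM.M1.nn_integral_fst[OF sm]) (rule refl)
  finally show ?thesis .
qed

lemma lower_kernel_step: "N > 0 \<Longrightarrow> lower_kernel T (step_kernel T N A) = (\<lambda>p. step_kernel T N A (fst p) (snd p))"
proof (rule ext)
  fix p assume N: "N > 0"
  show "lower_kernel T (step_kernel T N A) p = step_kernel T N A (fst p) (snd p)"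
  proof (cases "fst p \<in> {0<..T} \<and> snd p \<in> {0<..T}")
    case False
    then have "step_kernel T N A (fst p) (snd p) = 0" by (intro step_kernel_outside[OF T_pos]) auto
    then show ?thesis by (simp add: lower_kernel_def)
  next
    case True
    obtain j where j: "j < N" "fst p \<in> grid_cell T N j" using grid_cell_exists[OF T_pos N] True by blast
    obtain k where k: "k < N" "snd p \<in> grid_cell T N k" using grid_cell_exists[OF T_pos N] True by blast
    show ?thesis
    proof (cases "k < j")
      case True
      then have "T * real (Suc k) / real N \<le> T * real j / real N" using grid_mono[of "Suc k" j N] by simp
      then have "snd p < fst p" using j k unfolding grid_cell_def by auto
      then show ?thesis using \<open>fst p \<in> {0<..T} \<and> snd p \<in> {0<..T}\<close> by (cases p) (auto simp: lower_kernel_def)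
    next
      case False
      then have "step_kernel T N A (fst p) (snd p) = 0" using step_kernel_eval[OF T_pos N j(2,1) k(2), of A] by simp
      then show ?thesis by (simp add: lower_kernel_def)
    qed
  qed
qed

end

text \<open>The integrals are summable, so the series of the functions is finite almost everywhere
  and its terms tend to 0. This turns every mean square rate of the form \<open>(1/4) ^ n\<close>
  into almost sure convergence of the whole sequence.\<close>

lemma AE_tendsto_zero:
  assumes f: "\<And>n::nat. f n \<in> borel_measurable M" and le: "\<And>n. (\<integral>\<^sup>+x. f n x \<partial>M) \<le> ennreal ((1/4) ^ n)"
  shows "AE x in M. (\<lambda>n. f n x) \<longlonglongrightarrow> (0::ennreal)"
proof -
  have "(\<integral>\<^sup>+x. (\<Sum>n. f n x) \<partial>M) = (\<Sum>n. \<integral>\<^sup>+x. f n x \<partial>M)" using f by (rule nn_integral_suminf)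
  also have "\<dots> \<le> (\<Sum>n. ennreal ((1/4) ^ n))" using le by (intro suminf_le) auto
  also have "\<dots> < \<infinity>" by (subst suminf_ennreal2) (auto intro!: summable_geometric)
  finally have "(\<integral>\<^sup>+x. (\<Sum>n. f n x) \<partial>M) \<noteq> \<infinity>" by simp
  then have "AE x in M. (\<Sum>n. f n x) \<noteq> \<infinity>" using f by (intro nn_integral_PInf_AE) auto
  then show ?thesis
  proof eventually_elim
    case (elim x)
    have fin: "f n x \<noteq> \<top>" for n
      using ennreal_le_suminf[of "\<lambda>n. f n x" n] elim by (auto simp: top_unique)
    define g where "g n = enn2real (f n x)" for n
    have g: "f n x = ennreal (g n)" "0 \<le> g n" for n using fin[of n] by (auto simp: g_def less_top)
    have "summable g" using elim g by (intro summable_suminf_not_top) auto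
    then have "g \<longlonglongrightarrow> 0" by (rule summable_LIMSEQ_zero)
    then have "(\<lambda>n. ennreal (g n)) \<longlonglongrightarrow> ennreal 0" by (rule tendsto_ennrealI)
    then show ?case using g by simp
  qed
qed

section \<open>Existence of the iterated integral and of the drift path\<close>

context wiener_setup
begin

lemma procdist_deterministic: "procdist (\<lambda>s w. a s) (\<lambda>s w. b s) = (\<integral>\<^sup>+s\<in>{0..T}. ennreal ((norm (a s - b s))\<^sup>2) \<partial>lborel)"
  unfolding procdist_def by (simp add: emeasure_space_1)

lemma jm_deterministic: "a \<in> borel_measurable borel \<Longrightarrow> jm (\<lambda>s w. a s)"
  unfolding jm_def by (simp add: case_prod_beta')

lemma jm_section:
  assumes "jm X"
  shows "X t \<in> borel_measurable M" "w \<in> space M \<Longrightarrow> (\<lambda>s. X s w) \<in> borel_measurable borel"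
  using assms measurable_Pair2[of "\<lambda>(s, w). X s w" \<mu>T M borel t] measurable_Pair1[of "\<lambda>(s, w). X s w" \<mu>T M borel w] by (auto simp: jm_TM)

lemma AE_\<mu>T: "(AE t in \<mu>T. P t) \<longleftrightarrow> (AE t in lborel. t \<in> {0..T} \<longrightarrow> P t)"
  unfolding interval_measure_T_def by (subst AE_density) (auto simp: indicator_def)

text \<open>For step kernels the process and the iterated integral are explicit. Both form Cauchy
  sequences by the continuity estimates, and their limits are related by \<open>ito_closed\<close>.
  What remains is that the limit process has the prescribed rows for almost every
  \<open>t\<close>.\<close>

theorem wint_exists:
  fixes \<eta> :: "real \<Rightarrow> real \<Rightarrow> real ^ 'd ^ 'd"
  assumes m: "lower_kernel T \<eta> \<in> borel_measurable borel"
    and sq: "(\<integral>\<^sup>+p. ennreal ((norm (lower_kernel T \<eta> p))\<^sup>2) \<partial>square_measure T) < \<infinity>"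
    and row: "\<And>t i. t \<in> {0..T} \<Longrightarrow> (\<lambda>s. indicator {0..t} s *\<^sub>R (\<eta> t s $ i)) \<in> borel_measurable borel"
  shows "\<exists>X Q. wint_process T \<eta> X \<and> has_ito_integral T X Q"
proof -
  have app: "step_approx T (lower_kernel T \<eta>)"
    by (rule step_approx_L2[OF T_pos m _ sq]) (auto simp: lower_kernel_def)
  \<comment> \<open>The margin 400 pays for the losses: a factor 4 for comparing two approximants,
    which leaves 1/100, then 9 for the process and once more 9 for the iterated integral, in total
    81/100.\<close>
  have "\<exists>N A. N > 0 \<and> L2dist (square_measure T) (lower_kernel T \<eta>) (\<lambda>p. step_kernel T N A (fst p) (snd p)) < ennreal ((1/4) ^ n / 400)" for n
    using app unfolding step_approx_def by simp
  then obtain N A where N: "\<And>n. N n > 0"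
    and NA: "\<And>n. L2dist (square_measure T) (lower_kernel T \<eta>) (\<lambda>p. step_kernel T (N n) (A n) (fst p) (snd p)) < ennreal ((1/4) ^ n / 400)"
    by metis
  define K where "K n p = step_kernel T (N n) (A n) (fst p) (snd p)" for n p
  have lk: "lower_kernel T (step_kernel T (N n) (A n)) = K n" for n using lower_kernel_step[OF N, of n "A n"] by (simp add: K_def[abs_def])
  have Km[measurable]: "K n \<in> borel_measurable borel" for n unfolding K_def by measurable
  note [measurable] = m
  have four: "2 * ennreal x + 2 * ennreal x = ennreal (4 * x)" if "x \<ge> 0" for x
  proof -
    have "ennreal (4 * x) = ennreal (2 * x + 2 * x)" by simp
    also have "\<dots> = ennreal (2 * x) + ennreal (2 * x)" using that by (intro ennreal_plus) auto
    finally show ?thesis using ennreal_numeral_mult[OF that] by simp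
  qed
  have dK: "L2dist (square_measure T) (K n) (K k) \<le> ennreal ((1/4) ^ n / 100)" if "n \<le> k" for n k
  proof -
    have "L2dist (square_measure T) (K n) (K k) \<le> 2 * L2dist (square_measure T) (K n) (lower_kernel T \<eta>) + 2 * L2dist (square_measure T) (lower_kernel T \<eta>) (K k)"
      by (rule L2dist_triangle) measurable
    also have "\<dots> \<le> 2 * ennreal ((1/4) ^ n / 400) + 2 * ennreal ((1/4) ^ n / 400)"
    proof (intro add_mono mult_left_mono)
      show "L2dist (square_measure T) (K n) (lower_kernel T \<eta>) \<le> ennreal ((1/4) ^ n / 400)"
        using NA[of n] L2dist_commute[of "square_measure T" "K n" "lower_kernel T \<eta>"] unfolding K_def[abs_def] by simp
      have "L2dist (square_measure T) (lower_kernel T \<eta>) (K k) \<le> ennreal ((1/4) ^ k / 400)" using NA[of k] unfolding K_def[abs_def] by simp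
      also have "\<dots> \<le> ennreal ((1/4) ^ n / 400)" using that by (intro ennreal_leI divide_right_mono power_decreasing) auto
      finally show "L2dist (square_measure T) (lower_kernel T \<eta>) (K k) \<le> ennreal ((1/4) ^ n / 400)" .
    qed auto
    also have "\<dots> = ennreal (4 * ((1/4) ^ n / 400))" by (rule four) simp
    also have "4 * ((1/4) ^ n / 400) = (1/4::real) ^ n / 100" by simp
    finally show ?thesis .
  qed
  define Xn where "Xn n = step_process (N n) (A n)" for n
  define Qn where "Qn n = step_q (N n) (A n)" for n
  have ito: "has_ito_integral T (Xn n) (Qn n)" for n unfolding Xn_def Qn_def by (rule step_process_has_ito[OF N])
  have jmn: "jm (Xn n)" "Qn n \<in> borel_measurable M" for n using ito[of n] unfolding has_ito_iff by auto
  have nine: "9 * ennreal x = ennreal (9 * x)" if "x \<ge> 0" for x using ennreal_numeral_mult[OF that] by simp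
  have dX: "procdist (Xn n) (Xn k) \<le> ennreal (9 * ((1/4) ^ n / 100))" if "n \<le> k" for n k
  proof -
    have "procdist (Xn n) (Xn k) \<le> 9 * L2dist (square_measure T) (K n) (K k)"
      unfolding Xn_def lk[symmetric] by (rule wint_estimate[OF step_wint[OF N] step_wint[OF N]]) (simp_all add: lk)
    also have "\<dots> \<le> 9 * ennreal ((1/4) ^ n / 100)" by (intro mult_left_mono dK that) auto
    finally show ?thesis using nine[of "(1/4) ^ n / 100"] by simp
  qed
  have cX: "L2dist (\<mu>T \<Otimes>\<^sub>M M) (\<lambda>(s, w). Xn n s w) (\<lambda>(s, w). Xn k s w) \<le> ennreal ((1/4) ^ n)" if "n \<le> k" for n k
  proof -
    have "ennreal (9 * ((1/4) ^ n / 100)) \<le> ennreal ((1/4) ^ n)" by (intro ennreal_leI) simp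
    with dX[OF that] show ?thesis unfolding procdist_eq[OF jmn(1) jmn(1)] by (rule order_trans)
  qed
  have fm: "(\<lambda>(s, w). Xn n s w) \<in> borel_measurable (\<mu>T \<Otimes>\<^sub>M M)" for n using jmn(1)[of n] unfolding jm_TM .
  obtain Xp where Xp: "Xp \<in> borel_measurable (\<mu>T \<Otimes>\<^sub>M M)" "\<And>n. L2dist (\<mu>T \<Otimes>\<^sub>M M) (\<lambda>(s, w). Xn n s w) Xp \<le> ennreal ((1/4) ^ n)"
    by (rule L2_complete[OF fm cX]) (assumption, rule that)
  define X where "X s w = Xp (s, w)" for s w
  have jmX: "jm X" using Xp(1) unfolding jm_TM X_def by simp
  have pX: "procdist (Xn n) X \<le> ennreal ((1/4) ^ n)" for n
    unfolding procdist_eq[OF jmn(1) jmX] X_def case_prod_eta by (rule Xp)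
  have cQ: "L2dist M (Qn n) (Qn k) \<le> ennreal ((1/4) ^ n)" if "n \<le> k" for n k
  proof -
    have cQ: "L2dist M (Qn n) (Qn k) \<le> 9 * procdist (Xn n) (Xn k)" by (rule ito_ineq[OF ito ito])
    also have "\<dots> \<le> 9 * ennreal (9 * ((1/4) ^ n / 100))" by (intro mult_left_mono dX that) auto
    also have "\<dots> = ennreal (9 * (9 * ((1/4) ^ n / 100)))" by (rule nine) simp
    also have "\<dots> \<le> ennreal ((1/4) ^ n)" by (intro ennreal_leI) simp
    finally show ?thesis .
  qed
  obtain Q where Q: "Q \<in> borel_measurable M" "\<And>n. L2dist M (Qn n) Q \<le> ennreal ((1/4) ^ n)"
    by (rule L2_complete[OF jmn(2) cQ]) (assumption, rule that)
  have z: "(\<lambda>n. ennreal ((1/4) ^ n)) \<longlonglongrightarrow> 0"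
  proof -
    have "(\<lambda>n. ennreal ((1/4) ^ n)) \<longlonglongrightarrow> ennreal 0" by (intro tendsto_ennrealI LIMSEQ_power_zero) simp
    then show ?thesis by simp
  qed
  have hito: "has_ito_integral T X Q"
    by (rule ito_closed[OF ito jmX Q(1) tendsto_0_le_ennreal[OF pX z] tendsto_0_le_ennreal[OF Q(2) z]])
  interpret F: finite_measure \<mu>T by (rule finite_interval_measure_T)
  interpret FF: pair_sigma_finite \<mu>T \<mu>T ..
  have f1m: "(\<lambda>(t, w). ennreal ((norm (Xn n t w - X t w))\<^sup>2)) \<in> borel_measurable (\<mu>T \<Otimes>\<^sub>M M)" for n
    using jmn(1)[of n] jmX unfolding jm_TM by (simp add: case_prod_beta')
  have a1: "AE t in \<mu>T. (\<lambda>n. \<integral>\<^sup>+w. ennreal ((norm (Xn n t w - X t w))\<^sup>2) \<partial>M) \<longlonglongrightarrow> 0"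
  proof (rule AE_tendsto_zero)
    fix n
    show "(\<lambda>t. \<integral>\<^sup>+w. ennreal ((norm (Xn n t w - X t w))\<^sup>2) \<partial>M) \<in> borel_measurable \<mu>T"
      using borel_measurable_nn_integral_fst[OF f1m[of n]] by simp
    show "(\<integral>\<^sup>+t. (\<integral>\<^sup>+w. ennreal ((norm (Xn n t w - X t w))\<^sup>2) \<partial>M) \<partial>\<mu>T) \<le> ennreal ((1/4) ^ n)"
      using pX[of n] nn_integral_fst[OF f1m[of n]] unfolding procdist_eq[OF jmn(1) jmX] L2dist_def by (simp add: case_prod_beta')
  qed
  have f2m: "(\<lambda>p. ennreal ((norm (K n p - lower_kernel T \<eta> p))\<^sup>2)) \<in> borel_measurable (\<mu>T \<Otimes>\<^sub>M \<mu>T)" for n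
    unfolding square_measure_eq[symmetric] by measurable
  have a2: "AE t in \<mu>T. (\<lambda>n. \<integral>\<^sup>+s. ennreal ((norm (K n (t, s) - lower_kernel T \<eta> (t, s)))\<^sup>2) \<partial>\<mu>T) \<longlonglongrightarrow> 0"
  proof (rule AE_tendsto_zero)
    fix n
    show "(\<lambda>t. \<integral>\<^sup>+s. ennreal ((norm (K n (t, s) - lower_kernel T \<eta> (t, s)))\<^sup>2) \<partial>\<mu>T) \<in> borel_measurable \<mu>T"
      using TM.M1.borel_measurable_nn_integral_fst[OF f2m[of n]] by simp
    have "(\<integral>\<^sup>+t. (\<integral>\<^sup>+s. ennreal ((norm (K n (t, s) - lower_kernel T \<eta> (t, s)))\<^sup>2) \<partial>\<mu>T) \<partial>\<mu>T) = L2dist (square_measure T) (K n) (lower_kernel T \<eta>)"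
      unfolding L2dist_def square_measure_eq by (subst TM.M1.nn_integral_fst[OF f2m]) (rule refl)
    also have "\<dots> \<le> ennreal ((1/4) ^ n / 400)" using NA[of n] L2dist_commute[of "square_measure T" "K n" "lower_kernel T \<eta>"] unfolding K_def[abs_def] by simp
    also have "\<dots> \<le> ennreal ((1/4) ^ n)" by (intro ennreal_leI) simp
    finally show "(\<integral>\<^sup>+t. (\<integral>\<^sup>+s. ennreal ((norm (K n (t, s) - lower_kernel T \<eta> (t, s)))\<^sup>2) \<partial>\<mu>T) \<partial>\<mu>T) \<le> ennreal ((1/4) ^ n)" .
  qed
  \<comment> \<open>The rates are summable also after integration over \<open>t\<close>, so for
    almost every \<open>t\<close> the rows of the kernels and the values of the processes converge
    together, and \<open>ito_closed\<close> identifies the limit row.\<close>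
  have "AE t in \<mu>T. t \<in> {0..T} \<longrightarrow> (\<forall>i. has_ito_integral T (\<lambda>s w. indicator {0..t} s *\<^sub>R (\<eta> t s $ i)) (\<lambda>w. X t w $ i))"
    using a1 a2
  proof eventually_elim
    case (elim t)
    show ?case
    proof (intro impI allI)
      fix i assume t: "t \<in> {0..T}"
      show "has_ito_integral T (\<lambda>s w. indicator {0..t} s *\<^sub>R (\<eta> t s $ i)) (\<lambda>w. X t w $ i)"
      proof (rule ito_closed)
        show "has_ito_integral T (\<lambda>s w. indicator {0..t} s *\<^sub>R (step_kernel T (N n) (A n) t s $ i)) (\<lambda>w. Xn n t w $ i)" for n
          unfolding Xn_def by (rule step_row_ito[OF N t])
        show "jm (\<lambda>s w. indicator {0..t} s *\<^sub>R (\<eta> t s $ i))" by (intro jm_deterministic row t)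
        show "(\<lambda>w. X t w $ i) \<in> borel_measurable M" using measurable_compose[OF jm_section(1)[OF jmX] borel_measurable_nth] .
        show "(\<lambda>n. L2dist M (\<lambda>w. Xn n t w $ i) (\<lambda>w. X t w $ i)) \<longlonglongrightarrow> 0"
        proof (rule tendsto_0_le_ennreal[OF _ elim(1)])
          fix n
          show "L2dist M (\<lambda>w. Xn n t w $ i) (\<lambda>w. X t w $ i) \<le> (\<integral>\<^sup>+w. ennreal ((norm (Xn n t w - X t w))\<^sup>2) \<partial>M)"
            unfolding L2dist_def
          proof (intro nn_integral_mono ennreal_leI power_mono)
            fix w show "norm (Xn n t w $ i - X t w $ i) \<le> norm (Xn n t w - X t w)"
              using component_le_norm_cart[of "Xn n t w - X t w" i] by simp
          qed auto
        qed
        show "(\<lambda>n. procdist (\<lambda>s w. indicator {0..t} s *\<^sub>R (step_kernel T (N n) (A n) t s $ i)) (\<lambda>s w. indicator {0..t} s *\<^sub>R (\<eta> t s $ i))) \<longlonglongrightarrow> 0"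
        proof (rule tendsto_0_le_ennreal[OF _ elim(2)])
          fix n
          have "AE s in lborel. s \<noteq> t" by (rule AE_lborel_singleton)
          then have ae: "AE s in \<mu>T. s \<noteq> t \<and> s \<in> {0..T}" unfolding AE_\<mu>T by eventually_elim auto
          have rm: "(\<lambda>s. indicator {0..t} s *\<^sub>R (step_kernel T (N n) (A n) t s $ i)) \<in> borel_measurable borel"
            using step_row_ito[OF N t, of n "A n" i] not_empty jm_section(2) unfolding has_ito_iff by blast
          have "procdist (\<lambda>s w. indicator {0..t} s *\<^sub>R (step_kernel T (N n) (A n) t s $ i)) (\<lambda>s w. indicator {0..t} s *\<^sub>R (\<eta> t s $ i))
             = (\<integral>\<^sup>+s. ennreal ((norm (indicator {0..t} s *\<^sub>R (step_kernel T (N n) (A n) t s $ i) - indicator {0..t} s *\<^sub>R (\<eta> t s $ i)))\<^sup>2) \<partial>\<mu>T)"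
            unfolding procdist_deterministic using rm row[OF t, of i] by (subst nn_integral_interval_measure_T) auto
          also have "\<dots> \<le> (\<integral>\<^sup>+s. ennreal ((norm (K n (t, s) - lower_kernel T \<eta> (t, s)))\<^sup>2) \<partial>\<mu>T)"
          proof (rule nn_integral_mono_AE, use ae in eventually_elim)
            case (elim s)
            show ?case
            proof (intro ennreal_leI power_mono)
              show "norm (indicator {0..t} s *\<^sub>R (step_kernel T (N n) (A n) t s $ i) - indicator {0..t} s *\<^sub>R (\<eta> t s $ i)) \<le> norm (K n (t, s) - lower_kernel T \<eta> (t, s))"
              proof (cases "s < t")
                case True
                then have "indicator {0..t} s *\<^sub>R (step_kernel T (N n) (A n) t s $ i) - indicator {0..t} s *\<^sub>R (\<eta> t s $ i) = (K n (t, s) - lower_kernel T \<eta> (t, s)) $ i"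
                  using elim t by (simp add: K_def lower_kernel_def)
                then show ?thesis by (simp only: Finite_Cartesian_Product.norm_nth_le)
              next
                case False
                then have "indicator {0..t} s = (0::real)" using elim by auto
                then show ?thesis by simp
              qed
            qed simp
          qed
          finally show "procdist (\<lambda>s w. indicator {0..t} s *\<^sub>R (step_kernel T (N n) (A n) t s $ i)) (\<lambda>s w. indicator {0..t} s *\<^sub>R (\<eta> t s $ i))
             \<le> (\<integral>\<^sup>+s. ennreal ((norm (K n (t, s) - lower_kernel T \<eta> (t, s)))\<^sup>2) \<partial>\<mu>T)" .
        qed
      qed
    qed
  qed
  then have "wint_process T \<eta> X"
    unfolding wint_process_def M_wiener[symmetric] AE_\<mu>T using jmX unfolding jm_def by (auto elim: eventually_mono)
  then show ?thesis using hito by blast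
qed

lemma procdist_zero_AE:
  assumes jm: "jm X" and fin: "procdist X (\<lambda>_ _. 0) < \<infinity>"
  shows "AE w in M. set_integrable lborel {0..T} (\<lambda>s. X s w)"
proof -
  have "(\<lambda>(s, w). ennreal ((norm (X s w))\<^sup>2)) \<in> borel_measurable (\<mu>T \<Otimes>\<^sub>M M)"
    using jm unfolding jm_TM by (simp add: case_prod_beta')
  from measurable_pair_swap[OF this] have sw: "(\<lambda>(w, s). ennreal ((norm (X s w))\<^sup>2)) \<in> borel_measurable (M \<Otimes>\<^sub>M \<mu>T)"
    by (simp add: case_prod_beta' comp_def prod.swap_def)
  interpret F: finite_measure \<mu>T by (rule finite_interval_measure_T)
  have m: "(\<lambda>w. \<integral>\<^sup>+s. ennreal ((norm (X s w))\<^sup>2) \<partial>\<mu>T) \<in> borel_measurable M"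
    using TM.M1.borel_measurable_nn_integral_fst[OF sw] by simp
  have "(\<integral>\<^sup>+w. (\<integral>\<^sup>+s. ennreal ((norm (X s w))\<^sup>2) \<partial>\<mu>T) \<partial>M) = procdist X (\<lambda>_ _. 0)"
    unfolding procdist_def using jm_section(2)[OF jm] by (intro nn_integral_cong) (simp add: nn_integral_interval_measure_T)
  then have "AE w in M. (\<integral>\<^sup>+s. ennreal ((norm (X s w))\<^sup>2) \<partial>\<mu>T) \<noteq> \<infinity>" using fin by (intro nn_integral_PInf_AE m) auto
  then show ?thesis using AE_space
  proof eventually_elim
    case (elim w)
    have Xm[measurable]: "(\<lambda>s. X s w) \<in> borel_measurable borel" using jm_section(2)[OF jm] elim by simp
    have "(\<integral>\<^sup>+s. ennreal (norm (indicator {0..T} s *\<^sub>R X s w)) \<partial>lborel) = (\<integral>\<^sup>+s\<in>{0..T}. ennreal (norm (X s w)) \<partial>lborel)"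
      by (intro nn_integral_cong) (auto simp: indicator_def)
    also have "\<dots> = (\<integral>\<^sup>+s. ennreal (norm (X s w)) \<partial>\<mu>T)" by (simp add: nn_integral_interval_measure_T)
    also have "\<dots> \<le> (\<integral>\<^sup>+s. 1 + ennreal ((norm (X s w))\<^sup>2) \<partial>\<mu>T)"
    proof (intro nn_integral_mono)
      fix s
      have "norm (X s w) \<le> 1 + (norm (X s w))\<^sup>2"
        using zero_le_power2[of "norm (X s w) - 1"] zero_le_power2[of "norm (X s w)"] norm_ge_zero[of "X s w"] unfolding power2_diff by (simp, linarith)
      then have "ennreal (norm (X s w)) \<le> ennreal (1 + (norm (X s w))\<^sup>2)" by (rule ennreal_leI)
      also have "\<dots> = 1 + ennreal ((norm (X s w))\<^sup>2)" by (subst ennreal_plus) auto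
      finally show "ennreal (norm (X s w)) \<le> 1 + ennreal ((norm (X s w))\<^sup>2)" .
    qed
    also have "\<dots> = emeasure \<mu>T UNIV + (\<integral>\<^sup>+s. ennreal ((norm (X s w))\<^sup>2) \<partial>\<mu>T)" by (subst nn_integral_add) auto
    also have "\<dots> < \<infinity>"
    proof -
      have "emeasure \<mu>T UNIV < \<top>" using F.emeasure_finite[of UNIV] unfolding infinity_ennreal_def less_top .
      then show ?thesis using elim by (simp add: less_top)
    qed
    finally show ?case unfolding set_integrable_def by (intro integrableI_bounded) auto
  qed
qed

text \<open>Where \<open>X\<close> is not integrable in time the path is set to 0. So
  \<open>G\<close> maps every path into \<open>Wsp T\<close>, as measurability into
  \<open>Wsig T\<close> requires, while the integral formula is claimed almost surely.\<close>

theorem G_exists: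
  assumes jm: "jm X" and fin: "procdist X (\<lambda>_ _. 0) < \<infinity>"
  shows "\<exists>G \<in> measurable M (Wsig T). AE w in M. \<forall>t\<in>{0..T}. G w t = - (LINT s:{0..t}|lborel. X s w)"
proof -
  define good where "good w \<longleftrightarrow> (\<integral>\<^sup>+s. ennreal (norm (X s w)) \<partial>\<mu>T) < \<infinity>" for w
  define G where "G w t = (if good w \<and> t \<in> {0..T} then - (LINT s:{0..t}|lborel. X s w) else 0)" for w t
  have swap: "(\<lambda>(w, s). X s w) \<in> borel_measurable (M \<Otimes>\<^sub>M lborel)"
    using measurable_pair_swap[OF jm[unfolded jm_def]] by (simp add: case_prod_beta')
  have "(\<lambda>(w, s). X s w) \<in> borel_measurable (M \<Otimes>\<^sub>M \<mu>T)"
    using swap by (simp cong: measurable_cong_sets sets_pair_measure_cong)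
  then have "(\<lambda>(w, s). ennreal (norm (X s w))) \<in> borel_measurable (M \<Otimes>\<^sub>M \<mu>T)" by (simp add: case_prod_beta')
  from TM.M1.borel_measurable_nn_integral_fst[OF this] have gm: "(\<lambda>w. \<integral>\<^sup>+s. ennreal (norm (X s w)) \<partial>\<mu>T) \<in> borel_measurable M" by simp
  have [measurable]: "Measurable.pred M good" unfolding good_def using gm by simp
  have int: "set_integrable lborel {0..T} (\<lambda>s. X s w) \<longleftrightarrow> good w" if w: "w \<in> space M" for w
  proof -
    have Xm[measurable]: "(\<lambda>s. X s w) \<in> borel_measurable borel" using jm_section(2)[OF jm w] .
    have "(\<integral>\<^sup>+s. ennreal (norm (indicator {0..T} s *\<^sub>R X s w)) \<partial>lborel) = (\<integral>\<^sup>+s. ennreal (norm (X s w)) \<partial>\<mu>T)"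
      by (subst nn_integral_interval_measure_T) (auto intro!: nn_integral_cong simp: indicator_def)
    then show ?thesis unfolding good_def set_integrable_def integrable_iff_bounded by simp
  qed
  have "G w \<in> Wsp T" if w: "w \<in> space M" for w
  proof (cases "good w")
    case False then show ?thesis by (simp add: G_def Wsp_def)
  next
    case True
    then have i: "set_integrable lborel {0..T} (\<lambda>s. X s w)" using int[OF w] by simp
    have eq: "G w t = - integral {0..t} (\<lambda>s. X s w)" if "t \<in> {0..T}" for t
    proof -
      have "set_integrable lborel {0..t} (\<lambda>s. X s w)" using i that by (rule_tac set_integrable_subset) auto
      then show ?thesis using True that by (simp add: G_def set_borel_integral_eq_integral)
    qed
    have "continuous_on {0..T} (\<lambda>t. - integral {0..t} (\<lambda>s. X s w))"
      by (intro continuous_on_minus indefinite_integral_continuous_1 set_borel_integral_eq_integral i)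
    then have "continuous_on {0..T} (G w)" by (subst continuous_on_cong[OF refl eq]) auto
    moreover have "G w 0 = 0" using eq[of 0] T_pos by simp
    moreover have "\<forall>t. t \<notin> {0..T} \<longrightarrow> G w t = 0" by (auto simp: G_def)
    ultimately show ?thesis by (simp add: Wsp_def)
  qed
  moreover have "(\<lambda>w. G w t) \<in> borel_measurable M" for t
  proof -
    have "(\<lambda>w. LINT s|lborel. (\<lambda>(w, s). indicator {0..t} s *\<^sub>R X s w) (w, s)) \<in> borel_measurable M"
      using swap by (intro lborel.borel_measurable_lebesgue_integral) (simp add: case_prod_beta')
    then have [measurable]: "(\<lambda>w. LINT s:{0..t}|lborel. X s w) \<in> borel_measurable M" by (simp add: set_lebesgue_integral_def)
    show ?thesis unfolding G_def by measurable
  qed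
  ultimately have "G \<in> measurable M (Wsig T)" unfolding Wsig_def
    by (intro measurable_restrict_space2 measurable_PiM_single') (auto simp: space_PiM)
  moreover have "AE w in M. \<forall>t\<in>{0..T}. G w t = - (LINT s:{0..t}|lborel. X s w)"
    using procdist_zero_AE[OF jm fin] AE_space by eventually_elim (auto simp: G_def int)
  ultimately show ?thesis by blast
qed

end

section \<open>The discrete Girsanov formula\<close>

text \<open>The parameter \<open>h\<close> is the variance of each coordinate; it will be the length
  of a grid cell.\<close>

definition gauss_density :: "real \<Rightarrow> 'a::euclidean_space \<Rightarrow> real" where
  "gauss_density h x = (\<Prod>b\<in>Basis. normal_density 0 (sqrt h) (x \<bullet> b))"

definition gauss :: "real \<Rightarrow> 'a::euclidean_space measure" where
  "gauss h = density lborel (\<lambda>x. ennreal (gauss_density h x))"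

lemma gauss_density_measurable[measurable]: "gauss_density h \<in> borel_measurable borel"
  unfolding gauss_density_def by measurable

lemma gauss_density_nonneg: "0 \<le> gauss_density h x"
  unfolding gauss_density_def by (intro prod_nonneg) auto

lemma sets_gauss[simp, measurable_cong]: "sets (gauss h) = sets borel"
  and space_gauss[simp]: "space (gauss h) = UNIV"
  by (auto simp: gauss_def)

lemma prob_space_gauss:
  assumes h: "h > 0"
  shows "prob_space (gauss h :: 'a::euclidean_space measure)"
proof (rule prob_spaceI)
  have one: "(\<integral>\<^sup>+x. ennreal (normal_density 0 (sqrt h) x) \<partial>lborel) = 1"
    using h by (subst nn_integral_eq_integral) (auto intro: integrable_normal_density)
  have "emeasure (gauss h :: 'a measure) UNIV = (\<integral>\<^sup>+x. ennreal (gauss_density h x) \<partial>(lborel::'a measure))"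
    unfolding gauss_def by (subst emeasure_density) auto
  also have "\<dots> = (\<integral>\<^sup>+x. (\<Prod>b\<in>Basis. ennreal (normal_density 0 (sqrt h) (x \<bullet> b))) \<partial>(lborel::'a measure))"
    unfolding gauss_density_def by (simp add: prod_ennreal)
  also have "\<dots> = (\<Prod>b\<in>(Basis::'a set). \<integral>\<^sup>+x. ennreal (normal_density 0 (sqrt h) x) \<partial>lborel)"
    by (rule nn_integral_lborel_prod) auto
  also have "\<dots> = 1" by (simp add: one)
  finally show "emeasure (gauss h :: 'a measure) (space (gauss h)) = 1" by simp
qed

lemma normal_char:
  assumes h: "h > 0"
  shows "(\<integral>x. normal_density 0 (sqrt h) x *\<^sub>R cis (c * x) \<partial>lborel) = complex_of_real (exp (- (h * c\<^sup>2) / 2))"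
proof -
  have s: "sqrt h > 0" using h by simp
  have "(\<integral>x. normal_density 0 (sqrt h) x *\<^sub>R cis (c * x) \<partial>lborel)
     = \<bar>sqrt h\<bar> *\<^sub>R (\<integral>x. normal_density 0 (sqrt h) (0 + sqrt h * x) *\<^sub>R cis (c * (0 + sqrt h * x)) \<partial>lborel)"
    using s by (intro lborel_integral_real_affine) auto
  also have "\<dots> = (\<integral>x. sqrt h *\<^sub>R (normal_density 0 (sqrt h) (sqrt h * x) *\<^sub>R cis (c * (sqrt h * x))) \<partial>lborel)"
    by (simp only: integral_scaleR_right abs_of_pos[OF s] add_0)
  also have "\<dots> = (\<integral>x. std_normal_density x *\<^sub>R cis ((c * sqrt h) * x) \<partial>lborel)"
  proof (intro Bochner_Integration.integral_cong refl)
    fix x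
    have "sqrt h * normal_density 0 (sqrt h) (sqrt h * x) = std_normal_density x"
      using h unfolding normal_density_def by (simp add: power_mult_distrib real_sqrt_mult field_simps)
    then show "sqrt h *\<^sub>R (normal_density 0 (sqrt h) (sqrt h * x) *\<^sub>R cis (c * (sqrt h * x))) = std_normal_density x *\<^sub>R cis ((c * sqrt h) * x)"
      by (simp add: mult.assoc flip: scaleR_scaleR)  (metis scaleR_scaleR)
  qed
  also have "\<dots> = (\<integral>x. cis ((c * sqrt h) * x) \<partial>std_normal_distribution)"
    by (subst integral_density) auto
  also have "\<dots> = complex_of_real (exp (- (c * sqrt h)\<^sup>2 / 2))" by (rule std_normal_char)
  finally show ?thesis using h by (simp add: power_mult_distrib mult.commute)
qed

lemma gauss_char:
  assumes h: "h > 0"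
  shows "(\<integral>x. cis (\<xi> \<bullet> x) \<partial>gauss h) = complex_of_real (exp (- (h * (\<xi> \<bullet> \<xi>)) / 2))"
proof -
  interpret product_sigma_finite "\<lambda>_::'a. lborel :: real measure"
    by (simp add: product_sigma_finite_def sigma_finite_lborel)
  have int: "integrable lborel (\<lambda>x. normal_density 0 (sqrt h) x *\<^sub>R cis (c * x))" for c
  proof (rule Bochner_Integration.integrable_bound)
    show "integrable lborel (normal_density 0 (sqrt h))" using h by (intro integrable_normal_density) simp
  qed auto
  have "(\<integral>x. cis (\<xi> \<bullet> x) \<partial>gauss h) = (\<integral>x. gauss_density h x *\<^sub>R cis (\<xi> \<bullet> x) \<partial>lborel)"
    unfolding gauss_def by (subst integral_density) (auto simp: gauss_density_nonneg)
  also have "\<dots> = (\<integral>f. gauss_density h (\<Sum>b\<in>Basis. f b *\<^sub>R b) *\<^sub>R cis (\<xi> \<bullet> (\<Sum>b\<in>Basis. f b *\<^sub>R b)) \<partial>Pi\<^sub>M Basis (\<lambda>_. lborel))"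
    by (subst lborel_eq, subst integral_distr) auto
  also have "\<dots> = (\<integral>f. (\<Prod>b\<in>Basis. normal_density 0 (sqrt h) (f b) *\<^sub>R cis ((\<xi> \<bullet> b) * f b)) \<partial>Pi\<^sub>M Basis (\<lambda>_. lborel))"
  proof (intro Bochner_Integration.integral_cong refl)
    fix f :: "'a \<Rightarrow> real"
    have "gauss_density h (\<Sum>b\<in>Basis. f b *\<^sub>R b) = (\<Prod>b\<in>(Basis::'a set). normal_density 0 (sqrt h) (f b))"
      unfolding gauss_density_def by (intro prod.cong refl) simp
    moreover have "cis (\<xi> \<bullet> (\<Sum>b\<in>Basis. f b *\<^sub>R b)) = (\<Prod>b\<in>Basis. cis ((\<xi> \<bullet> b) * f b))"
      by (simp add: inner_sum_right cis_sum mult.commute)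
    moreover have "(\<Prod>b\<in>F. p b) *\<^sub>R (\<Prod>b\<in>F. q b) = (\<Prod>b\<in>F. p b *\<^sub>R q b)" for p and q :: "'a \<Rightarrow> complex" and F
      by (induction F rule: infinite_finite_induct) (auto simp: scaleR_conv_of_real)
    ultimately show "gauss_density h (\<Sum>b\<in>Basis. f b *\<^sub>R b) *\<^sub>R cis (\<xi> \<bullet> (\<Sum>b\<in>Basis. f b *\<^sub>R b)) = (\<Prod>b\<in>Basis. normal_density 0 (sqrt h) (f b) *\<^sub>R cis ((\<xi> \<bullet> b) * f b))"
      by simp
  qed
  also have "\<dots> = (\<Prod>b\<in>Basis. \<integral>x. normal_density 0 (sqrt h) x *\<^sub>R cis ((\<xi> \<bullet> b) * x) \<partial>lborel)"
    by (rule product_integral_prod) (auto intro: int)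
  also have "\<dots> = complex_of_real (\<Prod>b\<in>Basis. exp (- (h * (\<xi> \<bullet> b)\<^sup>2) / 2))"
    by (simp add: normal_char[OF h])
  also have "(\<Prod>b\<in>Basis. exp (- (h * (\<xi> \<bullet> b)\<^sup>2) / 2)) = exp (- (h * (\<xi> \<bullet> \<xi>)) / 2)"
  proof -
    have "(\<Sum>b\<in>Basis. - (h * (\<xi> \<bullet> b)\<^sup>2) / 2) = - (h * (\<xi> \<bullet> \<xi>)) / 2"
      by (subst euclidean_inner[of \<xi> \<xi>]) (simp add: sum_distrib_left sum_negf sum_divide_distrib power2_eq_square)
    then show ?thesis by (simp flip: exp_sum)
  qed
  finally show ?thesis .
qed

text \<open>Completing the square coordinate by coordinate: at the point translated by
  \<open>h *\<^sub>R a\<close>, the density times the exponential is the density at the original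
  point. Translation invariance of Lebesgue measure does the rest. This is the Girsanov formula for
  a single cell.\<close>

lemma gauss_shift:
  fixes a :: "'a::euclidean_space"
  assumes h: "h > 0" and g[measurable]: "g \<in> borel_measurable borel"
  shows "(\<integral>\<^sup>+y. ennreal (exp (a \<bullet> y - h / 2 * (a \<bullet> a))) * g (y - h *\<^sub>R a) \<partial>gauss h) = (\<integral>\<^sup>+y. g y \<partial>gauss h)"
proof -
  have one: "normal_density 0 (sqrt h) (x + h * c) * exp (c * (x + h * c) - h / 2 * (c * c)) = normal_density 0 (sqrt h) x" for x c
  proof -
    have "- (x + h * c)\<^sup>2 / (2 * h) + (c * (x + h * c) - h / 2 * (c * c)) = - x\<^sup>2 / (2 * h)"
      using h by (simp add: field_simps power2_eq_square)
    then have "exp (- (x + h * c)\<^sup>2 / (2 * h)) * exp (c * (x + h * c) - h / 2 * (c * c)) = exp (- x\<^sup>2 / (2 * h))"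
      by (simp only: exp_add[symmetric])
    then show ?thesis using h unfolding normal_density_def by (simp add: mult.assoc)
  qed
  have dens: "gauss_density h (z + h *\<^sub>R a) * exp (a \<bullet> (z + h *\<^sub>R a) - h / 2 * (a \<bullet> a)) = gauss_density h z" for z
  proof -
    have "a \<bullet> (z + h *\<^sub>R a) - h / 2 * (a \<bullet> a) = (\<Sum>b\<in>Basis. (a \<bullet> b) * (z \<bullet> b + h * (a \<bullet> b)) - h / 2 * ((a \<bullet> b) * (a \<bullet> b)))"
      by (subst (1 2) euclidean_inner) (simp add: inner_add_left sum_subtractf sum_distrib_left)
    then have "exp (a \<bullet> (z + h *\<^sub>R a) - h / 2 * (a \<bullet> a)) = (\<Prod>b\<in>Basis. exp ((a \<bullet> b) * (z \<bullet> b + h * (a \<bullet> b)) - h / 2 * ((a \<bullet> b) * (a \<bullet> b))))"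
      by (simp add: exp_sum)
    then show ?thesis unfolding gauss_density_def by (simp add: prod.distrib[symmetric] inner_add_left one[simplified])
  qed
  have "(\<integral>\<^sup>+y. ennreal (exp (a \<bullet> y - h / 2 * (a \<bullet> a))) * g (y - h *\<^sub>R a) \<partial>gauss h)
     = (\<integral>\<^sup>+y. ennreal (gauss_density h y) * (ennreal (exp (a \<bullet> y - h / 2 * (a \<bullet> a))) * g (y - h *\<^sub>R a)) \<partial>lborel)"
    unfolding gauss_def by (subst nn_integral_density) auto
  also have "\<dots> = (\<integral>\<^sup>+y. ennreal (gauss_density h y) * (ennreal (exp (a \<bullet> y - h / 2 * (a \<bullet> a))) * g (y - h *\<^sub>R a)) \<partial>distr lborel borel ((+) (h *\<^sub>R a)))"
    by (simp add: lborel_distr_plus)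
  also have "\<dots> = (\<integral>\<^sup>+z. ennreal (gauss_density h (h *\<^sub>R a + z)) * (ennreal (exp (a \<bullet> (h *\<^sub>R a + z) - h / 2 * (a \<bullet> a))) * g (h *\<^sub>R a + z - h *\<^sub>R a)) \<partial>lborel)"
    by (subst nn_integral_distr) auto
  also have "\<dots> = (\<integral>\<^sup>+z. ennreal (gauss_density h z) * g z \<partial>lborel)"
  proof (intro nn_integral_cong)
    fix z
    have "ennreal (gauss_density h (h *\<^sub>R a + z)) * ennreal (exp (a \<bullet> (h *\<^sub>R a + z) - h / 2 * (a \<bullet> a))) = ennreal (gauss_density h z)"
      using dens[of z] by (simp add: ennreal_mult[symmetric] gauss_density_nonneg add.commute)
    then show "ennreal (gauss_density h (h *\<^sub>R a + z)) * (ennreal (exp (a \<bullet> (h *\<^sub>R a + z) - h / 2 * (a \<bullet> a))) * g (h *\<^sub>R a + z - h *\<^sub>R a)) = ennreal (gauss_density h z) * g z"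
      by (simp add: mult.assoc[symmetric])
  qed
  also have "\<dots> = (\<integral>\<^sup>+y. g y \<partial>gauss h)" unfolding gauss_def by (subst nn_integral_density) auto
  finally show ?thesis .
qed

section \<open>The triangular shear and its density\<close>

definition lin_drift :: "(nat \<Rightarrow> nat \<Rightarrow> real ^ 'd ^ 'd) \<Rightarrow> nat \<Rightarrow> (nat \<Rightarrow> real ^ 'd) \<Rightarrow> real ^ 'd" where
  "lin_drift A j x = (\<Sum>k<j. A j k *v x k)"

text \<open>The discrete counterpart, on increments, of adding \<open>Gfun\<close> to the path: over
  a cell of length \<open>h\<close> the drift accumulates to \<open>h\<close> times its value, with
  the minus sign of \<open>Gfun\<close>. Restriction to \<open>{..<n}\<close> keeps the values in
  the finite product space.\<close>

definition shear :: "real \<Rightarrow> (nat \<Rightarrow> nat \<Rightarrow> real ^ 'd ^ 'd) \<Rightarrow> nat \<Rightarrow> (nat \<Rightarrow> real ^ 'd) \<Rightarrow> nat \<Rightarrow> real ^ 'd" where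
  "shear h A n x = (\<lambda>j\<in>{..<n}. x j - h *\<^sub>R lin_drift A j x)"

text \<open>The Girsanov exponent: the discrete stochastic integral of the drift minus half of its
  energy.\<close>

definition log_density :: "real \<Rightarrow> (nat \<Rightarrow> nat \<Rightarrow> real ^ 'd ^ 'd) \<Rightarrow> nat \<Rightarrow> (nat \<Rightarrow> real ^ 'd) \<Rightarrow> real" where
  "log_density h A n x = (\<Sum>j<n. lin_drift A j x \<bullet> x j - h / 2 * (lin_drift A j x \<bullet> lin_drift A j x))"

lemma lin_drift_measurable: "j \<le> n \<Longrightarrow> lin_drift A j \<in> borel_measurable (Pi\<^sub>M {..<n} (\<lambda>_. borel))"
  unfolding lin_drift_def
proof (intro borel_measurable_sum)
  fix k assume "j \<le> n" "k \<in> {..<j}"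
  then have "(\<lambda>x. x k) \<in> borel_measurable (Pi\<^sub>M {..<n} (\<lambda>_. borel :: (real ^ 'd) measure))" by (intro measurable_component_singleton) auto
  then show "(\<lambda>x. A j k *v x k) \<in> borel_measurable (Pi\<^sub>M {..<n} (\<lambda>_. borel))"
    by (rule measurable_compose) (auto intro!: borel_measurable_continuous_onI matrix_vector_mult_linear_continuous_on)
qed

lemma shear_measurable: "shear h A n \<in> measurable (Pi\<^sub>M {..<n} (\<lambda>_. borel)) (Pi\<^sub>M {..<n} (\<lambda>_. borel))"
  unfolding shear_def
proof (rule measurable_restrict)
  fix j assume "j \<in> {..<n}"
  then show "(\<lambda>x. x j - h *\<^sub>R lin_drift A j x) \<in> borel_measurable (Pi\<^sub>M {..<n} (\<lambda>_. borel))"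
    by (intro borel_measurable_diff borel_measurable_scaleR lin_drift_measurable measurable_component_singleton) auto
qed

lemma log_density_measurable: "log_density h A n \<in> borel_measurable (Pi\<^sub>M {..<n} (\<lambda>_. borel))"
  unfolding log_density_def
  by (intro borel_measurable_sum borel_measurable_diff borel_measurable_inner borel_measurable_times borel_measurable_const lin_drift_measurable measurable_component_singleton) auto

lemma lin_drift_upd: "j \<le> n \<Longrightarrow> lin_drift A j (x(n := y)) = lin_drift A j x"
  unfolding lin_drift_def by (intro sum.cong) auto

text \<open>Integrate out the last coordinate first. Its drift depends on the earlier coordinates
  alone, so with these frozen the shear is a constant shift of one Gaussian vector and
  \<open>gauss_shift\<close> applies; the other components of the shear and the remaining exponent
  do not see the last coordinate. The function \<open>g'\<close>, averaged over it, is passed to the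
  induction hypothesis.\<close>

theorem discrete_girsanov:
  fixes A :: "nat \<Rightarrow> nat \<Rightarrow> real ^ 'd ^ 'd"
  assumes h: "h > 0" and g: "g \<in> borel_measurable (Pi\<^sub>M {..<n} (\<lambda>_. borel))"
  shows "(\<integral>\<^sup>+x. ennreal (exp (log_density h A n x)) * g (shear h A n x) \<partial>Pi\<^sub>M {..<n} (\<lambda>_. gauss h))
     = (\<integral>\<^sup>+x. g x \<partial>Pi\<^sub>M {..<n} (\<lambda>_. gauss h))"
  using g
proof (induction n arbitrary: g)
  case 0
  have "shear h A 0 x = x" if "x \<in> space (Pi\<^sub>M {..<0::nat} (\<lambda>_. gauss h))" for x :: "nat \<Rightarrow> real ^ 'd"
    using that by (auto simp: shear_def space_PiM)
  then show ?case by (intro nn_integral_cong) (simp add: log_density_def)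
next
  case (Suc n)
  interpret G: prob_space "gauss h :: (real ^ 'd) measure" by (rule prob_space_gauss[OF h])
  interpret product_sigma_finite "\<lambda>_::nat. gauss h :: (real ^ 'd) measure" ..
  let ?P = "Pi\<^sub>M {..<n} (\<lambda>_. gauss h :: (real ^ 'd) measure)"
  have sets_eq: "sets (Pi\<^sub>M {..<m} (\<lambda>_. gauss h)) = sets (Pi\<^sub>M {..<m} (\<lambda>_. borel :: (real ^ 'd) measure))" for m
    by (intro sets_PiM_cong) auto
  have meq: "measurable (Pi\<^sub>M {..<m} (\<lambda>_. gauss h)) N = measurable (Pi\<^sub>M {..<m} (\<lambda>_. borel :: (real ^ 'd) measure)) N" for m N
    by (intro measurable_cong_sets sets_eq refl)
  have ins: "{..<Suc n} = insert n {..<n}" by auto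
  have gm: "g \<in> borel_measurable (Pi\<^sub>M (insert n {..<n}) (\<lambda>_. gauss h))"
    using Suc.prems meq[of "Suc n"] unfolding ins by simp
  have fm: "(\<lambda>x. ennreal (exp (log_density h A (Suc n) x)) * g (shear h A (Suc n) x)) \<in> borel_measurable (Pi\<^sub>M (insert n {..<n}) (\<lambda>_. gauss h))"
  proof -
    have "(\<lambda>x. ennreal (exp (log_density h A (Suc n) x)) * g (shear h A (Suc n) x)) \<in> borel_measurable (Pi\<^sub>M {..<Suc n} (\<lambda>_. borel))"
      using measurable_compose[OF shear_measurable Suc.prems] log_density_measurable by measurable
    then show ?thesis using meq[of "Suc n"] unfolding ins by simp
  qed
  have upd: "(\<lambda>(x, y). g (x(n := y))) \<in> borel_measurable (?P \<Otimes>\<^sub>M gauss h)"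
    using measurable_compose[OF measurable_add_dim gm] by (simp add: case_prod_beta')
  define g' where "g' x = (\<integral>\<^sup>+y. g (x(n := y)) \<partial>gauss h)" for x
  have g'm: "g' \<in> borel_measurable (Pi\<^sub>M {..<n} (\<lambda>_. borel))"
    using G.borel_measurable_nn_integral_fst[OF upd] unfolding g'_def meq by simp
  have "(\<integral>\<^sup>+x. ennreal (exp (log_density h A (Suc n) x)) * g (shear h A (Suc n) x) \<partial>Pi\<^sub>M {..<Suc n} (\<lambda>_. gauss h))
     = (\<integral>\<^sup>+x. (\<integral>\<^sup>+y. ennreal (exp (log_density h A (Suc n) (x(n := y)))) * g (shear h A (Suc n) (x(n := y))) \<partial>gauss h) \<partial>?P)"
    unfolding ins by (rule product_nn_integral_insert[OF _ _ fm]) auto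
  also have "\<dots> = (\<integral>\<^sup>+x. ennreal (exp (log_density h A n x)) * g' (shear h A n x) \<partial>?P)"
  proof (intro nn_integral_cong)
    fix x assume x: "x \<in> space ?P"
    let ?a = "lin_drift A n x"
    have L: "log_density h A (Suc n) (x(n := y)) = log_density h A n x + (?a \<bullet> y - h / 2 * (?a \<bullet> ?a))" for y
    proof -
      have "(\<Sum>j<n. lin_drift A j (x(n := y)) \<bullet> (x(n := y)) j - h / 2 * (lin_drift A j (x(n := y)) \<bullet> lin_drift A j (x(n := y)))) = log_density h A n x"
        unfolding log_density_def by (intro sum.cong) (auto simp: lin_drift_upd)
      then show ?thesis unfolding log_density_def by (simp add: lin_drift_upd)
    qed
    have S: "shear h A (Suc n) (x(n := y)) = (shear h A n x)(n := y - h *\<^sub>R ?a)" for y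
      unfolding shear_def by (auto simp: fun_eq_iff lin_drift_upd restrict_def less_Suc_eq)
    have sx: "shear h A n x \<in> space ?P" using measurable_space[OF shear_measurable] x by (simp add: space_PiM)
    have gs: "(\<lambda>y. g ((shear h A n x)(n := y))) \<in> borel_measurable borel"
      using measurable_Pair2[OF upd sx] by simp
    have "(\<integral>\<^sup>+y. ennreal (exp (log_density h A (Suc n) (x(n := y)))) * g (shear h A (Suc n) (x(n := y))) \<partial>gauss h)
       = (\<integral>\<^sup>+y. ennreal (exp (log_density h A n x)) * (ennreal (exp (?a \<bullet> y - h / 2 * (?a \<bullet> ?a))) * g ((shear h A n x)(n := y - h *\<^sub>R ?a))) \<partial>gauss h)"
      unfolding L S exp_add by (simp add: ennreal_mult mult.assoc)
    also have "\<dots> = ennreal (exp (log_density h A n x)) * (\<integral>\<^sup>+y. ennreal (exp (?a \<bullet> y - h / 2 * (?a \<bullet> ?a))) * g ((shear h A n x)(n := y - h *\<^sub>R ?a)) \<partial>gauss h)"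
    proof (rule nn_integral_cmult)
      have "(\<lambda>y. g ((shear h A n x)(n := y - h *\<^sub>R ?a))) \<in> borel_measurable borel"
        by (rule measurable_compose[OF _ gs]) simp
      moreover have "(\<lambda>y. ennreal (exp (?a \<bullet> y - h / 2 * (?a \<bullet> ?a)))) \<in> borel_measurable borel"
        by (intro measurable_compose[OF _ measurable_ennreal] borel_measurable_continuous_onI continuous_intros)
      ultimately show "(\<lambda>y. ennreal (exp (?a \<bullet> y - h / 2 * (?a \<bullet> ?a))) * g ((shear h A n x)(n := y - h *\<^sub>R ?a))) \<in> borel_measurable (gauss h)"
        unfolding measurable_cong_sets[OF sets_gauss refl] by (rule borel_measurable_times_ennreal[rotated])
    qed
    also have "(\<integral>\<^sup>+y. ennreal (exp (?a \<bullet> y - h / 2 * (?a \<bullet> ?a))) * g ((shear h A n x)(n := y - h *\<^sub>R ?a)) \<partial>gauss h) = g' (shear h A n x)"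
      unfolding g'_def by (rule gauss_shift[OF h gs])
    finally show "(\<integral>\<^sup>+y. ennreal (exp (log_density h A (Suc n) (x(n := y)))) * g (shear h A (Suc n) (x(n := y))) \<partial>gauss h) = ennreal (exp (log_density h A n x)) * g' (shear h A n x)" .
  qed
  also have "\<dots> = (\<integral>\<^sup>+x. g' x \<partial>?P)" by (rule Suc.IH[OF g'm])
  also have "\<dots> = (\<integral>\<^sup>+x. g x \<partial>Pi\<^sub>M {..<Suc n} (\<lambda>_. gauss h))"
    unfolding g'_def ins by (rule product_nn_integral_insert[OF _ _ gm, symmetric]) auto
  finally show ?case .
qed

context wiener_setup
begin

definition grid_vec :: "nat \<Rightarrow> (real \<Rightarrow> real ^ 'd) \<Rightarrow> nat \<Rightarrow> real ^ 'd" where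
  "grid_vec N w = (\<lambda>k\<in>{..<N}. grid_incr N k w)"

lemma grid_vec_measurable[measurable]: "grid_vec N \<in> measurable M (Pi\<^sub>M {..<N} (\<lambda>_. borel))"
  unfolding grid_vec_def by (intro measurable_restrict) measurable

text \<open>Increments over distinct cells are uncorrelated, so their characteristic functional is a
  product of Gaussian ones, and uniqueness of joint laws identifies the product measure.\<close>

theorem grid_law:
  assumes N: "N > 0"
  shows "distr M (Pi\<^sub>M {..<N} (\<lambda>_. borel)) (grid_vec N) = Pi\<^sub>M {..<N} (\<lambda>_. gauss (T / real N))"
proof -
  define h where "h = T / real N"
  have h: "h > 0" using T_pos N by (simp add: h_def)
  note PM = prob_space_axioms
  interpret G: prob_space "gauss h :: (real ^ 'd) measure" by (rule prob_space_gauss[OF h])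
  interpret product_prob_space "\<lambda>_::nat. gauss h :: (real ^ 'd) measure" "{..<N}" by (intro product_prob_spaceI G.prob_space_axioms)
  let ?P = "Pi\<^sub>M {..<N} (\<lambda>_. gauss h :: (real ^ 'd) measure)"
  have sets_eq: "sets ?P = sets (Pi\<^sub>M {..<N} (\<lambda>_. borel :: (real ^ 'd) measure))" by (intro sets_PiM_cong) auto
  have "(\<integral>w. cis (\<Sum>k\<in>{..<N}. \<xi> k \<bullet> grid_incr N k w) \<partial>M) = (\<integral>x. cis (\<Sum>k\<in>{..<N}. \<xi> k \<bullet> x k) \<partial>?P)" for \<xi>
  proof -
    let ?a = "\<lambda>k. T * real k / real N" and ?b = "\<lambda>k. T * real (Suc k) / real N"
    have cov: "(min (?b i) (?b j) - min (?a i) (?b j) - min (?b i) (?a j) + min (?a i) (?a j)) = (if i = j then h else 0)" for i j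
    proof -
      have bh: "?b i = ?a i + h" "?b j = ?a j + h" by (simp_all add: h_def add_divide_distrib algebra_simps)
      consider "i = j" | "i < j" | "j < i" by linarith
      then show ?thesis
      proof cases
        case 1 then show ?thesis using h unfolding bh by (simp add: min_def)
      next
        case 2
        then have "?b i \<le> ?a j" using grid_mono[of "Suc i" j N] by simp
        then show ?thesis using 2 h unfolding bh by (simp add: min_def)
      next
        case 3
        then have "?b j \<le> ?a i" using grid_mono[of "Suc j" i N] by simp
        then show ?thesis using 3 h unfolding bh by (simp add: min_def)
      qed
    qed
    have "(\<integral>w. cis (\<Sum>k\<in>{..<N}. \<xi> k \<bullet> grid_incr N k w) \<partial>M) = complex_of_real (exp (- (\<Sum>i<N. \<Sum>j<N. (if i = j then h else 0) * (\<xi> i \<bullet> \<xi> j)) / 2))"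
      unfolding grid_incr_def
    proof (subst increment_char)
      fix i assume "i \<in> {..<N}"
      then have "i < N" by simp
      from grid_order[OF N this] show "?a i \<in> {0..T}" "?b i \<in> {0..T}" unfolding atLeastAtMost_iff by linarith+
    qed (simp_all only: cov finite_lessThan)
    also have "(\<Sum>i<N. \<Sum>j<N. (if i = j then h else 0) * (\<xi> i \<bullet> \<xi> j)) = (\<Sum>i<N. h * (\<xi> i \<bullet> \<xi> i))"
      by (intro sum.cong refl) (simp add: if_distrib[of "\<lambda>x. x * _"] cong: if_cong)
    also have "complex_of_real (exp (- (\<Sum>i<N. h * (\<xi> i \<bullet> \<xi> i)) / 2)) = (\<Prod>i<N. complex_of_real (exp (- (h * (\<xi> i \<bullet> \<xi> i)) / 2)))"
      by (simp add: exp_sum[symmetric] sum_negf sum_divide_distrib flip: of_real_prod)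
    also have "\<dots> = (\<Prod>i<N. \<integral>x. cis (\<xi> i \<bullet> x) \<partial>gauss h)" by (simp add: gauss_char[OF h])
    also have "\<dots> = (\<integral>x. (\<Prod>i<N. cis (\<xi> i \<bullet> x i)) \<partial>?P)"
    proof (rule product_integral_prod[symmetric])
      fix i
      have "(\<lambda>x. cis (\<xi> i \<bullet> x)) \<in> borel_measurable (gauss h)"
        unfolding measurable_cong_sets[OF sets_gauss refl] by (intro borel_measurable_continuous_onI continuous_intros)
      then show "integrable (gauss h) (\<lambda>x. cis (\<xi> i \<bullet> x))" by (rule G.integrable_const_bound[of _ 1, rotated]) simp
    qed simp
    finally show ?thesis by (simp add: cis_sum)
  qed
  then have "distr M (Pi\<^sub>M {..<N} (\<lambda>_. borel)) (\<lambda>w. \<lambda>k\<in>{..<N}. grid_incr N k w) = distr ?P (Pi\<^sub>M {..<N} (\<lambda>_. borel)) (\<lambda>x. \<lambda>k\<in>{..<N}. x k)"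
    by (intro joint_char_unique_vec PM P.prob_space_axioms)
      (auto intro: measurable_component_singleton[of _ "{..<N}" "\<lambda>_. gauss h", unfolded measurable_cong_sets[OF refl sets_gauss]])
  also have "\<dots> = ?P"
  proof -
    have "distr ?P (Pi\<^sub>M {..<N} (\<lambda>_. borel)) (\<lambda>x. \<lambda>k\<in>{..<N}. x k) = distr ?P ?P (\<lambda>x. x)"
      by (intro distr_cong refl sets_eq[symmetric]) (auto simp: space_PiM)
    then show ?thesis by simp
  qed
  finally show ?thesis unfolding grid_vec_def[abs_def] h_def .
qed

theorem grid_girsanov:
  assumes N: "N > 0" and g: "g \<in> borel_measurable (Pi\<^sub>M {..<N} (\<lambda>_. borel))"
  shows "(\<integral>\<^sup>+w. ennreal (exp (log_density (T / real N) A N (grid_vec N w))) * g (shear (T / real N) A N (grid_vec N w)) \<partial>M) = (\<integral>\<^sup>+w. g (grid_vec N w) \<partial>M)"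
proof -
  have h: "T / real N > 0" using T_pos N by simp
  have "(\<integral>\<^sup>+w. ennreal (exp (log_density (T / real N) A N (grid_vec N w))) * g (shear (T / real N) A N (grid_vec N w)) \<partial>M)
     = (\<integral>\<^sup>+x. ennreal (exp (log_density (T / real N) A N x)) * g (shear (T / real N) A N x) \<partial>distr M (Pi\<^sub>M {..<N} (\<lambda>_. borel)) (grid_vec N))"
  proof -
    have "(\<lambda>x. ennreal (exp (log_density (T / real N) A N x)) * g (shear (T / real N) A N x)) \<in> borel_measurable (Pi\<^sub>M {..<N} (\<lambda>_. borel))"
      using measurable_compose[OF shear_measurable g] log_density_measurable by measurable
    then show ?thesis by (subst nn_integral_distr) auto
  qed
  also have "\<dots> = (\<integral>\<^sup>+x. g x \<partial>distr M (Pi\<^sub>M {..<N} (\<lambda>_. borel)) (grid_vec N))"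
    unfolding grid_law[OF N] by (rule discrete_girsanov[OF h g])
  also have "\<dots> = (\<integral>\<^sup>+w. g (grid_vec N w) \<partial>M)" using g by (subst nn_integral_distr) auto
  finally show ?thesis .
qed

end

section \<open>The inverse shear and the tail of the density\<close>

fun inv_drift :: "real \<Rightarrow> (nat \<Rightarrow> nat \<Rightarrow> real ^ 'd ^ 'd) \<Rightarrow> (nat \<Rightarrow> real ^ 'd) \<Rightarrow> nat \<Rightarrow> real ^ 'd" where
  "inv_drift h A y j = (\<Sum>k<j. A j k *v (y k + h *\<^sub>R inv_drift h A y k))"

declare inv_drift.simps[simp del]

text \<open>\<open>inv_drift\<close> recovers the drift from the sheared increments: the original
  increment is \<open>y k + h *\<^sub>R inv_drift h A y k\<close>, and because the shear is strictly
  triangular the values with smaller index are already known.\<close>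

lemma inv_drift_shear: "j \<le> n \<Longrightarrow> inv_drift h A (shear h A n x) j = lin_drift A j x"
proof (induction j rule: less_induct)
  case (less j)
  have "inv_drift h A (shear h A n x) j = (\<Sum>k<j. A j k *v (shear h A n x k + h *\<^sub>R inv_drift h A (shear h A n x) k))"
    by (rule inv_drift.simps)
  also have "\<dots> = (\<Sum>k<j. A j k *v x k)"
  proof (intro sum.cong refl)
    fix k assume "k \<in> {..<j}"
    then have k: "k < j" "k < n" using less.prems by auto
    have "inv_drift h A (shear h A n x) k = lin_drift A k x" using less.IH[of k] k by simp
    moreover have "shear h A n x k = x k - h *\<^sub>R lin_drift A k x" using k by (simp add: shear_def)
    ultimately show "A j k *v (shear h A n x k + h *\<^sub>R inv_drift h A (shear h A n x) k) = A j k *v x k" by simp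
  qed
  finally show ?case by (simp add: lin_drift_def)
qed

text \<open>The exponent in the sheared variable. Substituting x = y + h v turns the energy term -
  h/2 |v|^2 into + h/2 |v|^2.\<close>

definition log_density_inv :: "real \<Rightarrow> (nat \<Rightarrow> nat \<Rightarrow> real ^ 'd ^ 'd) \<Rightarrow> nat \<Rightarrow> (nat \<Rightarrow> real ^ 'd) \<Rightarrow> real" where
  "log_density_inv h A n y = (\<Sum>j<n. inv_drift h A y j \<bullet> y j) + h / 2 * (\<Sum>j<n. (norm (inv_drift h A y j))\<^sup>2)"

lemma log_density_shear: "log_density_inv h A n (shear h A n x) = log_density h A n x"
proof -
  have "log_density_inv h A n (shear h A n x) = (\<Sum>j<n. lin_drift A j x \<bullet> (x j - h *\<^sub>R lin_drift A j x) + h / 2 * (lin_drift A j x \<bullet> lin_drift A j x))"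
    unfolding log_density_inv_def sum_distrib_left sum.distrib[symmetric]
    by (intro sum.cong refl) (auto simp: inv_drift_shear power2_norm_eq_inner, simp add: shear_def)
  also have "\<dots> = log_density h A n x"
    unfolding log_density_def by (intro sum.cong refl) (simp add: inner_diff_right)
  finally show ?thesis .
qed

lemma inv_drift_measurable: "j \<le> n \<Longrightarrow> (\<lambda>y. inv_drift h A y j) \<in> borel_measurable (Pi\<^sub>M {..<n} (\<lambda>_. borel))"
proof (induction j rule: less_induct)
  case (less j)
  show ?case
  proof (subst inv_drift.simps, intro borel_measurable_sum)
    fix k assume k: "k \<in> {..<j}"
    have "(\<lambda>y. y k + h *\<^sub>R inv_drift h A y k) \<in> borel_measurable (Pi\<^sub>M {..<n} (\<lambda>_. borel))"
      using k less by (intro borel_measurable_add borel_measurable_scaleR less.IH measurable_component_singleton) auto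
    then show "(\<lambda>y. A j k *v (y k + h *\<^sub>R inv_drift h A y k)) \<in> borel_measurable (Pi\<^sub>M {..<n} (\<lambda>_. borel))"
      by (rule measurable_compose) (auto intro!: borel_measurable_continuous_onI matrix_vector_mult_linear_continuous_on)
  qed
qed

lemma log_density_inv_measurable: "log_density_inv h A n \<in> borel_measurable (Pi\<^sub>M {..<n} (\<lambda>_. borel))"
proof -
  have [measurable]: "(\<lambda>y. inv_drift h A y j) \<in> borel_measurable (Pi\<^sub>M {..<n} (\<lambda>_. borel))" if "j \<in> {..<n}" for j
    using that by (intro inv_drift_measurable) auto
  show ?thesis unfolding log_density_inv_def by measurable
qed

lemma ennreal_mult_add:
  "0 \<le> a \<Longrightarrow> 0 \<le> b \<Longrightarrow> 0 \<le> c \<Longrightarrow> 0 \<le> d \<Longrightarrow> ennreal a * ennreal b + ennreal c * ennreal d = ennreal (a * b + c * d)"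
  by (simp add: ennreal_mult)

lemma cell_sum_sq:
  fixes v :: "nat \<Rightarrow> 'b::real_normed_vector"
  assumes T: "T > 0" and N: "N > 0"
  shows "(norm (\<Sum>j<N. indicator (grid_cell T N j) t *\<^sub>R v j))\<^sup>2 = (\<Sum>j<N. indicator (grid_cell T N j) t * (norm (v j))\<^sup>2)"
proof (cases "\<exists>j<N. t \<in> grid_cell T N j")
  case False
  then have z: "indicator (grid_cell T N j) t = (0::real)" if "j < N" for j using that by auto
  then show ?thesis by (simp add: z)
next
  case True
  then obtain j where j: "j < N" "t \<in> grid_cell T N j" by blast
  have i: "indicator (grid_cell T N i) t = (if i = j then 1 else (0::real))" for i
  proof (cases "i = j")
    case True then show ?thesis using j(2) by simp
  next
    case False
    then have "t \<notin> grid_cell T N i" using grid_cell_unique[OF T N j(2)] by blast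
    then show ?thesis using False by simp
  qed
  show ?thesis unfolding i using j(1) by (simp add: if_distrib[of "\<lambda>x. x *\<^sub>R _"] if_distrib[of "\<lambda>x. x * _"] cong: if_cong)
qed

lemma grid_cell_emeasure:
  assumes "T > 0" "N > 0" "j < N"
  shows "emeasure (interval_measure_T T) (grid_cell T N j) = ennreal (T / real N)"
proof -
  have d: "T * real (Suc j) / real N = T * real j / real N + T / real N" by (simp add: add_divide_distrib[symmetric] algebra_simps)
  have "emeasure (interval_measure_T T) (grid_cell T N j) = (\<integral>\<^sup>+x. indicator {0..T} x * indicator (grid_cell T N j) x \<partial>lborel)"
    unfolding interval_measure_T_def by (subst emeasure_density) auto
  also have "\<dots> = (\<integral>\<^sup>+x. indicator (grid_cell T N j) x \<partial>lborel)"
    using grid_cell_subset[OF assms(1,3)] by (intro nn_integral_cong) (force simp: indicator_def)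
  also have "\<dots> = emeasure lborel (grid_cell T N j)" by simp
  also have "\<dots> = ennreal (T / real N)"
    unfolding grid_cell_def d using assms by (subst emeasure_lborel_Ioc) auto
  finally show ?thesis .
qed

text \<open>The squared L2 norm of the step kernel, each cell of the product grid having area
  \<open>(T / real N)\<^sup>2\<close>.\<close>

definition kernel_sq :: "real \<Rightarrow> nat \<Rightarrow> (nat \<Rightarrow> nat \<Rightarrow> 'b::real_normed_vector) \<Rightarrow> real" where
  "kernel_sq T N A = (T / real N)\<^sup>2 * (\<Sum>j<N. \<Sum>k<j. (norm (A j k))\<^sup>2)"

lemma step_kernel_norm_sq:
  fixes A :: "nat \<Rightarrow> nat \<Rightarrow> 'b::real_normed_vector"
  assumes T: "T > 0" and N: "N > 0"
  shows "(norm (step_kernel T N A t s))\<^sup>2 = step_kernel T N (\<lambda>j k. (norm (A j k))\<^sup>2) t s"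
proof (cases "t \<in> {0<..T} \<and> s \<in> {0<..T}")
  case True
  obtain j where j: "j < N" "t \<in> grid_cell T N j" using grid_cell_exists[OF T N] True by blast
  obtain k where k: "k < N" "s \<in> grid_cell T N k" using grid_cell_exists[OF T N] True by blast
  show ?thesis unfolding step_kernel_eval[OF T N j(2,1) k(2)] by simp
next
  case False
  then have f: "t \<notin> {0<..T} \<or> s \<notin> {0<..T}" by auto
  show ?thesis unfolding step_kernel_outside[OF T f] by simp
qed

lemma step_kernel_L2:
  fixes A :: "nat \<Rightarrow> nat \<Rightarrow> 'b::{banach, second_countable_topology}"
  assumes T: "T > 0" and N: "N > 0"
  shows "(\<integral>\<^sup>+p. ennreal ((norm (step_kernel T N A (fst p) (snd p)))\<^sup>2) \<partial>square_measure T) = ennreal (kernel_sq T N A)"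
proof -
  interpret F: finite_measure "interval_measure_T T" by (rule finite_interval_measure_T)
  let ?a = "\<lambda>j k. (norm (A j k))\<^sup>2"
  have e: "ennreal ((norm (step_kernel T N A (fst p) (snd p)))\<^sup>2) = (\<Sum>j<N. \<Sum>k<j. ennreal (?a j k) * indicator (grid_cell T N j \<times> grid_cell T N k) p)" for p
  proof -
    have "step_kernel T N ?a (fst p) (snd p) = (\<Sum>j<N. \<Sum>k<j. ?a j k * indicator (grid_cell T N j \<times> grid_cell T N k) p)"
      unfolding step_kernel_def by (intro sum.cong refl) (auto simp: indicator_def mem_Times_iff)
    moreover have "ennreal (\<Sum>j<N. \<Sum>k<j. ?a j k * indicator (grid_cell T N j \<times> grid_cell T N k) p) = (\<Sum>j<N. \<Sum>k<j. ennreal (?a j k * indicator (grid_cell T N j \<times> grid_cell T N k) p))"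
      by (simp add: sum_nonneg)
    moreover have "ennreal (?a j k * indicator (grid_cell T N j \<times> grid_cell T N k) p) = ennreal (?a j k) * indicator (grid_cell T N j \<times> grid_cell T N k) p" for j k
      by (auto simp: indicator_def)
    ultimately show ?thesis unfolding step_kernel_norm_sq[OF T N] by simp
  qed
  have cm: "grid_cell T N j \<times> grid_cell T N k \<in> sets (square_measure T)" for j k
    unfolding square_measure_eq by (intro pair_measureI) auto
  have em: "emeasure (square_measure T) (grid_cell T N j \<times> grid_cell T N k) = ennreal ((T / real N)\<^sup>2)" if "j < N" "k < j" for j k
    unfolding square_measure_eq using that T N
    by (subst F.emeasure_pair_measure_Times) (auto simp: grid_cell_emeasure ennreal_mult[symmetric] power2_eq_square)
  have "(\<integral>\<^sup>+p. ennreal ((norm (step_kernel T N A (fst p) (snd p)))\<^sup>2) \<partial>square_measure T) = (\<Sum>j<N. \<Sum>k<j. ennreal (?a j k) * ennreal ((T / real N)\<^sup>2))"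
  proof -
    have m1: "(\<lambda>p. ennreal (?a j k) * indicator (grid_cell T N j \<times> grid_cell T N k) p) \<in> borel_measurable (square_measure T)" for j k
      using cm by (intro borel_measurable_times_ennreal borel_measurable_const borel_measurable_indicator)
    have "(\<integral>\<^sup>+p. ennreal ((norm (step_kernel T N A (fst p) (snd p)))\<^sup>2) \<partial>square_measure T)
      = (\<Sum>j<N. \<integral>\<^sup>+p. (\<Sum>k<j. ennreal (?a j k) * indicator (grid_cell T N j \<times> grid_cell T N k) p) \<partial>square_measure T)"
      unfolding e by (intro nn_integral_sum borel_measurable_sum m1)
    also have "\<dots> = (\<Sum>j<N. \<Sum>k<j. \<integral>\<^sup>+p. ennreal (?a j k) * indicator (grid_cell T N j \<times> grid_cell T N k) p \<partial>square_measure T)"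
      by (intro sum.cong refl nn_integral_sum m1)
    also have "\<dots> = (\<Sum>j<N. \<Sum>k<j. ennreal (?a j k) * ennreal ((T / real N)\<^sup>2))"
    proof (intro sum.cong refl)
      fix j k assume "j \<in> {..<N}" "k \<in> {..<j}"
      then show "(\<integral>\<^sup>+p. ennreal (?a j k) * indicator (grid_cell T N j \<times> grid_cell T N k) p \<partial>square_measure T) = ennreal (?a j k) * ennreal ((T / real N)\<^sup>2)"
        using em[of j k] by (subst nn_integral_cmult_indicator[OF cm]) simp
    qed
    finally show ?thesis .
  qed
  also have "\<dots> = ennreal (kernel_sq T N A)"
  proof -
    have "(\<Sum>j<N. \<Sum>k<j. ennreal (?a j k) * ennreal ((T / real N)\<^sup>2)) = (\<Sum>j<N. \<Sum>k<j. ennreal (?a j k * (T / real N)\<^sup>2))"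
      by (intro sum.cong refl) (simp add: ennreal_mult)
    also have "\<dots> = ennreal (\<Sum>j<N. \<Sum>k<j. ?a j k * (T / real N)\<^sup>2)" by (simp add: sum_nonneg)
    finally show ?thesis by (simp add: kernel_sq_def sum_distrib_left mult.commute)
  qed
  finally show ?thesis .
qed

context wiener_setup
begin

definition sq_int :: "((real \<Rightarrow> real ^ 'd) \<Rightarrow> real ^ 'd) \<Rightarrow> bool" where
  "sq_int f \<longleftrightarrow> f \<in> borel_measurable M \<and> integrable M (\<lambda>w. (norm (f w))\<^sup>2)"

lemma sq_int_add: "sq_int f \<Longrightarrow> sq_int g \<Longrightarrow> sq_int (\<lambda>w. f w + g w)"
proof -
  assume fg: "sq_int f" "sq_int g"
  then have [measurable]: "f \<in> borel_measurable M" "g \<in> borel_measurable M" by (auto simp: sq_int_def)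
  have "integrable M (\<lambda>w. (norm (f w + g w))\<^sup>2)"
  proof (rule Bochner_Integration.integrable_bound)
    show "integrable M (\<lambda>w. 2 * (norm (f w))\<^sup>2 + 2 * (norm (g w))\<^sup>2)" using fg by (auto simp: sq_int_def)
    show "AE w in M. norm ((norm (f w + g w))\<^sup>2) \<le> norm (2 * (norm (f w))\<^sup>2 + 2 * (norm (g w))\<^sup>2)"
      using norm_diff2_sq[of "f _" "- g _" 0] by (intro AE_I2) simp
  qed measurable
  then show ?thesis by (simp add: sq_int_def)
qed

lemma sq_int_scaleR: "sq_int f \<Longrightarrow> sq_int (\<lambda>w. c *\<^sub>R f w)"
  by (auto simp: sq_int_def power_mult_distrib)

lemma sq_int_matrix: "sq_int f \<Longrightarrow> sq_int (\<lambda>w. B *v f w)"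
proof -
  assume f: "sq_int f"
  have m: "(\<lambda>w. B *v f w) \<in> borel_measurable M" using f by (intro matrix_vector_borel) (simp add: sq_int_def)
  have "integrable M (\<lambda>w. (norm (B *v f w))\<^sup>2)"
  proof (rule Bochner_Integration.integrable_bound)
    show "integrable M (\<lambda>w. (norm B)\<^sup>2 * (norm (f w))\<^sup>2)" using f by (auto simp: sq_int_def)
    show "AE w in M. norm ((norm (B *v f w))\<^sup>2) \<le> norm ((norm B)\<^sup>2 * (norm (f w))\<^sup>2)"
    proof (rule AE_I2)
      fix w
      have "(norm (B *v f w))\<^sup>2 \<le> (norm B * norm (f w))\<^sup>2" by (intro power_mono norm_matrix_vector_le) auto
      then show "norm ((norm (B *v f w))\<^sup>2) \<le> norm ((norm B)\<^sup>2 * (norm (f w))\<^sup>2)" by (simp add: power_mult_distrib)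
    qed
    show "(\<lambda>w. (norm (B *v f w))\<^sup>2) \<in> borel_measurable M" using m by measurable
  qed
  then show ?thesis using m by (simp add: sq_int_def)
qed

lemma sq_int_sum: "(\<And>k. k \<in> F \<Longrightarrow> sq_int (f k)) \<Longrightarrow> sq_int (\<lambda>w. \<Sum>k\<in>F. f k w)"
proof (induction F rule: infinite_finite_induct)
  case (insert x F)
  then have "sq_int (\<lambda>w. f x w + (\<Sum>k\<in>F. f k w))" by (intro sq_int_add) auto
  then show ?case using insert by simp
qed (auto simp: sq_int_def)

definition grid_inv :: "nat \<Rightarrow> (nat \<Rightarrow> nat \<Rightarrow> real ^ 'd ^ 'd) \<Rightarrow> nat \<Rightarrow> (real \<Rightarrow> real ^ 'd) \<Rightarrow> real ^ 'd" where
  "grid_inv N A j w = inv_drift (T / real N) A (grid_vec N w) j"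

lemma grid_inv_rec: "j \<le> N \<Longrightarrow> grid_inv N A j w = (\<Sum>k<j. A j k *v (grid_incr N k w + (T / real N) *\<^sub>R grid_inv N A k w))"
  unfolding grid_inv_def by (subst inv_drift.simps) (auto simp: grid_vec_def intro!: sum.cong)

lemma grid_inv_Filt: "j \<le> N \<Longrightarrow> grid_inv N A j \<in> borel_measurable (Filt T (T * real j / real N))"
proof (induction j rule: less_induct)
  case (less j)
  have eq: "grid_inv N A j = (\<lambda>w. \<Sum>k<j. A j k *v (grid_incr N k w + (T / real N) *\<^sub>R grid_inv N A k w))"
    using grid_inv_rec[OF less.prems] by auto
  show ?case unfolding eq
  proof (intro borel_measurable_sum matrix_vector_borel borel_measurable_add borel_measurable_scaleR borel_measurable_const)
    fix k assume k: "k \<in> {..<j}"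
    then show "grid_incr N k \<in> borel_measurable (Filt T (T * real j / real N))" by (intro grid_incr_Filt) simp
    show "grid_inv N A k \<in> borel_measurable (Filt T (T * real j / real N))"
      using k less by (intro Filt_mono[OF grid_mono[of k j N] less.IH]) auto
  qed
qed

lemma grid_inv_sq: "N > 0 \<Longrightarrow> j \<le> N \<Longrightarrow> sq_int (grid_inv N A j)"
proof (induction j rule: less_induct)
  case (less j)
  have eq: "grid_inv N A j = (\<lambda>w. \<Sum>k<j. A j k *v (grid_incr N k w + (T / real N) *\<^sub>R grid_inv N A k w))"
    using grid_inv_rec[OF less.prems(2)] by auto
  show ?case unfolding eq
  proof (intro sq_int_sum sq_int_matrix sq_int_add sq_int_scaleR)
    fix k assume "k \<in> {..<j}"
    then show "sq_int (grid_incr N k)" "sq_int (grid_inv N A k)"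
      using less grid_incr_sq(1)[of N k] by (auto simp: sq_int_def)
  qed
qed

text \<open>A pathwise Volterra estimate. The inverse drift is the drift \<open>U\<close> of the
  grid increments plus a feedback \<open>W\<close>, whose energy is by Cauchy-Schwarz at most
  \<open>kernel_sq\<close> times the energy of the inverse drift itself. In |U + W|^2 \<le> 2 |U|^2
  + 2 |W|^2 the feedback is absorbed on the left because \<open>2 * \<theta> < 1\<close>; the
  smallness of the kernel enters the proof here.\<close>

lemma grid_inv_sum_le:
  assumes N: "N > 0" and \<theta>: "kernel_sq T N A \<le> \<theta>" "\<theta> < 1/2"
  shows "(T / real N) * (\<Sum>j<N. (norm (grid_inv N A j w))\<^sup>2) \<le> 2 / (1 - 2 * \<theta>) * ((T / real N) * (\<Sum>j<N. (norm (step_drift N A j w))\<^sup>2))"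
proof -
  define h where "h = T / real N"
  have h: "h > 0" using T_pos N by (simp add: h_def)
  define V where "V j = grid_inv N A j w" for j
  define U where "U j = step_drift N A j w" for j
  define s where "s = h * (\<Sum>j<N. (norm (V j))\<^sup>2)"
  define u where "u = h * (\<Sum>j<N. (norm (U j))\<^sup>2)"
  have s0: "0 \<le> s" unfolding s_def using h by (intro mult_nonneg_nonneg sum_nonneg) auto
  have each: "(norm (V j))\<^sup>2 \<le> 2 * (norm (U j))\<^sup>2 + 2 * (h * (\<Sum>k<j. (norm (A j k))\<^sup>2) * s)" if j: "j < N" for j
  proof -
    define W where "W = (\<Sum>k<j. A j k *v (h *\<^sub>R V k))"
    have VUW: "V j = U j + W"
      unfolding V_def U_def W_def step_drift_def using j by (simp add: grid_inv_rec matrix_vector_right_distrib sum.distrib h_def V_def)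
    have "norm W \<le> (\<Sum>k<j. norm (A j k) * (h * norm (V k)))"
      unfolding W_def using h norm_matrix_vector_le[of "A j _" "h *\<^sub>R V _"] by (intro order_trans[OF norm_sum] sum_mono) auto
    then have "(norm W)\<^sup>2 \<le> (\<Sum>k<j. norm (A j k) * (h * norm (V k)))\<^sup>2" by (intro power_mono) auto
    also have "\<dots> \<le> (\<Sum>k<j. (norm (A j k))\<^sup>2) * (\<Sum>k<j. (h * norm (V k))\<^sup>2)" by (rule Cauchy_Schwarz_ineq_sum)
    also have "\<dots> \<le> (\<Sum>k<j. (norm (A j k))\<^sup>2) * (\<Sum>k<N. (h * norm (V k))\<^sup>2)"
      using j by (intro mult_left_mono sum_mono2 sum_nonneg) auto
    also have "(\<Sum>k<N. (h * norm (V k))\<^sup>2) = h * s" unfolding s_def by (simp add: power_mult_distrib sum_distrib_left power2_eq_square mult_ac)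
    finally have W: "(norm W)\<^sup>2 \<le> h * (\<Sum>k<j. (norm (A j k))\<^sup>2) * s" by (simp add: mult_ac)
    have "(norm (V j))\<^sup>2 \<le> 2 * (norm (U j))\<^sup>2 + 2 * (norm W)\<^sup>2"
      using norm_diff2_sq[of "U j" "- W" 0] unfolding VUW by simp
    then show ?thesis using W by linarith
  qed
  have "h * (\<Sum>j<N. (norm (V j))\<^sup>2) \<le> h * (\<Sum>j<N. 2 * (norm (U j))\<^sup>2 + 2 * (h * (\<Sum>k<j. (norm (A j k))\<^sup>2) * s))"
    using h each by (intro mult_left_mono sum_mono) auto
  then have "s \<le> h * (\<Sum>j<N. 2 * (norm (U j))\<^sup>2 + 2 * (h * (\<Sum>k<j. (norm (A j k))\<^sup>2) * s))"
    by (simp only: s_def[symmetric])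
  also have "\<dots> = 2 * u + 2 * (h\<^sup>2 * (\<Sum>j<N. \<Sum>k<j. (norm (A j k))\<^sup>2)) * s"
    unfolding u_def by (simp add: sum.distrib sum_distrib_left sum_distrib_right algebra_simps power2_eq_square)
  also have "h\<^sup>2 * (\<Sum>j<N. \<Sum>k<j. (norm (A j k))\<^sup>2) = kernel_sq T N A" by (simp add: kernel_sq_def h_def)
  finally have "s \<le> 2 * u + 2 * kernel_sq T N A * s" by simp
  moreover have "2 * kernel_sq T N A * s \<le> 2 * \<theta> * s" using \<theta> s0 by (intro mult_right_mono) auto
  ultimately have "(1 - 2 * \<theta>) * s \<le> 2 * u" by (simp add: algebra_simps)
  then have "s \<le> 2 * u / (1 - 2 * \<theta>)" using \<theta> by (simp add: pos_le_divide_eq mult.commute)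
  then have "s \<le> 2 / (1 - 2 * \<theta>) * u" by simp
  then show ?thesis unfolding s_def u_def V_def U_def h_def .
qed

text \<open>Each component is a Wiener integral of constants, so increments over distinct cells drop
  out and the squares of the matrix rows add up to the Frobenius norm.\<close>

lemma step_drift_second_moment:
  assumes N: "N > 0" and j: "j \<le> N"
  shows "(\<integral>w. (norm (step_drift N A j w))\<^sup>2 \<partial>M) = (T / real N) * (\<Sum>k<j. (norm (A j k))\<^sup>2)"
proof -
  have const: "adapted_bounded c (\<lambda>_. v)" for c v
    unfolding adapted_bounded_def by (auto simp: bounded_iff intro!: exI[of _ "norm v"])
  have len: "measure lborel ({T * real k / real N<..T * real (Suc k) / real N} \<inter> {T * real l / real N<..T * real (Suc l) / real N}) = (if k = l then T / real N else 0)" for k l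
  proof (cases "k = l")
    case True
    have d: "T * real (Suc l) / real N = T * real l / real N + T / real N" by (simp add: add_divide_distrib[symmetric] algebra_simps)
    have "measure lborel {T * real l / real N<..T * real (Suc l) / real N} = T * real (Suc l) / real N - T * real l / real N"
      by (rule measure_lborel_Ioc) (rule grid_mono, simp)
    then have "measure lborel {T * real l / real N<..T * real (Suc l) / real N} = T / real N" using d by linarith
    then show ?thesis unfolding True Int_absorb by (simp only: simp_thms if_True)
  next
    case False
    then have "grid_cell T N k \<inter> grid_cell T N l = {}" using grid_cell_unique[OF T_pos N] by blast
    then show ?thesis using False unfolding grid_cell_def by (simp only: measure_empty if_False)
  qed
  have row: "has_bochner_integral M (\<lambda>w. (step_drift N A j w $ i)\<^sup>2) (\<Sum>k<j. \<Sum>l<j. (A j k $ i \<bullet> A j l $ i) * (if k = l then T / real N else 0))" for i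
  proof -
    have "has_bochner_integral M (\<lambda>w. \<Sum>k<j. \<Sum>l<j. (A j k $ i \<bullet> grid_incr N k w) * (A j l $ i \<bullet> grid_incr N l w)) (\<Sum>k<j. \<Sum>l<j. (A j k $ i \<bullet> A j l $ i) * (if k = l then T / real N else 0))"
    proof (intro has_bochner_integral_sum)
      fix k l assume "k \<in> {..<j}" "l \<in> {..<j}"
      then have kl: "k < N" "l < N" using j by auto
      show "has_bochner_integral M (\<lambda>w. (A j k $ i \<bullet> grid_incr N k w) * (A j l $ i \<bullet> grid_incr N l w)) ((A j k $ i \<bullet> A j l $ i) * (if k = l then T / real N else 0))"
        using ito_pair[OF grid_order[OF N kl(1)] grid_order[OF N kl(2)] const const, of "A j k $ i" "A j l $ i"]
        unfolding len grid_incr_def by (simp add: prob_space)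
    qed
    then show ?thesis unfolding step_drift_def by (simp add: power2_eq_square sum_product matrix_vector_mul_component)
  qed
  have "(\<integral>w. (norm (step_drift N A j w))\<^sup>2 \<partial>M) = (\<integral>w. (\<Sum>i\<in>UNIV. (step_drift N A j w $ i)\<^sup>2) \<partial>M)"
    by (simp add: norm_vec_sq)
  also have "\<dots> = (\<Sum>i\<in>UNIV. \<Sum>k<j. \<Sum>l<j. (A j k $ i \<bullet> A j l $ i) * (if k = l then T / real N else 0))"
    using row by (subst Bochner_Integration.integral_sum) (auto simp: has_bochner_integral_iff)
  also have "\<dots> = (\<Sum>i\<in>UNIV. \<Sum>k<j. (norm (A j k $ i))\<^sup>2 * (T / real N))"
    by (intro sum.cong refl) (simp add: if_distrib[of "\<lambda>x. _ * x"] power2_norm_eq_inner cong: if_cong)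
  also have "\<dots> = (\<Sum>k<j. \<Sum>i\<in>UNIV. (norm (A j k $ i))\<^sup>2 * (T / real N))" by (rule sum.swap)
  also have "\<dots> = (T / real N) * (\<Sum>k<j. (norm (A j k))\<^sup>2)"
    by (simp add: norm_vec_sq[of "A j _"] sum_distrib_left sum_distrib_right mult.commute)
  finally show ?thesis .
qed

text \<open>The mean energy of \<open>step_drift\<close> is exactly \<open>kernel_sq\<close>, so the
  pathwise estimate integrates to a bound that depends on \<open>\<theta>\<close> alone and is
  uniform in the grid.\<close>

lemma grid_inv_expect:
  assumes N: "N > 0" and \<theta>: "kernel_sq T N A \<le> \<theta>" "\<theta> < 1/2"
  shows "integrable M (\<lambda>w. (T / real N) * (\<Sum>j<N. (norm (grid_inv N A j w))\<^sup>2))"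
    "(\<integral>w. (T / real N) * (\<Sum>j<N. (norm (grid_inv N A j w))\<^sup>2) \<partial>M) \<le> 2 * \<theta> / (1 - 2 * \<theta>)"
proof -
  show i: "integrable M (\<lambda>w. (T / real N) * (\<Sum>j<N. (norm (grid_inv N A j w))\<^sup>2))"
    using grid_inv_sq[OF N, of _ A] by (intro integrable_mult_right Bochner_Integration.integrable_sum) (auto simp: sq_int_def)
  have i2: "integrable M (\<lambda>w. 2 / (1 - 2 * \<theta>) * ((T / real N) * (\<Sum>j<N. (norm (step_drift N A j w))\<^sup>2)))"
    using step_drift_sq_integrable[OF N, of _ A] by (intro integrable_mult_right Bochner_Integration.integrable_sum) auto
  have "(\<integral>w. (T / real N) * (\<Sum>j<N. (norm (grid_inv N A j w))\<^sup>2) \<partial>M) \<le> (\<integral>w. 2 / (1 - 2 * \<theta>) * ((T / real N) * (\<Sum>j<N. (norm (step_drift N A j w))\<^sup>2)) \<partial>M)"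
    by (intro integral_mono i i2 grid_inv_sum_le[OF N \<theta>])
  also have "\<dots> = 2 / (1 - 2 * \<theta>) * ((T / real N) * (\<Sum>j<N. \<integral>w. (norm (step_drift N A j w))\<^sup>2 \<partial>M))"
    using step_drift_sq_integrable[OF N, of _ A] by (simp add: Bochner_Integration.integral_sum)
  also have "(\<Sum>j<N. \<integral>w. (norm (step_drift N A j w))\<^sup>2 \<partial>M) = (\<Sum>j<N. (T / real N) * (\<Sum>k<j. (norm (A j k))\<^sup>2))"
    using N by (intro sum.cong refl step_drift_second_moment) auto
  also have "(T / real N) * (\<Sum>j<N. (T / real N) * (\<Sum>k<j. (norm (A j k))\<^sup>2)) = kernel_sq T N A"
    unfolding kernel_sq_def sum_distrib_left[symmetric] power2_eq_square mult.assoc ..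
  also have "2 / (1 - 2 * \<theta>) * kernel_sq T N A \<le> 2 / (1 - 2 * \<theta>) * \<theta>" using \<theta> by (intro mult_left_mono) auto
  finally show "(\<integral>w. (T / real N) * (\<Sum>j<N. (norm (grid_inv N A j w))\<^sup>2) \<partial>M) \<le> 2 * \<theta> / (1 - 2 * \<theta>)" by simp
qed

text \<open>The inverse drift of the grid increments is adapted, so the sum is an Ito integral;
  comparing it with the zero integral by \<open>ito_ineq\<close> costs the factor 9.\<close>

lemma grid_inv_ito:
  assumes N: "N > 0"
  shows "(\<integral>\<^sup>+w. ennreal ((\<Sum>j<N. grid_inv N A j w \<bullet> grid_incr N j w)\<^sup>2) \<partial>M) \<le> 9 * (\<integral>\<^sup>+w. ennreal ((T / real N) * (\<Sum>j<N. (norm (grid_inv N A j w))\<^sup>2)) \<partial>M)"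
proof -
  let ?H = "\<lambda>t w. \<Sum>j<N. indicator (grid_cell T N j) t *\<^sub>R grid_inv N A j w"
  have h1: "has_ito_integral T ?H (\<lambda>w. \<Sum>j<N. grid_inv N A j w \<bullet> grid_incr N j w)"
    using grid_inv_sq[OF N, of _ A] by (intro step_ito[OF N order_refl] grid_inv_Filt) (auto simp: sq_int_def)
  have h0: "has_ito_integral T (\<lambda>t (w :: real \<Rightarrow> real ^ 'd). 0) (\<lambda>w. 0)" using step_ito[OF N, of 0 "\<lambda>_ _. 0"] by simp
  have "L2dist M (\<lambda>w. \<Sum>j<N. grid_inv N A j w \<bullet> grid_incr N j w) (\<lambda>w. 0) \<le> 9 * procdist ?H (\<lambda>t w. 0)"
    by (rule ito_ineq[OF h1 h0])
  also have "procdist ?H (\<lambda>t w. 0) = (\<integral>\<^sup>+w. ennreal ((T / real N) * (\<Sum>j<N. (norm (grid_inv N A j w))\<^sup>2)) \<partial>M)"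
    unfolding procdist_def
  proof (intro nn_integral_cong)
    fix w
    let ?v = "\<lambda>j. (norm (grid_inv N A j w))\<^sup>2"
    have "(\<integral>\<^sup>+s\<in>{0..T}. ennreal ((norm (?H s w - 0))\<^sup>2) \<partial>lborel) = (\<integral>\<^sup>+s. ennreal ((norm (?H s w))\<^sup>2) \<partial>\<mu>T)"
    proof -
      have "(\<lambda>s. ennreal ((norm (?H s w))\<^sup>2)) \<in> borel_measurable borel" by measurable
      then show ?thesis by (simp only: diff_zero nn_integral_interval_measure_T)
    qed
    also have "\<dots> = (\<integral>\<^sup>+s. (\<Sum>j<N. ennreal (?v j) * indicator (grid_cell T N j) s) \<partial>\<mu>T)"
    proof (intro nn_integral_cong)
      fix s
      have "ennreal ((norm (?H s w))\<^sup>2) = (\<Sum>j<N. ennreal (indicator (grid_cell T N j) s * ?v j))"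
        unfolding cell_sum_sq[OF T_pos N] by simp
      also have "\<dots> = (\<Sum>j<N. ennreal (?v j) * indicator (grid_cell T N j) s)" by (intro sum.cong refl) (auto simp: indicator_def)
      finally show "ennreal ((norm (?H s w))\<^sup>2) = (\<Sum>j<N. ennreal (?v j) * indicator (grid_cell T N j) s)" .
    qed
    also have "\<dots> = (\<Sum>j<N. ennreal (?v j) * ennreal (T / real N))"
    proof -
      have "(\<integral>\<^sup>+s. (\<Sum>j<N. ennreal (?v j) * indicator (grid_cell T N j) s) \<partial>\<mu>T) = (\<Sum>j<N. \<integral>\<^sup>+s. ennreal (?v j) * indicator (grid_cell T N j) s \<partial>\<mu>T)"
        by (rule nn_integral_sum) measurable
      also have "\<dots> = (\<Sum>j<N. ennreal (?v j) * ennreal (T / real N))"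
        by (intro sum.cong refl) (simp add: nn_integral_cmult_indicator grid_cell_emeasure[OF T_pos N])
      finally show ?thesis .
    qed
    also have "\<dots> = ennreal ((T / real N) * (\<Sum>j<N. ?v j))"
      using T_pos by (simp add: ennreal_mult[symmetric] sum_distrib_left mult.commute)
    finally show "(\<integral>\<^sup>+s\<in>{0..T}. ennreal ((norm (?H s w - 0))\<^sup>2) \<partial>lborel) = ennreal ((T / real N) * (\<Sum>j<N. ?v j))" .
  qed
  finally show ?thesis unfolding L2dist_def by simp
qed

text \<open>Under the tilted law the log-density is distributed like \<open>log_density_inv\<close> of the untilted grid increments,
  so the tail integral is a probability, and Chebyshev's inequality bounds it.\<close>

theorem density_tail:
  assumes N: "N > 0" and \<theta>: "kernel_sq T N A \<le> \<theta>" "\<theta> < 1/2" and L: "L > 0"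
  shows "(\<integral>\<^sup>+w. ennreal (exp (log_density (T / real N) A N (grid_vec N w))) * indicator {w. L < log_density (T / real N) A N (grid_vec N w)} w \<partial>M)
     \<le> ennreal ((36 / L\<^sup>2 + 1 / L) * (2 * \<theta> / (1 - 2 * \<theta>)))"
proof -
  define h where "h = T / real N"
  define F where "F = log_density_inv h A N"
  define g where "g y = (indicator {y. L < F y} y :: ennreal)" for y
  have Fm[measurable]: "F \<in> borel_measurable (Pi\<^sub>M {..<N} (\<lambda>_. borel))" unfolding F_def by (rule log_density_inv_measurable)
  have gm: "g \<in> borel_measurable (Pi\<^sub>M {..<N} (\<lambda>_. borel))" unfolding g_def by measurable
  let ?S = "\<lambda>w. h * (\<Sum>j<N. (norm (grid_inv N A j w))\<^sup>2)" and ?Q = "\<lambda>w. \<Sum>j<N. grid_inv N A j w \<bullet> grid_incr N j w"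
  have h0: "h > 0" using T_pos N by (simp add: h_def)
  have S0: "?S w \<ge> 0" for w using h0 by (intro mult_nonneg_nonneg sum_nonneg) auto
  have Si: "integrable M ?S" "(\<integral>w. ?S w \<partial>M) \<le> 2 * \<theta> / (1 - 2 * \<theta>)" using grid_inv_expect[OF N \<theta>] unfolding h_def by auto
  have Sn: "(\<integral>\<^sup>+w. ennreal (?S w) \<partial>M) \<le> ennreal (2 * \<theta> / (1 - 2 * \<theta>))"
    using Si S0 by (subst nn_integral_eq_integral) (auto intro!: ennreal_leI)
  have Gm[measurable]: "grid_inv N A j \<in> borel_measurable M" if "j < N" for j using grid_inv_sq[OF N, of j A] that by (simp add: sq_int_def)
  have Qm: "?Q \<in> borel_measurable M" using Gm by (intro borel_measurable_sum borel_measurable_inner) auto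
  have Sm: "?S \<in> borel_measurable M" using Si(1) by auto
  have "(\<integral>\<^sup>+w. ennreal (exp (log_density h A N (grid_vec N w))) * indicator {w. L < log_density h A N (grid_vec N w)} w \<partial>M)
     = (\<integral>\<^sup>+w. ennreal (exp (log_density h A N (grid_vec N w))) * g (shear h A N (grid_vec N w)) \<partial>M)"
    unfolding g_def F_def by (intro nn_integral_cong) (simp add: log_density_shear indicator_def)
  also have "\<dots> = (\<integral>\<^sup>+w. g (grid_vec N w) \<partial>M)" unfolding h_def by (rule grid_girsanov[OF N gm])
  also have "\<dots> \<le> (\<integral>\<^sup>+w. ennreal (4 / L\<^sup>2) * ennreal ((?Q w)\<^sup>2) + ennreal (1 / L) * ennreal (?S w) \<partial>M)"
  proof (intro nn_integral_mono)
    fix w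
    have Fw: "F (grid_vec N w) = ?Q w + 1 / 2 * ?S w"
      unfolding F_def log_density_inv_def grid_inv_def h_def by (simp add: grid_vec_def)
    have eq1: "ennreal (4 / L\<^sup>2) * ennreal ((?Q w)\<^sup>2) + ennreal (1 / L) * ennreal (?S w) = ennreal (4 / L\<^sup>2 * (?Q w)\<^sup>2 + 1 / L * ?S w)"
      using L S0[of w] by (intro ennreal_mult_add) auto
    \<comment> \<open>The exponent is \<open>?Q w + 1 / 2 * ?S w\<close>; if it exceeds
      \<open>L\<close>, then \<open>?Q w\<close> exceeds \<open>L / 2\<close> or \<open>?S w\<close>
      reaches \<open>L\<close>. The first case is paid by the square of \<open>?Q\<close>, whose
      mean is at most 9 times that of \<open>?S\<close>, which turns \<open>4 / L\<^sup>2\<close>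
      into \<open>36 / L\<^sup>2\<close>; the second costs \<open>1 / L\<close>.\<close>
    have ge1: "1 \<le> 4 / L\<^sup>2 * (?Q w)\<^sup>2 + 1 / L * ?S w" if "L < F (grid_vec N w)"
    proof (cases "?Q w > L / 2")
      case True
      then have "(L / 2)\<^sup>2 \<le> (?Q w)\<^sup>2" using L by (intro power_mono) auto
      then have "4 / L\<^sup>2 * (L / 2)\<^sup>2 \<le> 4 / L\<^sup>2 * (?Q w)\<^sup>2" using L by (intro mult_left_mono) auto
      moreover have "4 / L\<^sup>2 * (L / 2)\<^sup>2 = 1" using L by (simp add: power_divide)
      moreover have "0 \<le> 1 / L * ?S w" by (rule mult_nonneg_nonneg[OF _ S0]) (use L in simp)
      ultimately show ?thesis by linarith
    next
      case False
      then have "L \<le> ?S w" using that unfolding Fw by linarith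
      then have "1 \<le> 1 / L * ?S w" using L by (simp add: field_simps)
      moreover have "0 \<le> 4 / L\<^sup>2 * (?Q w)\<^sup>2" using L by simp
      ultimately show ?thesis by linarith
    qed
    show "g (grid_vec N w) \<le> ennreal (4 / L\<^sup>2) * ennreal ((?Q w)\<^sup>2) + ennreal (1 / L) * ennreal (?S w)"
    proof (cases "L < F (grid_vec N w)")
      case True
      then have "g (grid_vec N w) = 1" by (simp add: g_def)
      also have "1 \<le> ennreal (4 / L\<^sup>2 * (?Q w)\<^sup>2 + 1 / L * ?S w)" using ge1[OF True] ennreal_ge_1 by blast
      finally show ?thesis unfolding eq1 .
    next
      case False
      then have "g (grid_vec N w) = 0" by (simp add: g_def)
      then show ?thesis by simp
    qed
  qed
  also have "\<dots> = ennreal (4 / L\<^sup>2) * (\<integral>\<^sup>+w. ennreal ((?Q w)\<^sup>2) \<partial>M) + ennreal (1 / L) * (\<integral>\<^sup>+w. ennreal (?S w) \<partial>M)"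
    using Qm Sm by (simp add: nn_integral_add nn_integral_cmult)
  also have "\<dots> \<le> ennreal (4 / L\<^sup>2) * (9 * ennreal (2 * \<theta> / (1 - 2 * \<theta>))) + ennreal (1 / L) * ennreal (2 * \<theta> / (1 - 2 * \<theta>))"
    using grid_inv_ito[OF N, of A] Sn unfolding h_def[symmetric]
    by (intro add_mono mult_left_mono order_trans[OF grid_inv_ito[OF N, of A, folded h_def]]) auto
  also have "\<dots> = ennreal ((36 / L\<^sup>2 + 1 / L) * (2 * \<theta> / (1 - 2 * \<theta>)))"
  proof -
    have "0 \<le> kernel_sq T N A" unfolding kernel_sq_def by (intro mult_nonneg_nonneg sum_nonneg) auto
    then have c: "0 \<le> 2 * \<theta> / (1 - 2 * \<theta>)" using \<theta> by auto
    define c where "c = 2 * \<theta> / (1 - 2 * \<theta>)"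
    have "ennreal (4 / L\<^sup>2) * (9 * ennreal c) = ennreal (36 / L\<^sup>2 * c)"
      using c L unfolding c_def[symmetric] by (simp add: ennreal_numeral_mult[symmetric] ennreal_mult[symmetric])
    moreover have "ennreal (1 / L) * ennreal c = ennreal (1 / L * c)" using c L unfolding c_def[symmetric] by (simp add: ennreal_mult[symmetric])
    moreover have "ennreal (36 / L\<^sup>2 * c) + ennreal (1 / L * c) = ennreal (36 / L\<^sup>2 * c + 1 / L * c)"
      using c L unfolding c_def[symmetric] by (intro ennreal_plus[symmetric] mult_nonneg_nonneg) auto
    ultimately show ?thesis unfolding c_def[symmetric] by (simp add: distrib_right)
  qed
  finally show ?thesis unfolding h_def .
qed

end

section \<open>The reduced kernel\<close>

lemma sum_triangle_swap:
  fixes g :: "nat \<Rightarrow> nat \<Rightarrow> 'a::comm_monoid_add"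
  shows "(\<Sum>j<N. \<Sum>k<j. g j k) = (\<Sum>k<N. \<Sum>j\<in>{k<..<N}. g j k)"
proof (induction N)
  case (Suc N)
  have "(\<Sum>k<Suc N. \<Sum>j\<in>{k<..<Suc N}. g j k) = (\<Sum>k<N. \<Sum>j\<in>{k<..<Suc N}. g j k)"
  proof -
    have "{N<..<Suc N} = {}" by auto
    then show ?thesis by simp
  qed
  also have "\<dots> = (\<Sum>k<N. (\<Sum>j\<in>{k<..<N}. g j k) + g N k)"
  proof (intro sum.cong refl)
    fix k assume "k \<in> {..<N}"
    then have "{k<..<Suc N} = insert N {k<..<N}" by auto
    then show "(\<Sum>j\<in>{k<..<Suc N}. g j k) = (\<Sum>j\<in>{k<..<N}. g j k) + g N k" by (simp add: add.commute)
  qed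
  finally show ?case using Suc by (simp add: sum.distrib)
qed simp

lemma inner_sum_self:
  fixes a :: "nat \<Rightarrow> 'a::real_inner"
  shows "(\<Sum>k<j. a k) \<bullet> (\<Sum>k<j. a k) = (\<Sum>k<j. a k \<bullet> a k) + 2 * (\<Sum>k<j. \<Sum>l<k. a l \<bullet> a k)"
proof (induction j)
  case (Suc j)
  have "(\<Sum>k<Suc j. a k) \<bullet> (\<Sum>k<Suc j. a k) = (\<Sum>k<j. a k) \<bullet> (\<Sum>k<j. a k) + 2 * ((\<Sum>k<j. a k) \<bullet> a j) + a j \<bullet> a j"
    by (simp add: inner_add_left inner_add_right inner_commute)
  also have "(\<Sum>k<j. a k) \<bullet> a j = (\<Sum>l<j. a l \<bullet> a j)" by (rule inner_sum_left)
  finally show ?case unfolding Suc by simp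
qed simp

text \<open>What the kernel becomes when the off-diagonal part of the squared drift in the Girsanov
  exponent is absorbed into it; \<open>diag_form\<close> is the part that remains.\<close>

definition reduced_kernel :: "real \<Rightarrow> nat \<Rightarrow> (nat \<Rightarrow> nat \<Rightarrow> real ^ 'd ^ 'd) \<Rightarrow> nat \<Rightarrow> nat \<Rightarrow> real ^ 'd ^ 'd" where
  "reduced_kernel h N A k l = A k l - h *\<^sub>R (\<Sum>j\<in>{k<..<N}. transpose (A j k) ** A j l)"

definition diag_form :: "real \<Rightarrow> nat \<Rightarrow> (nat \<Rightarrow> nat \<Rightarrow> real ^ 'd ^ 'd) \<Rightarrow> nat \<Rightarrow> real ^ 'd \<Rightarrow> real" where
  "diag_form h N A k x = h * (\<Sum>j\<in>{k<..<N}. (norm (A j k *v x))\<^sup>2)"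

lemma matrix_sum_vector: "(\<Sum>j\<in>F. (B j :: real ^ 'd ^ 'd)) *v x = (\<Sum>j\<in>F. B j *v x)"
  by (induction F rule: infinite_finite_induct) (auto simp: matrix_vector_mult_add_rdistrib)

lemma matrix_scaleR_vector: "(c *\<^sub>R (B :: real ^ 'd ^ 'd)) *v x = c *\<^sub>R (B *v x)"
  by (simp add: scaleR_matrix_vector_assoc)

lemma matrix_transpose_inner: "((transpose (B :: real ^ 'd ^ 'd) ** C) *v x) \<bullet> y = (C *v x) \<bullet> (B *v y)"
  by (metis dot_lmul_matrix matrix_vector_mul_assoc transpose_matrix_vector)

text \<open>The square of the drift of cell \<open>j\<close> consists of diagonal terms and of pairs
  \<open>l < k < j\<close>. After exchanging the sums over \<open>j\<close> and \<open>k\<close>,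
  the pairs belonging to a fixed \<open>k\<close> are linear in the earlier \<open>x l\<close> and
  are paired with \<open>x k\<close>, the matrix \<open>A j k\<close> moving across the inner
  product as a transpose. They thus have the form of a drift term; their factor 2 cancels the 1/2 of
  the energy.\<close>

lemma log_density_decompose:
  "log_density h A N x = (\<Sum>k<N. lin_drift (reduced_kernel h N A) k x \<bullet> x k) - 1 / 2 * (\<Sum>k<N. diag_form h N A k (x k))"
proof -
  have "(\<Sum>j<N. lin_drift A j x \<bullet> lin_drift A j x) = (\<Sum>j<N. \<Sum>k<j. (norm (A j k *v x k))\<^sup>2) + 2 * (\<Sum>j<N. \<Sum>k<j. \<Sum>l<k. (A j l *v x l) \<bullet> (A j k *v x k))"
    unfolding lin_drift_def inner_sum_self by (simp add: sum.distrib sum_distrib_left power2_norm_eq_inner)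
  also have "\<dots> = (\<Sum>k<N. \<Sum>j\<in>{k<..<N}. (norm (A j k *v x k))\<^sup>2) + 2 * (\<Sum>k<N. \<Sum>j\<in>{k<..<N}. \<Sum>l<k. (A j l *v x l) \<bullet> (A j k *v x k))"
    unfolding sum_triangle_swap[of "\<lambda>j k. (norm (A j k *v x k))\<^sup>2"] sum_triangle_swap[of "\<lambda>j k. \<Sum>l<k. (A j l *v x l) \<bullet> (A j k *v x k)"] ..
  finally have 1: "(\<Sum>j<N. lin_drift A j x \<bullet> lin_drift A j x) = (\<Sum>k<N. \<Sum>j\<in>{k<..<N}. (norm (A j k *v x k))\<^sup>2) + 2 * (\<Sum>k<N. \<Sum>j\<in>{k<..<N}. \<Sum>l<k. (A j l *v x l) \<bullet> (A j k *v x k))" .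
  have 2: "lin_drift (reduced_kernel h N A) k x \<bullet> x k = lin_drift A k x \<bullet> x k - h * (\<Sum>j\<in>{k<..<N}. \<Sum>l<k. (A j l *v x l) \<bullet> (A j k *v x k))" for k
  proof -
    have "lin_drift (reduced_kernel h N A) k x \<bullet> x k = (\<Sum>l<k. (A k l *v x l) \<bullet> x k - h * (\<Sum>j\<in>{k<..<N}. (A j l *v x l) \<bullet> (A j k *v x k)))"
      unfolding lin_drift_def reduced_kernel_def
      by (simp add: inner_sum_left matrix_vector_mult_diff_rdistrib inner_diff_left matrix_scaleR_vector matrix_sum_vector matrix_transpose_inner)
    also have "\<dots> = lin_drift A k x \<bullet> x k - h * (\<Sum>l<k. \<Sum>j\<in>{k<..<N}. (A j l *v x l) \<bullet> (A j k *v x k))"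
      unfolding lin_drift_def by (simp add: sum_subtractf inner_sum_left sum_distrib_left)
    also have "(\<Sum>l<k. \<Sum>j\<in>{k<..<N}. (A j l *v x l) \<bullet> (A j k *v x k)) = (\<Sum>j\<in>{k<..<N}. \<Sum>l<k. (A j l *v x l) \<bullet> (A j k *v x k))"
      by (rule sum.swap)
    finally show ?thesis .
  qed
  have "log_density h A N x = (\<Sum>j<N. lin_drift A j x \<bullet> x j) - h / 2 * (\<Sum>j<N. lin_drift A j x \<bullet> lin_drift A j x)"
    unfolding log_density_def by (simp add: sum_subtractf sum_distrib_left)
  then show ?thesis unfolding 1 2 diag_form_def
    by (simp add: sum_subtractf sum_distrib_left[symmetric] algebra_simps)
qed

context wiener_setup
begin

lemma lin_drift_grid: "j \<le> N \<Longrightarrow> lin_drift A j (grid_vec N w) = step_drift N A j w"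
  unfolding lin_drift_def step_drift_def grid_vec_def by (intro sum.cong) auto

lemma log_density_grid:
  "log_density h A N (grid_vec N w) = step_q N (reduced_kernel h N A) w - 1 / 2 * (\<Sum>k<N. diag_form h N A k (grid_incr N k w))"
proof -
  have "(\<Sum>k<N. lin_drift (reduced_kernel h N A) k (grid_vec N w) \<bullet> grid_vec N w k) = step_q N (reduced_kernel h N A) w"
    unfolding step_q_def by (intro sum.cong refl) (simp add: lin_drift_grid, simp add: grid_vec_def)
  moreover have "(\<Sum>k<N. diag_form h N A k (grid_vec N w k)) = (\<Sum>k<N. diag_form h N A k (grid_incr N k w))"
    by (intro sum.cong refl) (simp add: grid_vec_def)
  ultimately show ?thesis unfolding log_density_decompose by simp
qed

lemma grid_incr_fourth:
  assumes N: "N > 0" and k: "k < N"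
  shows "integrable M (\<lambda>w. (norm (grid_incr N k w)) ^ 4)" "(\<integral>w. (norm (grid_incr N k w)) ^ 4 \<partial>M) \<le> 3 * (real CARD('d))\<^sup>2 * (T / real N)\<^sup>2"
proof -
  note o = grid_order[OF N k]
  have d: "T * real (Suc k) / real N - T * real k / real N = T / real N"
    by (simp add: diff_divide_distrib[symmetric] algebra_simps)
  have i: "integrable M (\<lambda>w. (grid_incr N k w $ i) ^ 4)" "(\<integral>w. (grid_incr N k w $ i) ^ 4 \<partial>M) = 3 * (T / real N)\<^sup>2" for i
    using increment_moment4[OF o, of i] unfolding grid_incr_def d by auto
  have le: "(norm x) ^ 4 \<le> real CARD('d) * (\<Sum>i\<in>UNIV. (x $ i) ^ 4)" for x :: "real ^ 'd"
  proof -
    have "(norm x) ^ 4 = ((norm x)\<^sup>2)\<^sup>2" by simp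
    also have "\<dots> = (\<Sum>i\<in>UNIV. (x $ i)\<^sup>2)\<^sup>2" by (simp add: norm_vec_sq)
    also have "\<dots> \<le> (\<Sum>i\<in>UNIV. ((x $ i)\<^sup>2)\<^sup>2) * real CARD('d)" by (rule sum_squared_le_sum_of_squares)
    finally show ?thesis by (simp add: mult.commute)
  qed
  have b: "integrable M (\<lambda>w. real CARD('d) * (\<Sum>i\<in>UNIV. (grid_incr N k w $ i) ^ 4))"
    using i by (intro integrable_mult_right Bochner_Integration.integrable_sum)
  show j: "integrable M (\<lambda>w. (norm (grid_incr N k w)) ^ 4)"
  proof (rule Bochner_Integration.integrable_bound[OF b])
    show "AE w in M. norm ((norm (grid_incr N k w)) ^ 4) \<le> norm (real CARD('d) * (\<Sum>i\<in>UNIV. (grid_incr N k w $ i) ^ 4))"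
      using le by (intro AE_I2) (auto simp: sum_nonneg abs_mult)
  qed measurable
  have "(\<integral>w. (norm (grid_incr N k w)) ^ 4 \<partial>M) \<le> (\<integral>w. real CARD('d) * (\<Sum>i\<in>UNIV. (grid_incr N k w $ i) ^ 4) \<partial>M)"
    by (intro integral_mono j b le)
  also have "\<dots> = real CARD('d) * (\<Sum>i\<in>(UNIV::'d set). 3 * (T / real N)\<^sup>2)"
    using i by (simp add: Bochner_Integration.integral_sum)
  finally show "(\<integral>w. (norm (grid_incr N k w)) ^ 4 \<partial>M) \<le> 3 * (real CARD('d))\<^sup>2 * (T / real N)\<^sup>2"
    by (simp add: power2_eq_square mult_ac)
qed

lemma matrix_incr_sq:
  assumes N: "N > 0" and k: "k < N"
  shows "integrable M (\<lambda>w. (norm (B *v grid_incr N k w))\<^sup>2)" "(\<integral>w. (norm (B *v grid_incr N k w))\<^sup>2 \<partial>M) = (T / real N) * (norm B)\<^sup>2"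
proof -
  note o = grid_order[OF N k]
  have d: "T * real (Suc k) / real N - T * real k / real N = T / real N"
    by (simp add: diff_divide_distrib[symmetric] algebra_simps)
  have r: "integrable M (\<lambda>w. (B $ i \<bullet> grid_incr N k w)\<^sup>2)" "(\<integral>w. (B $ i \<bullet> grid_incr N k w)\<^sup>2 \<partial>M) = (T / real N) * (norm (B $ i))\<^sup>2" for i
    using increment_moment2[OF o, of "B $ i"] increment_moment_integrable[OF o, of "B $ i" 2]
    unfolding grid_incr_def d by (auto simp: power2_norm_eq_inner)
  have e: "(norm (B *v x))\<^sup>2 = (\<Sum>i\<in>UNIV. (B $ i \<bullet> x)\<^sup>2)" for x
    by (simp add: norm_vec_sq matrix_vector_mul_component)
  show "integrable M (\<lambda>w. (norm (B *v grid_incr N k w))\<^sup>2)" unfolding e using r by (intro Bochner_Integration.integrable_sum)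
  show "(\<integral>w. (norm (B *v grid_incr N k w))\<^sup>2 \<partial>M) = (T / real N) * (norm B)\<^sup>2"
    unfolding e using r by (subst Bochner_Integration.integral_sum) (auto simp: norm_vec_sq[of B] sum_distrib_left)
qed

text \<open>The \<open>k\<close>-th diagonal form depends on the \<open>k\<close>-th increment
  alone, so the centred forms are uncorrelated and their variances add. By the fourth Gaussian
  moment each is at most \<open>3 * (real CARD('d))\<^sup>2 * h\<^sup>2\<close> times the square of
  \<open>T * C\<^sup>2\<close>; with \<open>h = T / real N\<close> the \<open>N\<close> terms sum to
  order \<open>C ^ 4 / real N\<close>. The means sum to \<open>kernel_sq\<close>.\<close>

theorem diag_variance:
  assumes N: "N > 0" and C: "C \<ge> 0" "\<And>j k. norm (A j k) \<le> C"
  defines "h \<equiv> T / real N"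
  shows "(\<integral>\<^sup>+w. ennreal (((\<Sum>k<N. diag_form h N A k (grid_incr N k w)) - kernel_sq T N A)\<^sup>2) \<partial>M) \<le> ennreal (3 * (real CARD('d))\<^sup>2 * T ^ 4 * (C ^ 4 / real N))"
proof -
  have h: "h > 0" using T_pos N by (simp add: h_def)
  define e where "e k = h\<^sup>2 * (\<Sum>j\<in>{k<..<N}. (norm (A j k))\<^sup>2)" for k
  define V where "V k w = diag_form h N A k (grid_incr N k w) - e k" for k w
  have dm: "diag_form h N A k \<in> borel_measurable borel" for k
    unfolding diag_form_def by measurable
  have Dint: "integrable M (\<lambda>w. diag_form h N A k (grid_incr N k w))" "(\<integral>w. diag_form h N A k (grid_incr N k w) \<partial>M) = e k" if "k < N" for k
  proof -
    show "integrable M (\<lambda>w. diag_form h N A k (grid_incr N k w))"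
      unfolding diag_form_def using matrix_incr_sq(1)[OF N that] by (intro integrable_mult_right Bochner_Integration.integrable_sum)
    show "(\<integral>w. diag_form h N A k (grid_incr N k w) \<partial>M) = e k"
    proof -
      have "(\<integral>w. diag_form h N A k (grid_incr N k w) \<partial>M) = h * (\<integral>w. (\<Sum>j\<in>{k<..<N}. (norm (A j k *v grid_incr N k w))\<^sup>2) \<partial>M)"
        unfolding diag_form_def by (rule integral_mult_right_zero)
      also have "(\<integral>w. (\<Sum>j\<in>{k<..<N}. (norm (A j k *v grid_incr N k w))\<^sup>2) \<partial>M) = (\<Sum>j\<in>{k<..<N}. \<integral>w. (norm (A j k *v grid_incr N k w))\<^sup>2 \<partial>M)"
        by (rule Bochner_Integration.integral_sum) (rule matrix_incr_sq(1)[OF N that])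
      also have "\<dots> = (\<Sum>j\<in>{k<..<N}. h * (norm (A j k))\<^sup>2)" unfolding matrix_incr_sq(2)[OF N that] h_def ..
      finally show ?thesis unfolding e_def by (simp add: sum_distrib_left[symmetric] power2_eq_square[of h])
    qed
  qed
  have sume: "(\<Sum>k<N. e k) = kernel_sq T N A"
    unfolding e_def kernel_sq_def h_def sum_triangle_swap[of "\<lambda>j k. (norm (A j k))\<^sup>2"] by (simp add: sum_distrib_left)
  have Dle: "0 \<le> diag_form h N A k x" "diag_form h N A k x \<le> T * C\<^sup>2 * (norm x)\<^sup>2" for k x
  proof -
    show "0 \<le> diag_form h N A k x" unfolding diag_form_def using h by (intro mult_nonneg_nonneg sum_nonneg) auto
    have "(\<Sum>j\<in>{k<..<N}. (norm (A j k *v x))\<^sup>2) \<le> (\<Sum>j\<in>{k<..<N}. C\<^sup>2 * (norm x)\<^sup>2)"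
    proof (rule sum_mono)
      fix j
      have "norm (A j k *v x) \<le> C * norm x" using norm_matrix_vector_le[of "A j k" x] mult_right_mono[OF C(2)[of j k], of "norm x"] by simp
      then have "(norm (A j k *v x))\<^sup>2 \<le> (C * norm x)\<^sup>2" by (intro power_mono) auto
      then show "(norm (A j k *v x))\<^sup>2 \<le> C\<^sup>2 * (norm x)\<^sup>2" by (simp add: power_mult_distrib)
    qed
    also have "\<dots> \<le> real N * (C\<^sup>2 * (norm x)\<^sup>2)" by (simp add: mult_right_mono)
    finally have "h * (\<Sum>j\<in>{k<..<N}. (norm (A j k *v x))\<^sup>2) \<le> h * (real N * (C\<^sup>2 * (norm x)\<^sup>2))" using h by (intro mult_left_mono) auto
    then show "diag_form h N A k x \<le> T * C\<^sup>2 * (norm x)\<^sup>2" unfolding diag_form_def h_def using N by simp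
  qed
  have D2: "integrable M (\<lambda>w. (diag_form h N A k (grid_incr N k w))\<^sup>2)" "(\<integral>w. (diag_form h N A k (grid_incr N k w))\<^sup>2 \<partial>M) \<le> (T * C\<^sup>2)\<^sup>2 * (3 * (real CARD('d))\<^sup>2 * h\<^sup>2)" if k: "k < N" for k
  proof -
    have p: "(diag_form h N A k x)\<^sup>2 \<le> (T * C\<^sup>2)\<^sup>2 * (norm x) ^ 4" for x
    proof -
      have "(diag_form h N A k x)\<^sup>2 \<le> (T * C\<^sup>2 * (norm x)\<^sup>2)\<^sup>2" using Dle[of k x] by (intro power_mono)
      then show ?thesis by (simp add: power_mult_distrib)
    qed
    have bi: "integrable M (\<lambda>w. (T * C\<^sup>2)\<^sup>2 * (norm (grid_incr N k w)) ^ 4)" using grid_incr_fourth(1)[OF N k] by (intro integrable_mult_right)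
    show ii: "integrable M (\<lambda>w. (diag_form h N A k (grid_incr N k w))\<^sup>2)"
    proof (rule Bochner_Integration.integrable_bound[OF bi])
      show "(\<lambda>w. (diag_form h N A k (grid_incr N k w))\<^sup>2) \<in> borel_measurable M"
        using measurable_compose[OF grid_incr_measurable dm] by measurable
      show "AE w in M. norm ((diag_form h N A k (grid_incr N k w))\<^sup>2) \<le> norm ((T * C\<^sup>2)\<^sup>2 * (norm (grid_incr N k w)) ^ 4)"
        using p by (intro AE_I2) (simp add: abs_mult)
    qed
    have "(\<integral>w. (diag_form h N A k (grid_incr N k w))\<^sup>2 \<partial>M) \<le> (\<integral>w. (T * C\<^sup>2)\<^sup>2 * (norm (grid_incr N k w)) ^ 4 \<partial>M)"
      by (intro integral_mono ii bi p)
    also have "\<dots> = (T * C\<^sup>2)\<^sup>2 * (\<integral>w. (norm (grid_incr N k w)) ^ 4 \<partial>M)" by simp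
    also have "\<dots> \<le> (T * C\<^sup>2)\<^sup>2 * (3 * (real CARD('d))\<^sup>2 * h\<^sup>2)"
      using grid_incr_fourth(2)[OF N k] unfolding h_def by (intro mult_left_mono) auto
    finally show "(\<integral>w. (diag_form h N A k (grid_incr N k w))\<^sup>2 \<partial>M) \<le> (T * C\<^sup>2)\<^sup>2 * (3 * (real CARD('d))\<^sup>2 * h\<^sup>2)" .
  qed
  have Vint: "integrable M (V k)" "(\<integral>w. V k w \<partial>M) = 0" if "k < N" for k
    unfolding V_def using Dint[OF that] by (auto simp: prob_space)
  have V2: "integrable M (\<lambda>w. (V k w)\<^sup>2)" "(\<integral>w. (V k w)\<^sup>2 \<partial>M) \<le> (T * C\<^sup>2)\<^sup>2 * (3 * (real CARD('d))\<^sup>2 * h\<^sup>2)" if k: "k < N" for k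
  proof -
    have e: "(V k w)\<^sup>2 = (diag_form h N A k (grid_incr N k w))\<^sup>2 - 2 * e k * diag_form h N A k (grid_incr N k w) + (e k)\<^sup>2" for w
      by (simp add: V_def power2_diff mult_ac)
    show "integrable M (\<lambda>w. (V k w)\<^sup>2)" unfolding e using D2[OF k] Dint[OF k] by auto
    have "(\<integral>w. (V k w)\<^sup>2 \<partial>M) = (\<integral>w. (diag_form h N A k (grid_incr N k w))\<^sup>2 \<partial>M) - 2 * e k * e k + (e k)\<^sup>2"
      unfolding e using D2[OF k] Dint[OF k] by (simp add: prob_space)
    also have "\<dots> \<le> (\<integral>w. (diag_form h N A k (grid_incr N k w))\<^sup>2 \<partial>M)" by (simp add: power2_eq_square)
    finally show "(\<integral>w. (V k w)\<^sup>2 \<partial>M) \<le> (T * C\<^sup>2)\<^sup>2 * (3 * (real CARD('d))\<^sup>2 * h\<^sup>2)" using D2(2)[OF k] by linarith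
  qed
  \<comment> \<open>For \<open>k < l\<close> the \<open>k\<close>-th term is known when cell
    \<open>l\<close> begins, so it is independent of the \<open>l\<close>-th, and both have mean
    0.\<close>
  have cross: "integrable M (\<lambda>w. V k w * V l w)" "(\<integral>w. V k w * V l w \<partial>M) = 0" if kl: "k < l" "l < N" for k l
  proof -
    have m: "V k \<in> borel_measurable (Filt T (T * real l / real N))"
      unfolding V_def by (intro borel_measurable_diff measurable_compose[OF grid_incr_Filt dm] borel_measurable_const kl)
    have gl: "(\<lambda>x. diag_form h N A l x - e l) \<in> borel_measurable borel" using dm by measurable
    have ind: "indep_var borel (V k) borel (V l)"
      using Filt_indep_var[OF grid_order[OF N kl(2)] m gl] unfolding V_def grid_incr_def .
    show "integrable M (\<lambda>w. V k w * V l w)" using indep_var_integrable[OF ind] Vint kl by auto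
    show "(\<integral>w. V k w * V l w \<partial>M) = 0" using indep_var_lebesgue_integral[OF ind] Vint kl by auto
  qed
  have "has_bochner_integral M (\<lambda>w. (\<Sum>k<n. V k w)\<^sup>2) (\<Sum>k<n. \<integral>w. (V k w)\<^sup>2 \<partial>M)" if "n \<le> N" for n
    using that
  proof (induction n)
    case (Suc n)
    have "has_bochner_integral M (\<lambda>w. \<Sum>k<n. V k w * V n w) (\<Sum>k<n. 0)"
      using cross[of _ n] Suc.prems by (intro has_bochner_integral_sum) (auto simp: has_bochner_integral_iff)
    then have c: "has_bochner_integral M (\<lambda>w. 2 * (\<Sum>k<n. V k w * V n w)) (2 * 0)" by (intro has_bochner_integral_mult_right) simp
    have n: "has_bochner_integral M (\<lambda>w. (V n w)\<^sup>2) (\<integral>w. (V n w)\<^sup>2 \<partial>M)" using V2(1)[of n] Suc.prems by (intro has_bochner_integral_integrable) simp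
    have "(\<Sum>k<Suc n. V k w)\<^sup>2 = (\<Sum>k<n. V k w)\<^sup>2 + (2 * (\<Sum>k<n. V k w * V n w) + (V n w)\<^sup>2)" for w
      by (simp add: power2_sum sum_distrib_left sum_distrib_right mult_ac)
    then show ?case using has_bochner_integral_add[OF Suc.IH has_bochner_integral_add[OF c n]] Suc.prems by simp
  qed (simp add: has_bochner_integral_zero)
  from this[OF order_refl] have tot: "has_bochner_integral M (\<lambda>w. (\<Sum>k<N. V k w)\<^sup>2) (\<Sum>k<N. \<integral>w. (V k w)\<^sup>2 \<partial>M)" .
  have "(\<Sum>k<N. V k w) = (\<Sum>k<N. diag_form h N A k (grid_incr N k w)) - kernel_sq T N A" for w
    unfolding V_def sum_subtractf sume ..
  then have "(\<integral>\<^sup>+w. ennreal (((\<Sum>k<N. diag_form h N A k (grid_incr N k w)) - kernel_sq T N A)\<^sup>2) \<partial>M) = ennreal (\<Sum>k<N. \<integral>w. (V k w)\<^sup>2 \<partial>M)"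
    using tot by (simp add: has_bochner_integral_iff nn_integral_eq_integral)
  also have "\<dots> \<le> ennreal (\<Sum>k<N. (T * C\<^sup>2)\<^sup>2 * (3 * (real CARD('d))\<^sup>2 * h\<^sup>2))"
    using V2(2) by (intro ennreal_leI sum_mono) auto
  also have "(\<Sum>k<N. (T * C\<^sup>2)\<^sup>2 * (3 * (real CARD('d))\<^sup>2 * h\<^sup>2)) = 3 * (real CARD('d))\<^sup>2 * T ^ 4 * (C ^ 4 / real N)"
    using N unfolding h_def by (simp add: power_mult_distrib power_divide field_simps power2_eq_square power4_eq_xxxx)
  finally show ?thesis .
qed

end

section \<open>Convergence of the reduced kernels\<close>

lemma norm_transpose: "norm (transpose (A :: real ^ 'd ^ 'e)) = norm A"
proof -
  have "(norm (transpose A))\<^sup>2 = (\<Sum>i\<in>UNIV. \<Sum>j\<in>UNIV. (A $ j $ i)\<^sup>2)"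
    by (simp add: norm_vec_sq transpose_def)
  also have "\<dots> = (\<Sum>j\<in>UNIV. \<Sum>i\<in>UNIV. (A $ j $ i)\<^sup>2)" by (rule sum.swap)
  also have "\<dots> = (norm A)\<^sup>2" by (simp add: norm_vec_sq)
  finally show ?thesis by simp
qed

lemma norm_matrix_mult_le: "norm ((A :: real ^ 'd ^ 'd) ** B) \<le> norm A * norm B"
proof -
  have r: "(A ** B) $ i = transpose B *v (A $ i)" for i
    by (simp add: vec_eq_iff matrix_matrix_mult_def matrix_vector_mult_def transpose_def mult.commute)
  have "(norm (A ** B))\<^sup>2 \<le> (\<Sum>i\<in>UNIV. (norm B * norm (A $ i))\<^sup>2)"
    unfolding norm_vec_sq[of "A ** B"] r
    by (intro sum_mono power_mono norm_ge_zero) (use norm_matrix_vector_le[of "transpose B"] in \<open>simp add: norm_transpose\<close>)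
  also have "\<dots> = (norm A * norm B)\<^sup>2"
    by (simp add: norm_vec_sq[of A] power_mult_distrib sum_distrib_left mult.commute)
  finally show ?thesis by (rule power2_le_imp_le) simp
qed

lemma borel_measurable_transpose_mult[measurable (raw)]:
  fixes f g :: "'a \<Rightarrow> real ^ 'd ^ 'd"
  assumes "f \<in> borel_measurable N" "g \<in> borel_measurable N"
  shows "(\<lambda>x. transpose (f x) ** g x) \<in> borel_measurable N"
proof -
  have "continuous_on UNIV (\<lambda>p :: (real ^ 'd ^ 'd) \<times> (real ^ 'd ^ 'd). transpose (fst p) ** snd p)"
    unfolding matrix_matrix_mult_def transpose_def by (intro continuous_on_vec_lambda continuous_intros)
  then show ?thesis
    using measurable_compose[OF borel_measurable_Pair[OF assms], of "\<lambda>p. transpose (fst p) ** snd p" borel]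
    by (simp add: borel_measurable_continuous_onI)
qed

lemma borel_measurable_section:
  fixes f :: "real \<times> real \<Rightarrow> 'b::topological_space"
  assumes "f \<in> borel_measurable borel"
  shows "(\<lambda>t. f (t, u)) \<in> borel_measurable borel"
  using measurable_compose[OF borel_measurable_Pair[OF measurable_ident_sets[OF refl] borel_measurable_const] assms, of u] by simp

text \<open>The continuous analogue of the sum subtracted in \<open>reduced_kernel\<close>. For a
  kernel supported on the lower triangle the integration effectively starts above both
  arguments.\<close>

definition kernel_product :: "real \<Rightarrow> (real \<times> real \<Rightarrow> real ^ 'd ^ 'd) \<Rightarrow> real \<times> real \<Rightarrow> real ^ 'd ^ 'd" where
  "kernel_product T f p = (\<integral>t. transpose (f (t, fst p)) ** f (t, snd p) \<partial>interval_measure_T T)"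

definition col_sq :: "real \<Rightarrow> (real \<times> real \<Rightarrow> 'b::real_normed_vector) \<Rightarrow> real \<Rightarrow> ennreal" where
  "col_sq T f u = (\<integral>\<^sup>+t. ennreal ((norm (f (t, u)))\<^sup>2) \<partial>interval_measure_T T)"

lemma sigma_finite_interval_measure_T: "sigma_finite_measure (interval_measure_T T)"
  using finite_interval_measure_T by (rule finite_measure.axioms(1))

lemma pair_interval: "pair_sigma_finite (interval_measure_T T) (interval_measure_T T)"
  by (intro pair_sigma_finite.intro sigma_finite_interval_measure_T)

lemma col_sq_measurable[measurable]:
  fixes f :: "real \<times> real \<Rightarrow> 'b::{real_normed_vector, second_countable_topology}"
  assumes "f \<in> borel_measurable borel"
  shows "col_sq T f \<in> borel_measurable borel"
proof -
  interpret P: pair_sigma_finite "interval_measure_T T" "interval_measure_T T" by (rule pair_interval)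
  have [measurable]: "f \<in> borel_measurable (borel \<Otimes>\<^sub>M borel)" using assms by (simp add: borel_prod)
  have "(\<lambda>p. ennreal ((norm (f (snd p, fst p)))\<^sup>2)) \<in> borel_measurable (interval_measure_T T \<Otimes>\<^sub>M interval_measure_T T)"
    by measurable
  from P.M1.borel_measurable_nn_integral_fst[OF this] show ?thesis unfolding col_sq_def by simp
qed

lemma col_sq_integral:
  fixes f :: "real \<times> real \<Rightarrow> 'b::{real_normed_vector, second_countable_topology}"
  assumes "f \<in> borel_measurable borel"
  shows "(\<integral>\<^sup>+u. col_sq T f u \<partial>interval_measure_T T) = (\<integral>\<^sup>+p. ennreal ((norm (f p))\<^sup>2) \<partial>square_measure T)"
proof -
  interpret P: pair_sigma_finite "interval_measure_T T" "interval_measure_T T" by (rule pair_interval)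
  have [measurable]: "f \<in> borel_measurable (borel \<Otimes>\<^sub>M borel)" using assms by (simp add: borel_prod)
  have "(\<lambda>p. ennreal ((norm (f p))\<^sup>2)) \<in> borel_measurable (interval_measure_T T \<Otimes>\<^sub>M interval_measure_T T)"
    by measurable
  from P.nn_integral_snd[OF this] show ?thesis unfolding col_sq_def square_measure_eq by simp
qed

lemma nn_integral_product:
  assumes [measurable]: "a \<in> borel_measurable borel" "b \<in> borel_measurable borel"
  shows "(\<integral>\<^sup>+p. a (fst p) * b (snd p) \<partial>square_measure T) = (\<integral>\<^sup>+u. a u \<partial>interval_measure_T T) * (\<integral>\<^sup>+u. b u \<partial>interval_measure_T T)"
proof -
  interpret P: pair_sigma_finite "interval_measure_T T" "interval_measure_T T" by (rule pair_interval)
  have "(\<lambda>p. a (fst p) * b (snd p)) \<in> borel_measurable (interval_measure_T T \<Otimes>\<^sub>M interval_measure_T T)" by measurable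
  from P.M1.nn_integral_fst[OF this] show ?thesis unfolding square_measure_eq
    by (simp add: nn_integral_cmult nn_integral_multc del: P.M1.nn_integral_fst)
qed

lemma AE_col_sq_finite:
  fixes f :: "real \<times> real \<Rightarrow> 'b::{real_normed_vector, second_countable_topology}"
  assumes f: "f \<in> borel_measurable borel" and fin: "(\<integral>\<^sup>+p. ennreal ((norm (f p))\<^sup>2) \<partial>square_measure T) < \<infinity>"
  shows "AE p in square_measure T. col_sq T f (fst p) < \<infinity> \<and> col_sq T f (snd p) < \<infinity>"
proof -
  interpret P: pair_sigma_finite "interval_measure_T T" "interval_measure_T T" by (rule pair_interval)
  have "AE u in interval_measure_T T. col_sq T f u \<noteq> \<infinity>"
    using col_sq_measurable[OF f] fin unfolding col_sq_integral[OF f, symmetric] by (intro nn_integral_PInf_AE) auto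
  then have a: "AE u in interval_measure_T T. col_sq T f u < \<infinity>" by (simp add: less_top)
  have m[measurable]: "col_sq T f \<in> borel_measurable borel" by (rule col_sq_measurable[OF f])
  have "AE p in square_measure T. col_sq T f (fst p) < \<infinity>"
    unfolding square_measure_eq
  proof (rule P.AE_pair_measure)
    show "AE x in interval_measure_T T. AE y in interval_measure_T T. col_sq T f (fst (x, y)) < \<infinity>" using a by eventually_elim simp
  qed measurable
  moreover have "AE p in square_measure T. col_sq T f (snd p) < \<infinity>"
    unfolding square_measure_eq
  proof (rule P.AE_pair_measure)
    show "AE x in interval_measure_T T. AE y in interval_measure_T T. col_sq T f (snd (x, y)) < \<infinity>" using a by simp
  qed measurable
  ultimately show ?thesis by eventually_elim simp
qed

lemma ennreal_add_sq_le: "((x::ennreal) + y)\<^sup>2 \<le> 2 * x\<^sup>2 + 2 * y\<^sup>2"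
proof (cases "x = \<top> \<or> y = \<top>")
  case True
  then show ?thesis by (auto simp: power2_eq_square ennreal_mult_top ennreal_top_mult)
next
  case False
  then obtain a b where x: "x = ennreal a" "a \<ge> 0" and y: "y = ennreal b" "b \<ge> 0"
    by (metis ennreal_cases)
  have "(a + b)\<^sup>2 \<le> 2 * a\<^sup>2 + 2 * b\<^sup>2" using sum_squares_bound[of a b] by (simp add: power2_sum)
  then show ?thesis using x y ennreal_le_2[of "(a + b)\<^sup>2" "a\<^sup>2" "b\<^sup>2"] by (simp add: ennreal_plus[symmetric] ennreal_power del: ennreal_plus)
qed

lemma kernel_product_integrable:
  assumes f[measurable]: "f \<in> borel_measurable borel" and fin: "col_sq T f u < \<infinity>" "col_sq T f s < \<infinity>"
  shows "integrable (interval_measure_T T) (\<lambda>t. transpose (f (t, u)) ** (f (t, s) :: real ^ 'd ^ 'd))"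
proof (rule integrableI_bounded)
  note [measurable] = borel_measurable_section[OF f]
  have "(\<integral>\<^sup>+t. ennreal (norm (transpose (f (t, u)) ** f (t, s))) \<partial>interval_measure_T T)
    \<le> (\<integral>\<^sup>+t. ennreal ((norm (f (t, u)))\<^sup>2) + ennreal ((norm (f (t, s)))\<^sup>2) \<partial>interval_measure_T T)"
  proof (rule nn_integral_mono)
    fix t
    have "norm (transpose (f (t, u)) ** f (t, s)) \<le> norm (f (t, u)) * norm (f (t, s))"
      using norm_matrix_mult_le[of "transpose (f (t, u))" "f (t, s)"] by (simp add: norm_transpose)
    also have "\<dots> \<le> (norm (f (t, u)))\<^sup>2 + (norm (f (t, s)))\<^sup>2"
      using sum_squares_bound[of "norm (f (t, u))" "norm (f (t, s))"] mult_nonneg_nonneg[OF norm_ge_zero[of "f (t, u)"] norm_ge_zero[of "f (t, s)"]] by linarith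
    finally show "ennreal (norm (transpose (f (t, u)) ** f (t, s))) \<le> ennreal ((norm (f (t, u)))\<^sup>2) + ennreal ((norm (f (t, s)))\<^sup>2)"
      by (simp add: ennreal_plus[symmetric] ennreal_leI del: ennreal_plus)
  qed
  also have "\<dots> = col_sq T f u + col_sq T f s" unfolding col_sq_def by (rule nn_integral_add) measurable
  also have "\<dots> < \<infinity>" using fin by simp
  finally show "(\<integral>\<^sup>+t. ennreal (norm (transpose (f (t, u)) ** f (t, s))) \<partial>interval_measure_T T) < \<infinity>" .
qed measurable

text \<open>Replace one factor at a time, f' f - g' g = (f - g)' f + g' (f - g) with primes for
  transposes, and apply Cauchy-Schwarz in \<open>t\<close>. The bound separates the variables
  \<open>u\<close> and \<open>s\<close>, so its integral over the square factorises by
  \<open>nn_integral_product\<close>.\<close>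

lemma kernel_product_diff:
  fixes f g :: "real \<times> real \<Rightarrow> real ^ 'd ^ 'd"
  assumes f[measurable]: "f \<in> borel_measurable borel" and g[measurable]: "g \<in> borel_measurable borel"
    and fin: "col_sq T f u < \<infinity>" "col_sq T f s < \<infinity>" "col_sq T g u < \<infinity>" "col_sq T g s < \<infinity>"
  shows "ennreal ((norm (kernel_product T f (u, s) - kernel_product T g (u, s)))\<^sup>2)
    \<le> 2 * (col_sq T (\<lambda>p. f p - g p) u * col_sq T f s) + 2 * (col_sq T g u * col_sq T (\<lambda>p. f p - g p) s)"
proof -
  let ?m = "interval_measure_T T"
  note [measurable] = borel_measurable_section[OF f] borel_measurable_section[OF g]
  let ?F = "\<lambda>t. transpose (f (t, u)) ** f (t, s)" and ?G = "\<lambda>t. transpose (g (t, u)) ** g (t, s)"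
  have I: "integrable ?m ?F" "integrable ?m ?G" using kernel_product_integrable fin f g by blast+
  have pt: "norm (?F t - ?G t) \<le> norm (f (t, u) - g (t, u)) * norm (f (t, s)) + norm (g (t, u)) * norm (f (t, s) - g (t, s))" for t
  proof -
    have "?F t - ?G t = transpose (f (t, u) - g (t, u)) ** f (t, s) + transpose (g (t, u)) ** (f (t, s) - g (t, s))"
      by (simp add: vec_eq_iff matrix_matrix_mult_def transpose_def sum.distrib[symmetric] sum_subtractf[symmetric] algebra_simps)
    then show ?thesis
      using norm_triangle_ineq[of "transpose (f (t, u) - g (t, u)) ** f (t, s)" "transpose (g (t, u)) ** (f (t, s) - g (t, s))"]
        norm_matrix_mult_le[of "transpose (f (t, u) - g (t, u))" "f (t, s)"] norm_matrix_mult_le[of "transpose (g (t, u))" "f (t, s) - g (t, s)"]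
      by (simp add: norm_transpose)
  qed
  have "ennreal (norm (kernel_product T f (u, s) - kernel_product T g (u, s))) = ennreal (norm (\<integral>t. ?F t - ?G t \<partial>?m))"
    using I by (simp add: kernel_product_def)
  also have "\<dots> \<le> (\<integral>\<^sup>+t. ennreal (norm (?F t - ?G t)) \<partial>?m)" using I by (intro integral_norm_bound_ennreal) auto
  also have "\<dots> \<le> (\<integral>\<^sup>+t. ennreal (norm (f (t, u) - g (t, u))) * ennreal (norm (f (t, s))) + ennreal (norm (g (t, u))) * ennreal (norm (f (t, s) - g (t, s))) \<partial>?m)"
    unfolding ennreal_mult_add[OF norm_ge_zero norm_ge_zero norm_ge_zero norm_ge_zero] using pt by (intro nn_integral_mono ennreal_leI)
  also have "\<dots> = (\<integral>\<^sup>+t. ennreal (norm (f (t, u) - g (t, u))) * ennreal (norm (f (t, s))) \<partial>?m) + (\<integral>\<^sup>+t. ennreal (norm (g (t, u))) * ennreal (norm (f (t, s) - g (t, s))) \<partial>?m)" (is "_ = ?a + ?b")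
    by (rule nn_integral_add) measurable
  finally have "(ennreal (norm (kernel_product T f (u, s) - kernel_product T g (u, s))))\<^sup>2 \<le> (?a + ?b)\<^sup>2" by (rule power_mono) simp
  also have "\<dots> \<le> 2 * ?a\<^sup>2 + 2 * ?b\<^sup>2" by (rule ennreal_add_sq_le)
  also have "?a\<^sup>2 \<le> col_sq T (\<lambda>p. f p - g p) u * col_sq T f s"
    unfolding col_sq_def ennreal_power[OF norm_ge_zero, symmetric] by (rule Cauchy_Schwarz_nn_integral) measurable
  also have "?b\<^sup>2 \<le> col_sq T g u * col_sq T (\<lambda>p. f p - g p) s"
    unfolding col_sq_def ennreal_power[OF norm_ge_zero, symmetric] by (rule Cauchy_Schwarz_nn_integral) measurable
  finally show ?thesis by (simp add: ennreal_power add_mono mult_left_mono)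
qed

text \<open>The case \<open>l = k\<close> is included: unlike the step kernel, the product does not
  vanish on diagonal cells, and this is the source of the discretisation error.\<close>

lemma kernel_product_step:
  fixes A :: "nat \<Rightarrow> nat \<Rightarrow> real ^ 'd ^ 'd"
  assumes T: "T > 0" and N: "N > 0" and u: "u \<in> grid_cell T N k" "k < N" and s: "s \<in> grid_cell T N l" "l \<le> k"
  shows "kernel_product T (\<lambda>p. step_kernel T N A (fst p) (snd p)) (u, s) = (T / real N) *\<^sub>R (\<Sum>j\<in>{k<..<N}. transpose (A j k) ** A j l)"
proof -
  interpret F: finite_measure "interval_measure_T T" by (rule finite_interval_measure_T)
  let ?B = "\<lambda>j. transpose (A j k) ** A j l"
  have e: "transpose (step_kernel T N A t u) ** step_kernel T N A t s = (\<Sum>j\<in>{k<..<N}. indicator (grid_cell T N j) t *\<^sub>R ?B j)" for t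
  proof (cases "t \<in> {0<..T}")
    case True
    obtain i where i: "i < N" "t \<in> grid_cell T N i" using grid_cell_exists[OF T N True] by blast
    have ind: "indicator (grid_cell T N j) t = (if j = i then 1 else 0 :: real)" for j
    proof (cases "j = i")
      case False
      then have "t \<notin> grid_cell T N j" using grid_cell_unique[OF T N i(2), of j] by blast
      then show ?thesis using False by simp
    qed (use i in simp)
    have z: "transpose (0 :: real ^ 'd ^ 'd) ** B = 0" for B :: "real ^ 'd ^ 'd"
      by (simp add: vec_eq_iff matrix_matrix_mult_def transpose_def)
    have "(\<Sum>j\<in>{k<..<N}. indicator (grid_cell T N j) t *\<^sub>R ?B j) = (\<Sum>j\<in>{k<..<N}. if j = i then ?B j else 0)"
      unfolding ind by (intro sum.cong) auto
    also have "\<dots> = (if k < i then ?B i else 0)" using i by simp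
    finally show ?thesis
      unfolding step_kernel_eval[OF T N i(2,1) u(1)] step_kernel_eval[OF T N i(2,1) s(1)] using s(2) z by auto
  next
    case False
    then have "indicator (grid_cell T N j) t = (0::real)" if "j < N" for j using grid_cell_subset[OF T that] by (auto simp: indicator_def)
    then have "(\<Sum>j\<in>{k<..<N}. indicator (grid_cell T N j) t *\<^sub>R ?B j) = 0" by (intro sum.neutral) auto
    moreover have "step_kernel T N A t s = 0" using False by (intro step_kernel_outside[OF T]) auto
    ultimately show ?thesis by (simp add: matrix_matrix_mult_def vec_eq_iff)
  qed
  have m: "measure (interval_measure_T T) (grid_cell T N j) = T / real N" if "j < N" for j
    using grid_cell_emeasure[OF T N that] T unfolding measure_def by simp
  have "kernel_product T (\<lambda>p. step_kernel T N A (fst p) (snd p)) (u, s) = (\<integral>t. (\<Sum>j\<in>{k<..<N}. indicator (grid_cell T N j) t *\<^sub>R ?B j) \<partial>interval_measure_T T)"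
    unfolding kernel_product_def by (simp add: e)
  also have "\<dots> = (\<Sum>j\<in>{k<..<N}. \<integral>t. indicator (grid_cell T N j) t *\<^sub>R ?B j \<partial>interval_measure_T T)"
    by (rule Bochner_Integration.integral_sum) (auto intro!: integrable_scaleR_left F.integrable_const_bound[where B=1] simp: indicator_def)
  also have "\<dots> = (\<Sum>j\<in>{k<..<N}. (T / real N) *\<^sub>R ?B j)"
    using m by (intro sum.cong refl) (simp add: F.emeasure_eq_measure)
  finally show ?thesis by (simp add: scaleR_sum_right)
qed

definition diag_cells :: "real \<Rightarrow> nat \<Rightarrow> (real \<times> real) set" where
  "diag_cells T N = (\<Union>k<N. grid_cell T N k \<times> grid_cell T N k)"

lemma diag_cells_borel[measurable]: "diag_cells T N \<in> sets borel"
  unfolding diag_cells_def borel_prod[symmetric] by measurable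

lemma diag_cells_emeasure:
  assumes T: "T > 0" and N: "N > 0"
  shows "emeasure (square_measure T) (diag_cells T N) \<le> ennreal (T\<^sup>2 / real N)"
proof -
  interpret P: pair_sigma_finite "interval_measure_T T" "interval_measure_T T" by (rule pair_interval)
  have "emeasure (square_measure T) (diag_cells T N) \<le> (\<Sum>k<N. emeasure (square_measure T) (grid_cell T N k \<times> grid_cell T N k))"
    unfolding diag_cells_def by (rule emeasure_subadditive_finite) (auto simp: borel_prod[symmetric])
  also have "\<dots> = (\<Sum>k<N. ennreal ((T / real N) * (T / real N)))"
    unfolding square_measure_eq using grid_cell_emeasure[OF T N] T
    by (intro sum.cong refl) (subst P.M1.emeasure_pair_measure_Times, auto simp: ennreal_mult[symmetric])
  also have "\<dots> = ennreal (\<Sum>k<N. (T / real N) * (T / real N))" using T by (intro sum_ennreal) simp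
  also have "(\<Sum>k<N. (T / real N) * (T / real N)) = T\<^sup>2 / real N" using N by (simp add: power2_eq_square)
  finally show ?thesis .
qed

text \<open>Off the diagonal cells the reduced step kernel is exact. On them it is 0, as is the step
  kernel, and what is missed is the product, a sum of at most \<open>N\<close> terms of norm at most
  \<open>C\<^sup>2\<close>, weighted by \<open>T / real N\<close>.\<close>

lemma step_reduced_kernel:
  fixes A :: "nat \<Rightarrow> nat \<Rightarrow> real ^ 'd ^ 'd"
  assumes T: "T > 0" and N: "N > 0" and u: "u \<in> {0<..T}" "s \<in> {0<..T}" "s < u"
    and C: "C \<ge> 0" "\<And>j k. norm (A j k) \<le> C"
  shows "norm (step_kernel T N (reduced_kernel (T / real N) N A) u s - (step_kernel T N A u s - kernel_product T (\<lambda>p. step_kernel T N A (fst p) (snd p)) (u, s))) \<le> T * C\<^sup>2 * indicator (diag_cells T N) (u, s)"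
proof -
  obtain k where k: "k < N" "u \<in> grid_cell T N k" using grid_cell_exists[OF T N u(1)] by blast
  obtain l where l: "l < N" "s \<in> grid_cell T N l" using grid_cell_exists[OF T N u(2)] by blast
  have "l \<le> k"
  proof (rule ccontr)
    assume "\<not> l \<le> k"
    then have "T * real (Suc k) / real N \<le> T * real l / real N" using T N by (intro divide_right_mono mult_left_mono) auto
    then show False using k l u(3) unfolding grid_cell_def by auto
  qed
  note p = kernel_product_step[OF T N k(2,1) l(2) this, of A]
  show ?thesis
  proof (cases "l < k")
    case True
    then show ?thesis unfolding step_kernel_eval[OF T N k(2,1) l(2)] p reduced_kernel_def using T by simp
  next
    case False
    then have lk: "l = k" using \<open>l \<le> k\<close> by simp
    have "norm (\<Sum>j\<in>{k<..<N}. transpose (A j k) ** A j l) \<le> (\<Sum>j\<in>{k<..<N}. C\<^sup>2)"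
    proof (rule sum_norm_le)
      fix j
      have "norm (transpose (A j k) ** A j l) \<le> norm (A j k) * norm (A j l)"
        using norm_matrix_mult_le[of "transpose (A j k)" "A j l"] by (simp add: norm_transpose)
      also have "\<dots> \<le> C * C" using C by (intro mult_mono) auto
      finally show "norm (transpose (A j k) ** A j l) \<le> C\<^sup>2" by (simp add: power2_eq_square)
    qed
    also have "\<dots> \<le> real N * C\<^sup>2" by (simp add: mult_right_mono)
    finally have "T / real N * norm (\<Sum>j\<in>{k<..<N}. transpose (A j k) ** A j l) \<le> T / real N * (real N * C\<^sup>2)" using T by (intro mult_left_mono) auto
    then have "norm ((T / real N) *\<^sub>R (\<Sum>j\<in>{k<..<N}. transpose (A j k) ** A j l)) \<le> T * C\<^sup>2" using T N by simp
    moreover have "indicator (diag_cells T N) (u, s) = (1::real)" using k l lk unfolding diag_cells_def by (auto simp: indicator_def)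
    ultimately show ?thesis unfolding step_kernel_eval[OF T N k(2,1) l(2)] p using lk by simp
  qed
qed

lemma nn_integral_lincomb2:
  assumes [measurable]: "f \<in> borel_measurable M" "g \<in> borel_measurable M"
  shows "(\<integral>\<^sup>+x. c * f x + c * g x \<partial>M) = c * (\<integral>\<^sup>+x. f x \<partial>M) + c * (\<integral>\<^sup>+x. g x \<partial>M)"
  by (simp add: nn_integral_add nn_integral_cmult)

text \<open>Three errors are added: that of the kernel itself, that of its product, which is
  bilinear and so again proportional to \<open>e\<close>, and that of the diagonal cells, whose
  total area \<open>T\<^sup>2 / real N\<close> meets the square of \<open>T * C\<^sup>2\<close>.
  Above the diagonal both kernels vanish.\<close>

theorem reduced_kernel_dist:
  fixes a r :: "real \<times> real \<Rightarrow> real ^ 'd ^ 'd" and A :: "nat \<Rightarrow> nat \<Rightarrow> real ^ 'd ^ 'd"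
  assumes T: "T > 0" and N: "N > 0" and C: "C \<ge> 0" "\<And>j k. norm (A j k) \<le> C"
    and a[measurable]: "a \<in> borel_measurable borel" and fin: "(\<integral>\<^sup>+p. ennreal ((norm (a p))\<^sup>2) \<partial>square_measure T) < \<infinity>"
    and r: "\<And>u s. 0 < s \<Longrightarrow> s < u \<Longrightarrow> u \<le> T \<Longrightarrow> r (u, s) = a (u, s) - kernel_product T a (u, s)"
    and r0: "\<And>u s. u \<le> s \<Longrightarrow> r (u, s) = 0"
  defines "e \<equiv> L2dist (square_measure T) a (\<lambda>p. step_kernel T N A (fst p) (snd p))"
  shows "L2dist (square_measure T) r (\<lambda>p. step_kernel T N (reduced_kernel (T / real N) N A) (fst p) (snd p))
    \<le> 3 * e + 3 * (2 * (e * (\<integral>\<^sup>+p. ennreal ((norm (a p))\<^sup>2) \<partial>square_measure T)) + 2 * (ennreal (kernel_sq T N A) * e)) + 3 * ennreal (T ^ 4 * (C ^ 4 / real N))"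
proof -
  let ?S = "square_measure T"
  let ?b = "\<lambda>p. step_kernel T N A (fst p) (snd p)"
  let ?d = "\<lambda>p. a p - ?b p"
  let ?R = "\<lambda>p. step_kernel T N (reduced_kernel (T / real N) N A) (fst p) (snd p)"
  have b[measurable]: "?b \<in> borel_measurable borel" by (rule step_kernel_measurable)
  have bfin: "(\<integral>\<^sup>+p. ennreal ((norm (?b p))\<^sup>2) \<partial>?S) < \<infinity>" unfolding step_kernel_L2[OF T N] by simp
  let ?c = "\<lambda>p. 2 * (col_sq T ?d (fst p) * col_sq T a (snd p)) + 2 * (col_sq T ?b (fst p) * col_sq T ?d (snd p))"
  let ?z = "\<lambda>p. ennreal (T\<^sup>2 * C ^ 4) * indicator (diag_cells T N) p"
  have d[measurable]: "?d \<in> borel_measurable borel" by measurable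
  have cm[measurable]: "col_sq T ?d \<in> borel_measurable borel" "col_sq T a \<in> borel_measurable borel" "col_sq T ?b \<in> borel_measurable borel"
    by (rule col_sq_measurable, measurable)+
  have [measurable]: "fst \<in> borel_measurable (borel :: (real \<times> real) measure)" "snd \<in> borel_measurable (borel :: (real \<times> real) measure)"
    by (intro borel_measurable_continuous_onI continuous_intros)+
  have "AE p in ?S. ennreal ((norm (r p - ?R p))\<^sup>2) \<le> 3 * ennreal ((norm (?d p))\<^sup>2) + 3 * ?c p + 3 * ?z p"
    using AE_square AE_col_sq_finite[OF a fin] AE_col_sq_finite[OF b bfin]
  proof eventually_elim
    case (elim p)
    obtain u s where p: "p = (u, s)" by (cases p)
    show ?case
    proof (cases "s < u")
      case True
      let ?Ka = "kernel_product T a (u, s)" and ?Kb = "kernel_product T ?b (u, s)"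
      have us: "u \<in> {0<..T}" "s \<in> {0<..T}" using elim p by auto
      have rp: "r p = a p - ?Ka" using r[of s u] True us p by simp
      have "norm (a p - ?Ka - ?R p) \<le> norm (?d p) + norm (?Kb - ?Ka) + norm (?b p - ?Kb - ?R p)"
        using norm_triangle_ineq[of "?d p + (?Kb - ?Ka)" "?b p - ?Kb - ?R p"] norm_triangle_ineq[of "?d p" "?Kb - ?Ka"] by (simp add: algebra_simps)
      also have "norm (?b p - ?Kb - ?R p) \<le> T * C\<^sup>2 * indicator (diag_cells T N) p"
        using step_reduced_kernel[OF T N us True C] p by (simp add: norm_minus_commute)
      finally have "norm (r p - ?R p) \<le> norm (?d p) + norm (?Kb - ?Ka) + T * C\<^sup>2 * indicator (diag_cells T N) p" unfolding rp by simp
      then have "(norm (r p - ?R p))\<^sup>2 \<le> (norm (?d p) + norm (?Kb - ?Ka) + T * C\<^sup>2 * indicator (diag_cells T N) p)\<^sup>2" by (intro power_mono) auto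
      also have "\<dots> \<le> 3 * (norm (?d p))\<^sup>2 + 3 * (norm (?Kb - ?Ka))\<^sup>2 + 3 * (T * C\<^sup>2 * indicator (diag_cells T N) p)\<^sup>2"
      proof -
        have "(x + y + z)\<^sup>2 \<le> 3 * x\<^sup>2 + 3 * y\<^sup>2 + 3 * z\<^sup>2" for x y z :: real
          using sum_squares_bound[of x y] sum_squares_bound[of x z] sum_squares_bound[of y z]
          by (simp add: power2_eq_square algebra_simps)
        then show ?thesis .
      qed
      finally have "ennreal ((norm (r p - ?R p))\<^sup>2) \<le> 3 * ennreal ((norm (?d p))\<^sup>2) + 3 * ennreal ((norm (?Kb - ?Ka))\<^sup>2) + 3 * ennreal ((T * C\<^sup>2 * indicator (diag_cells T N) p)\<^sup>2)"
        by (rule ennreal_le_3) auto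
      also have "ennreal ((norm (?Kb - ?Ka))\<^sup>2) \<le> ?c p"
        using kernel_product_diff[OF a b, of T u s] elim p by (simp add: norm_minus_commute)
      also have "ennreal ((T * C\<^sup>2 * indicator (diag_cells T N) p)\<^sup>2) = ?z p"
        by (cases "p \<in> diag_cells T N") (auto simp: power_mult_distrib)
      finally show ?thesis by (simp add: add_mono mult_left_mono)
    next
      case False
      have "?R p = 0"
      proof -
        obtain k where k: "k < N" "u \<in> grid_cell T N k" using grid_cell_exists[OF T N, of u] elim p by auto
        obtain l where l: "l < N" "s \<in> grid_cell T N l" using grid_cell_exists[OF T N, of s] elim p by auto
        have "\<not> l < k"
        proof
          assume "l < k"
          then have "T * real (Suc l) / real N \<le> T * real k / real N" using T N by (intro divide_right_mono mult_left_mono) auto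
          then show False using k l False unfolding grid_cell_def by auto
        qed
        then show ?thesis using step_kernel_eval[OF T N k(2,1) l(2)] p by simp
      qed
      then show ?thesis using r0[of u s] False p by simp
    qed
  qed
  then have "L2dist ?S r ?R \<le> (\<integral>\<^sup>+p. 3 * ennreal ((norm (?d p))\<^sup>2) + 3 * ?c p + 3 * ?z p \<partial>?S)"
    unfolding L2dist_def by (rule nn_integral_mono_AE)
  also have "\<dots> = 3 * (\<integral>\<^sup>+p. ennreal ((norm (?d p))\<^sup>2) \<partial>?S) + 3 * (\<integral>\<^sup>+p. ?c p \<partial>?S) + 3 * (\<integral>\<^sup>+p. ?z p \<partial>?S)"
  proof -
    have "(\<integral>\<^sup>+p. 3 * ennreal ((norm (?d p))\<^sup>2) + 3 * ?c p + 3 * ?z p \<partial>?S) = (\<integral>\<^sup>+p. 3 * ennreal ((norm (?d p))\<^sup>2) + 3 * ?c p \<partial>?S) + (\<integral>\<^sup>+p. 3 * ?z p \<partial>?S)"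
      by (rule nn_integral_add) measurable
    also have "(\<integral>\<^sup>+p. 3 * ?z p \<partial>?S) = 3 * (\<integral>\<^sup>+p. ?z p \<partial>?S)" by (rule nn_integral_cmult) measurable
    also have "(\<integral>\<^sup>+p. 3 * ennreal ((norm (?d p))\<^sup>2) + 3 * ?c p \<partial>?S) = 3 * (\<integral>\<^sup>+p. ennreal ((norm (?d p))\<^sup>2) \<partial>?S) + 3 * (\<integral>\<^sup>+p. ?c p \<partial>?S)"
      by (rule nn_integral_lincomb2) measurable
    finally show ?thesis .
  qed
  also have "(\<integral>\<^sup>+p. ennreal ((norm (?d p))\<^sup>2) \<partial>?S) = e" unfolding e_def L2dist_def ..
  also have "(\<integral>\<^sup>+p. ?c p \<partial>?S) = 2 * (e * (\<integral>\<^sup>+p. ennreal ((norm (a p))\<^sup>2) \<partial>?S)) + 2 * (ennreal (kernel_sq T N A) * e)"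
  proof -
    have "(\<integral>\<^sup>+p. ?c p \<partial>?S) = 2 * (\<integral>\<^sup>+p. col_sq T ?d (fst p) * col_sq T a (snd p) \<partial>?S) + 2 * (\<integral>\<^sup>+p. col_sq T ?b (fst p) * col_sq T ?d (snd p) \<partial>?S)"
      by (rule nn_integral_lincomb2) measurable
    then show ?thesis
      unfolding nn_integral_product[OF cm(1,2)] nn_integral_product[OF cm(3,1)] col_sq_integral[OF a] col_sq_integral[OF b] col_sq_integral[OF d]
        step_kernel_L2[OF T N] e_def L2dist_def .
  qed
  also have "(\<integral>\<^sup>+p. ?z p \<partial>?S) \<le> ennreal (T ^ 4 * (C ^ 4 / real N))"
  proof -
    have "(\<integral>\<^sup>+p. ?z p \<partial>?S) = ennreal (T\<^sup>2 * C ^ 4) * emeasure ?S (diag_cells T N)" by (simp add: nn_integral_cmult)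
    also have "\<dots> \<le> ennreal (T\<^sup>2 * C ^ 4) * ennreal (T\<^sup>2 / real N)" by (intro mult_left_mono diag_cells_emeasure[OF T N]) simp
    also have "\<dots> = ennreal (T ^ 4 * (C ^ 4 / real N))"
    proof -
      have "ennreal (T\<^sup>2 * C ^ 4) * ennreal (T\<^sup>2 / real N) = ennreal ((T\<^sup>2 * C ^ 4) * (T\<^sup>2 / real N))" using C T by (intro ennreal_mult[symmetric]) auto
      also have "(T\<^sup>2 * C ^ 4) * (T\<^sup>2 / real N) = T ^ 4 * (C ^ 4 / real N)" by (simp add: power2_eq_square power4_eq_xxxx)
      finally show ?thesis .
    qed
    finally show ?thesis .
  qed
  finally show ?thesis by (simp add: add_mono mult_left_mono)
qed

section \<open>Kernels in \<open>S2\<close> and their lower triangles\<close>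

lemma S2_square_measurable:
  assumes "\<eta> \<in> S2 T"
  shows "(\<lambda>p. indicator ({0..T} \<times> {0..T}) p *\<^sub>R \<eta> (fst p) (snd p)) \<in> borel_measurable borel"
  using assms by (simp add: S2_def lborel_prod)

lemma S2_lower_kernel_measurable:
  assumes "\<eta> \<in> S2 T"
  shows "lower_kernel T \<eta> \<in> borel_measurable borel"
proof -
  note [measurable] = S2_square_measurable[OF assms]
  show ?thesis unfolding lower_kernel_def by measurable
qed

lemma S2_row_measurable:
  assumes \<eta>: "\<eta> \<in> S2 T" and t: "t \<in> {0..T}"
  shows "(\<lambda>s. indicator {0..t} s *\<^sub>R (\<eta> t s $ i)) \<in> borel_measurable borel"
proof -
  have p: "(\<lambda>s. (t, s)) \<in> borel_measurable borel" by (intro borel_measurable_continuous_onI continuous_intros)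
  note [measurable] = measurable_compose[OF p S2_square_measurable[OF \<eta>]]
  have "(\<lambda>s. indicator {0..t} s *\<^sub>R (indicator ({0..T} \<times> {0..T}) (t, s) *\<^sub>R \<eta> (fst (t, s)) (snd (t, s)))) \<in> borel_measurable borel"
    by measurable
  then have "(\<lambda>s. (indicator {0..t} s *\<^sub>R (indicator ({0..T} \<times> {0..T}) (t, s) *\<^sub>R \<eta> (fst (t, s)) (snd (t, s)))) $ i) \<in> borel_measurable borel"
    by (rule borel_measurable_continuous_on[where f="\<lambda>x. x $ i", rotated]) (intro continuous_intros)
  also have "(\<lambda>s. (indicator {0..t} s *\<^sub>R (indicator ({0..T} \<times> {0..T}) (t, s) *\<^sub>R \<eta> (fst (t, s)) (snd (t, s)))) $ i) = (\<lambda>s. indicator {0..t} s *\<^sub>R (\<eta> t s $ i))"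
    using t by (auto simp: fun_eq_iff indicator_def)
  finally show ?thesis .
qed

lemma AE_square_off_diagonal: "AE p in square_measure T. fst p \<noteq> snd p"
proof -
  interpret P: pair_sigma_finite "interval_measure_T T" "interval_measure_T T" by (rule pair_interval)
  show ?thesis unfolding square_measure_eq
  proof (rule P.AE_pair_measure)
    have "AE y in interval_measure_T T. x \<noteq> y" for x
    proof -
      have "AE y in lborel. y \<noteq> x" by (rule AE_lborel_singleton)
      then show ?thesis unfolding interval_measure_T_def by (subst AE_density) (auto elim: eventually_mono)
    qed
    then show "AE x in interval_measure_T T. AE y in interval_measure_T T. fst (x, y) \<noteq> snd (x, y)" by simp
    have "{p :: real \<times> real. fst p \<noteq> snd p} \<in> sets borel"
      by (intro borel_open open_Collect_neq continuous_intros)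
    then show "{p \<in> space (interval_measure_T T \<Otimes>\<^sub>M interval_measure_T T). fst p \<noteq> snd p} \<in> sets (interval_measure_T T \<Otimes>\<^sub>M interval_measure_T T)"
      unfolding square_measure_eq[symmetric] by simp
  qed
qed

text \<open>By symmetry of the kernel the upper and the lower triangle carry the same mass.\<close>

lemma sqnorm_int_lower:
  assumes \<eta>: "\<eta> \<in> S2 T"
  shows "sqnorm_int T \<eta> = 2 * (\<integral>\<^sup>+p. ennreal ((norm (lower_kernel T \<eta> p))\<^sup>2) \<partial>square_measure T)"
proof -
  interpret P: pair_sigma_finite "interval_measure_T T" "interval_measure_T T" by (rule pair_interval)
  let ?S = "square_measure T" and ?Q = "{0..T} \<times> {0..T}"
  note [measurable] = S2_square_measurable[OF \<eta>] S2_lower_kernel_measurable[OF \<eta>]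
  let ?g = "\<lambda>p. ennreal ((norm (indicator ?Q p *\<^sub>R \<eta> (fst p) (snd p)))\<^sup>2)"
  let ?l = "\<lambda>p. ennreal ((norm (lower_kernel T \<eta> p))\<^sup>2)"
  have lm: "?l \<in> borel_measurable ?S" by measurable
  let ?sw = "\<lambda>p. (snd p, fst p) :: real \<times> real"
  have sw: "?sw \<in> measurable ?S ?S" "distr ?S ?S ?sw = ?S"
    using P.distr_pair_swap unfolding square_measure_eq by (simp_all add: case_prod_unfold)
  have "sqnorm_int T \<eta> = (\<integral>\<^sup>+p. indicator ?Q p * ?g p \<partial>lborel)"
    unfolding sqnorm_int_def lborel_prod by (intro nn_integral_cong) (auto simp: indicator_def)
  also have "\<dots> = (\<integral>\<^sup>+p. ?g p \<partial>?S)"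
  proof -
    have "?g \<in> borel_measurable lborel" by measurable
    then show ?thesis unfolding square_measure_def by (subst nn_integral_density) simp_all
  qed
  also have "\<dots> = (\<integral>\<^sup>+p. ?l p + ?l (?sw p) \<partial>?S)"
    using AE_square_off_diagonal
  proof (intro nn_integral_cong_AE, eventually_elim)
    case (elim p)
    obtain t s where p: "p = (t, s)" by (cases p)
    have "norm (\<eta> s t) = norm (\<eta> t s)" if "t \<in> {0..T}" "s \<in> {0..T}"
    proof -
      have "transpose (\<eta> t s) = \<eta> s t" using \<eta> that unfolding S2_def by blast
      then show ?thesis using norm_transpose[of "\<eta> t s"] by simp
    qed
    then show ?case using elim p unfolding lower_kernel_def by (cases "s < t") (auto simp: indicator_def)
  qed
  also have "\<dots> = (\<integral>\<^sup>+p. ?l p \<partial>?S) + (\<integral>\<^sup>+p. ?l (?sw p) \<partial>?S)"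
    by (rule nn_integral_add[OF lm measurable_compose[OF sw(1) lm]])
  also have "(\<integral>\<^sup>+p. ?l (?sw p) \<partial>?S) = (\<integral>\<^sup>+p. ?l p \<partial>distr ?S ?S ?sw)"
    by (rule nn_integral_distr[OF sw(1), symmetric]) (use lm in simp)
  finally show ?thesis unfolding sw(2) by (simp add: mult_2)
qed

lemma lower_kernel_L2_finite:
  assumes \<eta>: "\<eta> \<in> S2 T"
  shows "(\<integral>\<^sup>+p. ennreal ((norm (lower_kernel T \<eta> p))\<^sup>2) \<partial>square_measure T) < \<infinity>"
proof -
  have "2 * (\<integral>\<^sup>+p. ennreal ((norm (lower_kernel T \<eta> p))\<^sup>2) \<partial>square_measure T) < \<infinity>"
    using \<eta> unfolding sqnorm_int_lower[OF \<eta>, symmetric] S2_def by blast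
  then show ?thesis by (auto simp: ennreal_mult_less_top)
qed

lemma norm2_sq_lower:
  assumes \<eta>: "\<eta> \<in> S2 T"
  shows "(norm2 T \<eta>)\<^sup>2 = 2 * enn2real (\<integral>\<^sup>+p. ennreal ((norm (lower_kernel T \<eta> p))\<^sup>2) \<partial>square_measure T)"
  unfolding norm2_def by (simp add: sqnorm_int_lower[OF \<eta>] enn2real_mult)

text \<open>The triangular cut-offs confine the integration to \<open>u < t \<le> T\<close>, which
  differs from \<open>{u..T}\<close> by one point, and there the symmetry of \<open>\<eta>\<close>
  turns the transpose of \<open>\<eta> t u\<close> into \<open>\<eta> u t\<close>. So the defining
  equation of \<open>\<rho>\<close> is the continuous form of the reduced kernel.\<close>

lemma lower_kernel_reduced:
  assumes \<eta>: "\<eta> \<in> S2 T"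
    and \<rho>: "\<forall>s t. 0 \<le> s \<and> s < t \<and> t \<le> T \<longrightarrow> \<rho> t s = \<eta> t s - (LINT u:{t..T}|lborel. \<eta> t u ** \<eta> u s)"
    and us: "0 < s" "s < u" "u \<le> T"
  shows "lower_kernel T \<rho> (u, s) = lower_kernel T \<eta> (u, s) - kernel_product T (lower_kernel T \<eta>) (u, s)"
proof -
  let ?a = "lower_kernel T \<eta>"
  note m = borel_measurable_section[OF S2_lower_kernel_measurable[OF \<eta>]]
  have "kernel_product T ?a (u, s) = (\<integral>t. indicator {0..T} t *\<^sub>R (transpose (?a (t, u)) ** ?a (t, s)) \<partial>lborel)"
    unfolding kernel_product_def interval_measure_T_def
    using integral_density[of "\<lambda>t. transpose (?a (t, u)) ** ?a (t, s)" lborel "indicator {0..T}"] m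
    by (simp add: borel_measurable_transpose_mult ennreal_indicator)
  also have "\<dots> = (\<integral>t. indicator {u..T} t *\<^sub>R (\<eta> u t ** \<eta> t s) \<partial>lborel)"
  proof (rule integral_discrete_difference[where X="{u}"])
    fix t assume t: "t \<in> space lborel" "t \<notin> {u}"
    show "indicator {0..T} t *\<^sub>R (transpose (?a (t, u)) ** ?a (t, s)) = indicator {u..T} t *\<^sub>R (\<eta> u t ** \<eta> t s)"
    proof (cases "u < t \<and> t \<le> T")
      case True
      then have "t \<in> {0..T}" "u \<in> {0..T}" using us by auto
      then have "transpose (\<eta> t u) = \<eta> u t" using \<eta> unfolding S2_def by blast
      then show ?thesis using True us by (simp add: lower_kernel_def)
    next
      case False
      then have "indicator {0..T} t *\<^sub>R (transpose (?a (t, u)) ** ?a (t, s)) = 0"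
        by (auto simp: lower_kernel_def indicator_def vec_eq_iff matrix_matrix_mult_def transpose_def)
      then show ?thesis using False t by auto
    qed
  qed auto
  finally have k: "kernel_product T ?a (u, s) = (LINT t:{u..T}|lborel. \<eta> u t ** \<eta> t s)"
    unfolding set_lebesgue_integral_def .
  have "lower_kernel T \<rho> (u, s) = \<rho> u s" "?a (u, s) = \<eta> u s" using us by (simp_all add: lower_kernel_def)
  moreover have "\<rho> u s = \<eta> u s - (LINT t:{u..T}|lborel. \<eta> u t ** \<eta> t s)" by (rule \<rho>[rule_format]) (use us in simp)
  ultimately show ?thesis unfolding k by simp
qed

text \<open>A triangle inequality for squared norms with a free parameter, valid without square
  roots of extended reals. The factor in front of the norm can be brought close to 1 when the
  distance is small, as convergence of norms requires.\<close>

lemma L2_norm_young: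
  fixes f g :: "'a \<Rightarrow> 'b::{second_countable_topology, real_normed_vector}"
  assumes [measurable]: "f \<in> borel_measurable M" "g \<in> borel_measurable M" and \<delta>: "\<delta> > 0"
  shows "(\<integral>\<^sup>+x. ennreal ((norm (g x))\<^sup>2) \<partial>M) \<le> ennreal (1 + \<delta>) * (\<integral>\<^sup>+x. ennreal ((norm (f x))\<^sup>2) \<partial>M) + ennreal (1 + 1 / \<delta>) * L2dist M f g"
proof -
  have pt: "(norm y)\<^sup>2 \<le> (1 + \<delta>) * (norm x)\<^sup>2 + (1 + 1 / \<delta>) * (norm (x - y))\<^sup>2" for x y :: 'b
  proof -
    have n: "norm y \<le> norm x + norm (x - y)" using norm_triangle_sub[of y x] by (simp add: norm_minus_commute)
    have "0 \<le> (\<delta> * norm x - norm (x - y))\<^sup>2 / \<delta>" using \<delta> by simp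
    also have "\<dots> = \<delta> * (norm x)\<^sup>2 - 2 * norm x * norm (x - y) + (norm (x - y))\<^sup>2 / \<delta>"
      using \<delta> by (simp add: power2_diff power_mult_distrib field_simps power2_eq_square)
    finally have "(norm x + norm (x - y))\<^sup>2 \<le> (1 + \<delta>) * (norm x)\<^sup>2 + (1 + 1 / \<delta>) * (norm (x - y))\<^sup>2"
      by (simp add: power2_sum algebra_simps)
    moreover have "(norm y)\<^sup>2 \<le> (norm x + norm (x - y))\<^sup>2" using n by (intro power_mono) auto
    ultimately show ?thesis by linarith
  qed
  have "(\<integral>\<^sup>+x. ennreal ((norm (g x))\<^sup>2) \<partial>M) \<le> (\<integral>\<^sup>+x. ennreal (1 + \<delta>) * ennreal ((norm (f x))\<^sup>2) + ennreal (1 + 1 / \<delta>) * ennreal ((norm (f x - g x))\<^sup>2) \<partial>M)"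
  proof (rule nn_integral_mono)
    fix x
    show "ennreal ((norm (g x))\<^sup>2) \<le> ennreal (1 + \<delta>) * ennreal ((norm (f x))\<^sup>2) + ennreal (1 + 1 / \<delta>) * ennreal ((norm (f x - g x))\<^sup>2)"
    proof -
      have "ennreal (1 + \<delta>) * ennreal ((norm (f x))\<^sup>2) + ennreal (1 + 1 / \<delta>) * ennreal ((norm (f x - g x))\<^sup>2) = ennreal ((1 + \<delta>) * (norm (f x))\<^sup>2 + (1 + 1 / \<delta>) * (norm (f x - g x))\<^sup>2)"
        using \<delta> by (intro ennreal_mult_add) auto
      then show ?thesis using ennreal_leI[OF pt[of "g x" "f x"]] by simp
    qed
  qed
  also have "\<dots> = ennreal (1 + \<delta>) * (\<integral>\<^sup>+x. ennreal ((norm (f x))\<^sup>2) \<partial>M) + ennreal (1 + 1 / \<delta>) * L2dist M f g"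
    unfolding L2dist_def by (subst nn_integral_add) (auto simp: nn_integral_cmult)
  finally show ?thesis .
qed

text \<open>Young's inequality in both directions with \<open>\<delta> n = (1/2) ^ n\<close>: this
  tends to 0, and so does the error \<open>(1 + 1 / \<delta> n) * (1/4) ^ n\<close>, which equals
  \<open>(1/2) ^ n + (1/4) ^ n\<close>.\<close>

lemma kernel_sq_tendsto:
  fixes a :: "real \<times> real \<Rightarrow> 'b::{banach, second_countable_topology}"
  assumes T: "T > 0" and N: "\<And>n. N n > 0" and a: "a \<in> borel_measurable borel"
    and fin: "(\<integral>\<^sup>+p. ennreal ((norm (a p))\<^sup>2) \<partial>square_measure T) < \<infinity>"
    and d: "\<And>n. L2dist (square_measure T) a (\<lambda>p. step_kernel T (N n) (A n) (fst p) (snd p)) \<le> ennreal ((1/4) ^ n)"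
  shows "(\<lambda>n. kernel_sq T (N n) (A n)) \<longlonglongrightarrow> enn2real (\<integral>\<^sup>+p. ennreal ((norm (a p))\<^sup>2) \<partial>square_measure T)"
proof -
  define X where "X = enn2real (\<integral>\<^sup>+p. ennreal ((norm (a p))\<^sup>2) \<partial>square_measure T)"
  have X: "(\<integral>\<^sup>+p. ennreal ((norm (a p))\<^sup>2) \<partial>square_measure T) = ennreal X" "X \<ge> 0"
    unfolding X_def using fin by (auto simp: less_top)
  define c where "c n = (1/2 :: real) ^ n + (1/4) ^ n" for n
  define \<delta> where "\<delta> n = (1/2 :: real) ^ n" for n
  have \<delta>: "\<delta> n > 0" for n by (simp add: \<delta>_def)
  let ?k = "\<lambda>n. kernel_sq T (N n) (A n)"
  have k0: "?k n \<ge> 0" for n unfolding kernel_sq_def by (intro mult_nonneg_nonneg sum_nonneg) auto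
  have c0: "c n \<ge> 0" for n by (simp add: c_def)
  have cd: "(1 + 1 / \<delta> n) * (1/4) ^ n = c n" for n
  proof -
    have "(1/4 :: real) ^ n = \<delta> n * \<delta> n" unfolding \<delta>_def by (simp add: power_mult_distrib[symmetric])
    then show ?thesis unfolding c_def \<delta>_def[symmetric] using \<delta>[of n] by (simp add: field_simps)
  qed
  have e: "ennreal (1 + 1 / \<delta> n) * e \<le> ennreal (c n)" if "e \<le> ennreal ((1/4) ^ n)" for n e
  proof -
    have "ennreal (1 + 1 / \<delta> n) * e \<le> ennreal (1 + 1 / \<delta> n) * ennreal ((1/4) ^ n)" using that by (rule mult_left_mono) simp
    also have "\<dots> = ennreal ((1 + 1 / \<delta> n) * (1/4) ^ n)" using \<delta>[of n] by (intro ennreal_mult[symmetric]) auto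
    finally show ?thesis unfolding cd .
  qed
  have am: "a \<in> borel_measurable (square_measure T)" using a by simp
  have bm: "(\<lambda>p. step_kernel T (N n) (A n) (fst p) (snd p)) \<in> borel_measurable (square_measure T)" for n
    using step_kernel_measurable by simp
  have up: "?k n \<le> (1 + \<delta> n) * X + c n" for n
  proof -
    have "ennreal (?k n) \<le> ennreal (1 + \<delta> n) * ennreal X + ennreal (c n)"
      using L2_norm_young[OF am bm \<delta>, of n n] e[OF d, of n] unfolding step_kernel_L2[OF T N] X(1)
      by (meson add_left_mono order_trans)
    also have "\<dots> = ennreal ((1 + \<delta> n) * X + c n)"
    proof -
      have "ennreal (1 + \<delta> n) * ennreal (X) = ennreal ((1 + \<delta> n) * X)" using \<delta>[of n] X(2) by (intro ennreal_mult[symmetric]) auto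
      then show ?thesis using \<delta>[of n] X(2) c0[of n] by (simp only: ennreal_plus[OF mult_nonneg_nonneg])
    qed
    finally show ?thesis using X(2) c0[of n] \<delta>[of n] by (subst (asm) ennreal_le_iff) auto
  qed
  have "X \<le> (1 + \<delta> n) * ?k n + c n" for n
  proof -
    have "ennreal X \<le> ennreal (1 + \<delta> n) * ennreal (?k n) + ennreal (c n)"
      using L2_norm_young[OF bm am \<delta>, of n n] e[OF d, of n] unfolding step_kernel_L2[OF T N] X(1) L2dist_commute[of _ _ a]
      by (meson add_left_mono order_trans)
    also have "\<dots> = ennreal ((1 + \<delta> n) * ?k n + c n)"
    proof -
      have "ennreal (1 + \<delta> n) * ennreal (?k n) = ennreal ((1 + \<delta> n) * ?k n)" using \<delta>[of n] k0[of n] by (intro ennreal_mult[symmetric]) auto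
      then show ?thesis using \<delta>[of n] k0[of n] c0[of n] by (simp only: ennreal_plus[OF mult_nonneg_nonneg])
    qed
    finally show ?thesis using k0[of n] c0[of n] \<delta>[of n] by (subst (asm) ennreal_le_iff) auto
  qed
  then have lo: "(X - c n) / (1 + \<delta> n) \<le> ?k n" for n
    using \<delta>[of n] by (simp add: divide_le_eq mult.commute diff_le_eq)
  have lim: "c \<longlonglongrightarrow> 0 + 0" "\<delta> \<longlonglongrightarrow> 0" unfolding c_def \<delta>_def by (intro tendsto_add LIMSEQ_power_zero; simp)+
  have L1: "(\<lambda>n. (1 + \<delta> n) * X + c n) \<longlonglongrightarrow> (1 + 0) * X + (0 + 0)" by (intro tendsto_intros lim)
  have L2: "(\<lambda>n. (X - c n) / (1 + \<delta> n)) \<longlonglongrightarrow> (X - (0 + 0)) / (1 + 0)" by (intro tendsto_intros lim) simp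
  have L1': "(\<lambda>n. (1 + \<delta> n) * X + c n) \<longlonglongrightarrow> X" and L2': "(\<lambda>n. (X - c n) / (1 + \<delta> n)) \<longlonglongrightarrow> X"
    using L1 L2 by simp_all
  have "?k \<longlonglongrightarrow> X" by (rule tendsto_sandwich[OF _ _ L2' L1']) (use up lo in \<open>auto intro: always_eventually\<close>)
  then show ?thesis unfolding X_def .
qed

section \<open>Passage to the limit\<close>

text \<open>Cut the exponentials off at level \<open>exp L\<close>. The truncated integrals converge
  by domination, the truncation costs at most \<open>B\<close> times the tail bound
  \<open>c L\<close>, uniformly in \<open>n\<close>, and monotone convergence removes the cut-off in
  the limit. Working with extended integrals, finiteness of the limit is a result and not an
  assumption.\<close>

theorem exp_density_limit:
  fixes F :: "'a \<Rightarrow> real" and l :: "'a \<Rightarrow> real"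
  assumes M: "finite_measure M"
    and Fm[measurable]: "\<And>n. Fn n \<in> borel_measurable M" "F \<in> borel_measurable M"
    and lm[measurable]: "\<And>n. ell n \<in> borel_measurable M" "l \<in> borel_measurable M"
    and B: "\<And>n x. x \<in> space M \<Longrightarrow> 0 \<le> Fn n x \<and> Fn n x \<le> B" "\<And>x. x \<in> space M \<Longrightarrow> 0 \<le> F x \<and> F x \<le> B"
    and Flim: "AE x in M. (\<lambda>n. Fn n x) \<longlonglongrightarrow> F x" and llim: "AE x in M. (\<lambda>n. ell n x) \<longlonglongrightarrow> l x"
    and tail: "\<And>n L. L > 0 \<Longrightarrow> (\<integral>\<^sup>+x. ennreal (exp (ell n x)) * indicator {x. L < ell n x} x \<partial>M) \<le> ennreal (c L)"
    and c: "(\<lambda>m. c (real (Suc m))) \<longlonglongrightarrow> 0"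
    and en: "\<And>n. (\<integral>\<^sup>+x. ennreal (Fn n x * exp (ell n x)) \<partial>M) = e n" and e: "e \<longlonglongrightarrow> (E :: ennreal)"
  shows "(\<integral>\<^sup>+x. ennreal (F x * exp (l x)) \<partial>M) = E"
proof -
  interpret finite_measure M by (rule M)
  define y where "y L = (\<integral>\<^sup>+x. ennreal (F x * min (exp (l x)) (exp L)) \<partial>M)" for L
  define x where "x L n = (\<integral>\<^sup>+x. ennreal (Fn n x * min (exp (ell n x)) (exp L)) \<partial>M)" for L n
  have xy: "x L \<longlonglongrightarrow> y L" for L
    unfolding x_def y_def
  proof (rule nn_integral_dominated_convergence[where w="\<lambda>_. ennreal (B * exp L)"])
    show "AE x in M. ennreal (Fn n x * min (exp (ell n x)) (exp L)) \<le> ennreal (B * exp L)" for n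
      using B(1) by (intro AE_I2 ennreal_leI mult_mono) (auto intro: order_trans)
    show "AE x in M. (\<lambda>n. ennreal (Fn n x * min (exp (ell n x)) (exp L))) \<longlonglongrightarrow> ennreal (F x * min (exp (l x)) (exp L))"
      using Flim llim by eventually_elim (intro tendsto_intros)
    show "(\<integral>\<^sup>+x. ennreal (B * exp L) \<partial>M) < \<infinity>"
    proof -
      have "emeasure M (space M) < \<top>" using emeasure_finite[of "space M"] unfolding infinity_ennreal_def less_top .
      then show ?thesis by (simp add: ennreal_mult_less_top)
    qed
  qed measurable
  have x_le: "x L n \<le> e n" for L n
    unfolding x_def en[symmetric] using B(1) by (intro nn_integral_mono ennreal_leI mult_left_mono) auto
  have e_le: "e n \<le> x L n + ennreal B * ennreal (c L)" if L: "L > 0" for L n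
  proof -
    have "e n \<le> (\<integral>\<^sup>+x. ennreal (Fn n x * min (exp (ell n x)) (exp L)) + ennreal B * (ennreal (exp (ell n x)) * indicator {x. L < ell n x} x) \<partial>M)"
      unfolding en[symmetric]
    proof (rule nn_integral_mono)
      fix z assume z: "z \<in> space M"
      show "ennreal (Fn n z * exp (ell n z)) \<le> ennreal (Fn n z * min (exp (ell n z)) (exp L)) + ennreal B * (ennreal (exp (ell n z)) * indicator {x. L < ell n x} z)"
      proof (cases "L < ell n z")
        case True
        have "ennreal (Fn n z * exp (ell n z)) \<le> ennreal (B * exp (ell n z))" using B(1)[OF z] by (intro ennreal_leI mult_right_mono) auto
        also have "\<dots> = ennreal B * (ennreal (exp (ell n z)) * indicator {x. L < ell n x} z)"
          using True B(1)[OF z, of n] by (simp add: ennreal_mult)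
        finally show ?thesis by (simp add: add_increasing)
      qed (simp add: min_def)
    qed
    also have "\<dots> = x L n + ennreal B * (\<integral>\<^sup>+x. ennreal (exp (ell n x)) * indicator {x. L < ell n x} x \<partial>M)"
      unfolding x_def by (simp add: nn_integral_add nn_integral_cmult)
    also have "\<dots> \<le> x L n + ennreal B * ennreal (c L)" by (intro add_left_mono mult_left_mono tail L) simp
    finally show ?thesis .
  qed
  have yE: "y L \<le> E" for L using LIMSEQ_le[OF xy e] x_le by blast
  have Ey: "E \<le> y L + ennreal B * ennreal (c L)" if "L > 0" for L
    by (rule LIMSEQ_le[OF e tendsto_add[OF xy[of L] tendsto_const]]) (use e_le[OF that] in blast)
  have lim: "(\<lambda>m. y (real (Suc m))) \<longlonglongrightarrow> (\<integral>\<^sup>+x. ennreal (F x * exp (l x)) \<partial>M)"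
    unfolding y_def
  proof (rule nn_integral_LIMSEQ)
    show "incseq (\<lambda>m x. ennreal (F x * min (exp (l x)) (exp (real (Suc m)))))"
      unfolding incseq_def le_fun_def
    proof (intro allI impI)
      fix m m' :: nat and z assume m: "m \<le> m'"
      show "ennreal (F z * min (exp (l z)) (exp (real (Suc m)))) \<le> ennreal (F z * min (exp (l z)) (exp (real (Suc m'))))"
      \<comment> \<open>Monotonicity is asked at every point, also outside \<open>space M\<close>
        where the sign of \<open>F\<close> is unknown; there \<open>ennreal\<close> sends the
        nonpositive product to 0.\<close>
      proof (cases "F z \<ge> 0")
        case True
        then show ?thesis using m by (intro ennreal_leI mult_left_mono min.mono) auto
      next
        case False
        then have "F z * min (exp (l z)) (exp (real (Suc m))) \<le> 0" by (intro mult_nonpos_nonneg) auto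
        then show ?thesis by (simp add: ennreal_neg)
      qed
    qed
    fix z
    show "(\<lambda>m. ennreal (F z * min (exp (l z)) (exp (real (Suc m))))) \<longlonglongrightarrow> ennreal (F z * exp (l z))"
    proof (rule tendsto_eventually)
      obtain m0 where "l z \<le> real m0" using real_arch_simple by blast
      then have "min (exp (l z)) (exp (real (Suc m))) = exp (l z)" if "m \<ge> m0" for m using that by (simp add: min_def)
      then show "\<forall>\<^sub>F m in sequentially. ennreal (F z * min (exp (l z)) (exp (real (Suc m)))) = ennreal (F z * exp (l z))"
        unfolding eventually_sequentially by metis
    qed
  qed measurable
  have "(\<integral>\<^sup>+x. ennreal (F x * exp (l x)) \<partial>M) \<le> E" by (rule LIMSEQ_le_const2[OF lim]) (use yE in blast)
  moreover have "E \<le> (\<integral>\<^sup>+x. ennreal (F x * exp (l x)) \<partial>M)"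
  proof -
    have "(\<lambda>m. ennreal B * ennreal (c (real (Suc m)))) \<longlonglongrightarrow> ennreal B * ennreal 0"
      by (intro ennreal_tendsto_cmult tendsto_ennrealI c) simp
    then have "(\<lambda>m. y (real (Suc m)) + ennreal B * ennreal (c (real (Suc m)))) \<longlonglongrightarrow> (\<integral>\<^sup>+x. ennreal (F x * exp (l x)) \<partial>M) + ennreal B * ennreal 0"
      by (intro tendsto_add lim)
    from LIMSEQ_le_const[OF this, of E] show ?thesis using Ey by auto
  qed
  ultimately show ?thesis by (rule antisym)
qed

section \<open>Polygonal paths\<close>

definition ramp :: "real \<Rightarrow> real" where "ramp r = max 0 (min 1 r)"

text \<open>The polygonal path with increment \<open>x k\<close> over cell \<open>k\<close>, the
  ramp being the fraction of the cell elapsed at time \<open>t\<close>. It makes a functional of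
  paths a function of finitely many increments, to which the discrete formula applies.\<close>

definition interp :: "real \<Rightarrow> nat \<Rightarrow> (nat \<Rightarrow> real ^ 'd) \<Rightarrow> real \<Rightarrow> real ^ 'd" where
  "interp T N x t = (if t \<in> {0..T} then \<Sum>k<N. ramp (t * real N / T - real k) *\<^sub>R x k else 0)"

lemma interp_Wsp:
  assumes "T > 0"
  shows "interp T N x \<in> Wsp T"
proof -
  have "continuous_on {0..T} (\<lambda>t. \<Sum>k<N. ramp (t * real N / T - real k) *\<^sub>R x k)"
    unfolding ramp_def using assms by (intro continuous_intros) auto
  then have "continuous_on {0..T} (interp T N x)" by (subst continuous_on_cong[OF refl]) (auto simp: interp_def)
  moreover have "interp T N x 0 = 0" unfolding interp_def ramp_def by simp
  ultimately show ?thesis unfolding Wsp_def by (auto simp: interp_def)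
qed

lemma interp_cong: "(\<And>k. k < N \<Longrightarrow> x k = y k) \<Longrightarrow> interp T N x = interp T N y"
  unfolding interp_def by (intro ext if_cong refl sum.cong) auto

lemma interp_diff: "interp T N x t - interp T N y t = interp T N (\<lambda>k. x k - y k) t"
  unfolding interp_def by (simp add: sum_subtractf scaleR_diff_right)

lemma interp_norm_le: "norm (interp T N x t) \<le> (\<Sum>k<N. norm (x k))"
proof -
  have "norm (\<Sum>k<N. ramp (t * real N / T - real k) *\<^sub>R x k) \<le> (\<Sum>k<N. norm (x k))"
  proof (rule sum_norm_le)
    fix k
    have "\<bar>ramp (t * real N / T - real k)\<bar> \<le> 1" by (simp add: ramp_def)
    then have "\<bar>ramp (t * real N / T - real k)\<bar> * norm (x k) \<le> 1 * norm (x k)" by (rule mult_right_mono) simp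
    then show "norm (ramp (t * real N / T - real k) *\<^sub>R x k) \<le> norm (x k)" by simp
  qed
  then show ?thesis unfolding interp_def by (simp add: sum_nonneg)
qed

lemma interp_eval:
  assumes T: "T > 0" and N: "N > 0" and k: "k < N" and t: "T * real k / real N \<le> t" "t \<le> T * real (Suc k) / real N"
  shows "interp T N x t = (\<Sum>j<k. x j) + (t * real N / T - real k) *\<^sub>R x k"
proof -
  have tk: "real k \<le> t * real N / T" "t * real N / T \<le> real k + 1" using T N t by (auto simp: field_simps)
  have "0 \<le> T * real k / real N" using T by simp
  moreover have "T * real (Suc k) / real N \<le> T"
  proof -
    have "T * real (Suc k) \<le> T * real N" using T k by (intro mult_left_mono) auto
    then show ?thesis using N by (simp add: field_simps)
  qed
  ultimately have "t \<in> {0..T}" using t by auto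
  then have "interp T N x t = (\<Sum>j<N. ramp (t * real N / T - real j) *\<^sub>R x j)" by (simp add: interp_def)
  also have "\<dots> = (\<Sum>j<Suc k. ramp (t * real N / T - real j) *\<^sub>R x j)"
  proof (rule sum.mono_neutral_right)
    show "\<forall>j\<in>{..<N} - {..<Suc k}. ramp (t * real N / T - real j) *\<^sub>R x j = 0"
      using tk by (auto simp: ramp_def)
  qed (use k in auto)
  also have "\<dots> = (\<Sum>j<k. x j) + (t * real N / T - real k) *\<^sub>R x k"
  proof -
    have "(\<Sum>j<k. ramp (t * real N / T - real j) *\<^sub>R x j) = (\<Sum>j<k. x j)"
    proof (rule sum.cong[OF refl])
      fix j assume "j \<in> {..<k}"
      then have "real j + 1 \<le> real k" by (simp add: Suc_le_eq)
      then show "ramp (t * real N / T - real j) *\<^sub>R x j = x j" using tk by (simp add: ramp_def)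
    qed
    then show ?thesis using tk by (simp add: ramp_def)
  qed
  finally show ?thesis .
qed

lemma supnorm_le: "T \<ge> 0 \<Longrightarrow> (\<And>t. t \<in> {0..T} \<Longrightarrow> norm (v t) \<le> B) \<Longrightarrow> supnorm T v \<le> B"
  unfolding supnorm_def by (rule cSUP_least) auto

text \<open>Stated for an arbitrary filter, since it serves sequences of paths as well as continuity
  in the finitely many increments of a polygonal path.\<close>

lemma Cb_tendsto:
  assumes T: "T > 0" and f: "f \<in> Cb T" and w: "w \<in> Wsp T" and v: "\<And>n. v n \<in> Wsp T"
    and conv: "\<And>e. e > 0 \<Longrightarrow> \<forall>\<^sub>F n in G. \<forall>t\<in>{0..T}. norm (v n t - w t) \<le> e"
  shows "((\<lambda>n. f (v n)) \<longlongrightarrow> f w) G"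
proof (rule tendstoI)
  fix e :: real assume "e > 0"
  then obtain d where d: "d > 0" "\<And>v. v \<in> Wsp T \<Longrightarrow> supnorm T (\<lambda>t. v t - w t) < d \<Longrightarrow> \<bar>f v - f w\<bar> < e"
    using f w unfolding Cb_def by blast
  have "\<forall>\<^sub>F n in G. \<forall>t\<in>{0..T}. norm (v n t - w t) \<le> d / 2" using conv[of "d / 2"] d(1) by simp
  then show "\<forall>\<^sub>F n in G. dist (f (v n)) (f w) < e"
  proof eventually_elim
    case (elim n)
    then have "supnorm T (\<lambda>t. v n t - w t) \<le> d / 2" using T by (intro supnorm_le) auto
    then show ?case using d(2)[OF v, of n] d(1) by (simp add: dist_real_def)
  qed
qed

text \<open>The polygonal path depends uniformly continuously on finitely many increments, so the
  functional is continuous for the product topology on all sequences; its Borel sets are those of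
  the countable product.\<close>

lemma interp_functional_measurable:
  fixes f :: "(real \<Rightarrow> real ^ 'd) \<Rightarrow> real"
  assumes T: "T > 0" and f: "f \<in> Cb T"
  shows "(\<lambda>x. f (interp T N x)) \<in> borel_measurable (Pi\<^sub>M {..<N} (\<lambda>_. borel))"
proof -
  let ?F = "\<lambda>x. f (interp T N x)"
  have "continuous_on UNIV ?F"
    unfolding continuous_on_def
  proof (intro ballI)
    fix x :: "nat \<Rightarrow> real ^ 'd"
    show "(?F \<longlongrightarrow> ?F x) (at x within UNIV)"
    proof (rule Cb_tendsto[OF T f interp_Wsp[OF T] interp_Wsp[OF T]])
      fix e :: real assume e: "e > 0"
      have "((\<lambda>y. y k) \<longlongrightarrow> x k) (at x)" for k :: nat
      proof -
        have "continuous_on UNIV (\<lambda>y :: nat \<Rightarrow> real ^ 'd. y k)" by (rule continuous_on_product_coordinates)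
        then show ?thesis unfolding continuous_on_def by simp
      qed
      then have "((\<lambda>y. \<Sum>k<N. norm (y k - x k)) \<longlongrightarrow> (\<Sum>k<N. norm (x k - x k))) (at x)" by (intro tendsto_intros)
      then have "\<forall>\<^sub>F y in at x. (\<Sum>k<N. norm (y k - x k)) < e" using e by (intro order_tendstoD) simp
      then show "\<forall>\<^sub>F y in at x within UNIV. \<forall>t\<in>{0..T}. norm (interp T N y t - interp T N x t) \<le> e"
      proof eventually_elim
        case (elim y)
        then show ?case unfolding interp_diff using interp_norm_le[of T N "\<lambda>k. y k - x k"] by (meson less_imp_le order_trans)
      qed
    qed
  qed
  then have "?F \<in> borel_measurable borel" by (rule borel_measurable_continuous_onI)
  then have F: "?F \<in> borel_measurable (Pi\<^sub>M UNIV (\<lambda>_::nat. borel))"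
    by (simp cong: measurable_cong_sets add: sets_PiM_equal_borel)
  \<comment> \<open>Elements of the finite product are undefined off \<open>{..<N}\<close>. Padding
    with 0 maps them measurably into the full product, and \<open>interp\<close> ignores the
    padding.\<close>
  have "(\<lambda>x k. if k < N then x k else 0 :: real ^ 'd) \<in> measurable (Pi\<^sub>M {..<N} (\<lambda>_. borel)) (Pi\<^sub>M UNIV (\<lambda>_::nat. borel))"
  proof (rule measurable_PiM_single')
    show "(\<lambda>x. if k < N then x k else 0 :: real ^ 'd) \<in> borel_measurable (Pi\<^sub>M {..<N} (\<lambda>_. borel))" for k
      by (cases "k < N") auto
  qed (auto simp: space_PiM)
  from measurable_compose[OF this F]
  have "(\<lambda>x. f (interp T N (\<lambda>k. if k < N then x k else 0))) \<in> borel_measurable (Pi\<^sub>M {..<N} (\<lambda>_. borel))" .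
  moreover have "interp T N (\<lambda>k. if k < N then x k else 0) = interp T N x" for x :: "nat \<Rightarrow> real ^ 'd"
    by (rule interp_cong) simp
  ultimately show ?thesis by simp
qed

lemma ramp_integral:
  fixes v :: "real ^ 'd"
  assumes T: "T > 0" and N: "N > 0" and t: "t \<in> {0..T}"
  shows "set_integrable lborel {0..t} (\<lambda>s. indicator (grid_cell T N j) s *\<^sub>R v)"
    "(LINT s:{0..t}|lborel. indicator (grid_cell T N j) s *\<^sub>R v) = ramp (t * real N / T - real j) *\<^sub>R ((T / real N) *\<^sub>R v)"
proof -
  let ?a = "T * real j / real N" and ?b = "T * real (Suc j) / real N"
  have a0: "0 \<le> ?a" using T by simp
  have e: "indicator {0..t} s *\<^sub>R (indicator (grid_cell T N j) s *\<^sub>R v) = indicator {?a<..min t ?b} s *\<^sub>R v" for s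
    using a0 by (auto simp: grid_cell_def indicator_def)
  have m: "measure lborel {?a<..min t ?b} = T / real N * ramp (t * real N / T - real j)"
  proof -
    have "measure lborel {?a<..min t ?b} = max 0 (min t ?b - ?a)"
    proof (cases "?a \<le> min t ?b")
      case False
      then have "{?a<..min t ?b} = {}" by (intro greaterThanAtMost_empty) linarith
      then show ?thesis using False by (simp only: measure_empty)
    qed (simp add: measure_lborel_Ioc max_def)
    also have "min t ?b - ?a = T / real N * min (t * real N / T - real j) 1"
      using T N by (simp add: min_def field_simps)
    also have "max 0 \<dots> = T / real N * ramp (t * real N / T - real j)"
    proof -
      have "max 0 (h * z) = h * max 0 z" if "h > 0" for h z :: real using that by (simp add: max_def zero_le_mult_iff)
      then show ?thesis using T N by (simp only: ramp_def min.commute[of 1] zero_less_divide_iff of_nat_0_less_iff simp_thms)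
    qed
    finally show ?thesis .
  qed
  have "emeasure lborel {?a<..min t ?b} < \<infinity>" by (cases "?a \<le> min t ?b") auto
  then have i: "integrable lborel (indicator {?a<..min t ?b} :: real \<Rightarrow> real)" by (simp add: integrable_indicator_iff)
  then show "set_integrable lborel {0..t} (\<lambda>s. indicator (grid_cell T N j) s *\<^sub>R v)"
    unfolding set_integrable_def e by (intro integrable_scaleR_left)
  have "(LINT s:{0..t}|lborel. indicator (grid_cell T N j) s *\<^sub>R v) = (\<integral>s. indicator {?a<..min t ?b} s \<partial>lborel) *\<^sub>R v"
    unfolding set_lebesgue_integral_def e using i by (intro integral_scaleR_left)
  then show "(LINT s:{0..t}|lborel. indicator (grid_cell T N j) s *\<^sub>R v) = ramp (t * real N / T - real j) *\<^sub>R ((T / real N) *\<^sub>R v)"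
    using m by (simp add: mult.commute)
qed

context wiener_setup
begin

text \<open>Within a cell the interpolation is a convex combination of the path at the two grid
  points, each at distance at most one cell from \<open>t\<close>, so its error is the oscillation
  of the path.\<close>

lemma interp_grid_vec:
  assumes N: "N > 0" and w: "w \<in> Wsp T" and t: "t \<in> {0..T}"
    and osc: "\<And>r s. r \<in> {0..T} \<Longrightarrow> s \<in> {0..T} \<Longrightarrow> \<bar>r - s\<bar> \<le> T / real N \<Longrightarrow> norm (w r - w s) \<le> e"
  shows "norm (interp T N (grid_vec N w) t - w t) \<le> e"
proof -
  obtain k where k: "k < N" "T * real k / real N \<le> t" "t \<le> T * real (Suc k) / real N"
  proof (cases "t = 0")
    case True
    then show ?thesis using that[of 0] N T_pos by simp
  next
    case False
    then obtain k where "k < N" "t \<in> grid_cell T N k" using grid_cell_exists[OF T_pos N, of t] t by auto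
    then show ?thesis using that[of k] by (simp add: grid_cell_def)
  qed
  let ?a = "T * real k / real N" and ?b = "T * real (Suc k) / real N" and ?l = "t * real N / T - real k"
  note o = grid_order[OF N k(1)]
  have ba: "?b - ?a = T / real N" by (simp add: diff_divide_distrib[symmetric] algebra_simps)
  have l: "0 \<le> ?l" "?l \<le> 1" using T_pos N k by (auto simp: field_simps)
  have "(\<Sum>j<k. grid_vec N w j) = (\<Sum>j<k. w (T * real (Suc j) / real N) - w (T * real j / real N))"
    using k(1) by (intro sum.cong refl) (auto simp: grid_vec_def grid_incr_def)
  also have "\<dots> = w ?a - w (T * real 0 / real N)" by (rule sum_lessThan_telescope)
  also have "\<dots> = w ?a" using w by (simp add: Wsp_def)
  finally have "interp T N (grid_vec N w) t = w ?a + ?l *\<^sub>R (w ?b - w ?a)"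
    unfolding interp_eval[OF T_pos N k] using k(1) by (simp add: grid_vec_def grid_incr_def)
  then have "interp T N (grid_vec N w) t - w t = (1 - ?l) *\<^sub>R (w ?a - w t) + ?l *\<^sub>R (w ?b - w t)" by (simp add: algebra_simps)
  also have "norm \<dots> \<le> (1 - ?l) * norm (w ?a - w t) + ?l * norm (w ?b - w t)"
    using norm_triangle_ineq[of "(1 - ?l) *\<^sub>R (w ?a - w t)" "?l *\<^sub>R (w ?b - w t)"] l by simp
  also have "\<dots> \<le> (1 - ?l) * e + ?l * e"
    using l o k t ba by (intro add_mono mult_left_mono osc) auto
  finally show ?thesis by (simp add: algebra_simps)
qed

lemma interp_grid_vec_uniform:
  assumes w: "w \<in> Wsp T" and N: "\<And>n. N n > n" and e: "e > 0"
  shows "\<forall>\<^sub>F n in sequentially. \<forall>t\<in>{0..T}. norm (interp T (N n) (grid_vec (N n) w) t - w t) \<le> e"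
proof -
  have "uniformly_continuous_on {0..T} w" using w by (intro compact_uniformly_continuous) (auto simp: Wsp_def)
  then obtain d where d: "d > 0" "\<And>r s. r \<in> {0..T} \<Longrightarrow> s \<in> {0..T} \<Longrightarrow> dist s r < d \<Longrightarrow> dist (w s) (w r) < e"
    unfolding uniformly_continuous_on_def using e by metis
  obtain n0 where n0: "T / d < real n0" using reals_Archimedean2 by blast
  have "\<forall>t\<in>{0..T}. norm (interp T (N n) (grid_vec (N n) w) t - w t) \<le> e" if n: "n \<ge> n0" for n
  proof
    fix t assume t: "t \<in> {0..T}"
    have "T / d < real (N n)" using n0 n N[of n] by linarith
    then have "T / real (N n) < d" using d(1) N[of n] by (simp add: field_simps)
    then show "norm (interp T (N n) (grid_vec (N n) w) t - w t) \<le> e"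
      using N[of n] d(2) by (intro interp_grid_vec w t) (auto simp: dist_norm less_imp_le norm_minus_commute)
  qed
  then show ?thesis unfolding eventually_sequentially by blast
qed

text \<open>A process constant on the cells integrates to a polygonal path whose increments are the
  drifts times the cell length. Shearing the increments is thus exactly subtracting the integrated
  drift.\<close>

lemma interp_shear:
  assumes N: "N > 0" and t: "t \<in> {0..T}"
  shows "interp T N (shear (T / real N) A N (grid_vec N w)) t = interp T N (grid_vec N w) t - (LINT s:{0..t}|lborel. step_process N A s w)"
proof -
  have "(LINT s:{0..t}|lborel. step_process N A s w) = (\<Sum>j<N. LINT s:{0..t}|lborel. indicator (grid_cell T N j) s *\<^sub>R step_drift N A j w)"
    unfolding step_process_def set_lebesgue_integral_def scaleR_sum_right
    by (rule Bochner_Integration.integral_sum) (rule ramp_integral(1)[OF T_pos N t, unfolded set_integrable_def])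
  also have "\<dots> = interp T N (\<lambda>j. (T / real N) *\<^sub>R step_drift N A j w) t"
    unfolding ramp_integral(2)[OF T_pos N t] interp_def using t by simp
  finally have i: "(LINT s:{0..t}|lborel. step_process N A s w) = interp T N (\<lambda>j. (T / real N) *\<^sub>R step_drift N A j w) t" .
  show ?thesis unfolding i interp_diff
    by (rule fun_cong[OF interp_cong]) (simp add: shear_def lin_drift_grid)
qed

lemma step_process_set_integrable:
  assumes N: "N > 0" and t: "t \<in> {0..T}"
  shows "set_integrable lborel {0..t} (\<lambda>s. step_process N A s w)"
  unfolding step_process_def set_integrable_def scaleR_sum_right
  by (rule Bochner_Integration.integrable_sum) (rule ramp_integral(1)[OF T_pos N t, unfolded set_integrable_def])

text \<open>Cauchy-Schwarz in time, at the price of the factor \<open>T\<close>. The right-hand side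
  does not involve \<open>t\<close>, so mean square convergence of the drifts yields uniform
  convergence of the integrated paths.\<close>

lemma drift_error:
  assumes N: "N > 0" and t: "t \<in> {0..T}" and jm: "jm X" and w: "w \<in> space M" and X: "set_integrable lborel {0..T} (\<lambda>s. X s w)"
  shows "ennreal ((norm ((LINT s:{0..t}|lborel. X s w) - (LINT s:{0..t}|lborel. step_process N A s w)))\<^sup>2)
    \<le> ennreal T * (\<integral>\<^sup>+s\<in>{0..T}. ennreal ((norm (X s w - step_process N A s w))\<^sup>2) \<partial>lborel)"
proof -
  let ?D = "\<lambda>s. X s w - step_process N A s w"
  have Dm[measurable]: "?D \<in> borel_measurable borel"
    using jm_section(2)[OF jm w] jm_section(2)[OF step_process_jm[OF N] w] by (intro borel_measurable_diff)
  have X': "set_integrable lborel {0..t} (\<lambda>s. X s w)" by (rule set_integrable_subset[OF X]) (use t in auto)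
  note S = step_process_set_integrable[OF N t, of A w]
  have "(LINT s:{0..t}|lborel. X s w) - (LINT s:{0..t}|lborel. step_process N A s w) = (LINT s:{0..t}|lborel. ?D s)"
    using set_integral_diff(2)[OF X' S] by simp
  also have "ennreal (norm \<dots>) \<le> (\<integral>\<^sup>+s. ennreal (norm (indicator {0..t} s *\<^sub>R ?D s)) \<partial>lborel)"
    unfolding set_lebesgue_integral_def using set_integral_diff(1)[OF X' S] unfolding set_integrable_def by (rule integral_norm_bound_ennreal)
  also have "\<dots> \<le> (\<integral>\<^sup>+s\<in>{0..T}. ennreal (norm (?D s)) \<partial>lborel)"
    using t by (intro nn_integral_mono) (auto simp: indicator_def)
  also have "\<dots> = (\<integral>\<^sup>+s. ennreal (norm (?D s)) * 1 \<partial>\<mu>T)" by (simp add: nn_integral_interval_measure_T)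
  finally have "(ennreal (norm ((LINT s:{0..t}|lborel. X s w) - (LINT s:{0..t}|lborel. step_process N A s w))))\<^sup>2 \<le> (\<integral>\<^sup>+s. ennreal (norm (?D s)) * 1 \<partial>\<mu>T)\<^sup>2"
    by (rule power_mono) simp
  also have "\<dots> \<le> (\<integral>\<^sup>+s. (ennreal (norm (?D s)))\<^sup>2 \<partial>\<mu>T) * (\<integral>\<^sup>+s. 1\<^sup>2 \<partial>\<mu>T)" by (rule Cauchy_Schwarz_nn_integral) measurable
  also have "(\<integral>\<^sup>+s. 1\<^sup>2 \<partial>\<mu>T) = ennreal T" using T_pos by (subst nn_integral_interval_measure_T) auto
  also have "(\<integral>\<^sup>+s. (ennreal (norm (?D s)))\<^sup>2 \<partial>\<mu>T) = (\<integral>\<^sup>+s\<in>{0..T}. ennreal ((norm (?D s))\<^sup>2) \<partial>lborel)"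
    by (subst nn_integral_interval_measure_T) (auto simp: ennreal_power)
  finally show ?thesis by (simp add: ennreal_power mult.commute)
qed

text \<open>The functional is continuous in the supremum norm, whereas the sigma-algebra is
  generated by the coordinates. The bridge is that it is the pointwise limit of its values on
  polygonal interpolations, each a measurable function of finitely many increments.\<close>

lemma Cb_measurable:
  assumes f: "f \<in> Cb T"
  shows "f \<in> borel_measurable M"
proof (rule borel_measurable_LIMSEQ_real)
  show "(\<lambda>w. f (interp T (Suc n) (grid_vec (Suc n) w))) \<in> borel_measurable M" for n
    by (rule measurable_compose[OF grid_vec_measurable interp_functional_measurable[OF T_pos f]])
  show "(\<lambda>n. f (interp T (Suc n) (grid_vec (Suc n) w))) \<longlonglongrightarrow> f w" if "w \<in> space M" for w
    using that by (intro Cb_tendsto[OF T_pos f] interp_Wsp T_pos interp_grid_vec_uniform) (auto simp: space_M)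
qed

end

section \<open>The formula for nonnegative functionals\<close>

lemma LIMSEQ_of_sq:
  fixes x :: real
  assumes "(\<lambda>n. ennreal ((x - y n)\<^sup>2)) \<longlonglongrightarrow> 0"
  shows "y \<longlonglongrightarrow> x"
proof -
  have "(\<lambda>n. (x - y n)\<^sup>2) \<longlonglongrightarrow> 0" using assms tendsto_ennreal_iff[of "\<lambda>n. (x - y n)\<^sup>2" sequentially 0] by simp
  then have "(\<lambda>n. sqrt ((x - y n)\<^sup>2)) \<longlonglongrightarrow> sqrt 0" by (rule tendsto_real_sqrt)
  then have "(\<lambda>n. x - y n) \<longlonglongrightarrow> 0" by (simp add: tendsto_rabs_zero_iff)
  then have "(\<lambda>n. x - (x - y n)) \<longlonglongrightarrow> x - 0" by (intro tendsto_diff tendsto_const)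
  then show ?thesis by simp
qed

text \<open>Arithmetic for \<open>reduced_kernel_dist\<close>: with the kernel error and the
  diagonal error both at most \<open>d\<close>, the whole bound is \<open>d\<close> times a constant
  fixed along the sequence.\<close>

lemma reduced_kernel_error:
  assumes e: "e \<le> ennreal d" and d: "0 \<le> d" and X: "0 \<le> X" and k: "0 \<le> k" "k \<le> 2 * X + 2" and z: "z \<le> d" and c: "0 \<le> c"
  shows "3 * e + 3 * (2 * (e * ennreal X) + 2 * (ennreal k * e)) + 3 * ennreal (c * z) \<le> ennreal (3 * d * (5 + 6 * X + c))"
proof -
  have "3 * e + 3 * (2 * (e * ennreal X) + 2 * (ennreal k * e)) + 3 * ennreal (c * z)
    \<le> 3 * ennreal d + 3 * (2 * (ennreal d * ennreal X) + 2 * (ennreal (2 * X + 2) * ennreal d)) + 3 * ennreal (c * d)"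
    using assms by (intro add_mono mult_mono ennreal_leI mult_left_mono) auto
  also have "\<dots> = ennreal (3 * d + 3 * (2 * (d * X) + 2 * ((2 * X + 2) * d)) + 3 * (c * d))"
  proof -
    have "ennreal d * ennreal X = ennreal (d * X)" "ennreal (2 * X + 2) * ennreal d = ennreal ((2 * X + 2) * d)"
      using d X by (simp_all only: ennreal_mult[symmetric] add_nonneg_nonneg mult_nonneg_nonneg zero_le_numeral)
    then show ?thesis using d X c
      by (simp only: ennreal_numeral_mult ennreal_plus mult_nonneg_nonneg add_nonneg_nonneg zero_le_numeral)
  qed
  also have "3 * d + 3 * (2 * (d * X) + 2 * ((2 * X + 2) * d)) + 3 * (c * d) = 3 * d * (5 + 6 * X + c)" by (simp add: algebra_simps)
  finally show ?thesis .
qed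

lemma density_tail_rate_tendsto: "(\<lambda>m. (36 / (real (Suc m))\<^sup>2 + 1 / real (Suc m)) * c) \<longlonglongrightarrow> 0"
proof -
  have 1: "(\<lambda>m. 1 / real (Suc m)) \<longlonglongrightarrow> 0" by (rule LIMSEQ_Suc[OF lim_1_over_n])
  have "(\<lambda>m. (36 * (1 / real (Suc m))\<^sup>2 + 1 / real (Suc m)) * c) \<longlonglongrightarrow> (36 * 0\<^sup>2 + 0) * c" by (intro tendsto_intros 1)
  then show ?thesis by (simp add: power_divide)
qed

context wiener_setup
begin

lemma wint_process_jm: "wint_process T \<eta> X \<Longrightarrow> jm X"
  unfolding wint_process_def jm_def M_wiener[symmetric] by blast

text \<open>Comparison with the zero step kernel on a grid with one cell, whose process is
  0.\<close>

lemma wint_process_sq_finite: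
  assumes \<eta>: "\<eta> \<in> S2 T" and X: "wint_process T \<eta> X"
  shows "procdist X (\<lambda>_ _. 0) < \<infinity>"
proof -
  let ?Z = "\<lambda>_ _. 0 :: real ^ 'd ^ 'd"
  have z: "step_process (Suc 0) ?Z = (\<lambda>_ _. 0)" unfolding step_process_def step_drift_def by (auto simp: fun_eq_iff)
  have k: "lower_kernel T (step_kernel T (Suc 0) ?Z) = (\<lambda>p. 0)" unfolding lower_kernel_def step_kernel_def by (auto simp: fun_eq_iff)
  have "procdist X (step_process (Suc 0) ?Z) \<le> 9 * L2dist (square_measure T) (lower_kernel T \<eta>) (lower_kernel T (step_kernel T (Suc 0) ?Z))"
    by (rule wint_estimate[OF X step_wint]) (auto simp: k S2_lower_kernel_measurable[OF \<eta>])
  also have "\<dots> < \<infinity>" unfolding k L2dist_def using lower_kernel_L2_finite[OF \<eta>] by (simp add: ennreal_mult_less_top)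
  finally show ?thesis unfolding z .
qed

text \<open>Since a version exists, the choice returns some version. Which one is irrelevant: the
  continuity estimates compare any two, so the process found here may differ from the one behind
  \<open>Gfun\<close>.\<close>

lemma qfun_spec:
  fixes \<eta> :: "real \<Rightarrow> real \<Rightarrow> real ^ 'd ^ 'd"
  assumes \<eta>: "\<eta> \<in> S2 T"
  shows "\<exists>X. wint_process T \<eta> X \<and> has_ito_integral T X (qfun T \<eta>)"
proof -
  have "\<exists>X Q. wint_process T \<eta> X \<and> has_ito_integral T X Q"
    by (rule wint_exists[OF S2_lower_kernel_measurable[OF \<eta>] lower_kernel_L2_finite[OF \<eta>]]) (rule S2_row_measurable[OF \<eta>])
  then have "\<exists>Q X. wint_process T \<eta> X \<and> has_ito_integral T X Q" by blast
  then show ?thesis unfolding qfun_def by (rule someI_ex)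
qed

lemma Gfun_spec:
  assumes \<eta>: "\<eta> \<in> S2 T"
  shows "Gfun T \<eta> \<in> measurable M (Wsig T) \<and> (\<exists>X. wint_process T \<eta> X \<and> (AE w in M. \<forall>t\<in>{0..T}. Gfun T \<eta> w t = - (LINT s:{0..t}|lborel. X s w)))"
proof -
  obtain X where X: "wint_process T \<eta> X" using qfun_spec[OF \<eta>] by blast
  have "\<exists>G. G \<in> measurable M (Wsig T) \<and> (\<exists>X. wint_process T \<eta> X \<and> (AE w in M. \<forall>t\<in>{0..T}. G w t = - (LINT s:{0..t}|lborel. X s w)))"
    using G_exists[OF wint_process_jm[OF X] wint_process_sq_finite[OF \<eta> X]] X by blast
  then show ?thesis unfolding Gfun_def M_wiener[symmetric] by (rule someI_ex)
qed

lemma add_path_measurable: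
  assumes G: "G \<in> measurable M (Wsig T)"
  shows "(\<lambda>w t. w t + G w t) \<in> measurable M M"
proof -
  have "(\<lambda>w t. w t + G w t) \<in> measurable M (Wsig T)" unfolding Wsig_def
  proof (intro measurable_restrict_space2 measurable_PiM_single')
    show "(\<lambda>w t. w t + G w t) \<in> space M \<rightarrow> Wsp T"
    proof
      fix w assume w: "w \<in> space M"
      then have "w \<in> Wsp T" "G w \<in> Wsp T"
        using measurable_space[OF G w] by (auto simp: space_M Wsig_def space_restrict_space)
      then show "(\<lambda>t. w t + G w t) \<in> Wsp T" unfolding Wsp_def by (auto intro!: continuous_intros)
    qed
    show "(\<lambda>w. w t + G w t) \<in> borel_measurable M" for t
      using coordinate_measurable[of t] measurable_compose[OF G Wsig_coordinate[of t]] by (rule borel_measurable_add)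
  qed auto
  then show ?thesis by (simp cong: measurable_cong_sets add: sets_M)
qed

lemma procdist_pathwise_measurable:
  assumes "jm X" "jm Y"
  shows "(\<lambda>w. \<integral>\<^sup>+s\<in>{0..T}. ennreal ((norm (X s w - Y s w))\<^sup>2) \<partial>lborel) \<in> borel_measurable M"
proof -
  have "(\<lambda>(w, s). X s w) \<in> borel_measurable (M \<Otimes>\<^sub>M lborel)" "(\<lambda>(w, s). Y s w) \<in> borel_measurable (M \<Otimes>\<^sub>M lborel)"
    using measurable_pair_swap[OF assms(1)[unfolded jm_def]] measurable_pair_swap[OF assms(2)[unfolded jm_def]] by (simp_all add: case_prod_beta')
  then have "(\<lambda>p. ennreal ((norm (X (snd p) (fst p) - Y (snd p) (fst p)))\<^sup>2) * indicator {0..T} (snd p)) \<in> borel_measurable (M \<Otimes>\<^sub>M lborel)"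
    by (simp add: case_prod_beta')
  from lborel.borel_measurable_nn_integral_fst[OF this] show ?thesis by simp
qed

lemma step_kernel_sequence:
  fixes a :: "real \<times> real \<Rightarrow> real ^ 'd ^ 'd"
  assumes a: "step_approx T a" and e: "\<And>n. e n > 0"
  obtains N A C where "\<And>n. N n > n" "\<And>n. C n \<ge> 0" "\<And>n j k. norm (A n j k) \<le> C n" "\<And>n. C n ^ 4 / real (N n) < e n"
    "\<And>n. L2dist (square_measure T) a (\<lambda>p. step_kernel T (N n) (A n) (fst p) (snd p)) < ennreal (e n)"
proof -
  define P where "P n x \<longleftrightarrow> (case x of (N, A, C) \<Rightarrow> N > n \<and> C \<ge> 0 \<and> (\<forall>j k. norm (A j k) \<le> C) \<and> C ^ 4 / real N < e n
     \<and> L2dist (square_measure T) a (\<lambda>p. step_kernel T N A (fst p) (snd p)) < ennreal (e n))" for n and x :: "nat \<times> (nat \<Rightarrow> nat \<Rightarrow> real ^ 'd ^ 'd) \<times> real"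
  have "\<exists>x. P n x" for n
  proof -
    obtain N A C where "N > n" "C \<ge> 0" "\<And>j k. norm (A j k) \<le> C" "C ^ 4 / real N < e n"
      "L2dist (square_measure T) a (\<lambda>p. step_kernel T N A (fst p) (snd p)) < ennreal (e n)"
      by (rule step_approx_fine[OF T_pos a e, of n n]) (rule that)
    then have "P n (N, A, C)" unfolding P_def by simp
    then show ?thesis ..
  qed
  then obtain x where "\<And>n. P n (x n)" by metis
  then show ?thesis unfolding P_def case_prod_beta by (intro that[of "\<lambda>n. fst (x n)" "\<lambda>n. snd (snd (x n))" "\<lambda>n. fst (snd (x n))"]) auto
qed

text \<open>The grid formula is exact for polygonal paths, and every ingredient converges almost
  surely along one sequence: the quadratic forms of the reduced kernels to
  \<open>qfun T \<rho>\<close>, the diagonal sums to half of the squared norm of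
  \<open>\<eta>\<close>, and the sheared polygons uniformly to the shifted path. Extended integrals
  require \<open>f\<close> to be nonnegative at this stage.\<close>

theorem density_formula:
  fixes \<eta> \<rho> :: "real \<Rightarrow> real \<Rightarrow> real ^ 'd ^ 'd"
  assumes \<eta>: "\<eta> \<in> S2 T" and norm: "norm2 T \<eta> < 1" and \<rho>: "\<rho> \<in> S2 T"
    and eq: "\<forall>s t. 0 \<le> s \<and> s < t \<and> t \<le> T \<longrightarrow> \<rho> t s = \<eta> t s - (LINT u:{t..T}|lborel. \<eta> t u ** \<eta> u s)"
    and f: "f \<in> Cb T" and f0: "\<And>w. w \<in> Wsp T \<Longrightarrow> f w \<ge> 0"
  shows "(\<integral>\<^sup>+w. ennreal (f (\<lambda>t. w t + Gfun T \<eta> w t) * exp (qfun T \<rho> w - (norm2 T \<eta>)\<^sup>2 / 4)) \<partial>M) = (\<integral>\<^sup>+w. ennreal (f w) \<partial>M)"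
proof -
  let ?S = "square_measure T" and ?a = "lower_kernel T \<eta>"
  note am = S2_lower_kernel_measurable[OF \<eta>] and afin = lower_kernel_L2_finite[OF \<eta>]
  define X where "X = enn2real (\<integral>\<^sup>+p. ennreal ((norm (?a p))\<^sup>2) \<partial>?S)"
  have X: "(\<integral>\<^sup>+p. ennreal ((norm (?a p))\<^sup>2) \<partial>?S) = ennreal X" "X \<ge> 0" unfolding X_def using afin by (auto simp: less_top)
  have nX: "(norm2 T \<eta>)\<^sup>2 = 2 * X" unfolding X_def by (rule norm2_sq_lower[OF \<eta>])
  have "norm2 T \<eta> \<ge> 0" by (simp add: norm2_def)
  then have "(norm2 T \<eta>)\<^sup>2 < 1" using norm by (simp add: power_less_one_iff)
  then have Xlt: "X < 1/2" using nX by simp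
  \<comment> \<open>Each summand pays for one estimate that must end below \<open>(1/4) ^ n\<close>:
    9 for the drift process; 243 = 9 * 9 * 3 for the quadratic form, with one factor 9 for the
    process, one for its integral and 3 from \<open>reduced_kernel_error\<close>; the last one for
    \<open>diag_variance\<close>.\<close>
  define K where "K = 9 + 243 * (5 + 6 * X + T ^ 4) + 3 * (real CARD('d))\<^sup>2 * T ^ 4"
  have T4: "T ^ 4 \<ge> 0" using T_pos by simp
  have dT: "3 * (real CARD('d))\<^sup>2 * T ^ 4 \<ge> 0" using T4 by simp
  have K: "K \<ge> 9" "K \<ge> 243 * (5 + 6 * X + T ^ 4)" "K \<ge> 3 * (real CARD('d))\<^sup>2 * T ^ 4"
    unfolding K_def using X(2) T4 dT by simp_all
  define e where "e n = (1/4) ^ n / K" for n :: nat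
  have e0: "e n > 0" for n using K by (simp add: e_def)
  have ce: "c * e n \<le> (1/4) ^ n" if "c \<le> K" for c n
  proof -
    have "c * e n \<le> K * e n" using that e0[of n] by (intro mult_right_mono) auto
    then show ?thesis using K by (simp add: e_def)
  qed
  have e1: "e n \<le> (1/4) ^ n" for n using ce[of 1 n] K by simp
  have "step_approx T ?a"
    by (rule step_approx_L2[OF T_pos am _ afin]) (auto simp: lower_kernel_def)
  then obtain N A C where N: "\<And>n. N n > n" and C: "\<And>n. C n \<ge> 0" "\<And>n j k. norm (A n j k) \<le> C n" "\<And>n. C n ^ 4 / real (N n) < e n"
    and d: "\<And>n. L2dist ?S ?a (\<lambda>p. step_kernel T (N n) (A n) (fst p) (snd p)) < ennreal (e n)"
    by (rule step_kernel_sequence[OF _ e0]) (rule that)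
  have N0: "N n > 0" for n using N[of n] by simp
  have d': "L2dist ?S ?a (\<lambda>p. step_kernel T (N n) (A n) (fst p) (snd p)) \<le> ennreal ((1/4) ^ n)" for n
    using d[of n] ennreal_leI[OF e1[of n]] by (meson less_imp_le order_trans)
  define k where "k n = kernel_sq T (N n) (A n)" for n
  have k0: "k n \<ge> 0" for n unfolding k_def kernel_sq_def by (intro mult_nonneg_nonneg sum_nonneg) auto
  have klim: "k \<longlonglongrightarrow> X" unfolding k_def X_def by (rule kernel_sq_tendsto[OF T_pos N0 am afin d'])
  \<comment> \<open>Convergence of \<open>k\<close> bounds it only implicitly. The error estimate of
    the reduced kernels wants an explicit bound for all \<open>n\<close>, obtained from Young's
    inequality with parameter 1.\<close>
  have kle: "k n \<le> 2 * X + 2" for n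
  proof -
    have "ennreal (k n) \<le> ennreal (1 + 1) * ennreal X + ennreal (1 + 1 / 1) * L2dist ?S ?a (\<lambda>p. step_kernel T (N n) (A n) (fst p) (snd p))"
      using L2_norm_young[of ?a ?S "\<lambda>p. step_kernel T (N n) (A n) (fst p) (snd p)" 1] am step_kernel_measurable
      unfolding step_kernel_L2[OF T_pos N0] X(1) k_def by simp
    also have "\<dots> \<le> ennreal (1 + 1) * ennreal X + ennreal (1 + 1 / 1) * ennreal 1"
      using d'[of n] by (intro add_left_mono mult_left_mono) (auto elim!: order_trans intro!: ennreal_leI power_le_one)
    also have "\<dots> = ennreal (2 * X + 2)" using X(2) by (simp add: ennreal_mult)
    finally show ?thesis using X(2) by (subst (asm) ennreal_le_iff) auto
  qed
  define R where "R n = reduced_kernel (T / real (N n)) (N n) (A n)" for n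
  have rd: "L2dist ?S (lower_kernel T \<rho>) (\<lambda>p. step_kernel T (N n) (R n) (fst p) (snd p)) \<le> ennreal (3 * e n * (5 + 6 * X + T ^ 4))" for n
  proof -
    have "L2dist ?S (lower_kernel T \<rho>) (\<lambda>p. step_kernel T (N n) (R n) (fst p) (snd p))
      \<le> 3 * L2dist ?S ?a (\<lambda>p. step_kernel T (N n) (A n) (fst p) (snd p))
        + 3 * (2 * (L2dist ?S ?a (\<lambda>p. step_kernel T (N n) (A n) (fst p) (snd p)) * ennreal X) + 2 * (ennreal (k n) * L2dist ?S ?a (\<lambda>p. step_kernel T (N n) (A n) (fst p) (snd p))))
        + 3 * ennreal (T ^ 4 * (C n ^ 4 / real (N n)))"
      unfolding R_def X(1)[symmetric] k_def
      by (rule reduced_kernel_dist[OF T_pos N0 C(1,2) am afin lower_kernel_reduced[OF \<eta> eq]]) (auto simp: lower_kernel_def)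
    also have "\<dots> \<le> ennreal (3 * e n * (5 + 6 * X + T ^ 4))"
      by (rule reduced_kernel_error) (use d[of n] e0[of n] X(2) k0 kle C(3)[of n] T4 in \<open>auto intro: less_imp_le\<close>)
    finally show ?thesis .
  qed
  obtain Y where Y: "wint_process T \<rho> Y" "has_ito_integral T Y (qfun T \<rho>)" using qfun_spec[OF \<rho>] by blast
  have qm: "qfun T \<rho> \<in> borel_measurable M" using Y(2) unfolding has_ito_iff by blast
  have sqm: "step_q (N n) (R n) \<in> borel_measurable M" for n using step_process_has_ito[OF N0] unfolding has_ito_iff by blast
  have q: "L2dist M (qfun T \<rho>) (step_q (N n) (R n)) \<le> ennreal ((1/4) ^ n)" for n
  proof -
    have "L2dist M (qfun T \<rho>) (step_q (N n) (R n)) \<le> 9 * procdist Y (step_process (N n) (R n))"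
      by (rule ito_ineq[OF Y(2) step_process_has_ito[OF N0]])
    also have "procdist Y (step_process (N n) (R n)) \<le> 9 * L2dist ?S (lower_kernel T \<rho>) (lower_kernel T (step_kernel T (N n) (R n)))"
      by (rule wint_estimate[OF Y(1) step_wint[OF N0] S2_lower_kernel_measurable[OF \<rho>]]) (simp add: lower_kernel_step[OF N0])
    also have "\<dots> \<le> 9 * ennreal (3 * e n * (5 + 6 * X + T ^ 4))" unfolding lower_kernel_step[OF N0] using rd by (rule mult_left_mono) simp
    finally have "L2dist M (qfun T \<rho>) (step_q (N n) (R n)) \<le> 9 * (9 * ennreal (3 * e n * (5 + 6 * X + T ^ 4)))" by (simp add: mult_left_mono)
    also have "\<dots> = ennreal (9 * (9 * (3 * e n * (5 + 6 * X + T ^ 4))))"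
    proof -
      have "0 \<le> 3 * e n * (5 + 6 * X + T ^ 4)" using e0[of n] X(2) T4 by simp
      then show ?thesis by (simp only: ennreal_numeral_mult mult_nonneg_nonneg zero_le_numeral)
    qed
    also have "\<dots> \<le> ennreal ((1/4) ^ n)" using ce[OF K(2), of n] by (intro ennreal_leI) (simp add: algebra_simps)
    finally show ?thesis .
  qed
  have "AE w in M. (\<lambda>n. ennreal ((norm (qfun T \<rho> w - step_q (N n) (R n) w))\<^sup>2)) \<longlonglongrightarrow> 0"
    by (rule AE_tendsto_zero) (use qm sqm q[unfolded L2dist_def] in auto)
  then have qlim: "AE w in M. (\<lambda>n. step_q (N n) (R n) w) \<longlonglongrightarrow> qfun T \<rho> w"
    by eventually_elim (rule LIMSEQ_of_sq, simp)
  define D where "D n w = (\<Sum>j<N n. diag_form (T / real (N n)) (N n) (A n) j (grid_incr (N n) j w))" for n w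
  have Dm: "D n \<in> borel_measurable M" for n unfolding D_def diag_form_def by measurable
  have "(\<integral>\<^sup>+w. ennreal ((D n w - k n)\<^sup>2) \<partial>M) \<le> ennreal ((1/4) ^ n)" for n
  proof -
    have "(\<integral>\<^sup>+w. ennreal ((D n w - k n)\<^sup>2) \<partial>M) \<le> ennreal (3 * (real CARD('d))\<^sup>2 * T ^ 4 * (C n ^ 4 / real (N n)))"
      unfolding D_def k_def by (rule diag_variance[OF N0 C(1,2)])
    also have "\<dots> \<le> ennreal (3 * (real CARD('d))\<^sup>2 * T ^ 4 * e n)"
      using C(3)[of n] by (intro ennreal_leI mult_left_mono dT less_imp_le)
    also have "\<dots> \<le> ennreal ((1/4) ^ n)" by (rule ennreal_leI[OF ce[OF K(3)]])
    finally show ?thesis .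
  qed
  then have "AE w in M. (\<lambda>n. ennreal ((D n w - k n)\<^sup>2)) \<longlonglongrightarrow> 0"
    by (intro AE_tendsto_zero) (use Dm in auto)
  then have Dlim: "AE w in M. (\<lambda>n. D n w) \<longlonglongrightarrow> X"
  proof eventually_elim
    case (elim w)
    then have "(\<lambda>n. ennreal ((0 - (D n w - k n))\<^sup>2)) \<longlonglongrightarrow> 0" by (simp only: diff_0 power2_minus)
    from tendsto_add[OF LIMSEQ_of_sq[OF this] klim] show ?case by simp
  qed
  define l where "l n w = log_density (T / real (N n)) (A n) (N n) (grid_vec (N n) w)" for n w
  have l: "l n w = step_q (N n) (R n) w - 1 / 2 * D n w" for n w unfolding l_def D_def R_def by (rule log_density_grid)
  have lm: "l n \<in> borel_measurable M" for n unfolding l_def using measurable_compose[OF grid_vec_measurable log_density_measurable] .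
  have llim: "AE w in M. (\<lambda>n. l n w) \<longlonglongrightarrow> qfun T \<rho> w - (norm2 T \<eta>)\<^sup>2 / 4"
    using qlim Dlim
  proof eventually_elim
    case (elim w)
    \<comment> \<open>\<open>X\<close> is the squared norm over the lower triangle, half of that of
      \<open>\<eta>\<close>; the factor 1/2 before the diagonal sum halves it again, whence the
      quarter.\<close>
    have "(\<lambda>n. step_q (N n) (R n) w - 1 / 2 * D n w) \<longlonglongrightarrow> qfun T \<rho> w - 1 / 2 * X" by (intro tendsto_intros elim)
    then show ?case unfolding l nX by simp
  qed
  from Gfun_spec[OF \<eta>] obtain Z where G: "Gfun T \<eta> \<in> measurable M (Wsig T)" and Z: "wint_process T \<eta> Z"
    and GZ: "AE w in M. \<forall>t\<in>{0..T}. Gfun T \<eta> w t = - (LINT s:{0..t}|lborel. Z s w)" by blast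
  note Zjm = wint_process_jm[OF Z]
  define dist where "dist n w = (\<integral>\<^sup>+s\<in>{0..T}. ennreal ((norm (Z s w - step_process (N n) (A n) s w))\<^sup>2) \<partial>lborel)" for n w
  have "(\<integral>\<^sup>+w. dist n w \<partial>M) \<le> ennreal ((1/4) ^ n)" for n
  proof -
    have "(\<integral>\<^sup>+w. dist n w \<partial>M) = procdist Z (step_process (N n) (A n))" unfolding dist_def procdist_def ..
    also have "\<dots> \<le> 9 * L2dist ?S ?a (lower_kernel T (step_kernel T (N n) (A n)))"
      by (rule wint_estimate[OF Z step_wint[OF N0] am]) (simp add: lower_kernel_step[OF N0])
    also have "\<dots> \<le> 9 * ennreal (e n)" unfolding lower_kernel_step[OF N0] by (intro mult_left_mono less_imp_le d) simp
    also have "\<dots> = ennreal (9 * e n)" using e0[of n] by (simp add: ennreal_numeral_mult)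
    also have "\<dots> \<le> ennreal ((1/4) ^ n)" by (rule ennreal_leI[OF ce[OF K(1)]])
    finally show ?thesis .
  qed
  then have distlim: "AE w in M. (\<lambda>n. dist n w) \<longlonglongrightarrow> 0"
    by (intro AE_tendsto_zero) (auto simp: dist_def intro: procdist_pathwise_measurable Zjm step_process_jm N0)
  define Fn where "Fn n w = f (interp T (N n) (shear (T / real (N n)) (A n) (N n) (grid_vec (N n) w)))" for n w
  have Fnm: "Fn n \<in> borel_measurable M" for n
    unfolding Fn_def by (rule measurable_compose[OF grid_vec_measurable measurable_compose[OF shear_measurable interp_functional_measurable[OF T_pos f]]])
  have path: "(\<lambda>t. w t + Gfun T \<eta> w t) \<in> Wsp T" if "w \<in> space M" for w
    using measurable_space[OF add_path_measurable[OF G] that] by (simp add: space_M)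
  have Fm: "(\<lambda>w. f (\<lambda>t. w t + Gfun T \<eta> w t)) \<in> borel_measurable M"
    by (rule measurable_compose[OF add_path_measurable[OF G] Cb_measurable[OF f]])
  have Flim: "AE w in M. (\<lambda>n. Fn n w) \<longlonglongrightarrow> f (\<lambda>t. w t + Gfun T \<eta> w t)"
    using GZ distlim procdist_zero_AE[OF Zjm wint_process_sq_finite[OF \<eta> Z]] AE_space
  proof eventually_elim
    case (elim w)
    show ?case unfolding Fn_def
    proof (rule Cb_tendsto[OF T_pos f path[OF elim(4)] interp_Wsp[OF T_pos]])
      fix r :: real assume r: "r > 0"
      \<comment> \<open>Half of \<open>r\<close> is reserved for the interpolation error. The other
        half is for the drift, and the division by \<open>T\<close> offsets the factor in
        \<open>drift_error\<close>.\<close>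
      have "ennreal ((r / 2)\<^sup>2 / T) > 0" using r T_pos by simp
      with elim(2) have "\<forall>\<^sub>F n in sequentially. dist n w < ennreal ((r / 2)\<^sup>2 / T)" by (rule order_tendstoD)
      moreover have "\<forall>\<^sub>F n in sequentially. \<forall>t\<in>{0..T}. norm (interp T (N n) (grid_vec (N n) w) t - w t) \<le> r / 2"
        using elim(4) N r by (intro interp_grid_vec_uniform) (auto simp: space_M)
      ultimately show "\<forall>\<^sub>F n in sequentially. \<forall>t\<in>{0..T}. norm (interp T (N n) (shear (T / real (N n)) (A n) (N n) (grid_vec (N n) w)) t - (w t + Gfun T \<eta> w t)) \<le> r"
      proof eventually_elim
        case (elim n)
        show ?case
        proof
          fix t assume t: "t \<in> {0..T}"
          let ?I = "LINT s:{0..t}|lborel. Z s w" and ?J = "LINT s:{0..t}|lborel. step_process (N n) (A n) s w"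
          have "ennreal ((norm (?I - ?J))\<^sup>2) \<le> ennreal T * dist n w"
            unfolding dist_def by (rule drift_error[OF N0 t Zjm \<open>w \<in> space M\<close> \<open>set_integrable lborel {0..T} (\<lambda>s. Z s w)\<close>])
          also have "\<dots> \<le> ennreal T * ennreal ((r / 2)\<^sup>2 / T)" by (rule mult_left_mono[OF less_imp_le[OF elim(1)]]) simp
          also have "\<dots> = ennreal ((r / 2)\<^sup>2)" using T_pos by (simp add: ennreal_mult[symmetric])
          finally have "(norm (?I - ?J))\<^sup>2 \<le> (r / 2)\<^sup>2" by (subst (asm) ennreal_le_iff) auto
          then have J: "norm (?I - ?J) \<le> r / 2" using r by (intro power2_le_imp_le[of "norm (?I - ?J)"]) auto
          have "interp T (N n) (shear (T / real (N n)) (A n) (N n) (grid_vec (N n) w)) t - (w t + Gfun T \<eta> w t)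
            = (interp T (N n) (grid_vec (N n) w) t - w t) + (?I - ?J)"
            unfolding interp_shear[OF N0 t] using t \<open>\<forall>t\<in>{0..T}. Gfun T \<eta> w t = - (LINT s:{0..t}|lborel. Z s w)\<close> by simp
          also have "norm \<dots> \<le> norm (interp T (N n) (grid_vec (N n) w) t - w t) + norm (?I - ?J)" by (rule norm_triangle_ineq)
          also have "\<dots> \<le> r" using elim(2) t J by force
          finally show "norm (interp T (N n) (shear (T / real (N n)) (A n) (N n) (grid_vec (N n) w)) t - (w t + Gfun T \<eta> w t)) \<le> r" .
        qed
      qed
    qed
  qed
  obtain B where B: "\<And>w. w \<in> Wsp T \<Longrightarrow> \<bar>f w\<bar> \<le> B" using f unfolding Cb_def by blast
  have fB: "0 \<le> f w \<and> f w \<le> B" if "w \<in> Wsp T" for w using B[OF that] f0[OF that] by auto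
  \<comment> \<open>Halfway between \<open>X\<close> and 1/2: eventually the discrete norms lie
    below \<open>\<theta>\<close>, which keeps a fixed distance from the critical value and makes
    the tail bound uniform.\<close>
  define \<theta> where "\<theta> = (X + 1/2) / 2"
  have \<theta>: "X < \<theta>" "\<theta> < 1/2" using Xlt by (auto simp: \<theta>_def)
  have "\<forall>\<^sub>F n in sequentially. k n < \<theta>" using klim \<theta>(1) by (rule order_tendstoD)
  then obtain m where m: "\<And>n. n \<ge> m \<Longrightarrow> k n < \<theta>" unfolding eventually_sequentially by blast
  define E where "E n = (\<integral>\<^sup>+w. ennreal (f (interp T (N n) (grid_vec (N n) w))) \<partial>M)" for n
  have gm: "(\<lambda>w. f (interp T (N n) (grid_vec (N n) w))) \<in> borel_measurable M" for n
    by (rule measurable_compose[OF grid_vec_measurable interp_functional_measurable[OF T_pos f]])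
  have Elim: "E \<longlonglongrightarrow> (\<integral>\<^sup>+w. ennreal (f w) \<partial>M)"
    unfolding E_def
  proof (rule nn_integral_dominated_convergence[where w="\<lambda>_. ennreal B"])
    show "AE w in M. ennreal (f (interp T (N n) (grid_vec (N n) w))) \<le> ennreal B" for n
      using fB[OF interp_Wsp[OF T_pos]] by (intro AE_I2 ennreal_leI) blast
    show "AE w in M. (\<lambda>n. ennreal (f (interp T (N n) (grid_vec (N n) w)))) \<longlonglongrightarrow> ennreal (f w)"
    proof (rule AE_I2)
      fix w assume "w \<in> space M"
      then show "(\<lambda>n. ennreal (f (interp T (N n) (grid_vec (N n) w)))) \<longlonglongrightarrow> ennreal (f w)"
        by (intro tendsto_ennrealI Cb_tendsto[OF T_pos f] interp_Wsp T_pos interp_grid_vec_uniform N) (auto simp: space_M)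
    qed
    show "(\<integral>\<^sup>+w. ennreal B \<partial>M) < \<infinity>" by (simp add: emeasure_space_1)
  qed (use gm Cb_measurable[OF f] in auto)
  have FE: "(\<integral>\<^sup>+w. ennreal (Fn n w * exp (l n w)) \<partial>M) = E n" for n
  proof -
    have "(\<integral>\<^sup>+w. ennreal (Fn n w * exp (l n w)) \<partial>M) = (\<integral>\<^sup>+w. ennreal (exp (l n w)) * ennreal (Fn n w) \<partial>M)"
      unfolding Fn_def using fB[OF interp_Wsp[OF T_pos]] by (intro nn_integral_cong) (simp add: ennreal_mult mult.commute)
    also have "\<dots> = E n" unfolding Fn_def l_def E_def
      by (rule grid_girsanov[OF N0, where g="\<lambda>x. ennreal (f (interp T _ x))"])
        (use interp_functional_measurable[OF T_pos f] in auto)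
    finally show ?thesis .
  qed
  have fin: "finite_measure M" by unfold_locales
  show ?thesis
  \<comment> \<open>The shift by \<open>m\<close> discards the finitely many grids on which the
    discrete norm may still exceed \<open>\<theta>\<close>.\<close>
  proof (rule exp_density_limit[OF fin, where Fn="\<lambda>n. Fn (n + m)" and ell="\<lambda>n. l (n + m)" and e="\<lambda>n. E (n + m)" and B=B
        and c="\<lambda>L. (36 / L\<^sup>2 + 1 / L) * (2 * \<theta> / (1 - 2 * \<theta>))"])
    show "AE w in M. (\<lambda>n. Fn (n + m) w) \<longlonglongrightarrow> f (\<lambda>t. w t + Gfun T \<eta> w t)"
      using Flim by eventually_elim (rule LIMSEQ_ignore_initial_segment)
    show "AE w in M. (\<lambda>n. l (n + m) w) \<longlonglongrightarrow> qfun T \<rho> w - (norm2 T \<eta>)\<^sup>2 / 4"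
      using llim by eventually_elim (rule LIMSEQ_ignore_initial_segment)
    show "(\<integral>\<^sup>+w. ennreal (exp (l (n + m) w)) * indicator {w. L < l (n + m) w} w \<partial>M) \<le> ennreal ((36 / L\<^sup>2 + 1 / L) * (2 * \<theta> / (1 - 2 * \<theta>)))" if "L > 0" for n L
      unfolding l_def by (rule density_tail[OF N0 _ \<theta>(2) that]) (use m[of "n + m"] in \<open>simp add: k_def\<close>)
    show "(\<lambda>n. E (n + m)) \<longlonglongrightarrow> (\<integral>\<^sup>+w. ennreal (f w) \<partial>M)" by (rule LIMSEQ_ignore_initial_segment[OF Elim])
    show "0 \<le> Fn (n + m) w \<and> Fn (n + m) w \<le> B" for n w unfolding Fn_def by (rule fB[OF interp_Wsp[OF T_pos]])
    show "0 \<le> f (\<lambda>t. w t + Gfun T \<eta> w t) \<and> f (\<lambda>t. w t + Gfun T \<eta> w t) \<le> B" if "w \<in> space M" for w by (rule fB[OF path[OF that]])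
    show "(\<lambda>j. (36 / (real (Suc j))\<^sup>2 + 1 / real (Suc j)) * (2 * \<theta> / (1 - 2 * \<theta>))) \<longlonglongrightarrow> 0" by (rule density_tail_rate_tendsto)
  qed (use Fnm Fm lm qm FE in auto)
qed

end

lemma Cb_add_const:
  fixes f :: "(real \<Rightarrow> real ^ 'd) \<Rightarrow> real"
  assumes f: "f \<in> Cb T"
  shows "(\<lambda>w. f w + c) \<in> Cb T"
proof -
  obtain B where B: "\<And>w. w \<in> Wsp T \<Longrightarrow> \<bar>f w\<bar> \<le> B" using f unfolding Cb_def by blast
  have "\<forall>w\<in>Wsp T. \<bar>f w + c\<bar> \<le> B + \<bar>c\<bar>"
  proof
    fix w :: "real \<Rightarrow> real ^ 'd" assume "w \<in> Wsp T"
    then show "\<bar>f w + c\<bar> \<le> B + \<bar>c\<bar>" using B[of w] by linarith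
  qed
  then show ?thesis using f unfolding Cb_def by auto
qed

lemma Cb_const: "(\<lambda>w. c) \<in> Cb T"
  unfolding Cb_def by (auto intro: exI[of _ "\<bar>c\<bar>"] exI[of _ "1::real"])

theorem mainTheorem1:
  fixes T :: real
    and \<eta> \<rho> :: "real \<Rightarrow> real \<Rightarrow> real ^ 'd ^ 'd"
    and f :: "(real \<Rightarrow> real ^ 'd) \<Rightarrow> real"
  assumes "T > 0"
    and "\<eta> \<in> S2 T" and "norm2 T \<eta> < 1"
    and "\<rho> \<in> S2 T"
    and "\<forall>s t. 0 \<le> s \<and> s < t \<and> t \<le> T \<longrightarrow>
           \<rho> t s = \<eta> t s - (LINT u:{t..T}|lborel. \<eta> t u ** \<eta> u s)"
    and "f \<in> Cb T"
  shows "(\<integral>w. f (\<lambda>t. w t + Gfun T \<eta> w t) * exp (qfun T \<rho> w) \<partial>wiener T)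
           = exp ((norm2 T \<eta>)\<^sup>2 / 4) * (\<integral>w. f w \<partial>wiener T)"
proof -
  define M :: "(real \<Rightarrow> real ^ 'd) measure" where "M = wiener T"
  interpret wiener_setup T M by unfold_locales (simp_all add: assms(1) M_def)
  let ?F = "\<lambda>w. f (\<lambda>t. w t + Gfun T \<eta> w t)" and ?Z = "\<lambda>w. exp (qfun T \<rho> w - (norm2 T \<eta>)\<^sup>2 / 4)"
  obtain B where B: "\<And>w. w \<in> Wsp T \<Longrightarrow> \<bar>f w\<bar> \<le> B" using assms(6) unfolding Cb_def by blast
  have G: "Gfun T \<eta> \<in> measurable M (Wsig T)" using Gfun_spec[OF assms(2)] by blast
  have path: "(\<lambda>t. w t + Gfun T \<eta> w t) \<in> Wsp T" if "w \<in> space M" for w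
    using measurable_space[OF add_path_measurable[OF G] that] by (simp add: space_M)
  have qm[measurable]: "qfun T \<rho> \<in> borel_measurable M" using qfun_spec[OF assms(4)] unfolding has_ito_iff by blast
  have fm[measurable]: "f \<in> borel_measurable M" by (rule Cb_measurable[OF assms(6)])
  have Fm[measurable]: "?F \<in> borel_measurable M" by (rule measurable_compose[OF add_path_measurable[OF G] fm])
  \<comment> \<open>The extended integral on the right is finite, as \<open>g\<close> is bounded, so
    the formula for nonnegative functionals carries integrability to the left as well.\<close>
  have transfer: "has_bochner_integral M (\<lambda>w. g (\<lambda>t. w t + Gfun T \<eta> w t) * ?Z w) (\<integral>w. g w \<partial>M)"
    if g: "g \<in> Cb T" "\<And>w. w \<in> Wsp T \<Longrightarrow> g w \<ge> 0" for g
  proof -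
    have gm: "g \<in> borel_measurable M" by (rule Cb_measurable[OF g(1)])
    obtain b where b: "\<And>w. w \<in> Wsp T \<Longrightarrow> \<bar>g w\<bar> \<le> b" using g(1) unfolding Cb_def by blast
    have "integrable M g" by (rule integrable_const_bound[where B=b]) (use b gm in \<open>auto simp: space_M\<close>)
    then have "(\<integral>\<^sup>+w. ennreal (g w) \<partial>M) = ennreal (\<integral>w. g w \<partial>M)"
      using g(2) by (intro nn_integral_eq_integral) (auto simp: space_M)
    then have "(\<integral>\<^sup>+w. ennreal (g (\<lambda>t. w t + Gfun T \<eta> w t) * ?Z w) \<partial>M) = ennreal (\<integral>w. g w \<partial>M)"
      by (subst density_formula[OF assms(2-5) g(1)]) (use g(2) in auto)
    moreover have "(\<lambda>w. g (\<lambda>t. w t + Gfun T \<eta> w t) * ?Z w) \<in> borel_measurable M"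
      using measurable_compose[OF add_path_measurable[OF G] gm] by measurable
    ultimately show ?thesis using g(2) path
      by (intro has_bochner_integral_nn_integral) (auto intro!: Bochner_Integration.integral_nonneg_AE AE_I2 simp: space_M)
  qed
  \<comment> \<open>A signed functional is made nonnegative by adding its bound \<open>B\<close>.
    The contribution of \<open>B\<close> is then subtracted by the formula for the constant 1, which
    also provides the integrability of the density that the subtraction uses.\<close>
  have 1: "has_bochner_integral M (\<lambda>w. (?F w + B) * ?Z w) (\<integral>w. f w + B \<partial>M)"
    by (rule transfer[OF Cb_add_const[OF assms(6)]]) (use B in force)
  have 2: "has_bochner_integral M (\<lambda>w. 1 * ?Z w) (\<integral>w. 1 \<partial>M)" by (rule transfer[OF Cb_const]) simp
  have "integrable M f" by (rule integrable_const_bound[where B=B]) (use B in \<open>auto simp: space_M\<close>)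
  then have c: "(\<integral>w. f w + B \<partial>M) = (\<integral>w. f w \<partial>M) + B" by (simp add: prob_space)
  have "has_bochner_integral M (\<lambda>w. (?F w + B) * ?Z w - B * (1 * ?Z w)) ((\<integral>w. f w \<partial>M) + B - B * 1)"
    using has_bochner_integral_diff[OF 1 has_bochner_integral_mult_right[OF 2, of B]] unfolding c by (simp add: prob_space)
  then have 3: "(\<integral>w. ?F w * ?Z w \<partial>M) = (\<integral>w. f w \<partial>M)"
    unfolding has_bochner_integral_iff by (simp add: algebra_simps)
  have "(\<integral>w. ?F w * exp (qfun T \<rho> w) \<partial>M) = (\<integral>w. exp ((norm2 T \<eta>)\<^sup>2 / 4) * (?F w * ?Z w) \<partial>M)"
    by (intro Bochner_Integration.integral_cong refl) (simp add: exp_diff)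
  also have "\<dots> = exp ((norm2 T \<eta>)\<^sup>2 / 4) * (\<integral>w. f w \<partial>M)" by (simp only: integral_mult_right_zero 3)
  finally show ?thesis unfolding M_def .
qed

end
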